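(* There is an algorithm that, given a CNF formula $F$, a weight function $w$ mapping each literal of $F$ to a real number, an integer $k$, and a contraction sequence of the signed incidence graph $G_F$ of $F$ in which every signed trigraph has maximum red degree at most $d$, outputs $\sum_{\pi\in M(F),\ \mathrm{ones}(\pi)\le k} w(\pi)$ in time $f(k,d)\cdot n^{c}$, where $n$ is the size of the input, $f$ is a computable function and $c$ is a constant independent of $k$ and $d$. In other words, Bounded-ones Weighted Model Counting (BWMC) is fixed-parameter tractable when parameterized by $k$ plus the red degree (twin-width) of a signed contraction sequence of the incidence graph provided on the input.
   Context: A CNF formula is a finite set of clauses; a clause is a finite set of literals (variables $x$ or negated variables $\bar x$) containing no complementary pair; $\mathrm{var}(F)$ is its set of variables. A model of $F$ is an assignment $\tau:\mathrm{var}(F)\to\{0,1\}$ such that every clause contains a literal $z$ with $\tau(z)=1$ (where $\tau(\bar x)=1-\tau(x)$); $M(F)$ is the set of models. For a weight function $w$ on literals, $w(\tau)=\prod_{v\in\tau^{-1}(1)}w(v)\cdot\prod_{v\in\tau^{-1}(0)}w(\bar v)$, and $\mathrm{ones}(\tau)=|\tau^{-1}(1)|$. BWMC: given $F$, $w$, $k$, compute $\sum_{\pi\in M(F),\,\mathrm{ones}(\pi)\le k}w(\pi)$. The signed incidence graph $G_F$ has vertex set $F\cup\mathrm{var}(F)$; a clause $a$ and variable $b$ are joined by a positive edge if $b\in a$ and by a negative edge if $\bar b\in a$; there are no other edges. A signed trigraph has a vertex set and three pairwise disjoint sets of edges: positive, negative and red. Contracting two vertices $u,v$ of a signed trigraph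 replaces them by a new vertex $w$ such that for every other vertex $x$: $wx$ is positive if $ux$ and $vx$ are both positive; negative if both negative; absent if both $ux$ and $vx$ are absent; and red otherwise (all other edges unchanged). A contraction sequence of a signed graph $G$ on $n$ vertices is a sequence $G=G_n,G_{n-1},\dots,G_1$ of signed trigraphs where $G_i$ has $i$ vertices and is obtained from $G_{i+1}$ by one contraction; it is a $d$-sequence if every vertex of every $G_i$ is incident to at most $d$ red edges. *)

theory Defs
  imports Complex_Main "HOL-Library.FuncSet"
begin

section \<open>CNF formulas and weighted model counting\<close>

datatype lit = Pos nat | Neg nat

type_synonym clause = "lit set"
type_synonym formula = "clause set"

definition is_clause :: "clause \<Rightarrow> bool" where
  "is_clause C \<longleftrightarrow> finite C \<and> \<not> (\<exists>x. Pos x \<in> C \<and> Neg x \<in> C)"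

definition is_cnf :: "formula \<Rightarrow> bool" where
  "is_cnf F \<longleftrightarrow> finite F \<and> (\<forall>C\<in>F. is_clause C)"

definition vars :: "formula \<Rightarrow> nat set" where
  "vars F = {x. \<exists>C\<in>F. Pos x \<in> C \<or> Neg x \<in> C}"

fun lit_value :: "(nat \<Rightarrow> nat) \<Rightarrow> lit \<Rightarrow> nat" where
  "lit_value \<tau> (Pos x) = \<tau> x"
| "lit_value \<tau> (Neg x) = 1 - \<tau> x"

definition models :: "formula \<Rightarrow> (nat \<Rightarrow> nat) set" where
  "models F = {\<tau> \<in> vars F \<rightarrow>\<^sub>E {0, 1}. \<forall>C\<in>F. \<exists>z\<in>C. lit_value \<tau> z = 1}"

definition ones :: "formula \<Rightarrow> (nat \<Rightarrow> nat) \<Rightarrow> nat" where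
  "ones F \<tau> = card {v \<in> vars F. \<tau> v = 1}"

definition weight :: "formula \<Rightarrow> (lit \<Rightarrow> real) \<Rightarrow> (nat \<Rightarrow> nat) \<Rightarrow> real" where
  "weight F w \<tau> = (\<Prod>v\<in>{v \<in> vars F. \<tau> v = 1}. w (Pos v)) * (\<Prod>v\<in>{v \<in> vars F. \<tau> v = 0}. w (Neg v))"

definition bwmc :: "formula \<Rightarrow> (lit \<Rightarrow> real) \<Rightarrow> int \<Rightarrow> real" where
  "bwmc F w k = (\<Sum>\<pi>\<in>{\<pi> \<in> models F. int (ones F \<pi>) \<le> k}. weight F w \<pi>)"


section \<open>Signed trigraphs and contraction sequences\<close>

text \<open>Edges are two-element vertex sets.\<close>

record 'v trigraph =
  verts :: "'v set"
  pos_edges :: "'v set set"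
  neg_edges :: "'v set set"
  red_edges :: "'v set set"

definition is_signed_trigraph :: "'v trigraph \<Rightarrow> bool" where
  "is_signed_trigraph G \<longleftrightarrow>
     finite (verts G) \<and>
     (\<forall>e \<in> pos_edges G \<union> neg_edges G \<union> red_edges G. e \<subseteq> verts G \<and> card e = 2) \<and>
     pos_edges G \<inter> neg_edges G = {} \<and>
     pos_edges G \<inter> red_edges G = {} \<and>
     neg_edges G \<inter> red_edges G = {}"

definition is_pos :: "'v trigraph \<Rightarrow> 'v \<Rightarrow> 'v \<Rightarrow> bool" where
  "is_pos G u x \<longleftrightarrow> {u, x} \<in> pos_edges G"

definition is_neg :: "'v trigraph \<Rightarrow> 'v \<Rightarrow> 'v \<Rightarrow> bool" where
  "is_neg G u x \<longleftrightarrow> {u, x} \<in> neg_edges G"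

definition is_absent :: "'v trigraph \<Rightarrow> 'v \<Rightarrow> 'v \<Rightarrow> bool" where
  "is_absent G u x \<longleftrightarrow> {u, x} \<notin> pos_edges G \<union> neg_edges G \<union> red_edges G"

definition contract :: "'v trigraph \<Rightarrow> 'v \<Rightarrow> 'v \<Rightarrow> 'v \<Rightarrow> 'v trigraph" where
  "contract G u v w =
    (let X = verts G - {u, v};
         P = {x \<in> X. is_pos G u x \<and> is_pos G v x};
         N = {x \<in> X. is_neg G u x \<and> is_neg G v x};
         A = {x \<in> X. is_absent G u x \<and> is_absent G v x}
     in \<lparr> verts = insert w X,
          pos_edges = {e \<in> pos_edges G. u \<notin> e \<and> v \<notin> e} \<union> (\<lambda>x. {w, x}) ` P,
          neg_edges = {e \<in> neg_edges G. u \<notin> e \<and> v \<notin> e} \<union> (\<lambda>x. {w, x}) ` N,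
          red_edges = {e \<in> red_edges G. u \<notin> e \<and> v \<notin> e} \<union> (\<lambda>x. {w, x}) ` (X - P - N - A) \<rparr>)"

definition is_contraction :: "'v trigraph \<Rightarrow> 'v trigraph \<Rightarrow> bool" where
  "is_contraction G H \<longleftrightarrow>
     (\<exists>u v w. u \<in> verts G \<and> v \<in> verts G \<and> u \<noteq> v \<and> w \<notin> verts G \<and> H = contract G u v w)"

text \<open>
  The list holds the trigraphs on n, n - 1, ..., 1 vertices, in this order, where n is the
  number of vertices of the given graph. The graph without vertices has only the empty sequence.
\<close>

definition is_contraction_sequence :: "'v trigraph \<Rightarrow> 'v trigraph list \<Rightarrow> bool" where
  "is_contraction_sequence G Gs \<longleftrightarrow>
     length Gs = card (verts G) \<and>
     (Gs \<noteq> [] \<longrightarrow> hd Gs = G) \<and>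
     (\<forall>H\<in>set Gs. is_signed_trigraph H) \<and>
     (\<forall>i. Suc i < length Gs \<longrightarrow> is_contraction (Gs ! i) (Gs ! Suc i))"

definition red_degree :: "'v trigraph \<Rightarrow> 'v \<Rightarrow> nat" where
  "red_degree G x = card {e \<in> red_edges G. x \<in> e}"

definition is_d_sequence :: "nat \<Rightarrow> 'v trigraph \<Rightarrow> 'v trigraph list \<Rightarrow> bool" where
  "is_d_sequence d G Gs \<longleftrightarrow>
     is_contraction_sequence G Gs \<and> (\<forall>H\<in>set Gs. \<forall>x\<in>verts H. red_degree H x \<le> d)"

text \<open>
  The vertices of the signed incidence graph are the clauses and the variables; the third
  constructor supplies names for the vertices created by contractions.
\<close>

datatype node = Clause_node clause | Var_node nat | New_node nat

definition incidence_graph :: "formula \<Rightarrow> node trigraph" where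
  "incidence_graph F =
     \<lparr> verts = Clause_node ` F \<union> Var_node ` vars F,
       pos_edges = {{Clause_node a, Var_node b} | a b. a \<in> F \<and> Pos b \<in> a},
       neg_edges = {{Clause_node a, Var_node b} | a b. a \<in> F \<and> Neg b \<in> a},
       red_edges = {} \<rparr>"


section \<open>Random access machine with real-number cells\<close>

text \<open>
  Programs of a random access machine with unit-cost operations. Besides registers it has a memory
  of integers and a memory of reals, both addressed by the contents of integer registers.
  The integer operations are addition and subtraction only, since a unit-cost multiplication
  would allow numbers of exponential bit length in polynomial time. The real operations
  are the ring operations; there is no test on reals and no conversion to integers, so control flow
  and addresses never depend on real values. In particular the integer part is an ordinary random
  access machine.
\<close>

record state =
  ireg :: "nat \<Rightarrow> int"
  imem :: "int \<Rightarrow> int"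
  rreg :: "nat \<Rightarrow> real"
  rmem :: "int \<Rightarrow> real"

datatype instr =
    Const nat int
  | Add nat nat nat
  | Sub nat nat nat
  | Load nat nat
  | Store nat nat
  | RConst nat int
  | RAdd nat nat nat
  | RSub nat nat nat
  | RMul nat nat nat
  | RLoad nat nat
  | RStore nat nat

fun exec_instr :: "instr \<Rightarrow> state \<Rightarrow> state" where
  "exec_instr (Const a c) s = s\<lparr>ireg := (ireg s)(a := c)\<rparr>"
| "exec_instr (Add a b c) s = s\<lparr>ireg := (ireg s)(a := ireg s b + ireg s c)\<rparr>"
| "exec_instr (Sub a b c) s = s\<lparr>ireg := (ireg s)(a := ireg s b - ireg s c)\<rparr>"
| "exec_instr (Load a b) s = s\<lparr>ireg := (ireg s)(a := imem s (ireg s b))\<rparr>"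
| "exec_instr (Store a b) s = s\<lparr>imem := (imem s)(ireg s a := ireg s b)\<rparr>"
| "exec_instr (RConst a c) s = s\<lparr>rreg := (rreg s)(a := of_int c)\<rparr>"
| "exec_instr (RAdd a b c) s = s\<lparr>rreg := (rreg s)(a := rreg s b + rreg s c)\<rparr>"
| "exec_instr (RSub a b c) s = s\<lparr>rreg := (rreg s)(a := rreg s b - rreg s c)\<rparr>"
| "exec_instr (RMul a b c) s = s\<lparr>rreg := (rreg s)(a := rreg s b * rreg s c)\<rparr>"
| "exec_instr (RLoad a b) s = s\<lparr>rreg := (rreg s)(a := rmem s (ireg s b))\<rparr>"
| "exec_instr (RStore a b) s = s\<lparr>rmem := (rmem s)(ireg s a := rreg s b)\<rparr>"

text \<open>\<open>Cond\<close> and \<open>Loop\<close> test whether the given integer register is positive.\<close>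

datatype program =
    Do instr
  | Seq program program
  | Cond nat program program
  | Loop nat program

text \<open>\<open>exec P s t s'\<close>: started in \<open>s\<close>, the program \<open>P\<close> halts after \<open>t\<close> steps in \<open>s'\<close>.\<close>

inductive exec :: "program \<Rightarrow> state \<Rightarrow> nat \<Rightarrow> state \<Rightarrow> bool" where
  exec_Do: "exec (Do i) s 1 (exec_instr i s)"
| exec_Seq: "exec P s t s' \<Longrightarrow> exec Q s' t' s'' \<Longrightarrow> exec (Seq P Q) s (t + t') s''"
| exec_Cond_True: "ireg s r > 0 \<Longrightarrow> exec P s t s' \<Longrightarrow> exec (Cond r P Q) s (1 + t) s'"
| exec_Cond_False: "\<not> ireg s r > 0 \<Longrightarrow> exec Q s t s' \<Longrightarrow> exec (Cond r P Q) s (1 + t) s'"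
| exec_Loop_False: "\<not> ireg s r > 0 \<Longrightarrow> exec (Loop r P) s 1 s"
| exec_Loop_True: "ireg s r > 0 \<Longrightarrow> exec P s t s' \<Longrightarrow> exec (Loop r P) s' t' s'' \<Longrightarrow>
    exec (Loop r P) s (1 + t + t') s''"


lemma exec_deterministic:
  "exec P s t s' \<Longrightarrow> exec P s u s'' \<Longrightarrow> u = t \<and> s'' = s'"
proof (induction arbitrary: u s'' rule: exec.induct)
  case (exec_Do i s)
  then show ?case by cases simp
next
  case (exec_Seq P s t s' Q t' s2)
  from exec_Seq.prems obtain t1 s1 t2 where
    "u = t1 + t2" "exec P s t1 s1" "exec Q s1 t2 s''" by cases simp
  moreover from exec_Seq.IH(1)[OF this(2)] have "t1 = t" "s1 = s'" by simp_all
  ultimately show ?case using exec_Seq.IH(2)[of t2 s''] by simp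
next
  case (exec_Cond_True s r P t s' Q)
  from exec_Cond_True.prems exec_Cond_True.hyps obtain t1 where
    "u = 1 + t1" "exec P s t1 s''" by cases simp_all
  then show ?case using exec_Cond_True.IH[of t1 s''] by simp
next
  case (exec_Cond_False s r Q t s' P)
  from exec_Cond_False.prems exec_Cond_False.hyps obtain t1 where
    "u = 1 + t1" "exec Q s t1 s''" by cases simp_all
  then show ?case using exec_Cond_False.IH[of t1 s''] by simp
next
  case (exec_Loop_False s r P)
  from exec_Loop_False.prems exec_Loop_False.hyps show ?case by cases simp_all
next
  case (exec_Loop_True s r P t s' t' s2)
  from exec_Loop_True.prems exec_Loop_True.hyps obtain t1 s1 t2 where
    "u = 1 + t1 + t2" "exec P s t1 s1" "exec (Loop r P) s1 t2 s''" by cases simp_all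
  moreover from exec_Loop_True.IH(1)[OF this(2)] have "t1 = t" "s1 = s'" by simp_all
  ultimately show ?case using exec_Loop_True.IH(2)[of t2 s''] by simp
qed

definition mem_of_list :: "'a::zero list \<Rightarrow> int \<Rightarrow> 'a" where
  "mem_of_list xs a = (if 0 \<le> a \<and> a < int (length xs) then xs ! nat a else 0)"

definition init_state :: "int list \<Rightarrow> real list \<Rightarrow> state" where
  "init_state is rs =
     \<lparr> ireg = (\<lambda>_. 0), imem = mem_of_list is, rreg = (\<lambda>_. 0), rmem = mem_of_list rs \<rparr>"

definition computable2 :: "(int \<Rightarrow> nat \<Rightarrow> nat) \<Rightarrow> bool" where
  "computable2 f \<longleftrightarrow>
     (\<exists>P. \<forall>k d. \<exists>t s. exec P (init_state [k, int d] []) t s \<and> ireg s 0 = int (f k d))"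


section \<open>Encoding of the input\<close>

text \<open>
  An encoding is a relation between objects and lists of integers: a finite set may be listed in
  any order and an edge in either orientation. Lists are preceded by their length.
\<close>

definition enc_list :: "('a \<Rightarrow> int list \<Rightarrow> bool) \<Rightarrow> 'a list \<Rightarrow> int list \<Rightarrow> bool" where
  "enc_list E xs code \<longleftrightarrow> (\<exists>cs. list_all2 E xs cs \<and> code = int (length xs) # concat cs)"

definition enc_set :: "('a \<Rightarrow> int list \<Rightarrow> bool) \<Rightarrow> 'a set \<Rightarrow> int list \<Rightarrow> bool" where
  "enc_set E A code \<longleftrightarrow> (\<exists>xs. distinct xs \<and> set xs = A \<and> enc_list E xs code)"

fun lit_code :: "lit \<Rightarrow> int" where
  "lit_code (Pos x) = int x + 1"
| "lit_code (Neg x) = - (int x + 1)"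

text \<open>
  The function \<open>\<nu>\<close> names the vertices of the trigraphs by integers. The name of a clause precedes
  its literals and the name of a variable follows the variable.
\<close>

definition enc_clause :: "(node \<Rightarrow> int) \<Rightarrow> clause \<Rightarrow> int list \<Rightarrow> bool" where
  "enc_clause \<nu> C code \<longleftrightarrow>
     (\<exists>c. enc_set (\<lambda>l c. c = [lit_code l]) C c \<and> code = \<nu> (Clause_node C) # c)"

definition enc_var :: "(node \<Rightarrow> int) \<Rightarrow> nat \<Rightarrow> int list \<Rightarrow> bool" where
  "enc_var \<nu> x code \<longleftrightarrow> code = [lit_code (Pos x), \<nu> (Var_node x)]"

definition enc_node :: "(node \<Rightarrow> int) \<Rightarrow> node \<Rightarrow> int list \<Rightarrow> bool" where
  "enc_node \<nu> x code \<longleftrightarrow> code = [\<nu> x]"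

definition enc_edge :: "(node \<Rightarrow> int) \<Rightarrow> node set \<Rightarrow> int list \<Rightarrow> bool" where
  "enc_edge \<nu> e code \<longleftrightarrow> (\<exists>x y. e = {x, y} \<and> code = [\<nu> x, \<nu> y])"

definition enc_trigraph :: "(node \<Rightarrow> int) \<Rightarrow> node trigraph \<Rightarrow> int list \<Rightarrow> bool" where
  "enc_trigraph \<nu> G code \<longleftrightarrow>
     (\<exists>V P N R. enc_set (enc_node \<nu>) (verts G) V \<and>
        enc_set (enc_edge \<nu>) (pos_edges G) P \<and>
        enc_set (enc_edge \<nu>) (neg_edges G) N \<and>
        enc_set (enc_edge \<nu>) (red_edges G) R \<and>
        code = V @ P @ N @ R)"

text \<open>
  The integer part of an instance consists of \<open>k\<close>, the formula, its variables and the contraction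
  sequence; the real part lists the two weights of each variable, in the order in which
  the variables are listed.
\<close>

definition enc_instance ::
    "formula \<Rightarrow> (lit \<Rightarrow> real) \<Rightarrow> int \<Rightarrow> node trigraph list \<Rightarrow> int list \<Rightarrow> real list \<Rightarrow> bool" where
  "enc_instance F w k Gs is rs \<longleftrightarrow>
     (\<exists>\<nu> xs cF cV cG.
        inj_on \<nu> (\<Union>G\<in>set Gs. verts G) \<and>
        enc_set (enc_clause \<nu>) F cF \<and>
        distinct xs \<and> set xs = vars F \<and> enc_list (enc_var \<nu>) xs cV \<and>
        enc_list (enc_trigraph \<nu>) Gs cG \<and>
        is = k # cF @ cV @ cG \<and>
        rs = concat (map (\<lambda>x. [w (Pos x), w (Neg x)]) xs))"

end

theory Submission
  imports Defs
begin

text \<open>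
  For a trigraph \<open>G\<^sub>t\<close> of the contraction sequence and a function \<open>s\<close> on its vertices let \<open>L t s e\<close> be the
  weighted number of assignments to the variables in the bags of the support of \<open>s\<close> that set exactly
  \<open>s y\<close> variables of each bag \<open>y\<close> to one and satisfy, by variables in the closed red neighbourhood, all
  clauses near the support, except in the bags marked by \<open>e\<close>. The variables outside the support count
  as zero. The marks \<open>e\<close> stand for clauses already satisfied through positive or negative edges, which
  are homogeneous, so that this is a property of the whole bag. Undoing one contraction splits a single
  value of \<open>s\<close>, and \<open>L\<close> is multiplicative over the parts of the support that are pairwise at red
  distance at least three. Hence only supports that are connected by steps of red distance at most two
  are needed. There are at most \<open>k\<close> vertices in such a support, so it lies in a red ball whose size is
  bounded in terms of \<open>k\<close> and \<open>d\<close>, and for each vertex there are boundedly many pairs \<open>(s, e)\<close>.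

  For the machine, every quantity except the table of the values of \<open>L\<close> is an expression over the
  unchanged input, built with sums, products and searches that always range over \<open>{0..<X}\<close> for
  one bound \<open>X = N + g(k, d)\<close>, where \<open>N\<close> is the length of the input. The nesting depth is fixed, so the
  running time is a polynomial in \<open>X\<close>.
\<close>

section \<open>Computable functions on the random access machine\<close>

text \<open>The instruction set neither multiplies integers nor tests reals, so the table is
  addressed by integer codes alone: level, position of a vertex, and two numbers below
  \<open>X\<close>. Also \<open>d\<close> is not in the input; the least degree bound that fits the
  sequence replaces it.

  The threshold three comes from clauses: an unmarked clause depends only on the closed red
  neighbourhood of its bag. If two parts of the support have no common closed red neighbour, no
  clause sees both, and independent choices multiply.

  The radius of the balls comes from reachability: at most \<open>k\<close> support vertices form at
  most \<open>k * k\<close> related pairs, each bridged by two red edges, and a little room is left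
  to reach the neighbouring bags that carry marks. With a base \<open>b\<close> above all counts and
  degrees, walks of this length \<open>2 * m\<close> have codes below \<open>b ^ (2 * m)\<close>,
  and functions on a ball have codes below \<open>b ^ (b ^ (2 * m))\<close>. A tower of powers of
  two above this number serves as \<open>g\<close>.

  The assignment without ones has an empty support, near which there is no clause; it is counted
  separately.\<close>

definition poly_bounded :: "(nat \<Rightarrow> nat) \<Rightarrow> bool" where
  "poly_bounded T \<longleftrightarrow> (\<exists>c e. \<forall>x. T x \<le> c * (x + 1) ^ e)"

lemma poly_bounded_const: "poly_bounded (\<lambda>_. a)"
  unfolding poly_bounded_def by (intro exI[of _ a] exI[of _ 0]) simp

lemma poly_bounded_id: "poly_bounded (\<lambda>x. x)"
  unfolding poly_bounded_def by (intro exI[of _ 1] exI[of _ 1]) simp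

lemma poly_bounded_add:
  assumes "poly_bounded T" "poly_bounded U"
  shows "poly_bounded (\<lambda>x. T x + U x)"
proof -
  from assms obtain c e c' e' where
    b: "\<And>x. T x \<le> c * (x + 1) ^ e" "\<And>x. U x \<le> c' * (x + 1) ^ e'"
    unfolding poly_bounded_def by blast
  have "T x + U x \<le> (c + c') * (x + 1) ^ (e + e')" for x
  proof -
    have "(x + 1) ^ e \<le> (x + 1) ^ (e + e')" "(x + 1) ^ e' \<le> (x + 1) ^ (e + e')"
      by (intro power_increasing; simp)+
    then have "c * (x + 1) ^ e + c' * (x + 1) ^ e' \<le> (c + c') * (x + 1) ^ (e + e')"
      unfolding distrib_right by (intro add_mono mult_le_mono) auto
    with b[of x] show ?thesis by linarith
  qed
  then show ?thesis unfolding poly_bounded_def by blast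
qed

lemma poly_bounded_mult:
  assumes "poly_bounded T" "poly_bounded U"
  shows "poly_bounded (\<lambda>x. T x * U x)"
proof -
  from assms obtain c e c' e' where
    b: "\<And>x. T x \<le> c * (x + 1) ^ e" "\<And>x. U x \<le> c' * (x + 1) ^ e'"
    unfolding poly_bounded_def by blast
  have "T x * U x \<le> (c * c') * (x + 1) ^ (e + e')" for x
    using mult_le_mono[OF b(1)[of x] b(2)[of x]] by (simp add: power_add mult_ac)
  then show ?thesis unfolding poly_bounded_def by blast
qed

lemmas poly_bounded_intros = poly_bounded_const poly_bounded_id poly_bounded_add poly_bounded_mult

text \<open>A time-bounded total-correctness triple for one start state. The time is only an upper
  bound, so that both branches of a conditional and all rounds of a loop can be charged
  alike.\<close>

definition runs :: "program \<Rightarrow> state \<Rightarrow> nat \<Rightarrow> (state \<Rightarrow> bool) \<Rightarrow> bool" where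
  "runs P s T R \<longleftrightarrow> (\<exists>t s'. exec P s t s' \<and> t \<le> T \<and> R s')"

lemma runs_Do: "R (exec_instr i s) \<Longrightarrow> 0 < T \<Longrightarrow> runs (Do i) s T R"
  unfolding runs_def by (intro exI conjI, rule exec_Do) auto

text \<open>The postcondition of the first program is itself a \<open>runs\<close> statement about
  the second. Programs are thus verified by running them symbolically from the front.\<close>

lemma runs_Seq: "runs P s T (\<lambda>s'. runs Q s' U R) \<Longrightarrow> runs (Seq P Q) s (T + U) R"
  unfolding runs_def by (blast intro: exec_Seq add_mono)

lemma runs_Do_Seq: "runs Q (exec_instr i s) U R \<Longrightarrow> runs (Seq (Do i) Q) s (Suc U) R"
  using runs_Seq[of "Do i" s 1 Q U R] by (simp add: runs_Do)

lemma runs_mono: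
  "runs P s T R \<Longrightarrow> T \<le> T' \<Longrightarrow> (\<And>s'. R s' \<Longrightarrow> R' s') \<Longrightarrow> runs P s T' R'"
  unfolding runs_def by (meson order_trans)

lemma runs_Cond:
  assumes "ireg s r > 0 \<Longrightarrow> runs P s T R" "\<not> ireg s r > 0 \<Longrightarrow> runs Q s U R"
  shows "runs (Cond r P Q) s (1 + T + U) R"
proof (cases "ireg s r > 0")
  case True
  from assms(1)[OF this] obtain t s' where "exec P s t s'" "t \<le> T" "R s'" unfolding runs_def by blast
  with exec_Cond_True[OF True this(1)] show ?thesis unfolding runs_def by (metis add.commute add_le_mono le_add1 le_add2 le_trans nat_add_left_cancel_le add.assoc)
next
  case False
  from assms(2)[OF this] obtain t s' where "exec Q s t s'" "t \<le> U" "R s'" unfolding runs_def by blast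
  with exec_Cond_False[OF False this(1)] show ?thesis
    unfolding runs_def by (intro exI[of _ "1 + t"] exI[of _ s']) auto
qed

text \<open>The invariant fixes the counter as \<open>n - i\<close>, so every loop is a counted one:
  the number of rounds is known on entry, and the extra 1 per round pays for the test.\<close>

lemma runs_Loop:
  assumes step: "\<And>i s. i < n \<Longrightarrow> Inv i s \<Longrightarrow> runs B s T (Inv (Suc i))"
    and cnt: "\<And>i s. i \<le> n \<Longrightarrow> Inv i s \<Longrightarrow> ireg s q = int (n - i)"
    and "Inv 0 s"
  shows "runs (Loop q B) s (n * (T + 1) + 1) (Inv n)"
proof -
  have "runs (Loop q B) s ((n - i) * (T + 1) + 1) (Inv n)" if "i \<le> n" "Inv i s" for i s
    using that
  proof (induction "n - i" arbitrary: i s)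
    case 0
    then have "i = n" by simp
    moreover have "\<not> ireg s q > 0" using cnt[OF 0(2,3)] 0 by simp
    ultimately show ?case using exec_Loop_False[of s q B] 0 unfolding runs_def by fastforce
  next
    case (Suc m)
    from Suc.hyps(2) have i: "i < n" by simp
    have pos: "ireg s q > 0" using cnt[OF Suc.prems] i by simp
    obtain t s' where 1: "exec B s t s'" "t \<le> T" "Inv (Suc i) s'"
      using step[OF i Suc.prems(2)] unfolding runs_def by blast
    have "runs (Loop q B) s' ((n - Suc i) * (T + 1) + 1) (Inv n)"
      using Suc.hyps(1)[of "Suc i" s'] Suc.hyps(2) i 1 by simp
    then obtain t' s'' where 2: "exec (Loop q B) s' t' s''"
      "t' \<le> (n - Suc i) * (T + 1) + 1" "Inv n s''"
      unfolding runs_def by blast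
    have "n - i = Suc (n - Suc i)" using i by simp
    then have "1 + t + t' \<le> (n - i) * (T + 1) + 1" using 1(2) 2(2) by simp
    with exec_Loop_True[OF pos 1(1) 2(1)] 2(3) show ?case unfolding runs_def by blast
  qed
  from this[of 0 s] assms(3) show ?thesis by simp
qed

section \<open>Integer expressions compiled to programs with a uniform loop bound\<close>

text \<open>An input consists of the integer memory and the loop bound \<open>X\<close>.\<close>

type_synonym inp = "(int \<Rightarrow> int) \<times> nat"
type_synonym env = "nat \<Rightarrow> int"

text \<open>The frame condition of expression evaluation: both memories and all registers below
  \<open>b\<close> survive, which leaves the registers from \<open>b\<close> on as a stack for
  intermediate results.\<close>

definition keeps :: "nat \<Rightarrow> state \<Rightarrow> state \<Rightarrow> bool" where
  "keeps b s s' \<longleftrightarrow> imem s' = imem s \<and> rmem s' = rmem s \<and>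
     (\<forall>r<b. ireg s' r = ireg s r \<and> rreg s' r = rreg s r)"

lemma keepsD:
  assumes "keeps b s s'"
  shows "imem s' = imem s" "rmem s' = rmem s" "\<And>r. r < b \<Longrightarrow> ireg s' r = ireg s r"
    "\<And>r. r < b \<Longrightarrow> rreg s' r = rreg s r"
  using assms unfolding keeps_def by auto

lemma keeps_trans: "keeps b s s' \<Longrightarrow> keeps b' s' s'' \<Longrightarrow> b \<le> b' \<Longrightarrow> keeps b s s''"
  unfolding keeps_def by auto

text \<open>The program is parameterised by the registers \<open>\<rho> j\<close> that hold the variables of the environment and by a
  number \<open>b\<close> such that the registers from \<open>b\<close> on are free; the result is left in register \<open>b\<close>. Register 0
  holds the bound \<open>X\<close> of all loops, so that the running time depends on \<open>X\<close> only.\<close>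

definition icomp :: "((nat \<Rightarrow> nat) \<Rightarrow> nat \<Rightarrow> program) \<Rightarrow> (nat \<Rightarrow> nat) \<Rightarrow> (inp \<Rightarrow> env \<Rightarrow> int) \<Rightarrow> bool" where
  "icomp P T f \<longleftrightarrow> (\<forall>\<rho> b s X. (\<forall>j. \<rho> j < b) \<longrightarrow> ireg s 0 = int X \<longrightarrow>
     runs (P \<rho> b) s (T X) (\<lambda>s'. keeps b s s' \<and> ireg s' b = f (imem s, X) (\<lambda>j. ireg s (\<rho> j))))"

definition icomputable :: "(inp \<Rightarrow> env \<Rightarrow> int) \<Rightarrow> bool" where
  "icomputable f \<longleftrightarrow> (\<exists>P T. poly_bounded T \<and> icomp P T f)"

lemma icompD:
  "icomp P T f \<Longrightarrow> (\<And>j. \<rho> j < b) \<Longrightarrow> ireg s 0 = int X \<Longrightarrow>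
     (\<And>s'. keeps b s s' \<Longrightarrow> ireg s' b = f (imem s, X) (\<lambda>j. ireg s (\<rho> j)) \<Longrightarrow> R s') \<Longrightarrow>
     runs (P \<rho> b) s (T X) R"
  unfolding icomp_def by (erule allE[of _ \<rho>], erule allE[of _ b], erule allE[of _ s],
    erule allE[of _ X]) (auto elim: runs_mono)

lemma icompI:
  "(\<And>\<rho> b s X. (\<And>j. \<rho> j < b) \<Longrightarrow> 0 < b \<Longrightarrow> ireg s 0 = int X \<Longrightarrow>
     runs (P \<rho> b) s (T X) (\<lambda>s'. keeps b s s' \<and> ireg s' b = f (imem s, X) (\<lambda>j. ireg s (\<rho> j)))) \<Longrightarrow>
   icomp P T f"
  unfolding icomp_def by (metis gr_zeroI not_less0)

lemma icomputableI: "icomp P T f \<Longrightarrow> poly_bounded T \<Longrightarrow> icomputable f"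
  unfolding icomputable_def by blast

lemma comp_const: "icomputable (\<lambda>c \<sigma>. a)"
  by (rule icomputableI[of "\<lambda>\<rho> b. Do (Const b a)" "\<lambda>_. 1"])
    (auto intro!: icompI poly_bounded_const runs_Do simp: keeps_def simp del: One_nat_def)

lemma comp_var: "icomputable (\<lambda>c \<sigma>. \<sigma> n)"
\<comment> \<open>The machine has no move instruction; a register is copied by adding a zero to
  it.\<close>
proof (rule icomputableI[of "\<lambda>\<rho> b. Seq (Do (Const b 0)) (Do (Add b (\<rho> n) b))" "\<lambda>_. 2"])
  show "icomp (\<lambda>\<rho> b. Seq (Do (Const b 0)) (Do (Add b (\<rho> n) b))) (\<lambda>_. 2) (\<lambda>c \<sigma>. \<sigma> n)"
  proof (rule icompI)
    fix \<rho> :: "nat \<Rightarrow> nat" and b s X assume \<rho>: "\<And>j. \<rho> j < b"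
    then have "\<rho> n \<noteq> b" by (metis less_irrefl)
    then show "runs (Seq (Do (Const b 0)) (Do (Add b (\<rho> n) b))) s 2
      (\<lambda>s'. keeps b s s' \<and> ireg s' b = ireg s (\<rho> n))"
      unfolding numeral_2_eq_2
      by (intro runs_Do_Seq runs_Do) (simp_all add: keeps_def)
  qed
qed (intro poly_bounded_intros)

lemma comp_X: "icomputable (\<lambda>c \<sigma>. int (snd c))"
proof (rule icomputableI[of "\<lambda>\<rho> b. Seq (Do (Const b 0)) (Do (Add b 0 b))" "\<lambda>_. 2"])
  show "icomp (\<lambda>\<rho> b. Seq (Do (Const b 0)) (Do (Add b 0 b))) (\<lambda>_. 2) (\<lambda>c \<sigma>. int (snd c))"
    unfolding numeral_2_eq_2
    by (rule icompI, intro runs_Do_Seq runs_Do) (simp_all add: keeps_def)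
qed (intro poly_bounded_intros)

text \<open>Renaming adds no instruction: only the map \<open>\<rho>\<close> from variables to
  registers is composed with \<open>\<pi>\<close>.\<close>

lemma comp_rename:
  assumes "icomputable f"
  shows "icomputable (\<lambda>c \<sigma>. f c (\<lambda>n. \<sigma> (\<pi> n)))"
proof -
  obtain P T where "poly_bounded T" and f: "icomp P T f" using assms unfolding icomputable_def by blast
  then show ?thesis
    by (intro icomputableI[of "\<lambda>\<rho>. P (\<lambda>n. \<rho> (\<pi> n))" T] icompI icompD[OF f]) auto
qed

lemma comp_binop:
  assumes op: "\<And>a b c s. exec_instr (ins a b c) s = s\<lparr>ireg := (ireg s)(a := g (ireg s b) (ireg s c))\<rparr>"
    and "icomputable f1" "icomputable f2"
  shows "icomputable (\<lambda>c \<sigma>. g (f1 c \<sigma>) (f2 c \<sigma>))"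
proof -
  obtain P1 T1 where T1: "poly_bounded T1" and f1: "icomp P1 T1 f1" using assms unfolding icomputable_def by blast
  obtain P2 T2 where T2: "poly_bounded T2" and f2: "icomp P2 T2 f2" using assms unfolding icomputable_def by blast
  let ?P = "\<lambda>\<rho> b. Seq (P1 \<rho> b) (Seq (P2 \<rho> (Suc b)) (Do (ins b b (Suc b))))"
  show ?thesis
  proof (rule icomputableI[of ?P "\<lambda>X. T1 X + (T2 X + 1)"])
    show "icomp ?P (\<lambda>X. T1 X + (T2 X + 1)) (\<lambda>c \<sigma>. g (f1 c \<sigma>) (f2 c \<sigma>))"
    proof (rule icompI, rule runs_Seq, rule icompD[OF f1], goal_cases)
      case (3 \<rho> b s X s')
      have e: "ireg s' (\<rho> j) = ireg s (\<rho> j)" for j using 3 keepsD by blast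
      show ?case
      proof (rule runs_Seq, rule icompD[OF f2], goal_cases)
        case (3 s'')
        then show ?case using \<open>keeps b s s'\<close> \<open>ireg s' b = _\<close>
          by (intro runs_Do) (simp_all add: op keeps_def e)
      qed (use 3 keepsD in \<open>auto simp: less_Suc_eq\<close>)
    qed
  qed (intro poly_bounded_intros T1 T2)
qed

lemma comp_add: "icomputable f \<Longrightarrow> icomputable g \<Longrightarrow> icomputable (\<lambda>c \<sigma>. f c \<sigma> + g c \<sigma>)"
  by (rule comp_binop[of Add]) auto

lemma comp_diff: "icomputable f \<Longrightarrow> icomputable g \<Longrightarrow> icomputable (\<lambda>c \<sigma>. f c \<sigma> - g c \<sigma>)"
  by (rule comp_binop[of Sub]) auto

lemma comp_load:
  assumes "icomputable f"
  shows "icomputable (\<lambda>c \<sigma>. fst c (f c \<sigma>))"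
proof -
  obtain P T where T: "poly_bounded T" and f: "icomp P T f" using assms unfolding icomputable_def by blast
  show ?thesis
  proof (rule icomputableI[of "\<lambda>\<rho> b. Seq (P \<rho> b) (Do (Load b b))" "\<lambda>X. T X + 1"])
    show "icomp (\<lambda>\<rho> b. Seq (P \<rho> b) (Do (Load b b))) (\<lambda>X. T X + 1) (\<lambda>c \<sigma>. fst c (f c \<sigma>))"
      by (rule icompI, rule runs_Seq, rule icompD[OF f]; (rule runs_Do)?) (auto simp: keeps_def)
  qed (intro poly_bounded_intros T)
qed

lemma comp_if_pos:
  assumes "icomputable f" "icomputable g" "icomputable h"
  shows "icomputable (\<lambda>c \<sigma>. if 0 < f c \<sigma> then g c \<sigma> else h c \<sigma>)"
proof -
  obtain P T where T: "poly_bounded T" and f: "icomp P T f" using assms unfolding icomputable_def by blast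
  obtain P1 T1 where T1: "poly_bounded T1" and g: "icomp P1 T1 g" using assms unfolding icomputable_def by blast
  obtain P2 T2 where T2: "poly_bounded T2" and h: "icomp P2 T2 h" using assms unfolding icomputable_def by blast
  let ?P = "\<lambda>\<rho> b. Seq (P \<rho> b) (Cond b (P1 \<rho> b) (P2 \<rho> b))"
  show ?thesis
  proof (rule icomputableI[of ?P "\<lambda>X. T X + (1 + T1 X + T2 X)"])
    show "icomp ?P (\<lambda>X. T X + (1 + T1 X + T2 X)) (\<lambda>c \<sigma>. if 0 < f c \<sigma> then g c \<sigma> else h c \<sigma>)"
    proof (rule icompI, rule runs_Seq, rule icompD[OF f], goal_cases)
      case (3 \<rho> b s X s')
      have e: "ireg s' (\<rho> j) = ireg s (\<rho> j)" for j using 3 keepsD by blast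
      have e0: "ireg s' 0 = int X" using 3 keepsD by metis
      show ?case
        by (rule runs_Cond; rule icompD[OF g] icompD[OF h])
          (use 3 e0 in \<open>auto simp: e keepsD(1)[OF 3(4)] intro: keeps_trans\<close>)
    qed
  qed (intro poly_bounded_intros T T1 T2)
qed

text \<open>Environments follow de Bruijn: the value of \<open>g\<close> becomes variable 0 and the
  older variables move up by one. It stays in register \<open>b\<close> while the body is evaluated
  from \<open>Suc b\<close> on, and is then overwritten by the result.\<close>

lemma comp_let:
  assumes "icomputable g" "icomputable (\<lambda>c \<sigma>. f c (\<lambda>n. \<sigma> (Suc n)) (\<sigma> 0))"
  shows "icomputable (\<lambda>c \<sigma>. f c \<sigma> (g c \<sigma>))"
proof -
  obtain P T where T: "poly_bounded T" and g: "icomp P T g" using assms unfolding icomputable_def by blast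
  obtain P1 T1 where T1: "poly_bounded T1" and f: "icomp P1 T1 (\<lambda>c \<sigma>. f c (\<lambda>n. \<sigma> (Suc n)) (\<sigma> 0))"
    using assms unfolding icomputable_def by blast
  let ?P = "\<lambda>\<rho> b. Seq (P \<rho> b) (Seq (P1 (case_nat b \<rho>) (Suc b)) (Seq (Do (Const b 0)) (Do (Add b b (Suc b)))))"
  show ?thesis
  proof (rule icomputableI[of ?P "\<lambda>X. T X + (T1 X + Suc 1)"])
    show "icomp ?P (\<lambda>X. T X + (T1 X + Suc 1)) (\<lambda>c \<sigma>. f c \<sigma> (g c \<sigma>))"
    proof (rule icompI, rule runs_Seq, rule icompD[OF g], goal_cases)
      case (3 \<rho> b s X s')
      have e: "ireg s' (\<rho> j) = ireg s (\<rho> j)" for j using 3 keepsD by blast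
      have e0: "ireg s' 0 = int X" using 3 keepsD by metis
      show ?case
      proof (rule runs_Seq, rule icompD[OF f], goal_cases)
        case (3 s'')
        then show ?case using \<open>keeps b s s'\<close> \<open>ireg s' b = _\<close>
          by (intro runs_Do_Seq runs_Do) (simp_all add: keeps_def e)
      qed (use 3 e0 in \<open>auto simp: less_Suc_eq split: nat.split\<close>)
    qed
  qed (intro poly_bounded_intros T T1)
qed

fun iter :: "nat \<Rightarrow> (int \<Rightarrow> 'a \<Rightarrow> 'a) \<Rightarrow> 'a \<Rightarrow> 'a" where
  "iter 0 f a = a"
| "iter (Suc n) f a = f (int n) (iter n f a)"

text \<open>The loop runs exactly \<open>X\<close> rounds, so its time depends on \<open>X\<close>
  alone. Variable 0 of the body is the index and variable 1 the accumulator; they live in the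
  registers \<open>b + 1\<close> and \<open>b\<close>, the countdown in \<open>b + 2\<close>, and
  the body is evaluated from \<open>b + 3\<close> on.\<close>

lemma comp_iter:
  assumes "icomputable g" "icomputable (\<lambda>c \<sigma>. f c (\<lambda>n. \<sigma> (Suc (Suc n))) (\<sigma> 0) (\<sigma> (Suc 0)))"
  shows "icomputable (\<lambda>c \<sigma>. iter (snd c) (f c \<sigma>) (g c \<sigma>))"
proof -
  obtain P T where T: "poly_bounded T" and g: "icomp P T g" using assms unfolding icomputable_def by blast
  obtain P1 T1 where T1: "poly_bounded T1"
    and f: "icomp P1 T1 (\<lambda>c \<sigma>. f c (\<lambda>n. \<sigma> (Suc (Suc n))) (\<sigma> 0) (\<sigma> (Suc 0)))"
    using assms unfolding icomputable_def by blast
  let ?B = "\<lambda>\<rho> b. Seq (P1 (case_nat (b+1) (case_nat b \<rho>)) (b+3))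
    (Seq (Do (Const (b+4) 0)) (Seq (Do (Add b (b+3) (b+4))) (Seq (Do (Const (b+4) 1))
      (Seq (Do (Add (b+1) (b+1) (b+4))) (Do (Sub (b+2) (b+2) (b+4)))))))"
  let ?P = "\<lambda>\<rho> b. Seq (P \<rho> b) (Seq (Do (Const (b+1) 0)) (Seq (Do (Add (b+2) 0 (b+1)))
    (Loop (b+2) (?B \<rho> b))))"
  let ?T = "\<lambda>X. T X + Suc (Suc (X * (T1 X + 5 + 1) + 1))"
  show ?thesis
  proof (rule icomputableI[of ?P ?T])
    show "icomp ?P ?T (\<lambda>c \<sigma>. iter (snd c) (f c \<sigma>) (g c \<sigma>))"
    proof (rule icompI, rule runs_Seq, rule icompD[OF g], goal_cases)
      case (3 \<rho> b s X s')
      note b0 = \<open>0 < b\<close>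
      let ?\<sigma> = "\<lambda>j. ireg s (\<rho> j)" let ?c = "(imem s, X)"
      let ?it = "\<lambda>i. iter i (f ?c ?\<sigma>) (g ?c ?\<sigma>)"
      define Inv where "Inv i s2 \<longleftrightarrow> keeps b s s2 \<and> ireg s2 b = ?it i \<and> ireg s2 (b+1) = int i \<and>
        ireg s2 (b+2) = int (X - i)" for i s2
      have rho_ne: "\<rho> j \<noteq> b + m" for j m using 3(1)[of j] by simp
      show ?case
      proof (intro runs_Do_Seq, rule runs_mono[OF runs_Loop[where Inv = Inv and n = X]])
        show "Inv 0 (exec_instr (Add (b+2) 0 (b+1)) (exec_instr (Const (b+1) 0) s'))"
          using 3 unfolding Inv_def by (simp add: keeps_def)
      next
        fix i s2 assume i: "i < X" and I: "Inv i s2"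
        have k2: "keeps b s s2" using I unfolding Inv_def by simp
        have e: "ireg s2 (\<rho> j) = ireg s (\<rho> j)" for j using keepsD(3)[OF k2 3(1)] .
        have e0: "ireg s2 0 = int X" using keepsD(3)[OF k2 b0] 3 by simp
        have lt: "case_nat (b + 1) (case_nat b \<rho>) j < b + 3" for j
          using 3(1) by (auto split: nat.split simp: less_Suc_eq trans_less_add1)
        show "runs (?B \<rho> b) s2 (T1 X + 5) (Inv (Suc i))"
        proof (rule runs_Seq, rule icompD[OF f lt e0], goal_cases)
          case (1 s3)
          have r: "ireg s3 (b+3) = ?it (Suc i)"
            using 1(2) I unfolding Inv_def by (simp add: e keepsD(1)[OF k2])
          have k3: "keeps b s s3" using keeps_trans[OF k2 1(1)] by simp
          have r1: "ireg s3 (b+1) = int i" "ireg s3 (b+2) = int (X - i)"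
            using I keepsD(3)[OF 1(1)] unfolding Inv_def by simp_all
          have "runs (Seq (Do (Const (b+4) 0)) (Seq (Do (Add b (b+3) (b+4))) (Seq (Do (Const (b+4) 1))
            (Seq (Do (Add (b+1) (b+1) (b+4))) (Do (Sub (b+2) (b+2) (b+4))))))) s3
            (Suc (Suc (Suc (Suc 1)))) (Inv (Suc i))"
            using k3 r r1 i by (intro runs_Do_Seq runs_Do) (auto simp: Inv_def keeps_def)
          then show ?case by (simp add: eval_nat_numeral)
        qed
      next
        show "\<And>i s. i \<le> X \<Longrightarrow> Inv i s \<Longrightarrow> ireg s (b+2) = int (X - i)" unfolding Inv_def by simp
      next
        fix s2 assume "Inv X s2"
        then show "keeps b s s2 \<and> ireg s2 b = iter (snd ?c) (f ?c ?\<sigma>) (g ?c ?\<sigma>)"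
          unfolding Inv_def by simp
      qed simp
    qed
  qed (unfold Suc_eq_plus1, intro poly_bounded_intros T T1)
qed

lemma comp_cong: "icomputable f \<Longrightarrow> (\<And>c \<sigma>. g c \<sigma> = f c \<sigma>) \<Longrightarrow> icomputable g"
  by presburger

fun push :: "int list \<Rightarrow> env \<Rightarrow> env" where
  "push [] \<sigma> = \<sigma>"
| "push (x # xs) \<sigma> = case_nat x (push xs \<sigma>)"

lemma push_add: "push xs \<sigma> (n + length xs) = \<sigma> n"
  by (induction xs) auto

text \<open>Call by value. The arguments are pushed by nested lets, and each is evaluated in the
  outer environment, which is reached by skipping the values already pushed. Hence a function
  compiled once for plain variables can be applied to arbitrary computable arguments; all later
  definitions are composed in this way.\<close>

lemma comp_push:
  "icomputable h \<Longrightarrow> list_all icomputable fs \<Longrightarrow> icomputable (\<lambda>c \<sigma>. h c (push (map (\<lambda>f. f c \<sigma>) fs) \<sigma>))"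
proof (induction fs arbitrary: h)
  case (Cons f fs)
  have "icomputable (\<lambda>c \<sigma>. h c (case_nat (f c (\<lambda>n. \<sigma> (n + length fs))) \<sigma>))"
  proof (rule comp_let[of "\<lambda>c \<sigma>. f c (\<lambda>n. \<sigma> (n + length fs))" "\<lambda>c \<sigma> x. h c (case_nat x \<sigma>)"])
    show "icomputable (\<lambda>c \<sigma>. f c (\<lambda>n. \<sigma> (n + length fs)))" using comp_rename[of f "\<lambda>n. n + length fs"] Cons.prems by simp
    have "case_nat (\<sigma> 0) (\<lambda>n. \<sigma> (Suc n)) = \<sigma>" for \<sigma> :: env by (rule ext) (simp split: nat.split)
    with Cons.prems show "icomputable (\<lambda>c \<sigma>. h c (case_nat (\<sigma> 0) (\<lambda>n. \<sigma> (Suc n))))" by simp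
  qed
  from Cons.IH[OF this] Cons.prems push_add[of "map (\<lambda>f. f _ _) fs"] show ?case by simp
qed simp

lemma comp_app1:
  assumes "icomputable (\<lambda>c \<sigma>. h c (\<sigma> 0))" "icomputable f1"
  shows "icomputable (\<lambda>c \<sigma>. h c (f1 c \<sigma>))"
  using comp_push[OF assms(1), of "[f1]"] assms by (simp add: eval_nat_numeral)

lemma comp_app2:
  assumes "icomputable (\<lambda>c \<sigma>. h c (\<sigma> 0) (\<sigma> 1))" "icomputable f1" "icomputable f2"
  shows "icomputable (\<lambda>c \<sigma>. h c (f1 c \<sigma>) (f2 c \<sigma>))"
  using comp_push[OF assms(1), of "[f1, f2]"] assms by (simp add: eval_nat_numeral)

lemma comp_app3:
  assumes "icomputable (\<lambda>c \<sigma>. h c (\<sigma> 0) (\<sigma> 1) (\<sigma> 2))" "icomputable f1" "icomputable f2" "icomputable f3"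
  shows "icomputable (\<lambda>c \<sigma>. h c (f1 c \<sigma>) (f2 c \<sigma>) (f3 c \<sigma>))"
  using comp_push[OF assms(1), of "[f1, f2, f3]"] assms by (simp add: eval_nat_numeral)

lemma comp_app4:
  assumes "icomputable (\<lambda>c \<sigma>. h c (\<sigma> 0) (\<sigma> 1) (\<sigma> 2) (\<sigma> 3))" "icomputable f1" "icomputable f2" "icomputable f3" "icomputable f4"
  shows "icomputable (\<lambda>c \<sigma>. h c (f1 c \<sigma>) (f2 c \<sigma>) (f3 c \<sigma>) (f4 c \<sigma>))"
  using comp_push[OF assms(1), of "[f1, f2, f3, f4]"] assms by (simp add: eval_nat_numeral)

lemma comp_app5:
  assumes "icomputable (\<lambda>c \<sigma>. h c (\<sigma> 0) (\<sigma> 1) (\<sigma> 2) (\<sigma> 3) (\<sigma> 4))" "icomputable f1" "icomputable f2" "icomputable f3" "icomputable f4" "icomputable f5"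
  shows "icomputable (\<lambda>c \<sigma>. h c (f1 c \<sigma>) (f2 c \<sigma>) (f3 c \<sigma>) (f4 c \<sigma>) (f5 c \<sigma>))"
  using comp_push[OF assms(1), of "[f1, f2, f3, f4, f5]"] assms by (simp add: eval_nat_numeral)

lemma comp_app6:
  assumes "icomputable (\<lambda>c \<sigma>. h c (\<sigma> 0) (\<sigma> 1) (\<sigma> 2) (\<sigma> 3) (\<sigma> 4) (\<sigma> 5))" "icomputable f1" "icomputable f2" "icomputable f3" "icomputable f4" "icomputable f5" "icomputable f6"
  shows "icomputable (\<lambda>c \<sigma>. h c (f1 c \<sigma>) (f2 c \<sigma>) (f3 c \<sigma>) (f4 c \<sigma>) (f5 c \<sigma>) (f6 c \<sigma>))"
  using comp_push[OF assms(1), of "[f1, f2, f3, f4, f5, f6]"] assms by (simp add: eval_nat_numeral)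

lemma comp_app7:
  assumes "icomputable (\<lambda>c \<sigma>. h c (\<sigma> 0) (\<sigma> 1) (\<sigma> 2) (\<sigma> 3) (\<sigma> 4) (\<sigma> 5) (\<sigma> 6))" "icomputable f1" "icomputable f2" "icomputable f3" "icomputable f4" "icomputable f5" "icomputable f6" "icomputable f7"
  shows "icomputable (\<lambda>c \<sigma>. h c (f1 c \<sigma>) (f2 c \<sigma>) (f3 c \<sigma>) (f4 c \<sigma>) (f5 c \<sigma>) (f6 c \<sigma>) (f7 c \<sigma>))"
  using comp_push[OF assms(1), of "[f1, f2, f3, f4, f5, f6, f7]"] assms by (simp add: eval_nat_numeral)

section \<open>Truth values, bounded quantifiers and least-number search\<close>

definition bcomputable :: "(inp \<Rightarrow> env \<Rightarrow> bool) \<Rightarrow> bool" where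
  "bcomputable \<phi> \<longleftrightarrow> icomputable (\<lambda>c \<sigma>. if \<phi> c \<sigma> then 1 else 0)"

lemma comp_if:
  assumes "bcomputable \<phi>" "icomputable f" "icomputable g"
  shows "icomputable (\<lambda>c \<sigma>. if \<phi> c \<sigma> then f c \<sigma> else g c \<sigma>)"
  by (rule comp_cong[OF comp_if_pos[OF assms(1)[unfolded bcomputable_def] assms(2,3)]]) simp

lemma bcomp_less:
  assumes "icomputable f" "icomputable g" shows "bcomputable (\<lambda>c \<sigma>. f c \<sigma> < g c \<sigma>)"
  unfolding bcomputable_def
  by (rule comp_cong[OF comp_if_pos[OF comp_diff[OF assms(2,1)] comp_const[of 1] comp_const[of 0]]]) simp

lemma bcomp_True: "bcomputable (\<lambda>c \<sigma>. True)" and bcomp_False: "bcomputable (\<lambda>c \<sigma>. False)"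
  unfolding bcomputable_def by (simp_all add: comp_const)

lemma bcomp_if:
  assumes "bcomputable \<phi>" "bcomputable \<psi>" "bcomputable \<chi>"
  shows "bcomputable (\<lambda>c \<sigma>. if \<phi> c \<sigma> then \<psi> c \<sigma> else \<chi> c \<sigma>)"
  unfolding bcomputable_def
  by (rule comp_cong[OF comp_if[OF assms(1) assms(2,3)[unfolded bcomputable_def]]]) simp

lemma bcomp_cong: "bcomputable f \<Longrightarrow> (\<And>c \<sigma>. g c \<sigma> = f c \<sigma>) \<Longrightarrow> bcomputable g"
  by presburger

lemma bcomp_not:
  assumes "bcomputable \<phi>" shows "bcomputable (\<lambda>c \<sigma>. \<not> \<phi> c \<sigma>)"
  by (rule bcomp_cong[OF bcomp_if[OF assms bcomp_False bcomp_True]]) simp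

lemma bcomp_conj:
  assumes "bcomputable \<phi>" "bcomputable \<psi>" shows "bcomputable (\<lambda>c \<sigma>. \<phi> c \<sigma> \<and> \<psi> c \<sigma>)"
  by (rule bcomp_cong[OF bcomp_if[OF assms bcomp_False]]) simp

lemma bcomp_disj:
  assumes "bcomputable \<phi>" "bcomputable \<psi>" shows "bcomputable (\<lambda>c \<sigma>. \<phi> c \<sigma> \<or> \<psi> c \<sigma>)"
  by (rule bcomp_cong[OF bcomp_if[OF assms(1) bcomp_True assms(2)]]) simp

lemma bcomp_imp:
  assumes "bcomputable \<phi>" "bcomputable \<psi>" shows "bcomputable (\<lambda>c \<sigma>. \<phi> c \<sigma> \<longrightarrow> \<psi> c \<sigma>)"
  by (rule bcomp_cong[OF bcomp_if[OF assms bcomp_True]]) simp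

lemma bcomp_le:
  assumes "icomputable f" "icomputable g" shows "bcomputable (\<lambda>c \<sigma>. f c \<sigma> \<le> g c \<sigma>)"
  by (rule bcomp_cong[OF bcomp_not[OF bcomp_less[OF assms(2,1)]]]) auto

lemma bcomp_eq:
  assumes "icomputable f" "icomputable g" shows "bcomputable (\<lambda>c \<sigma>. f c \<sigma> = g c \<sigma>)"
  by (rule bcomp_cong[OF bcomp_conj[OF bcomp_le[OF assms] bcomp_le[OF assms(2,1)]]]) auto

definition range_of :: "inp \<Rightarrow> int set" where
  "range_of c = {0..<int (snd c)}"

lemma range_of_eq: "range_of c = int ` {..<snd c}"
proof -
  have "x \<in> int ` {..<snd c}" if "x \<in> range_of c" for x
    using that by (intro image_eqI[of _ _ "nat x"]) (auto simp: range_of_def)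
  then show ?thesis by (auto simp: range_of_def)
qed

lemma comp_skip:
  assumes "icomputable (\<lambda>c \<sigma>. f c (\<lambda>n. \<sigma> (Suc n)) (\<sigma> 0))"
  shows "icomputable (\<lambda>c \<sigma>. f c (\<lambda>n. \<sigma> (Suc (Suc n))) (\<sigma> 0))"
  using comp_rename[OF assms, of "case_nat 0 (\<lambda>n. Suc (Suc n))"] by simp

lemma comp_sum:
  assumes "icomputable (\<lambda>c \<sigma>. f c (\<lambda>n. \<sigma> (Suc n)) (\<sigma> 0))"
  shows "icomputable (\<lambda>c \<sigma>. \<Sum>i\<in>range_of c. f c \<sigma> i)"
proof (rule comp_cong[OF comp_iter[OF comp_const[of 0] comp_add[OF comp_skip[OF assms] comp_var[of "Suc 0"]]]])
  have "iter n (\<lambda>i. (+) (f i)) 0 = (\<Sum>i<n. f (int i))" for n and f :: "int \<Rightarrow> int"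
    by (induction n) auto
  then show "(\<Sum>i\<in>range_of c. f c \<sigma> i) = iter (snd c) (\<lambda>i. (+) (f c \<sigma> i)) 0" for c \<sigma>
    by (simp add: range_of_eq sum.reindex)
qed

lemma bcomp_ex:
  assumes "bcomputable (\<lambda>c \<sigma>. \<phi> c (\<lambda>n. \<sigma> (Suc n)) (\<sigma> 0))"
  shows "bcomputable (\<lambda>c \<sigma>. \<exists>i\<in>range_of c. \<phi> c \<sigma> i)"
proof (rule bcomp_cong[OF bcomp_less[OF comp_const[of 0]
    comp_sum[of "\<lambda>c \<sigma> i. if \<phi> c \<sigma> i then 1 else 0", OF assms[unfolded bcomputable_def]]]])
  show "(\<exists>i\<in>range_of c. \<phi> c \<sigma> i) = (0 < (\<Sum>i\<in>range_of c. if \<phi> c \<sigma> i then 1 else (0::int)))" for c \<sigma>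
    by (auto simp: sum.If_cases range_of_def card_gt_0_iff)
qed

lemma bcomp_all:
  assumes "bcomputable (\<lambda>c \<sigma>. \<phi> c (\<lambda>n. \<sigma> (Suc n)) (\<sigma> 0))"
  shows "bcomputable (\<lambda>c \<sigma>. \<forall>i\<in>range_of c. \<phi> c \<sigma> i)"
  by (rule bcomp_cong[OF bcomp_not[OF bcomp_ex[of "\<lambda>c \<sigma> i. \<not> \<phi> c \<sigma> i", OF bcomp_not[OF assms]]]]) simp

definition search :: "inp \<Rightarrow> (int \<Rightarrow> bool) \<Rightarrow> int" where
  "search c \<phi> = (if \<exists>i\<in>range_of c. \<phi> i then (LEAST i. i \<in> range_of c \<and> \<phi> i) else - 1)"

lemma search_found:
  assumes "i \<in> range_of c" "\<phi> i"
  shows "search c \<phi> \<in> range_of c" "\<phi> (search c \<phi>)" "search c \<phi> \<le> i"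
proof -
  let ?S = "{i \<in> range_of c. \<phi> i}"
  have f: "finite ?S" "?S \<noteq> {}"
    using assms by (auto simp: range_of_def intro: finite_subset[of _ "{0..<int (snd c)}"])
  have "(LEAST i. i \<in> range_of c \<and> \<phi> i) = Min ?S"
    by (rule Least_equality) (use Min_in[OF f] f in auto)
  then have "search c \<phi> = Min ?S" unfolding search_def using assms by auto
  with Min_in[OF f] Min_le[OF f(1), of i] assms
  show "search c \<phi> \<in> range_of c" "\<phi> (search c \<phi>)" "search c \<phi> \<le> i" by auto
qed

lemma search_none: "(\<And>i. i \<in> range_of c \<Longrightarrow> \<not> \<phi> i) \<Longrightarrow> search c \<phi> = - 1"
  unfolding search_def by auto

lemma comp_search:
  assumes "bcomputable (\<lambda>c \<sigma>. \<phi> c (\<lambda>n. \<sigma> (Suc n)) (\<sigma> 0))"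
  shows "icomputable (\<lambda>c \<sigma>. search c (\<phi> c \<sigma>))"
proof -
  \<comment> \<open>The iteration scans upwards, so the first hit is the least one; a negative
    accumulator means that nothing has been found yet.\<close>
  define F where "F \<phi> i a = (if \<phi> i then (if a < 0 then i else a) else a)"
    for \<phi> :: "int \<Rightarrow> bool" and i a :: int
  have a: "bcomputable (\<lambda>c \<sigma>. \<phi> c (\<lambda>n. \<sigma> (Suc (Suc n))) (\<sigma> 0))"
    using comp_skip[of "\<lambda>c \<sigma> i. if \<phi> c \<sigma> i then 1 else 0"] assms unfolding bcomputable_def by simp
  have it: "iter n (F \<phi>) (- 1) = (if \<exists>i<n. \<phi> (int i) then int (LEAST i. \<phi> (int i)) else - 1)" for n \<phi>
  proof (induction n)
    case (Suc n)
    have "(LEAST i. \<phi> (int i)) = n" if "\<phi> (int n)" "\<not> (\<exists>i<n. \<phi> (int i))"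
      using that by (intro Least_equality) (auto simp: not_less[symmetric])
    with Suc show ?case by (auto simp: F_def less_Suc_eq)
  qed (simp add: F_def)
  have s: "search c \<phi> = iter (snd c) (F \<phi>) (- 1)" for c \<phi>
  proof (cases "\<exists>i<snd c. \<phi> (int i)")
    case True
    then obtain i where i: "i < snd c" "\<phi> (int i)" by blast
    let ?l = "LEAST i. \<phi> (int i)"
    have l: "\<phi> (int ?l)" "?l \<le> i" using i by (auto intro: LeastI Least_le)
    then have r: "int ?l \<in> range_of c" using i by (auto simp: range_of_def)
    note sf = search_found[of _ c \<phi>, OF r l(1)]
    have "?l \<le> nat (search c \<phi>)" using sf(1,2) by (intro Least_le) (auto simp: range_of_def)
    with sf(1,3) have "search c \<phi> = int ?l" by (auto simp: range_of_def)
    with True show ?thesis by (simp add: it)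
  next
    case False
    then show ?thesis using search_none[of c \<phi>] by (auto simp: it range_of_eq)
  qed
  have "icomputable (\<lambda>c \<sigma>. iter (snd c) (F (\<phi> c \<sigma>)) (- 1))"
    unfolding F_def by (intro comp_iter comp_const comp_if a bcomp_less comp_var)
  then show ?thesis by (rule comp_cong) (rule s)
qed

lemma bcomp_app2:
  assumes "bcomputable (\<lambda>c \<sigma>. h c (\<sigma> 0) (\<sigma> 1))" "icomputable f1" "icomputable f2"
  shows "bcomputable (\<lambda>c \<sigma>. h c (f1 c \<sigma>) (f2 c \<sigma>))"
  using comp_app2[of "\<lambda>c x1 x2. if h c x1 x2 then 1 else 0"] assms unfolding bcomputable_def by blast

lemma bcomp_app3:
  assumes "bcomputable (\<lambda>c \<sigma>. h c (\<sigma> 0) (\<sigma> 1) (\<sigma> 2))" "icomputable f1" "icomputable f2" "icomputable f3"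
  shows "bcomputable (\<lambda>c \<sigma>. h c (f1 c \<sigma>) (f2 c \<sigma>) (f3 c \<sigma>))"
  using comp_app3[of "\<lambda>c x1 x2 x3. if h c x1 x2 x3 then 1 else 0"] assms unfolding bcomputable_def by blast

lemma bcomp_app4:
  assumes "bcomputable (\<lambda>c \<sigma>. h c (\<sigma> 0) (\<sigma> 1) (\<sigma> 2) (\<sigma> 3))" "icomputable f1" "icomputable f2" "icomputable f3" "icomputable f4"
  shows "bcomputable (\<lambda>c \<sigma>. h c (f1 c \<sigma>) (f2 c \<sigma>) (f3 c \<sigma>) (f4 c \<sigma>))"
  using comp_app4[of "\<lambda>c x1 x2 x3 x4. if h c x1 x2 x3 x4 then 1 else 0"] assms unfolding bcomputable_def by blast

lemma bcomp_app5:
  assumes "bcomputable (\<lambda>c \<sigma>. h c (\<sigma> 0) (\<sigma> 1) (\<sigma> 2) (\<sigma> 3) (\<sigma> 4))" "icomputable f1" "icomputable f2" "icomputable f3" "icomputable f4" "icomputable f5"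
  shows "bcomputable (\<lambda>c \<sigma>. h c (f1 c \<sigma>) (f2 c \<sigma>) (f3 c \<sigma>) (f4 c \<sigma>) (f5 c \<sigma>))"
  using comp_app5[of "\<lambda>c x1 x2 x3 x4 x5. if h c x1 x2 x3 x4 x5 then 1 else 0"] assms unfolding bcomputable_def by blast

lemma bcomp_app6:
  assumes "bcomputable (\<lambda>c \<sigma>. h c (\<sigma> 0) (\<sigma> 1) (\<sigma> 2) (\<sigma> 3) (\<sigma> 4) (\<sigma> 5))" "icomputable f1" "icomputable f2" "icomputable f3" "icomputable f4" "icomputable f5" "icomputable f6"
  shows "bcomputable (\<lambda>c \<sigma>. h c (f1 c \<sigma>) (f2 c \<sigma>) (f3 c \<sigma>) (f4 c \<sigma>) (f5 c \<sigma>) (f6 c \<sigma>))"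
  using comp_app6[of "\<lambda>c x1 x2 x3 x4 x5 x6. if h c x1 x2 x3 x4 x5 x6 then 1 else 0"] assms unfolding bcomputable_def by blast

lemmas comp_intros = comp_const comp_var comp_X comp_add comp_diff comp_load comp_if
  comp_iter comp_sum comp_search bcomp_less bcomp_le bcomp_eq bcomp_not bcomp_conj bcomp_disj bcomp_imp
  bcomp_True bcomp_False bcomp_ex bcomp_all

section \<open>Real-valued expressions under integer control\<close>

definition rcomp :: "((nat \<Rightarrow> nat) \<Rightarrow> nat \<Rightarrow> program) \<Rightarrow> (nat \<Rightarrow> nat) \<Rightarrow>
    (inp \<Rightarrow> env \<Rightarrow> (int \<Rightarrow> real) \<Rightarrow> real) \<Rightarrow> bool" where
  "rcomp P T f \<longleftrightarrow> (\<forall>\<rho> b s X. (\<forall>j. \<rho> j < b) \<longrightarrow> ireg s 0 = int X \<longrightarrow>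
     runs (P \<rho> b) s (T X) (\<lambda>s'. keeps b s s' \<and>
       rreg s' b = f (imem s, X) (\<lambda>j. ireg s (\<rho> j)) (rmem s)))"

definition rcomputable :: "(inp \<Rightarrow> env \<Rightarrow> (int \<Rightarrow> real) \<Rightarrow> real) \<Rightarrow> bool" where
  "rcomputable f \<longleftrightarrow> (\<exists>P T. poly_bounded T \<and> rcomp P T f)"

lemma rcompD:
  "rcomp P T f \<Longrightarrow> (\<And>j. \<rho> j < b) \<Longrightarrow> ireg s 0 = int X \<Longrightarrow>
     (\<And>s'. keeps b s s' \<Longrightarrow> rreg s' b = f (imem s, X) (\<lambda>j. ireg s (\<rho> j)) (rmem s) \<Longrightarrow> R s') \<Longrightarrow>
     runs (P \<rho> b) s (T X) R"
  unfolding rcomp_def by (erule allE[of _ \<rho>], erule allE[of _ b], erule allE[of _ s],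
    erule allE[of _ X]) (auto elim: runs_mono)

lemma rcompI:
  "(\<And>\<rho> b s X. (\<And>j. \<rho> j < b) \<Longrightarrow> 0 < b \<Longrightarrow> ireg s 0 = int X \<Longrightarrow>
     runs (P \<rho> b) s (T X) (\<lambda>s'. keeps b s s' \<and>
       rreg s' b = f (imem s, X) (\<lambda>j. ireg s (\<rho> j)) (rmem s))) \<Longrightarrow> rcomp P T f"
  unfolding rcomp_def by (metis gr_zeroI not_less0)

lemma rcomputableI: "rcomp P T f \<Longrightarrow> poly_bounded T \<Longrightarrow> rcomputable f"
  unfolding rcomputable_def by blast

lemma rcomp_const: "rcomputable (\<lambda>c \<sigma> M. of_int a)"
  by (rule rcomputableI[of "\<lambda>\<rho> b. Do (RConst b a)" "\<lambda>_. 1"])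
    (auto intro!: rcompI poly_bounded_const runs_Do simp: keeps_def simp del: One_nat_def)

lemma rcomp_0: "rcomputable (\<lambda>c \<sigma> M. 0)" and rcomp_1: "rcomputable (\<lambda>c \<sigma> M. 1)"
  using rcomp_const[of 0] rcomp_const[of 1] by simp_all

lemma rcomp_load:
  assumes "icomputable f"
  shows "rcomputable (\<lambda>c \<sigma> M. M (f c \<sigma>))"
proof -
  obtain P T where T: "poly_bounded T" and f: "icomp P T f" using assms unfolding icomputable_def by blast
  show ?thesis
  proof (rule rcomputableI[of "\<lambda>\<rho> b. Seq (P \<rho> b) (Do (RLoad b b))" "\<lambda>X. T X + 1"])
    show "rcomp (\<lambda>\<rho> b. Seq (P \<rho> b) (Do (RLoad b b))) (\<lambda>X. T X + 1) (\<lambda>c \<sigma> M. M (f c \<sigma>))"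
      by (rule rcompI, rule runs_Seq, rule icompD[OF f]; (rule runs_Do)?) (auto simp: keeps_def)
  qed (intro poly_bounded_intros T)
qed

lemma rcomp_binop:
  assumes op: "\<And>a b c s. exec_instr (ins a b c) s = s\<lparr>rreg := (rreg s)(a := g (rreg s b) (rreg s c))\<rparr>"
    and "rcomputable f1" "rcomputable f2"
  shows "rcomputable (\<lambda>c \<sigma> M. g (f1 c \<sigma> M) (f2 c \<sigma> M))"
proof -
  obtain P1 T1 where T1: "poly_bounded T1" and f1: "rcomp P1 T1 f1" using assms unfolding rcomputable_def by blast
  obtain P2 T2 where T2: "poly_bounded T2" and f2: "rcomp P2 T2 f2" using assms unfolding rcomputable_def by blast
  let ?P = "\<lambda>\<rho> b. Seq (P1 \<rho> b) (Seq (P2 \<rho> (Suc b)) (Do (ins b b (Suc b))))"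
  show ?thesis
  proof (rule rcomputableI[of ?P "\<lambda>X. T1 X + (T2 X + 1)"])
    show "rcomp ?P (\<lambda>X. T1 X + (T2 X + 1)) (\<lambda>c \<sigma> M. g (f1 c \<sigma> M) (f2 c \<sigma> M))"
    proof (rule rcompI, rule runs_Seq, rule rcompD[OF f1], goal_cases)
      case (3 \<rho> b s X s')
      have e: "ireg s' (\<rho> j) = ireg s (\<rho> j)" for j using 3 keepsD by blast
      show ?case
      proof (rule runs_Seq, rule rcompD[OF f2], goal_cases)
        case (3 s'')
        then show ?case using \<open>keeps b s s'\<close> \<open>rreg s' b = _\<close>
          by (intro runs_Do) (simp_all add: op keeps_def e)
      qed (use 3 keepsD in \<open>auto simp: less_Suc_eq\<close>)
    qed
  qed (intro poly_bounded_intros T1 T2)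
qed

lemma rcomp_mult:
  "rcomputable f \<Longrightarrow> rcomputable g \<Longrightarrow> rcomputable (\<lambda>c \<sigma> M. f c \<sigma> M * g c \<sigma> M)"
  by (rule rcomp_binop[of RMul]) auto

lemma rcomp_add:
  "rcomputable f \<Longrightarrow> rcomputable g \<Longrightarrow> rcomputable (\<lambda>c \<sigma> M. f c \<sigma> M + g c \<sigma> M)"
  by (rule rcomp_binop[of RAdd]) auto

lemma rcomp_if:
  assumes "bcomputable \<phi>" "rcomputable g" "rcomputable h"
  shows "rcomputable (\<lambda>c \<sigma> M. if \<phi> c \<sigma> then g c \<sigma> M else h c \<sigma> M)"
proof -
  obtain P T where T: "poly_bounded T" and f: "icomp P T (\<lambda>c \<sigma>. if \<phi> c \<sigma> then 1 else 0)"
    using assms unfolding bcomputable_def icomputable_def by blast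
  obtain P1 T1 where T1: "poly_bounded T1" and g: "rcomp P1 T1 g" using assms unfolding rcomputable_def by blast
  obtain P2 T2 where T2: "poly_bounded T2" and h: "rcomp P2 T2 h" using assms unfolding rcomputable_def by blast
  let ?P = "\<lambda>\<rho> b. Seq (P \<rho> b) (Cond b (P1 \<rho> b) (P2 \<rho> b))"
  show ?thesis
  proof (rule rcomputableI[of ?P "\<lambda>X. T X + (1 + T1 X + T2 X)"])
    show "rcomp ?P (\<lambda>X. T X + (1 + T1 X + T2 X)) (\<lambda>c \<sigma> M. if \<phi> c \<sigma> then g c \<sigma> M else h c \<sigma> M)"
    proof (rule rcompI, rule runs_Seq, rule icompD[OF f], goal_cases)
      case (3 \<rho> b s X s')
      have e: "ireg s' (\<rho> j) = ireg s (\<rho> j)" for j using 3 keepsD by blast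
      have e0: "ireg s' 0 = int X" using 3 keepsD by metis
      show ?case
        by (rule runs_Cond; rule rcompD[OF g] rcompD[OF h])
          (use 3 e0 in \<open>auto simp: e keepsD(1,2)[OF 3(4)] intro: keeps_trans split: if_splits\<close>)
    qed
  qed (intro poly_bounded_intros T T1 T2)
qed

text \<open>One loop serves sums and products: \<open>ins\<close> is the machine instruction that
  performs \<open>g\<close>. The index is an integer variable, the accumulator is the real register
  \<open>b\<close>.\<close>

lemma rcomp_fold:
  assumes op: "\<And>a b c s. exec_instr (ins a b c) s = s\<lparr>rreg := (rreg s)(a := g (rreg s b) (rreg s c))\<rparr>"
    and "rcomputable (\<lambda>c \<sigma>. f c (\<lambda>n. \<sigma> (Suc n)) (\<sigma> 0))"
  shows "rcomputable (\<lambda>c \<sigma> M. iter (snd c) (\<lambda>i a. g a (f c \<sigma> i M)) (of_int a0))"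
proof -
  obtain P1 T1 where T1: "poly_bounded T1" and f: "rcomp P1 T1 (\<lambda>c \<sigma>. f c (\<lambda>n. \<sigma> (Suc n)) (\<sigma> 0))"
    using assms unfolding rcomputable_def by blast
  let ?C = "\<lambda>b. Seq (Do (ins b b (b+3))) (Seq (Do (Const (b+3) 1))
      (Seq (Do (Add (b+1) (b+1) (b+3))) (Do (Sub (b+2) (b+2) (b+3)))))"
  let ?B = "\<lambda>\<rho> b. Seq (P1 (case_nat (b+1) \<rho>) (b+3)) (?C b)"
  let ?P = "\<lambda>\<rho> b. Seq (Do (RConst b a0)) (Seq (Do (Const (b+1) 0)) (Seq (Do (Add (b+2) 0 (b+1)))
    (Loop (b+2) (?B \<rho> b))))"
  let ?T = "\<lambda>X. Suc (Suc (Suc (X * (T1 X + 4 + 1) + 1)))"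
  show ?thesis
  proof (rule rcomputableI[of ?P ?T])
    show "rcomp ?P ?T (\<lambda>c \<sigma> M. iter (snd c) (\<lambda>i a. g a (f c \<sigma> i M)) (of_int a0))"
    proof (rule rcompI, goal_cases)
      case (1 \<rho> b s X)
      let ?\<sigma> = "\<lambda>j. ireg s (\<rho> j)" let ?c = "(imem s, X)"
      let ?it = "\<lambda>i. iter i (\<lambda>i a. g a (f ?c ?\<sigma> i (rmem s))) (of_int a0)"
      define Inv where "Inv i s2 \<longleftrightarrow> keeps b s s2 \<and> rreg s2 b = ?it i \<and> ireg s2 (b+1) = int i \<and>
        ireg s2 (b+2) = int (X - i)" for i s2
      show ?case
      proof (intro runs_Do_Seq, rule runs_mono[OF runs_Loop[where Inv = Inv and n = X]])
        show "Inv 0 (exec_instr (Add (b+2) 0 (b+1)) (exec_instr (Const (b+1) 0) (exec_instr (RConst b a0) s)))"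
          using 1 unfolding Inv_def by (simp add: keeps_def)
      next
        fix i s2 assume i: "i < X" and I: "Inv i s2"
        have k2: "keeps b s s2" using I unfolding Inv_def by simp
        have e: "ireg s2 (\<rho> j) = ireg s (\<rho> j)" for j using keepsD(3)[OF k2 1(1)] .
        have e0: "ireg s2 0 = int X" using keepsD(3)[OF k2 1(2)] 1 by simp
        have lt: "case_nat (b + 1) \<rho> j < b + 3" for j
          using 1(1) by (auto split: nat.split simp: less_Suc_eq trans_less_add1)
        show "runs (?B \<rho> b) s2 (T1 X + 4) (Inv (Suc i))"
        proof (rule runs_Seq, rule rcompD[OF f lt e0], goal_cases)
          case (1 s3)
          have r: "g (rreg s3 b) (rreg s3 (b+3)) = ?it (Suc i)"
            using 1(2) keepsD(4)[OF 1(1), of b] I unfolding Inv_def by (simp add: e keepsD(1,2)[OF k2])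
          have k3: "keeps b s s3" using keeps_trans[OF k2 1(1)] by simp
          have r1: "ireg s3 (b+1) = int i" "ireg s3 (b+2) = int (X - i)"
            using I keepsD(3)[OF 1(1)] unfolding Inv_def by simp_all
          have "runs (?C b) s3 (Suc (Suc (Suc 1))) (Inv (Suc i))"
            using k3 r r1 i by (intro runs_Do_Seq runs_Do) (auto simp: Inv_def keeps_def op)
          then show ?case by (simp add: eval_nat_numeral)
        qed
      next
        show "\<And>i s. i \<le> X \<Longrightarrow> Inv i s \<Longrightarrow> ireg s (b+2) = int (X - i)" unfolding Inv_def by simp
      next
        fix s2 assume "Inv X s2"
        then show "keeps b s s2 \<and> rreg s2 b = iter (snd ?c) (\<lambda>i a. g a (f ?c ?\<sigma> i (rmem s))) (of_int a0)"
          unfolding Inv_def by simp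
      qed simp
    qed
  qed (unfold Suc_eq_plus1, intro poly_bounded_intros T1)
qed

lemma rcomp_sum:
  assumes "rcomputable (\<lambda>c \<sigma>. f c (\<lambda>n. \<sigma> (Suc n)) (\<sigma> 0))"
  shows "rcomputable (\<lambda>c \<sigma> M. \<Sum>i\<in>range_of c. f c \<sigma> i M)"
proof -
  have "iter n (\<lambda>i a. a + h i) (of_int 0) = (\<Sum>i<n. h (int i))" for n and h :: "int \<Rightarrow> real"
    by (induction n) auto
  then show ?thesis using rcomp_fold[OF _ assms, of RAdd "(+)" 0]
    by (simp add: range_of_eq sum.reindex)
qed

lemma rcomp_prod:
  assumes "rcomputable (\<lambda>c \<sigma>. f c (\<lambda>n. \<sigma> (Suc n)) (\<sigma> 0))"
  shows "rcomputable (\<lambda>c \<sigma> M. \<Prod>i\<in>range_of c. f c \<sigma> i M)"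
proof -
  have "iter n (\<lambda>i a. a * h i) (of_int 1) = (\<Prod>i<n. h (int i))" for n and h :: "int \<Rightarrow> real"
    by (induction n) (auto simp: mult.commute)
  then show ?thesis using rcomp_fold[OF _ assms, of RMul "(*)" 1]
    by (simp add: range_of_eq prod.reindex)
qed

text \<open>Programs that write to the real memory. Among the registers, only integer ones are
  guaranteed to survive: loop counters and indices are integers, and no real value is kept in a
  register across an update.\<close>

definition ucomp :: "((nat \<Rightarrow> nat) \<Rightarrow> nat \<Rightarrow> program) \<Rightarrow> (nat \<Rightarrow> nat) \<Rightarrow>
    (inp \<Rightarrow> env \<Rightarrow> (int \<Rightarrow> real) \<Rightarrow> int \<Rightarrow> real) \<Rightarrow> bool" where
  "ucomp P T f \<longleftrightarrow> (\<forall>\<rho> b s X. (\<forall>j. \<rho> j < b) \<longrightarrow> 0 < b \<longrightarrow> ireg s 0 = int X \<longrightarrow>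
     runs (P \<rho> b) s (T X) (\<lambda>s'. imem s' = imem s \<and> (\<forall>r<b. ireg s' r = ireg s r) \<and>
       rmem s' = f (imem s, X) (\<lambda>j. ireg s (\<rho> j)) (rmem s)))"

definition ucomputable :: "(inp \<Rightarrow> env \<Rightarrow> (int \<Rightarrow> real) \<Rightarrow> int \<Rightarrow> real) \<Rightarrow> bool" where
  "ucomputable f \<longleftrightarrow> (\<exists>P T. poly_bounded T \<and> ucomp P T f)"

lemma ucomp_store:
  assumes "icomputable f" "rcomputable g"
  shows "ucomputable (\<lambda>c \<sigma> M. M(f c \<sigma> := g c \<sigma> M))"
proof -
  obtain P1 T1 where T1: "poly_bounded T1" and f: "icomp P1 T1 f" using assms unfolding icomputable_def by blast
  obtain P2 T2 where T2: "poly_bounded T2" and g: "rcomp P2 T2 g" using assms unfolding rcomputable_def by blast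
  let ?P = "\<lambda>\<rho> b. Seq (P1 \<rho> b) (Seq (P2 \<rho> (Suc b)) (Do (RStore b (Suc b))))"
  have "ucomp ?P (\<lambda>X. T1 X + (T2 X + 1)) (\<lambda>c \<sigma> M. M(f c \<sigma> := g c \<sigma> M))"
    unfolding ucomp_def
  proof (intro allI impI, rule runs_Seq, rule icompD[OF f], goal_cases)
    case (3 \<rho> b s X s')
    have e: "ireg s' (\<rho> j) = ireg s (\<rho> j)" for j using 3 keepsD by blast
    show ?case
    proof (rule runs_Seq, rule rcompD[OF g], goal_cases)
      case (3 s'')
      then show ?case using \<open>keeps b s s'\<close> \<open>ireg s' b = _\<close>
        by (intro runs_Do) (simp_all add: keeps_def e)
    qed (use 3 keepsD in \<open>auto simp: less_Suc_eq\<close>)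
  qed auto
  moreover have "poly_bounded (\<lambda>X. T1 X + (T2 X + 1))" by (intro poly_bounded_intros T1 T2)
  ultimately show ?thesis unfolding ucomputable_def by blast
qed

lemma ucomp_loop:
  assumes "ucomputable (\<lambda>c \<sigma>. f c (\<lambda>n. \<sigma> (Suc n)) (\<sigma> 0))"
  shows "ucomputable (\<lambda>c \<sigma> M. iter (snd c) (f c \<sigma>) M)"
proof -
  obtain P1 T1 where T1: "poly_bounded T1" and f: "ucomp P1 T1 (\<lambda>c \<sigma>. f c (\<lambda>n. \<sigma> (Suc n)) (\<sigma> 0))"
    using assms unfolding ucomputable_def by blast
  let ?C = "\<lambda>b. Seq (Do (Const (b+2) 1)) (Seq (Do (Add b b (b+2))) (Do (Sub (b+1) (b+1) (b+2))))"
  let ?B = "\<lambda>\<rho> b. Seq (P1 (case_nat b \<rho>) (b+2)) (?C b)"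
  let ?P = "\<lambda>\<rho> b. Seq (Do (Const b 0)) (Seq (Do (Add (b+1) 0 b)) (Loop (b+1) (?B \<rho> b)))"
  let ?T = "\<lambda>X. Suc (Suc (X * (T1 X + 3 + 1) + 1))"
  have "ucomp ?P ?T (\<lambda>c \<sigma> M. iter (snd c) (f c \<sigma>) M)"
    unfolding ucomp_def
  proof (intro allI impI, goal_cases)
    case (1 \<rho> b s X)
    let ?\<sigma> = "\<lambda>j. ireg s (\<rho> j)" let ?c = "(imem s, X)"
    let ?it = "\<lambda>i. iter i (f ?c ?\<sigma>) (rmem s)"
    define Inv where "Inv i s2 \<longleftrightarrow> imem s2 = imem s \<and> (\<forall>r<b. ireg s2 r = ireg s r) \<and>
      rmem s2 = ?it i \<and> ireg s2 b = int i \<and> ireg s2 (b+1) = int (X - i)" for i and s2 :: state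
    show ?case
    proof (intro runs_Do_Seq, rule runs_mono[OF runs_Loop[where Inv = Inv and n = X]])
      show "Inv 0 (exec_instr (Add (b+1) 0 b) (exec_instr (Const b 0) s))"
        using 1 unfolding Inv_def by simp
    next
      fix i s2 assume i: "i < X" and I: "Inv i s2"
      have e: "ireg s2 (\<rho> j) = ireg s (\<rho> j)" for j using I 1(1) unfolding Inv_def by simp
      have e0: "ireg s2 0 = int X" using I 1 unfolding Inv_def by simp
      have lt: "\<forall>j. case_nat b \<rho> j < b + 2"
        using 1(1) by (auto split: nat.split simp: less_Suc_eq trans_less_add1)
      from f[unfolded ucomp_def, rule_format, of "case_nat b \<rho>" "b + 2" s2 X] lt e0
      have "runs (P1 (case_nat b \<rho>) (b+2)) s2 (T1 X) (\<lambda>s3. imem s3 = imem s2 \<and>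
          (\<forall>r<b+2. ireg s3 r = ireg s2 r) \<and> rmem s3 = ?it (Suc i))"
        using I unfolding Inv_def by (simp add: e)
      then show "runs (?B \<rho> b) s2 (T1 X + 3) (Inv (Suc i))"
      proof (intro runs_Seq[of "P1 _ _"], rule runs_mono[OF _ order_refl], goal_cases)
        case (1 s3)
        have "runs (?C b) s3 (Suc (Suc 1)) (Inv (Suc i))"
          using 1 I i unfolding Inv_def by (intro runs_Do_Seq runs_Do) auto
        then show ?case by (simp add: eval_nat_numeral)
      qed
    next
      show "\<And>i s. i \<le> X \<Longrightarrow> Inv i s \<Longrightarrow> ireg s (b+1) = int (X - i)" unfolding Inv_def by simp
    next
      fix s2 assume "Inv X s2"
      then show "imem s2 = imem s \<and> (\<forall>r<b. ireg s2 r = ireg s r) \<and>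
        rmem s2 = iter (snd ?c) (f ?c ?\<sigma>) (rmem s)"
        unfolding Inv_def by simp
    qed simp
  qed
  moreover have "poly_bounded ?T" by (unfold Suc_eq_plus1, intro poly_bounded_intros T1)
  ultimately show ?thesis unfolding ucomputable_def by blast
qed

lemmas rcomp_intros = comp_intros rcomp_0 rcomp_1 rcomp_load rcomp_add rcomp_mult rcomp_if rcomp_sum rcomp_prod
  ucomp_store ucomp_loop

section \<open>Contraction levels and local counts\<close>

text \<open>Variables and clauses are given by indices, vertices by integer names. Level 0 is the given graph,
  \<open>bv t j\<close> and \<open>bc t i\<close> are the vertices of level \<open>t\<close> whose bags contain the variable \<open>j\<close> and the clause
  \<open>i\<close>, and \<open>par t\<close> maps a vertex of level \<open>t\<close> to the vertex of level \<open>t + 1\<close> that it becomes part of.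
  The contraction of level \<open>t\<close> merges \<open>u t\<close> and a second vertex into \<open>w t\<close>.\<close>

locale contraction_levels =
  fixes Xs Cs :: "int set" and hasP hasN :: "int \<Rightarrow> int \<Rightarrow> bool" and wp wn :: "int \<Rightarrow> real"
    and n :: nat and V :: "nat \<Rightarrow> int set" and pos neg red :: "nat \<Rightarrow> int \<Rightarrow> int \<Rightarrow> bool"
    and par :: "nat \<Rightarrow> int \<Rightarrow> int" and bv bc :: "nat \<Rightarrow> int \<Rightarrow> int" and u w :: "nat \<Rightarrow> int"
  assumes finX: "finite Xs" and finV: "finite (V t)"
    and bvV: "t < n \<Longrightarrow> j \<in> Xs \<Longrightarrow> bv t j \<in> V t"
    and bcV: "t < n \<Longrightarrow> i \<in> Cs \<Longrightarrow> bc t i \<in> V t"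
    and bv_Suc: "Suc t < n \<Longrightarrow> j \<in> Xs \<Longrightarrow> bv (Suc t) j = par t (bv t j)"
    and bc_Suc: "Suc t < n \<Longrightarrow> i \<in> Cs \<Longrightarrow> bc (Suc t) i = par t (bc t i)"
    and red_sym: "red t x y \<Longrightarrow> red t y x"
    and red_V: "t < n \<Longrightarrow> red t x y \<Longrightarrow> x \<in> V t"
    and red_par: "Suc t < n \<Longrightarrow> red t x y \<Longrightarrow> par t x = par t y \<or> red (Suc t) (par t x) (par t y)"
    and pos_hom: "t < n \<Longrightarrow> i \<in> Cs \<Longrightarrow> j \<in> Xs \<Longrightarrow> pos t (bv t j) (bc t i) \<Longrightarrow> hasP i j"
    and neg_hom: "t < n \<Longrightarrow> i \<in> Cs \<Longrightarrow> j \<in> Xs \<Longrightarrow> neg t (bv t j) (bc t i) \<Longrightarrow> hasN i j"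
    and absent_hom: "t < n \<Longrightarrow> i \<in> Cs \<Longrightarrow> j \<in> Xs \<Longrightarrow> hasP i j \<or> hasN i j \<Longrightarrow>
      bv t j = bc t i \<or> red t (bv t j) (bc t i) \<or> pos t (bv t j) (bc t i) \<or> neg t (bv t j) (bc t i)"
    and consistent: "i \<in> Cs \<Longrightarrow> j \<in> Xs \<Longrightarrow> hasP i j \<Longrightarrow> \<not> hasN i j"
    and contracted: "Suc t < n \<Longrightarrow> \<exists>v. u t \<in> V t \<and> v \<in> V t \<and> u t \<noteq> v \<and> w t \<notin> V t \<and>
      V (Suc t) = insert (w t) (V t - {u t, v})"
    and par_eq: "Suc t < n \<Longrightarrow> x \<in> V t \<Longrightarrow> par t x = (if x \<in> V (Suc t) then x else w t)"
begin

definition nb where "nb t x y \<longleftrightarrow> x = y \<or> red t x y"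
definition supp where "supp t s = {y \<in> V t. 0 < s y}" for s :: "int \<Rightarrow> int"
definition Sel where
  "Sel t s = {S. S \<subseteq> Xs \<and> (\<forall>y\<in>V t. int (card {j \<in> S. bv t j = y}) = s y)}"
text \<open>Variables outside the support contribute 1 and not \<open>wn\<close>, although they
  count as zero: with \<open>wn\<close>, the same factors would occur in every part of a factorised
  support. The recurrence supplies them through \<open>fct\<close>.\<close>

definition wt where
  "wt t s S = (\<Prod>j\<in>Xs. if 0 < s (bv t j) then (if j \<in> S then wp j else wn j) else 1)" for s :: "int \<Rightarrow> int"
definition near where "near t D y \<longleftrightarrow> (\<exists>z\<in>D. nb t z y)"
definition satn where
  "satn t S i \<longleftrightarrow> (\<exists>j\<in>Xs. nb t (bc t i) (bv t j) \<and> (hasP i j \<and> j \<in> S \<or> hasN i j \<and> j \<notin> S))"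
definition ok where
  "ok t s e S \<longleftrightarrow> (\<forall>i\<in>Cs. near t (supp t s) (bc t i) \<and> \<not> e (bc t i) \<longrightarrow> satn t S i)"
definition L where "L t s e = (\<Sum>S\<in>Sel t s. if ok t s e S then wt t s S else 0)"
definition nvar where "nvar t b = int (card {j \<in> Xs. bv t j = b})"

text \<open>The distribution of \<open>s\<close> to level \<open>t\<close> that gives the value \<open>j\<close> to \<open>u t\<close>, the marks of the bags of level \<open>t\<close>,
  and the condition on the clauses that are near the support on level \<open>t + 1\<close> but not on level \<open>t\<close>: their
  remaining variables are all zero.\<close>

definition ref where
  "ref t s j y = (if y \<in> V (Suc t) then s y else if y = u t then j else s (w t) - j)" for s :: "int \<Rightarrow> int"
definition eref where
  "eref t e s' y \<longleftrightarrow> e (par t y) \<or> (\<exists>b\<in>V t. nb (Suc t) (par t b) (par t y) \<and>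
     (pos t b y \<and> 0 < s' b \<or> neg t b y \<and> s' b < nvar t b))"
definition zero_ok where
  "zero_ok t y \<longleftrightarrow> (\<forall>i\<in>Cs. bc t i = y \<longrightarrow> (\<exists>j\<in>Xs. hasN i j \<and> nb t y (bv t j)))"
definition chk where
  "chk t s e s' \<longleftrightarrow> (\<forall>y\<in>V t. near (Suc t) (supp (Suc t) s) (par t y) \<and> \<not> near t (supp t s') y \<and>
     \<not> eref t e s' y \<longrightarrow> zero_ok t y)"
definition fct where
  "fct t s s' = (\<Prod>j\<in>Xs. if 0 < s (bv (Suc t) j) \<and> \<not> 0 < s' (bv t j) then wn j else 1)" for s s' :: "int \<Rightarrow> int"

section \<open>Splitting the count when one contraction is undone\<close>

lemma nb_sym: "nb t x y \<Longrightarrow> nb t y x"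
  unfolding nb_def using red_sym by blast

lemma nb_par: "Suc t < n \<Longrightarrow> nb t x y \<Longrightarrow> nb (Suc t) (par t x) (par t y)"
  unfolding nb_def using red_par by auto

lemma par_V: "Suc t < n \<Longrightarrow> x \<in> V t \<Longrightarrow> par t x \<in> V (Suc t)"
  using par_eq contracted by auto

lemma finite_Sel: "finite (Sel t s)"
  by (rule finite_subset[of _ "Pow Xs"]) (auto simp: Sel_def finX)

lemma Sel_finite: "S \<in> Sel t s \<Longrightarrow> finite S"
  unfolding Sel_def using finX finite_subset by auto

lemma Sel_card:
  assumes "S \<in> Sel t s" "y \<in> V t" shows "int (card {j \<in> S. bv t j = y}) = s y"
  using assms unfolding Sel_def by auto

lemma Sel_pos: "S \<in> Sel t s \<Longrightarrow> t < n \<Longrightarrow> j \<in> S \<Longrightarrow> 0 < s (bv t j)"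
proof -
  assume a: "S \<in> Sel t s" "t < n" "j \<in> S"
  then have "j \<in> {i \<in> S. bv t i = bv t j}" by simp
  moreover have "finite {i \<in> S. bv t i = bv t j}" using Sel_finite[OF a(1)] by simp
  ultimately have "0 < card {i \<in> S. bv t i = bv t j}" by (auto simp: card_gt_0_iff)
  moreover have "bv t j \<in> V t" using bvV a unfolding Sel_def by blast
  ultimately show ?thesis using Sel_card[OF a(1)] by fastforce
qed

lemma Sel_ex_pos:
  assumes "S \<in> Sel t s" "y \<in> V t" "0 < s y" shows "\<exists>j\<in>S. bv t j = y"
proof (rule ccontr)
  assume "\<not> ?thesis"
  then have "{j \<in> S. bv t j = y} = {}" by blast
  with Sel_card[OF assms(1,2)] assms(3) show False by (metis card.empty less_irrefl of_nat_0)
qed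

text \<open>With \<open>Sel_pos\<close>, \<open>Sel_ex_pos\<close> and \<open>Sel_neg_less\<close>
  this turns truth values into counts: a bag holds a variable set to one iff \<open>0 < s y\<close>,
  and a variable set to zero iff \<open>s y < nvar t y\<close>. These are the tests that
  \<open>eref\<close> makes at positive and negative edges.\<close>

lemma Sel_ex_neg:
  assumes "S \<in> Sel t s" "y \<in> V t" "s y < nvar t y" shows "\<exists>j\<in>Xs - S. bv t j = y"
proof (rule ccontr)
  assume "\<not> ?thesis"
  then have "{j \<in> Xs. bv t j = y} \<subseteq> {j \<in> S. bv t j = y}" by blast
  then have "card {j \<in> Xs. bv t j = y} \<le> card {j \<in> S. bv t j = y}"
    using Sel_finite[OF assms(1)] by (intro card_mono) auto
  then show False using Sel_card[OF assms(1,2)] assms(3) unfolding nvar_def by simp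
qed

lemma Sel_neg_less:
  assumes "S \<in> Sel t s" "t < n" "j \<in> Xs" "j \<notin> S" shows "s (bv t j) < nvar t (bv t j)"
proof -
  have "{i \<in> S. bv t i = bv t j} \<subset> {i \<in> Xs. bv t i = bv t j}"
    using assms unfolding Sel_def by auto
  then have "card {i \<in> S. bv t i = bv t j} < card {i \<in> Xs. bv t i = bv t j}"
    using finX by (intro psubset_card_mono) auto
  then show ?thesis using Sel_card[OF assms(1)] bvV assms unfolding nvar_def by fastforce
qed

text \<open>The chosen set is the same on both levels. Only the count of \<open>w t\<close> is
  refined; its share for \<open>u t\<close> is read off from \<open>S\<close>, and the other
  contracted vertex gets the rest.\<close>

lemma Sel_Suc_iff:
  assumes t: "Suc t < n" and S: "S \<subseteq> Xs"
  shows "S \<in> Sel (Suc t) s \<longleftrightarrow> S \<in> Sel t (ref t s (int (card {j \<in> S. bv t j = u t})))"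
proof -
  obtain v where v: "u t \<in> V t" "v \<in> V t" "u t \<noteq> v" "w t \<notin> V t" "V (Suc t) = insert (w t) (V t - {u t, v})"
    using contracted[OF t] by blast
  have fS: "finite S" using S finX finite_subset by blast
  have bvS: "bv (Suc t) j = (if bv t j = u t \<or> bv t j = v then w t else bv t j)" "bv t j \<in> V t"
    if "j \<in> S" for j
    using bv_Suc[OF t, of j] bvV[of t j] par_eq[OF t, of "bv t j"] that S t v by auto
  have eq: "{j \<in> S. bv (Suc t) j = y} = {j \<in> S. bv t j = y}" if "y \<in> V t - {u t, v}" for y
    using bvS that v by auto
  have "{j \<in> S. bv (Suc t) j = w t} = {j \<in> S. bv t j = u t} \<union> {j \<in> S. bv t j = v}"
  proof -
    have "bv (Suc t) j = w t \<longleftrightarrow> bv t j = u t \<or> bv t j = v" if "j \<in> S" for j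
      using bvS[OF that] v(4) by auto
    then show ?thesis by blast
  qed
  then have cw: "card {j \<in> S. bv (Suc t) j = w t} = card {j \<in> S. bv t j = u t} + card {j \<in> S. bv t j = v}"
    using fS v(3) by (subst card_Un_disjoint[symmetric]) auto
  have 1: "S \<in> Sel (Suc t) s \<longleftrightarrow> (\<forall>y\<in>V t - {u t, v}. int (card {j \<in> S. bv t j = y}) = s y) \<and>
     int (card {j \<in> S. bv t j = u t}) + int (card {j \<in> S. bv t j = v}) = s (w t)"
    unfolding Sel_def v(5) using S cw eq by auto
  have 2: "V t = insert (u t) (insert v (V t - {u t, v}))" using v by blast
  let ?j = "int (card {j \<in> S. bv t j = u t})"
  have "ref t s ?j (u t) = ?j" "ref t s ?j v = s (w t) - ?j"
    "\<And>y. y \<in> V t - {u t, v} \<Longrightarrow> ref t s ?j y = s y"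
    using v unfolding ref_def by auto
  then have "S \<in> Sel t (ref t s ?j) \<longleftrightarrow> (\<forall>y\<in>V t - {u t, v}. int (card {j \<in> S. bv t j = y}) = s y) \<and>
     int (card {j \<in> S. bv t j = v}) = s (w t) - ?j"
    unfolding Sel_def using S by (subst 2) auto
  with 1 show ?thesis by auto
qed

lemma ref_u: "Suc t < n \<Longrightarrow> ref t s j (u t) = j"
  using contracted[of t] unfolding ref_def by auto

lemma Sel_ref_card: "Suc t < n \<Longrightarrow> S \<in> Sel t (ref t s j) \<Longrightarrow> int (card {j \<in> S. bv t j = u t}) = j"
  using Sel_card[of S t _ "u t"] contracted[of t] ref_u by auto

text \<open>The union is disjoint, since \<open>S\<close> determines the share \<open>j\<close> by
  \<open>Sel_ref_card\<close>.\<close>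

lemma Sel_Suc:
  assumes t: "Suc t < n"
  shows "Sel (Suc t) s = (\<Union>j\<in>{0..s (w t)}. Sel t (ref t s j))"
proof (intro set_eqI iffI)
  fix S assume S: "S \<in> Sel (Suc t) s"
  then have SX: "S \<subseteq> Xs" unfolding Sel_def by simp
  let ?j = "int (card {j \<in> S. bv t j = u t})"
  obtain v where v: "u t \<in> V t" "v \<in> V t" "u t \<noteq> v" "w t \<notin> V t" "V (Suc t) = insert (w t) (V t - {u t, v})"
    using contracted[OF t] by blast
  have S': "S \<in> Sel t (ref t s ?j)" using Sel_Suc_iff[OF t SX] S by simp
  have "ref t s ?j v = s (w t) - ?j" using v unfolding ref_def by auto
  then have "?j \<le> s (w t)" using Sel_card[OF S' v(2)] by linarith
  with S' show "S \<in> (\<Union>j\<in>{0..s (w t)}. Sel t (ref t s j))" by auto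
next
  fix S assume "S \<in> (\<Union>j\<in>{0..s (w t)}. Sel t (ref t s j))"
  then obtain j where S: "S \<in> Sel t (ref t s j)" by blast
  then have "S \<subseteq> Xs" unfolding Sel_def by simp
  from Sel_Suc_iff[OF t this] S Sel_ref_card[OF t S] show "S \<in> Sel (Suc t) s" by simp
qed

lemma ref_pos:
  assumes "Suc t < n" "y \<in> V t" "j \<in> {0..s (w t)}" "0 < ref t s j y"
  shows "0 < s (par t y)"
  using assms par_eq[OF assms(1,2)] unfolding ref_def by (auto split: if_splits)

text \<open>A variable whose bag is in the support on level \<open>t + 1\<close> but not on level
  \<open>t\<close> is zero under \<open>S\<close>. It loses its factor \<open>wn\<close> in
  \<open>wt\<close>, and \<open>fct\<close> restores it. By \<open>ref_pos\<close> no variable is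
  affected in the other direction.\<close>

lemma wt_Suc:
  assumes t: "Suc t < n" and j: "j \<in> {0..s (w t)}" and S: "S \<in> Sel t (ref t s j)"
  shows "wt (Suc t) s S = fct t s (ref t s j) * wt t (ref t s j) S"
  unfolding wt_def fct_def prod.distrib[symmetric]
proof (rule prod.cong[OF refl])
  fix x assume x: "x \<in> Xs"
  have b: "bv t x \<in> V t" "bv (Suc t) x = par t (bv t x)" using bvV bv_Suc t x by auto
  show "(if 0 < s (bv (Suc t) x) then if x \<in> S then wp x else wn x else 1) =
    (if 0 < s (bv (Suc t) x) \<and> \<not> 0 < ref t s j (bv t x) then wn x else 1) *
    (if 0 < ref t s j (bv t x) then if x \<in> S then wp x else wn x else 1)"
    using ref_pos[of t "bv t x" j s, OF t b(1) j] Sel_pos[OF S, of x] t unfolding b(2) by auto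
qed

lemma near_Suc:
  assumes t: "Suc t < n" and j: "j \<in> {0..s (w t)}" and "near t (supp t (ref t s j)) y"
  shows "near (Suc t) (supp (Suc t) s) (par t y)"
proof -
  from assms(3) obtain z where z: "z \<in> V t" "0 < ref t s j z" "nb t z y"
    unfolding near_def supp_def by blast
  then show ?thesis using ref_pos[of t z j s, OF t z(1) j z(2)] par_V[OF t z(1)] nb_par[OF t z(3)]
    unfolding near_def supp_def by blast
qed

text \<open>Going down, the closed red neighbourhood shrinks. A satisfying variable lost in this way
  must be joined to the clause bag by a positive or negative edge, because a missing edge excludes
  an occurrence (\<open>absent_hom\<close>). The value of this variable then shows in the counts, so
  \<open>eref\<close> would have marked the bag.\<close>

lemma satn_Suc:
  assumes t: "Suc t < n" and S: "S \<in> Sel t s'" and i: "i \<in> Cs" and e: "\<not> eref t e s' (bc t i)"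
  shows "satn (Suc t) S i \<longleftrightarrow> satn t S i"
proof
  have tn: "t < n" using t by simp
  show "satn t S i \<Longrightarrow> satn (Suc t) S i"
    unfolding satn_def using nb_par[OF t] bv_Suc[OF t] bc_Suc[OF t] i by fastforce
  assume "satn (Suc t) S i"
  then obtain j where j: "j \<in> Xs" "nb (Suc t) (bc (Suc t) i) (bv (Suc t) j)"
    "hasP i j \<and> j \<in> S \<or> hasN i j \<and> j \<notin> S" unfolding satn_def by blast
  have bV: "bv t j \<in> V t" using bvV tn j by simp
  have nbS: "nb (Suc t) (par t (bv t j)) (par t (bc t i))"
    using nb_sym[OF j(2)] bv_Suc[OF t j(1)] bc_Suc[OF t i] by simp
  consider "nb t (bc t i) (bv t j)" | "pos t (bv t j) (bc t i)" | "neg t (bv t j) (bc t i)"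
    using absent_hom[OF tn i j(1)] j(3) red_sym[of t "bv t j" "bc t i"] unfolding nb_def by metis
  then show "satn t S i"
  proof cases
    case 1 then show ?thesis using j unfolding satn_def by blast
  next
    case 2
    then have "j \<in> S" using j(3) pos_hom[OF tn i j(1)] consistent[OF i j(1)] by blast
    then have "0 < s' (bv t j)" using Sel_pos[OF S tn] by blast
    then show ?thesis using e 2 nbS bV unfolding eref_def by blast
  next
    case 3
    then have "j \<notin> S" using j(3) neg_hom[OF tn i j(1)] consistent[OF i j(1)] by blast
    then have "s' (bv t j) < nvar t (bv t j)" using Sel_neg_less[OF S tn j(1)] by blast
    then show ?thesis using e 3 nbS bV unfolding eref_def by blast
  qed
qed

text \<open>A new mark comes from a homogeneous edge and a count that guarantees a variable of the
  required value in the bag at its other end. By homogeneity this variable satisfies every clause of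
  the marked bag.\<close>

lemma satn_eref:
  assumes t: "Suc t < n" and S: "S \<in> Sel t s'" and i: "i \<in> Cs"
    and e: "eref t e s' (bc t i)" "\<not> e (par t (bc t i))"
  shows "satn (Suc t) S i"
proof -
  have tn: "t < n" using t by simp
  have SX: "S \<subseteq> Xs" using S unfolding Sel_def by simp
  from e obtain b where b: "b \<in> V t" "nb (Suc t) (par t b) (par t (bc t i))"
    "pos t b (bc t i) \<and> 0 < s' b \<or> neg t b (bc t i) \<and> s' b < nvar t b" unfolding eref_def by blast
  have nbS: "nb (Suc t) (bc (Suc t) i) (bv (Suc t) j)" if "j \<in> Xs" "bv t j = b" for j
    using nb_sym[OF b(2)] bv_Suc[OF t that(1)] bc_Suc[OF t i] that by simp
  from b(3) show ?thesis
  proof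
    assume a: "pos t b (bc t i) \<and> 0 < s' b"
    with Sel_ex_pos[OF S b(1)] obtain j where "j \<in> S" "bv t j = b" by blast
    then show ?thesis using pos_hom[OF tn i, of j] nbS a SX unfolding satn_def by blast
  next
    assume a: "neg t b (bc t i) \<and> s' b < nvar t b"
    with Sel_ex_neg[OF S b(1)] obtain j where "j \<in> Xs - S" "bv t j = b" by blast
    then show ?thesis using neg_hom[OF tn i, of j] nbS a unfolding satn_def by blast
  qed
qed

text \<open>Far from the support all neighbouring variables are zero, so only negative literals can
  help and the condition no longer depends on \<open>S\<close>. This is why \<open>zero_ok\<close>
  can be tested without knowing \<open>S\<close>.\<close>

lemma satn_far:
  assumes t: "t < n" and S: "S \<in> Sel t s" and "\<not> near t (supp t s) (bc t i)"
  shows "satn t S i \<longleftrightarrow> (\<exists>j\<in>Xs. hasN i j \<and> nb t (bc t i) (bv t j))"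
proof -
  have "j \<notin> S" if "j \<in> Xs" "nb t (bc t i) (bv t j)" for j
    using Sel_pos[OF S t, of j] assms(3) bvV[OF t that(1)] nb_sym[OF that(2)]
    unfolding near_def supp_def by blast
  then show ?thesis unfolding satn_def by blast
qed

text \<open>An unmarked clause near the support on level \<open>t + 1\<close> falls into one of
  three classes on level \<open>t\<close>: it becomes marked (\<open>satn_eref\<close>), it is still
  near the support (\<open>ok\<close> on level \<open>t\<close>), or it is neither
  (\<open>chk\<close>). By \<open>near_Suc\<close> no other clause comes near the support.\<close>

lemma ok_Suc:
  assumes t: "Suc t < n" and j: "j \<in> {0..s (w t)}" and S: "S \<in> Sel t (ref t s j)"
  shows "ok (Suc t) s e S \<longleftrightarrow> chk t s e (ref t s j) \<and> ok t (ref t s j) (eref t e (ref t s j)) S"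
    (is "_ \<longleftrightarrow> chk t s e ?s \<and> ok t ?s ?e S")
proof -
  have tn: "t < n" using t by simp
  note far = satn_far[OF tn S]
  show ?thesis
  proof (intro iffI conjI)
    assume a: "ok (Suc t) s e S"
    have sat: "satn t S i" if "i \<in> Cs" "near (Suc t) (supp (Suc t) s) (par t (bc t i))" "\<not> ?e (bc t i)" for i
    proof -
      have "\<not> e (par t (bc t i))" using that(3) unfolding eref_def by blast
      then have "satn (Suc t) S i" using a that unfolding ok_def by (simp add: bc_Suc[OF t])
      then show ?thesis using satn_Suc[OF t S that(1,3)] by simp
    qed
    show "chk t s e ?s"
      unfolding chk_def zero_ok_def using sat far by metis
    show "ok t ?s ?e S"
      unfolding ok_def using sat near_Suc[of t j s, OF t j] by blast
  next
    assume a: "chk t s e ?s \<and> ok t ?s ?e S"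
    show "ok (Suc t) s e S" unfolding ok_def
    proof (intro ballI impI)
      fix i assume i: "i \<in> Cs" and h: "near (Suc t) (supp (Suc t) s) (bc (Suc t) i) \<and> \<not> e (bc (Suc t) i)"
      show "satn (Suc t) S i"
      proof (cases "?e (bc t i)")
        case True
        then show ?thesis using satn_eref[OF t S i True] h by (simp add: bc_Suc[OF t i])
      next
        case False
        have "satn t S i"
        proof (cases "near t (supp t ?s) (bc t i)")
          case True
          then show ?thesis using a False i unfolding ok_def by blast
        next
          case nf: False
          then have "zero_ok t (bc t i)" using a h False bcV[OF tn i] unfolding chk_def
            by (simp add: bc_Suc[OF t i])
          then show ?thesis using far[OF nf] i unfolding zero_ok_def by blast
        qed
        then show ?thesis using satn_Suc[OF t S i False] by simp
      qed
    qed
  qed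
qed

text \<open>\<open>fct\<close> and \<open>chk\<close> depend on the split but not on
  \<open>S\<close>, so for each \<open>j\<close> they leave the sum over \<open>S\<close>.\<close>

theorem L_Suc:
  assumes t: "Suc t < n"
  shows "L (Suc t) s e = (\<Sum>j\<in>{0..s (w t)}. if chk t s e (ref t s j)
    then fct t s (ref t s j) * L t (ref t s j) (eref t e (ref t s j)) else 0)"
proof -
  have "L (Suc t) s e = (\<Sum>j\<in>{0..s (w t)}. \<Sum>S\<in>Sel t (ref t s j). if ok (Suc t) s e S then wt (Suc t) s S else 0)"
    unfolding L_def Sel_Suc[OF t]
    by (rule sum.UNION_disjoint) (auto simp: finite_Sel dest: Sel_ref_card[OF t])
  also have "\<dots> = (\<Sum>j\<in>{0..s (w t)}. if chk t s e (ref t s j)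
    then fct t s (ref t s j) * L t (ref t s j) (eref t e (ref t s j)) else 0)"
    unfolding L_def sum_distrib_left
    by (intro sum.cong refl) (auto simp: ok_Suc[OF t] wt_Suc[OF t] intro!: sum.cong)
  finally show ?thesis .
qed

text \<open>Marks away from the support have no influence. They may be set to zero, which lets the
  marks of a component be coded inside a ball.\<close>

lemma L_cong:
  assumes t: "t < n" and s: "\<And>y. y \<in> V t \<Longrightarrow> s y = s' y"
    and e: "\<And>y. y \<in> V t \<Longrightarrow> near t (supp t s) y \<Longrightarrow> e y = e' y"
  shows "L t s e = L t s' e'"
proof -
  have 1: "Sel t s = Sel t s'" unfolding Sel_def using s by auto
  have 2: "supp t s = supp t s'" unfolding supp_def using s by auto
  have 3: "wt t s S = wt t s' S" for S
    unfolding wt_def using s bvV[OF t] by (intro prod.cong) auto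
  have 4: "ok t s e S = ok t s' e' S" for S
    unfolding ok_def 2[symmetric] using e bcV[OF t] by blast
  show ?thesis unfolding L_def 1 3 4 ..
qed

section \<open>Factorisation over the components of the support\<close>

definition linked where "linked t a b \<longleftrightarrow> (\<exists>z\<in>V t. nb t a z \<and> nb t z b)"
definition restr where "restr s A y = (if y \<in> A then s y else 0)" for s :: "int \<Rightarrow> int"

text \<open>\<open>linked\<close> means a common closed red neighbour, that is, red distance at most
  two. If \<open>A\<close> and \<open>B\<close> are unlinked, no clause bag near one of them sees a
  variable bag of the other. So every clause condition concerns one part of \<open>S\<close> only,
  and the sum over pairs becomes a product of sums.\<close>

lemma L_union:
  assumes t: "t < n" and AB: "A \<inter> B = {}"
    and unl: "\<And>a b. a \<in> A \<Longrightarrow> b \<in> B \<Longrightarrow> \<not> linked t a b"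
  shows "L t (restr s (A \<union> B)) e = L t (restr s A) e * L t (restr s B) e"
proof -
  let ?f = "\<lambda>S. ({j \<in> S. bv t j \<in> A}, {j \<in> S. bv t j \<in> B})" and ?g = "\<lambda>(S1, S2). S1 \<union> S2"
  have inA: "bv t j \<in> C" if "S \<in> Sel t (restr s C)" "j \<in> S" for S C j
    using Sel_pos[OF that(1) t that(2)] unfolding restr_def by (auto split: if_splits)
  have part: "{j \<in> S. bv t j \<in> C} \<in> Sel t (restr s C)" if "S \<in> Sel t (restr s (A \<union> B))" "C = A \<or> C = B" for S C
  proof -
    have "{x \<in> {j \<in> S. bv t j \<in> C}. bv t x = y} = (if y \<in> C then {x \<in> S. bv t x = y} else {})" for y by auto
    then show ?thesis using that unfolding Sel_def restr_def by auto
  qed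
  have un: "S1 \<union> S2 \<in> Sel t (restr s (A \<union> B))" if S: "S1 \<in> Sel t (restr s A)" "S2 \<in> Sel t (restr s B)" for S1 S2
  proof -
    have "int (card {j \<in> S1 \<union> S2. bv t j = y}) = restr s (A \<union> B) y" if y: "y \<in> V t" for y
    proof -
      have a: "{j \<in> S1 \<union> S2. bv t j = y} = {j \<in> S1. bv t j = y}" if "y \<notin> B" using inA[OF S(2)] that by auto
      have b: "{j \<in> S1 \<union> S2. bv t j = y} = {j \<in> S2. bv t j = y}" if "y \<notin> A" using inA[OF S(1)] that by auto
      show ?thesis
        using a b Sel_card[OF S(1) y] Sel_card[OF S(2) y] AB unfolding restr_def by (cases "y \<in> A"; cases "y \<in> B") auto
    qed
    then show ?thesis using S unfolding Sel_def by auto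
  qed
  have wtm: "wt t (restr s (A \<union> B)) (S1 \<union> S2) = wt t (restr s A) S1 * wt t (restr s B) S2"
    if S: "S1 \<in> Sel t (restr s A)" "S2 \<in> Sel t (restr s B)" for S1 S2
    unfolding wt_def prod.distrib[symmetric]
    using inA[OF S(1)] inA[OF S(2)] AB by (intro prod.cong refl) (auto simp: restr_def)
  have sat: "satn t (S1 \<union> S2) i \<longleftrightarrow> satn t S1 i"
    if nr: "near t (supp t (restr s A')) (bc t i)" and S2: "S2 \<in> Sel t (restr s B')" and i: "i \<in> Cs"
      and ul: "\<And>a b. a \<in> A' \<Longrightarrow> b \<in> B' \<Longrightarrow> \<not> linked t a b" for S1 S2 i A' B'
  proof -
    obtain a where a: "a \<in> A'" "nb t a (bc t i)"
      using nr unfolding near_def supp_def restr_def by (auto split: if_splits)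
    have "j \<notin> S2" if "nb t (bc t i) (bv t j)" for j
      using inA[OF S2] that a ul[OF a(1)] bcV[OF t i] unfolding linked_def by blast
    then show ?thesis unfolding satn_def by blast
  qed
  have unl': "\<And>b a. b \<in> B \<Longrightarrow> a \<in> A \<Longrightarrow> \<not> linked t b a"
    using unl nb_sym unfolding linked_def by blast
  have okm: "ok t (restr s (A \<union> B)) e (S1 \<union> S2) \<longleftrightarrow> ok t (restr s A) e S1 \<and> ok t (restr s B) e S2"
    if S: "S1 \<in> Sel t (restr s A)" "S2 \<in> Sel t (restr s B)" for S1 S2
  proof -
    have nr: "near t (supp t (restr s (A \<union> B))) y \<longleftrightarrow> near t (supp t (restr s A)) y \<or> near t (supp t (restr s B)) y" for y
      unfolding near_def supp_def restr_def by auto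
    have "satn t (S1 \<union> S2) i = satn t S1 i" if "near t (supp t (restr s A)) (bc t i)" "i \<in> Cs" for i
      using sat[OF that(1) S(2) that(2) unl] .
    moreover have "satn t (S1 \<union> S2) i = satn t S2 i" if "near t (supp t (restr s B)) (bc t i)" "i \<in> Cs" for i
      using sat[OF that(1) S(1) that(2) unl', of S2] by (simp add: Un_commute)
    ultimately show ?thesis unfolding ok_def nr by blast
  qed
  have "L t (restr s A) e * L t (restr s B) e =
    (\<Sum>(S1, S2)\<in>Sel t (restr s A) \<times> Sel t (restr s B). (if ok t (restr s A) e S1 then wt t (restr s A) S1 else 0) *
      (if ok t (restr s B) e S2 then wt t (restr s B) S2 else 0))"
    unfolding L_def sum_product sum.cartesian_product ..
  also have "\<dots> = L t (restr s (A \<union> B)) e"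
    unfolding L_def
  proof (rule sum.reindex_bij_witness[of _ ?f ?g], goal_cases)
    case (1 a)
    then show ?case using inA AB by (auto split: prod.splits)
  next
    case (2 a)
    then show ?case using un by auto
  next
    case (3 S)
    then show ?case using inA by auto
  next
    case (4 S)
    then show ?case using part by auto
  next
    case (5 a)
    then show ?case using wtm okm by (auto split: prod.splits)
  qed
  finally show ?thesis ..
qed

lemma L_empty:
  assumes "t < n" "\<And>y. y \<in> V t \<Longrightarrow> s y = 0" shows "L t s e = 1"
proof -
  have "S = {}" if "S \<in> Sel t s" for S
    using Sel_pos[OF that assms(1)] assms(2) bvV[OF assms(1)] that unfolding Sel_def by force
  moreover have "{} \<in> Sel t s" unfolding Sel_def using assms by simp
  ultimately have "Sel t s = {{}}" by blast
  moreover have "ok t s e {}" unfolding ok_def near_def supp_def using assms by auto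
  moreover have "wt t s {} = 1" unfolding wt_def using assms bvV by (intro prod.neutral) auto
  ultimately show ?thesis unfolding L_def by simp
qed

definition R where "R t s = {(a, b). a \<in> supp t s \<and> b \<in> supp t s \<and> linked t a b}"
definition component where "component t s y = {z. (y, z) \<in> (R t s)\<^sup>*} \<inter> supp t s"
text \<open>Each component is represented by its least vertex; vertices are integers, so the machine
  finds it by comparisons.\<close>

definition roots where "roots t s = {y \<in> supp t s. \<forall>z\<in>V t. (y, z) \<in> (R t s)\<^sup>* \<longrightarrow> y \<le> z}"

lemma R_rtrancl_sym: "(a, b) \<in> (R t s)\<^sup>* \<Longrightarrow> (b, a) \<in> (R t s)\<^sup>*"
proof -
  have "sym (R t s)" unfolding sym_def R_def linked_def using nb_sym by blast
  then show "(a, b) \<in> (R t s)\<^sup>* \<Longrightarrow> (b, a) \<in> (R t s)\<^sup>*" by (meson sym_rtrancl symD)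
qed

text \<open>\<open>L_union\<close> is applied once per root. Two roots in one component coincide, as
  each of them is least; conversely, the minimum of the component of a support vertex is a root, so
  the components of the roots cover the support.\<close>

theorem L_roots:
  assumes t: "t < n" and s: "\<And>y. y \<in> V t \<Longrightarrow> 0 \<le> s y"
  shows "L t s e = (\<Prod>y\<in>roots t s. L t (restr s (component t s y)) e)"
proof -
  have fr: "finite (roots t s)" unfolding roots_def supp_def using finV[of t] by simp
  have eqr: "x = y" if "x \<in> roots t s" "y \<in> roots t s" "(x, y) \<in> (R t s)\<^sup>*" for x y
    using that R_rtrancl_sym[OF that(3)] unfolding roots_def supp_def by fastforce
  have "L t (restr s (\<Union>y\<in>A. component t s y)) e = (\<Prod>y\<in>A. L t (restr s (component t s y)) e)"
    if "finite A" "A \<subseteq> roots t s" for A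
    using that
  proof (induction A rule: finite_induct)
    case empty
    then show ?case using L_empty[OF t] by (simp add: restr_def)
  next
    case (insert x A)
    have no: "(x, y) \<notin> (R t s)\<^sup>*" if "y \<in> A" for y using insert that eqr by blast
    have "component t s x \<inter> (\<Union>y\<in>A. component t s y) = {}"
      unfolding component_def using no R_rtrancl_sym by (blast intro: rtrancl_trans)
    moreover have "\<not> linked t a b" if "a \<in> component t s x" "b \<in> (\<Union>y\<in>A. component t s y)" for a b
    proof
      assume l: "linked t a b"
      from that obtain y where y: "y \<in> A" "(y, b) \<in> (R t s)\<^sup>*" "(x, a) \<in> (R t s)\<^sup>*" "a \<in> supp t s" "b \<in> supp t s"
        unfolding component_def by blast
      with l have "(a, b) \<in> (R t s)\<^sup>*" unfolding R_def by blast
      with y have "(x, y) \<in> (R t s)\<^sup>*" using R_rtrancl_sym by (meson rtrancl_trans)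
      with no y show False by blast
    qed
    ultimately show ?case using insert L_union[OF t, of "component t s x" "\<Union>y\<in>A. component t s y" s e]
      by simp
  qed
  from this[OF fr order_refl]
  have "L t (restr s (\<Union>y\<in>roots t s. component t s y)) e = (\<Prod>y\<in>roots t s. L t (restr s (component t s y)) e)" .
  moreover have "restr s (\<Union>y\<in>roots t s. component t s y) z = s z" if z: "z \<in> V t" for z
  proof (cases "z \<in> supp t s")
    case True
    let ?C = "component t s z"
    have C: "finite ?C" "z \<in> ?C" using True finV[of t] unfolding component_def supp_def by auto
    have m: "Min ?C \<in> ?C" using C Min_in by blast
    have "Min ?C \<in> roots t s" unfolding roots_def
    proof (intro CollectI conjI ballI impI)
      show "Min ?C \<in> supp t s" using m unfolding component_def by simp
      fix y assume y: "y \<in> V t" "(Min ?C, y) \<in> (R t s)\<^sup>*"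
      have "y \<in> supp t s" using y(2) m unfolding component_def by (cases rule: rtranclE) (auto simp: R_def)
      moreover have "(z, y) \<in> (R t s)\<^sup>*" using m y unfolding component_def by (auto intro: rtrancl_trans)
      ultimately have "y \<in> ?C" unfolding component_def by simp
      then show "Min ?C \<le> y" using C by simp
    qed
    moreover have "z \<in> component t s (Min ?C)"
      using m True R_rtrancl_sym unfolding component_def by simp
    ultimately have "z \<in> (\<Union>y\<in>roots t s. component t s y)" by blast
    then show ?thesis unfolding restr_def by simp
  next
    case False
    then have "z \<notin> (\<Union>y\<in>roots t s. component t s y)" unfolding component_def by blast
    then show ?thesis using False s[OF z] z unfolding restr_def supp_def by auto
  qed
  ultimately show ?thesis using L_cong[OF t, of "restr s (\<Union>y\<in>roots t s. component t s y)" s e e] by simp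
qed

text \<open>On level 0 a bag contains at most one variable, so the counts determine
  \<open>S\<close>. Without red edges a clause is near the support only if its own bag belongs to
  it; but clause bags contain no variable, which forces their counts to be zero, and the clause
  condition is vacuous.\<close>

lemma L_0:
  assumes n: "0 < n" and red0: "\<And>x y. \<not> red 0 x y" and inj: "inj_on (bv 0) Xs"
    and dis: "\<And>i j. i \<in> Cs \<Longrightarrow> j \<in> Xs \<Longrightarrow> bc 0 i \<noteq> bv 0 j" and s: "\<And>y. y \<in> V 0 \<Longrightarrow> 0 \<le> s y"
  shows "L 0 s e = (if \<forall>y\<in>V 0. s y \<le> nvar 0 y then \<Prod>j\<in>Xs. if 0 < s (bv 0 j) then wp j else 1 else 0)"
proof (cases "\<forall>y\<in>V 0. s y \<le> nvar 0 y")
  case False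
  have "Sel 0 s = {}"
  proof (rule ccontr)
    assume "Sel 0 s \<noteq> {}"
    then obtain S where S: "S \<in> Sel 0 s" by blast
    have "s y \<le> nvar 0 y" if "y \<in> V 0" for y
    proof -
      have "card {j \<in> S. bv 0 j = y} \<le> card {j \<in> Xs. bv 0 j = y}"
        using S finX unfolding Sel_def by (intro card_mono) auto
      then show ?thesis using Sel_card[OF S that] unfolding nvar_def by simp
    qed
    with False show False by blast
  qed
  then show ?thesis unfolding L_def if_not_P[OF False] by simp
next
  case True
  let ?S = "{j \<in> Xs. 0 < s (bv 0 j)}"
  have sing: "{j \<in> Xs. bv 0 j = bv 0 x} = {x}" if "x \<in> Xs" for x
    using inj that unfolding inj_on_def by auto
  have le1: "s (bv 0 x) \<le> 1" if "x \<in> Xs" for x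
    using True bvV[OF n that] sing[OF that] unfolding nvar_def by fastforce
  have out: "s y = 0" if "y \<in> V 0" "y \<notin> bv 0 ` Xs" for y
  proof -
    have "{j \<in> Xs. bv 0 j = y} = {}" using that by blast
    then have "nvar 0 y = 0" unfolding nvar_def by (metis card.empty of_nat_0)
    then show ?thesis using True s[OF that(1)] that(1) by fastforce
  qed
  have "S = ?S" if S: "S \<in> Sel 0 s" for S
  proof (intro set_eqI iffI)
    fix x assume "x \<in> S" then show "x \<in> ?S" using Sel_pos[OF S n] S unfolding Sel_def by auto
  next
    fix x assume x: "x \<in> ?S"
    then obtain j where "j \<in> S" "bv 0 j = bv 0 x" using Sel_ex_pos[OF S, of "bv 0 x"] bvV[OF n] by auto
    then show "x \<in> S" using inj x S unfolding Sel_def inj_on_def by auto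
  qed
  moreover have "?S \<in> Sel 0 s"
    unfolding Sel_def
  proof (intro CollectI conjI ballI)
    fix y assume y: "y \<in> V 0"
    show "int (card {j \<in> ?S. bv 0 j = y}) = s y"
    proof (cases "y \<in> bv 0 ` Xs")
      case True
      then obtain x where x: "x \<in> Xs" "y = bv 0 x" by blast
      have "{j \<in> ?S. bv 0 j = y} = (if 0 < s y then {x} else {})" using sing[OF x(1)] x by auto
      then show ?thesis using le1[OF x(1)] s[OF y] x by auto
    next
      case False
      then have "{j \<in> ?S. bv 0 j = y} = {}" by blast
      then show ?thesis using out[OF y False] by (metis card.empty of_nat_0)
    qed
  qed simp
  ultimately have "Sel 0 s = {?S}" by blast
  moreover have "ok 0 s e ?S"
  proof -
    have "\<not> near 0 (supp 0 s) (bc 0 i)" if "i \<in> Cs" for i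
      using out[of "bc 0 i"] bcV[OF n that] dis[OF that] red0
      unfolding near_def nb_def supp_def by fastforce
    then show ?thesis unfolding ok_def by blast
  qed
  moreover have "wt 0 s ?S = (\<Prod>j\<in>Xs. if 0 < s (bv 0 j) then wp j else 1)"
    unfolding wt_def by (intro prod.cong) auto
  ultimately show ?thesis using True unfolding L_def by simp
qed

section \<open>The last level and the sum over all assignments with few ones\<close>

definition sat where
  "sat S i \<longleftrightarrow> (\<exists>j\<in>Xs. hasP i j \<and> j \<in> S \<or> hasN i j \<and> j \<notin> S)"
definition weight_of where "weight_of S = (\<Prod>j\<in>Xs. if j \<in> S then wp j else wn j)"

text \<open>In a single bag everything is near everything, so \<open>satn\<close> is satisfaction by
  the whole assignment. For \<open>j = 0\<close> the support would be empty and no clause would be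
  tested at all, hence \<open>0 < j\<close>.\<close>

lemma L_last:
  assumes n: "0 < n" and V: "V (n - 1) = {x}" and j: "0 < j"
  shows "L (n - 1) (\<lambda>_. j) (\<lambda>_. False) =
    (\<Sum>S\<in>{S. S \<subseteq> Xs \<and> int (card S) = j}. if \<forall>i\<in>Cs. sat S i then weight_of S else 0)"
proof -
  have t: "n - 1 < n" using n by simp
  have bv: "bv (n - 1) i = x" if "i \<in> Xs" for i using bvV[OF t that] V by simp
  have bc: "bc (n - 1) i = x" if "i \<in> Cs" for i using bcV[OF t that] V by simp
  have "{j \<in> S. bv (n - 1) j = x} = S" if "S \<subseteq> Xs" for S using bv that by auto
  then have "Sel (n - 1) (\<lambda>_. j) = {S. S \<subseteq> Xs \<and> int (card S) = j}" unfolding Sel_def V by auto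
  moreover have "ok (n - 1) (\<lambda>_. j) (\<lambda>_. False) S \<longleftrightarrow> (\<forall>i\<in>Cs. sat S i)" for S
    unfolding ok_def near_def supp_def V satn_def sat_def nb_def using bc bv j by auto
  moreover have "wt (n - 1) (\<lambda>_. j) S = weight_of S" for S
    unfolding wt_def weight_of_def using j by simp
  ultimately show ?thesis unfolding L_def by (simp del: One_nat_def cong: if_cong)
qed

text \<open>The empty set of ones is treated by itself, as \<open>L_last\<close> does not cover it:
  it satisfies exactly the clauses with a negative literal. If there is no trigraph there are no
  variables, and this term is the only one.\<close>

theorem count_eq:
  assumes "0 < n \<Longrightarrow> \<exists>x. V (n - 1) = {x}" and "n = 0 \<Longrightarrow> Xs = {}"
  shows "(\<Sum>S\<in>{S. S \<subseteq> Xs \<and> int (card S) \<le> k}. if \<forall>i\<in>Cs. sat S i then weight_of S else 0) =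
    (if 0 \<le> k then (if \<forall>i\<in>Cs. \<exists>j\<in>Xs. hasN i j then \<Prod>j\<in>Xs. wn j else 0) +
       (if 0 < n then \<Sum>j\<in>{1..k}. L (n - 1) (\<lambda>_. j) (\<lambda>_. False) else 0) else 0)"
proof (cases "0 \<le> k")
  case k: True
  let ?F = "\<lambda>S. if \<forall>i\<in>Cs. sat S i then weight_of S else 0"
  let ?P = "\<lambda>j. {S. S \<subseteq> Xs \<and> int (card S) = j}"
  have fin: "finite (?P j)" for j using finX by (auto intro: finite_subset[of _ "Pow Xs"])
  have "{S. S \<subseteq> Xs \<and> int (card S) \<le> k} = (\<Union>j\<in>{0..k}. ?P j)" by auto
  then have "sum ?F {S. S \<subseteq> Xs \<and> int (card S) \<le> k} = (\<Sum>j\<in>{0..k}. sum ?F (?P j))"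
    using fin by (simp add: sum.UNION_disjoint) (subst sum.UNION_disjoint, auto)
  also have "{0..k} = insert 0 {1..k}" using k by auto
  also have "(\<Sum>j\<in>insert 0 {1..k}. sum ?F (?P j)) = sum ?F (?P 0) + (\<Sum>j\<in>{1..k}. sum ?F (?P j))" by simp
  also have "?P 0 = {{}}" using finX finite_subset by fastforce
  also have "sum ?F {{}} = (if \<forall>i\<in>Cs. \<exists>j\<in>Xs. hasN i j then \<Prod>j\<in>Xs. wn j else 0)"
  proof -
    have "sat {} i = (\<exists>j\<in>Xs. hasN i j)" for i unfolding sat_def by simp
    then show ?thesis by (simp add: weight_of_def cong: if_cong)
  qed
  also have "(\<Sum>j\<in>{1..k}. sum ?F (?P j)) = (if 0 < n then \<Sum>j\<in>{1..k}. L (n - 1) (\<lambda>_. j) (\<lambda>_. False) else 0)"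
  proof (cases "0 < n")
    case True
    then obtain x where x: "V (n - 1) = {x}" using assms(1) by blast
    show ?thesis using True L_last[OF True x] by simp
  next
    case False
    then have "?P j = {}" if "j \<in> {1..k}" for j using assms(2) that by auto
    then have "sum ?F (?P j) = 0" if "j \<in> {1..k}" for j using that by (metis (no_types, lifting) sum.empty)
    then show ?thesis using False by simp
  qed
  finally show ?thesis using k by simp
next
  case False
  then have "{S. S \<subseteq> Xs \<and> int (card S) \<le> k} = {}" by auto
  then show ?thesis using False by simp
qed

end

section \<open>The algorithm as arithmetic expressions over the input\<close>

named_theorems computable_intros

section \<open>Positions of the parts of the input\<close>

declare rcomp_intros [computable_intros]

text \<open>The clauses follow the cells 0 for \<open>k\<close> and 1 for their number. A clause
  takes two cells for its name and its length, and then its literals; this is the jump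
  \<open>2 + fst c (a + 1)\<close>. Rounds with \<open>i \<ge> j\<close> are idle.\<close>

definition off_clause :: "inp \<Rightarrow> int \<Rightarrow> int" where
  "off_clause c j = (iter (snd c) (\<lambda>i a. if i < j then a + 2 + fst c (a + 1) else a) 2)"

lemma comp_off_clause [computable_intros]:
  "icomputable f1 \<Longrightarrow>
   icomputable (\<lambda>c \<sigma>. off_clause c (f1 c \<sigma>))"
  by (rule comp_app1[of off_clause]; (assumption | (unfold off_clause_def, intro computable_intros)))

definition off_vars :: "inp \<Rightarrow> int" where
  "off_vars c = (off_clause c (fst c 1))"

lemma comp_off_vars [computable_intros]: "icomputable (\<lambda>c \<sigma>. off_vars c)"
  unfolding off_vars_def by (intro computable_intros)

definition num_vars :: "inp \<Rightarrow> int" where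
  "num_vars c = (fst c (off_vars c))"

lemma comp_num_vars [computable_intros]: "icomputable (\<lambda>c \<sigma>. num_vars c)"
  unfolding num_vars_def by (intro computable_intros)

definition off_seq :: "inp \<Rightarrow> int" where
  "off_seq c = (off_vars c + 1 + num_vars c + num_vars c)"

lemma comp_off_seq [computable_intros]: "icomputable (\<lambda>c \<sigma>. off_seq c)"
  unfolding off_seq_def by (intro computable_intros)

definition num_graphs :: "inp \<Rightarrow> int" where
  "num_graphs c = (fst c (off_seq c))"

lemma comp_num_graphs [computable_intros]: "icomputable (\<lambda>c \<sigma>. num_graphs c)"
  unfolding num_graphs_def by (intro computable_intros)

definition pos_base :: "inp \<Rightarrow> int \<Rightarrow> int" where
  "pos_base c g = (g + 1 + fst c g)"

lemma comp_pos_base [computable_intros]: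
  "icomputable f1 \<Longrightarrow>
   icomputable (\<lambda>c \<sigma>. pos_base c (f1 c \<sigma>))"
  by (rule comp_app1[of pos_base]; (assumption | (unfold pos_base_def, intro computable_intros)))

definition after_edges :: "inp \<Rightarrow> int \<Rightarrow> int" where
  "after_edges c p = (p + 1 + fst c p + fst c p)"

lemma comp_after_edges [computable_intros]:
  "icomputable f1 \<Longrightarrow>
   icomputable (\<lambda>c \<sigma>. after_edges c (f1 c \<sigma>))"
  by (rule comp_app1[of after_edges]; (assumption | (unfold after_edges_def, intro computable_intros)))

definition neg_base :: "inp \<Rightarrow> int \<Rightarrow> int" where
  "neg_base c g = (after_edges c (pos_base c g))"

lemma comp_neg_base [computable_intros]:
  "icomputable f1 \<Longrightarrow>
   icomputable (\<lambda>c \<sigma>. neg_base c (f1 c \<sigma>))"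
  by (rule comp_app1[of neg_base]; (assumption | (unfold neg_base_def, intro computable_intros)))

definition red_base :: "inp \<Rightarrow> int \<Rightarrow> int" where
  "red_base c g = (after_edges c (neg_base c g))"

lemma comp_red_base [computable_intros]:
  "icomputable f1 \<Longrightarrow>
   icomputable (\<lambda>c \<sigma>. red_base c (f1 c \<sigma>))"
  by (rule comp_app1[of red_base]; (assumption | (unfold red_base_def, intro computable_intros)))

definition off_graph :: "inp \<Rightarrow> int \<Rightarrow> int" where
  "off_graph c t = (iter (snd c) (\<lambda>i a. if i < t then after_edges c (red_base c a) else a) (off_seq c + 1))"

lemma comp_off_graph [computable_intros]:
  "icomputable f1 \<Longrightarrow>
   icomputable (\<lambda>c \<sigma>. off_graph c (f1 c \<sigma>))"
  by (rule comp_app1[of off_graph]; (assumption | (unfold off_graph_def, intro computable_intros)))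

definition num_verts :: "inp \<Rightarrow> int \<Rightarrow> int" where
  "num_verts c t = (fst c (off_graph c t))"

lemma comp_num_verts [computable_intros]:
  "icomputable f1 \<Longrightarrow>
   icomputable (\<lambda>c \<sigma>. num_verts c (f1 c \<sigma>))"
  by (rule comp_app1[of num_verts]; (assumption | (unfold num_verts_def, intro computable_intros)))

definition vert :: "inp \<Rightarrow> int \<Rightarrow> int \<Rightarrow> int" where
  "vert c t j = (fst c (off_graph c t + 1 + j))"

lemma comp_vert [computable_intros]:
  "icomputable f1 \<Longrightarrow> icomputable f2 \<Longrightarrow>
   icomputable (\<lambda>c \<sigma>. vert c (f1 c \<sigma>) (f2 c \<sigma>))"
  by (rule comp_app2[of vert]; (assumption | (unfold vert_def, intro computable_intros)))

definition is_vert :: "inp \<Rightarrow> int \<Rightarrow> int \<Rightarrow> bool" where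
  "is_vert c t y \<longleftrightarrow> (\<exists>j\<in>range_of c. j < num_verts c t \<and> vert c t j = y)"

lemma comp_is_vert [computable_intros]:
  "icomputable f1 \<Longrightarrow> icomputable f2 \<Longrightarrow>
   bcomputable (\<lambda>c \<sigma>. is_vert c (f1 c \<sigma>) (f2 c \<sigma>))"
  by (rule bcomp_app2[of is_vert]; (assumption | (unfold is_vert_def, intro computable_intros)))

text \<open>Both orientations are tested because the encoding may list an edge in either.\<close>

definition edge_at :: "inp \<Rightarrow> int \<Rightarrow> int \<Rightarrow> int \<Rightarrow> bool" where
  "edge_at c p x y \<longleftrightarrow> (\<exists>j\<in>range_of c. j < fst c p \<and>
     (fst c (p + 1 + j + j) = x \<and> fst c (p + 2 + j + j) = y \<or> fst c (p + 1 + j + j) = y \<and> fst c (p + 2 + j + j) = x))"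

lemma comp_edge_at [computable_intros]:
  "icomputable f1 \<Longrightarrow> icomputable f2 \<Longrightarrow> icomputable f3 \<Longrightarrow>
   bcomputable (\<lambda>c \<sigma>. edge_at c (f1 c \<sigma>) (f2 c \<sigma>) (f3 c \<sigma>))"
  by (rule bcomp_app3[of edge_at]; (assumption | (unfold edge_at_def, intro computable_intros)))

definition pos_edge :: "inp \<Rightarrow> int \<Rightarrow> int \<Rightarrow> int \<Rightarrow> bool" where
  "pos_edge c t x y \<longleftrightarrow> (edge_at c (pos_base c (off_graph c t)) x y)"

lemma comp_pos_edge [computable_intros]:
  "icomputable f1 \<Longrightarrow> icomputable f2 \<Longrightarrow> icomputable f3 \<Longrightarrow>
   bcomputable (\<lambda>c \<sigma>. pos_edge c (f1 c \<sigma>) (f2 c \<sigma>) (f3 c \<sigma>))"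
  by (rule bcomp_app3[of pos_edge]; (assumption | (unfold pos_edge_def, intro computable_intros)))

definition neg_edge :: "inp \<Rightarrow> int \<Rightarrow> int \<Rightarrow> int \<Rightarrow> bool" where
  "neg_edge c t x y \<longleftrightarrow> (edge_at c (neg_base c (off_graph c t)) x y)"

lemma comp_neg_edge [computable_intros]:
  "icomputable f1 \<Longrightarrow> icomputable f2 \<Longrightarrow> icomputable f3 \<Longrightarrow>
   bcomputable (\<lambda>c \<sigma>. neg_edge c (f1 c \<sigma>) (f2 c \<sigma>) (f3 c \<sigma>))"
  by (rule bcomp_app3[of neg_edge]; (assumption | (unfold neg_edge_def, intro computable_intros)))

definition red_edge :: "inp \<Rightarrow> int \<Rightarrow> int \<Rightarrow> int \<Rightarrow> bool" where
  "red_edge c t x y \<longleftrightarrow> (edge_at c (red_base c (off_graph c t)) x y)"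

lemma comp_red_edge [computable_intros]:
  "icomputable f1 \<Longrightarrow> icomputable f2 \<Longrightarrow> icomputable f3 \<Longrightarrow>
   bcomputable (\<lambda>c \<sigma>. red_edge c (f1 c \<sigma>) (f2 c \<sigma>) (f3 c \<sigma>))"
  by (rule bcomp_app3[of red_edge]; (assumption | (unfold red_edge_def, intro computable_intros)))

text \<open>The encoding does not say what is contracted. The new vertex is recovered as the name
  that occurs on level \<open>t + 1\<close> but not on level \<open>t\<close>;
  \<open>old_vert\<close> takes the first listed of the two names that disappear.\<close>

definition new_vert :: "inp \<Rightarrow> int \<Rightarrow> int" where
  "new_vert c t = (vert c (t + 1) (search c (\<lambda>j. j < num_verts c (t + 1) \<and> \<not> is_vert c t (vert c (t + 1) j))))"

lemma comp_new_vert [computable_intros]: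
  "icomputable f1 \<Longrightarrow>
   icomputable (\<lambda>c \<sigma>. new_vert c (f1 c \<sigma>))"
  by (rule comp_app1[of new_vert]; (assumption | (unfold new_vert_def, intro computable_intros)))

definition old_vert :: "inp \<Rightarrow> int \<Rightarrow> int" where
  "old_vert c t = (vert c t (search c (\<lambda>j. j < num_verts c t \<and> \<not> is_vert c (t + 1) (vert c t j))))"

lemma comp_old_vert [computable_intros]:
  "icomputable f1 \<Longrightarrow>
   icomputable (\<lambda>c \<sigma>. old_vert c (f1 c \<sigma>))"
  by (rule comp_app1[of old_vert]; (assumption | (unfold old_vert_def, intro computable_intros)))

definition parent :: "inp \<Rightarrow> int \<Rightarrow> int \<Rightarrow> int" where
  "parent c t y = (if is_vert c (t + 1) y then y else new_vert c t)"

lemma comp_parent [computable_intros]: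
  "icomputable f1 \<Longrightarrow> icomputable f2 \<Longrightarrow>
   icomputable (\<lambda>c \<sigma>. parent c (f1 c \<sigma>) (f2 c \<sigma>))"
  by (rule comp_app2[of parent]; (assumption | (unfold parent_def, intro computable_intros)))

definition bag :: "inp \<Rightarrow> int \<Rightarrow> int \<Rightarrow> int" where
  "bag c t y = (iter (snd c) (\<lambda>i a. if i < t then parent c i a else a) y)"

lemma comp_bag [computable_intros]:
  "icomputable f1 \<Longrightarrow> icomputable f2 \<Longrightarrow>
   icomputable (\<lambda>c \<sigma>. bag c (f1 c \<sigma>) (f2 c \<sigma>))"
  by (rule comp_app2[of bag]; (assumption | (unfold bag_def, intro computable_intros)))

definition var_bag :: "inp \<Rightarrow> int \<Rightarrow> int \<Rightarrow> int" where
  "var_bag c t j = (bag c t (fst c (off_vars c + 2 + j + j)))"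

lemma comp_var_bag [computable_intros]:
  "icomputable f1 \<Longrightarrow> icomputable f2 \<Longrightarrow>
   icomputable (\<lambda>c \<sigma>. var_bag c (f1 c \<sigma>) (f2 c \<sigma>))"
  by (rule comp_app2[of var_bag]; (assumption | (unfold var_bag_def, intro computable_intros)))

definition clause_bag :: "inp \<Rightarrow> int \<Rightarrow> int \<Rightarrow> int" where
  "clause_bag c t i = (bag c t (fst c (off_clause c i)))"

lemma comp_clause_bag [computable_intros]:
  "icomputable f1 \<Longrightarrow> icomputable f2 \<Longrightarrow>
   icomputable (\<lambda>c \<sigma>. clause_bag c (f1 c \<sigma>) (f2 c \<sigma>))"
  by (rule comp_app2[of clause_bag]; (assumption | (unfold clause_bag_def, intro computable_intros)))

definition has_lit :: "inp \<Rightarrow> int \<Rightarrow> int \<Rightarrow> bool" where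
  "has_lit c i z \<longleftrightarrow> (\<exists>l\<in>range_of c. l < fst c (off_clause c i + 1) \<and> fst c (off_clause c i + 2 + l) = z)"

lemma comp_has_lit [computable_intros]:
  "icomputable f1 \<Longrightarrow> icomputable f2 \<Longrightarrow>
   bcomputable (\<lambda>c \<sigma>. has_lit c (f1 c \<sigma>) (f2 c \<sigma>))"
  by (rule bcomp_app2[of has_lit]; (assumption | (unfold has_lit_def, intro computable_intros)))

definition has_pos :: "inp \<Rightarrow> int \<Rightarrow> int \<Rightarrow> bool" where
  "has_pos c i j \<longleftrightarrow> (has_lit c i (fst c (off_vars c + 1 + j + j)))"

definition has_neg :: "inp \<Rightarrow> int \<Rightarrow> int \<Rightarrow> bool" where
  "has_neg c i j \<longleftrightarrow> (has_lit c i (0 - fst c (off_vars c + 1 + j + j)))"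

lemma comp_has_neg [computable_intros]:
  "icomputable f1 \<Longrightarrow> icomputable f2 \<Longrightarrow>
   bcomputable (\<lambda>c \<sigma>. has_neg c (f1 c \<sigma>) (f2 c \<sigma>))"
  by (rule bcomp_app2[of has_neg]; (assumption | (unfold has_neg_def, intro computable_intros)))

definition red_eq :: "inp \<Rightarrow> int \<Rightarrow> int \<Rightarrow> int \<Rightarrow> bool" where
  "red_eq c t x y \<longleftrightarrow> (x = y \<or> red_edge c t x y)"

lemma comp_red_eq [computable_intros]:
  "icomputable f1 \<Longrightarrow> icomputable f2 \<Longrightarrow> icomputable f3 \<Longrightarrow>
   bcomputable (\<lambda>c \<sigma>. red_eq c (f1 c \<sigma>) (f2 c \<sigma>) (f3 c \<sigma>))"
  by (rule bcomp_app3[of red_eq]; (assumption | (unfold red_eq_def, intro computable_intros)))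

definition var_count :: "inp \<Rightarrow> int \<Rightarrow> int \<Rightarrow> int" where
  "var_count c t y = (\<Sum>j\<in>range_of c. if j < num_vars c \<and> var_bag c t j = y then 1 else 0)"

lemma comp_var_count [computable_intros]:
  "icomputable f1 \<Longrightarrow> icomputable f2 \<Longrightarrow>
   icomputable (\<lambda>c \<sigma>. var_count c (f1 c \<sigma>) (f2 c \<sigma>))"
  by (rule comp_app2[of var_count]; (assumption | (unfold var_count_def, intro computable_intros)))

text \<open>Numbers the red neighbours of \<open>x\<close> from 0 in the order of their names, so
  that a single digit can name a step of a walk.\<close>

definition red_rank :: "inp \<Rightarrow> int \<Rightarrow> int \<Rightarrow> int \<Rightarrow> int" where
  "red_rank c t x y = (\<Sum>l\<in>range_of c. if l < num_verts c t \<and> red_edge c t x (vert c t l) \<and> vert c t l < y then 1 else 0)"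

lemma comp_red_rank [computable_intros]:
  "icomputable f1 \<Longrightarrow> icomputable f2 \<Longrightarrow> icomputable f3 \<Longrightarrow>
   icomputable (\<lambda>c \<sigma>. red_rank c (f1 c \<sigma>) (f2 c \<sigma>) (f3 c \<sigma>))"
  by (rule comp_app3[of red_rank]; (assumption | (unfold red_rank_def, intro computable_intros)))

definition red_deg :: "inp \<Rightarrow> int \<Rightarrow> int \<Rightarrow> int" where
  "red_deg c t x = (\<Sum>l\<in>range_of c. if l < num_verts c t \<and> red_edge c t x (vert c t l) then 1 else 0)"

lemma comp_red_deg [computable_intros]:
  "icomputable f1 \<Longrightarrow> icomputable f2 \<Longrightarrow>
   icomputable (\<lambda>c \<sigma>. red_deg c (f1 c \<sigma>) (f2 c \<sigma>))"
  by (rule comp_app2[of red_deg]; (assumption | (unfold red_deg_def, intro computable_intros)))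

text \<open>\<open>d\<close> is not given to the algorithm; the least common bound on the red
  degrees of the sequence takes its place.\<close>

definition max_deg :: "inp \<Rightarrow> int" where
  "max_deg c = (search c (\<lambda>D. \<forall>t\<in>range_of c. t < num_graphs c \<longrightarrow>
     (\<forall>l\<in>range_of c. l < num_verts c t \<longrightarrow> red_deg c t (vert c t l) \<le> D)))"

lemma comp_max_deg [computable_intros]: "icomputable (\<lambda>c \<sigma>. max_deg c)"
  unfolding max_deg_def by (intro computable_intros)

text \<open>Digits must cover the counts from 0 to \<open>k\<close> and the moves from 0 to
  \<open>max_deg c\<close>. With the summand 2 the base is also at least 2 whenever \<open>k\<close>
  is nonnegative.\<close>

definition base :: "inp \<Rightarrow> int" where
  "base c = (fst c 0 + max_deg c + 2)"

lemma comp_base [computable_intros]: "icomputable (\<lambda>c \<sigma>. base c)"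
  unfolding base_def by (intro computable_intros)

text \<open>Integer products and quotients are obtained by counting, as the machine only adds and
  subtracts. They are correct for a first argument between 0 and \<open>X\<close> and, in
  \<open>quot\<close>, a positive divisor.\<close>

definition mult :: "inp \<Rightarrow> int \<Rightarrow> int \<Rightarrow> int" where
  "mult c a b = (\<Sum>i\<in>range_of c. if i < a then b else 0)"

lemma comp_mult [computable_intros]:
  "icomputable f1 \<Longrightarrow> icomputable f2 \<Longrightarrow>
   icomputable (\<lambda>c \<sigma>. mult c (f1 c \<sigma>) (f2 c \<sigma>))"
  by (rule comp_app2[of mult]; (assumption | (unfold mult_def, intro computable_intros)))

definition quot :: "inp \<Rightarrow> int \<Rightarrow> int \<Rightarrow> int" where
  "quot c a b = (\<Sum>i\<in>range_of c. if mult c (i + 1) b \<le> a then 1 else 0)"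

lemma comp_quot [computable_intros]:
  "icomputable f1 \<Longrightarrow> icomputable f2 \<Longrightarrow>
   icomputable (\<lambda>c \<sigma>. quot c (f1 c \<sigma>) (f2 c \<sigma>))"
  by (rule comp_app2[of quot]; (assumption | (unfold quot_def, intro computable_intros)))

definition shift :: "inp \<Rightarrow> int \<Rightarrow> int \<Rightarrow> int" where
  "shift c q i = (iter (snd c) (\<lambda>l a. if l < i then quot c a (base c) else a) q)"

lemma comp_shift [computable_intros]:
  "icomputable f1 \<Longrightarrow> icomputable f2 \<Longrightarrow>
   icomputable (\<lambda>c \<sigma>. shift c (f1 c \<sigma>) (f2 c \<sigma>))"
  by (rule comp_app2[of shift]; (assumption | (unfold shift_def, intro computable_intros)))

definition digit :: "inp \<Rightarrow> int \<Rightarrow> int \<Rightarrow> int" where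
  "digit c q i = (shift c q i - mult c (quot c (shift c q i) (base c)) (base c))"

lemma comp_digit [computable_intros]:
  "icomputable f1 \<Longrightarrow> icomputable f2 \<Longrightarrow>
   icomputable (\<lambda>c \<sigma>. digit c (f1 c \<sigma>) (f2 c \<sigma>))"
  by (rule comp_app2[of digit]; (assumption | (unfold digit_def, intro computable_intros)))

text \<open>A number \<open>q\<close> encodes a walk in the red graph by its digits to the base \<open>base c\<close>: the digit 0 means
  staying at the vertex, the digit \<open>i\<close> moving to its \<open>i\<close>-th red neighbour.\<close>

definition next_index :: "inp \<Rightarrow> int \<Rightarrow> int \<Rightarrow> int \<Rightarrow> int" where
  "next_index c t x d = (search c (\<lambda>l. l < num_verts c t \<and> red_edge c t x (vert c t l) \<and> red_rank c t x (vert c t l) = d - 1))"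

lemma comp_next_index [computable_intros]:
  "icomputable f1 \<Longrightarrow> icomputable f2 \<Longrightarrow> icomputable f3 \<Longrightarrow>
   icomputable (\<lambda>c \<sigma>. next_index c (f1 c \<sigma>) (f2 c \<sigma>) (f3 c \<sigma>))"
  by (rule comp_app3[of next_index]; (assumption | (unfold next_index_def, intro computable_intros)))

text \<open>A digit that names no neighbour means staying. Thus every number codes a walk, and short
  walks can be padded to the fixed length.\<close>

definition next_vert :: "inp \<Rightarrow> int \<Rightarrow> int \<Rightarrow> int \<Rightarrow> int" where
  "next_vert c t x d = (if next_index c t x d < 0 then x else vert c t (next_index c t x d))"

lemma comp_next_vert [computable_intros]:
  "icomputable f1 \<Longrightarrow> icomputable f2 \<Longrightarrow> icomputable f3 \<Longrightarrow>
   icomputable (\<lambda>c \<sigma>. next_vert c (f1 c \<sigma>) (f2 c \<sigma>) (f3 c \<sigma>))"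
  by (rule comp_app3[of next_vert]; (assumption | (unfold next_vert_def, intro computable_intros)))

definition walk :: "inp \<Rightarrow> int \<Rightarrow> int \<Rightarrow> int \<Rightarrow> int \<Rightarrow> int" where
  "walk c t x q l = (iter (snd c) (\<lambda>i a. if i < l then next_vert c t a (digit c q i) else a) x)"

lemma comp_walk [computable_intros]:
  "icomputable f1 \<Longrightarrow> icomputable f2 \<Longrightarrow> icomputable f3 \<Longrightarrow> icomputable f4 \<Longrightarrow>
   icomputable (\<lambda>c \<sigma>. walk c (f1 c \<sigma>) (f2 c \<sigma>) (f3 c \<sigma>) (f4 c \<sigma>))"
  by (rule comp_app4[of walk]; (assumption | (unfold walk_def, intro computable_intros)))

text \<open>\<open>k * k\<close> bounds the number of pairs of support vertices, hence the number of
  two-edge steps needed inside a component; the extra 1 leaves room for a step to a neighbouring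
  clause bag.\<close>

definition half_length :: "inp \<Rightarrow> int" where
  "half_length c = (mult c (fst c 0) (fst c 0) + 1)"

lemma comp_half_length [computable_intros]: "icomputable (\<lambda>c \<sigma>. half_length c)"
  unfolding half_length_def by (intro computable_intros)

definition walk_end :: "inp \<Rightarrow> int \<Rightarrow> int \<Rightarrow> int \<Rightarrow> int" where
  "walk_end c t x q = (walk c t x q (half_length c + half_length c))"

lemma comp_walk_end [computable_intros]:
  "icomputable f1 \<Longrightarrow> icomputable f2 \<Longrightarrow> icomputable f3 \<Longrightarrow>
   icomputable (\<lambda>c \<sigma>. walk_end c (f1 c \<sigma>) (f2 c \<sigma>) (f3 c \<sigma>))"
  by (rule comp_app3[of walk_end]; (assumption | (unfold walk_end_def, intro computable_intros)))

text \<open>A number \<open>q\<close> also encodes a function on the red ball around \<open>x\<close>: its value at \<open>y\<close> is the digit of \<open>q\<close> at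
  the position of the least number that encodes a walk from \<open>x\<close> to \<open>y\<close>. Outside the ball the search fails
  with the result \<open>- 1\<close> and the value is 0.\<close>

definition label :: "inp \<Rightarrow> int \<Rightarrow> int \<Rightarrow> int \<Rightarrow> int" where
  "label c t x y = (search c (\<lambda>q. walk_end c t x q = y))"

lemma comp_label [computable_intros]:
  "icomputable f1 \<Longrightarrow> icomputable f2 \<Longrightarrow> icomputable f3 \<Longrightarrow>
   icomputable (\<lambda>c \<sigma>. label c (f1 c \<sigma>) (f2 c \<sigma>) (f3 c \<sigma>))"
  by (rule comp_app3[of label]; (assumption | (unfold label_def, intro computable_intros)))

definition val :: "inp \<Rightarrow> int \<Rightarrow> int \<Rightarrow> int \<Rightarrow> int \<Rightarrow> int" where
  "val c t x q y = (if label c t x y < 0 then 0 else digit c q (label c t x y))"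

lemma comp_val [computable_intros]:
  "icomputable f1 \<Longrightarrow> icomputable f2 \<Longrightarrow> icomputable f3 \<Longrightarrow> icomputable f4 \<Longrightarrow>
   icomputable (\<lambda>c \<sigma>. val c (f1 c \<sigma>) (f2 c \<sigma>) (f3 c \<sigma>) (f4 c \<sigma>))"
  by (rule comp_app4[of val]; (assumption | (unfold val_def, intro computable_intros)))

text \<open>From here on \<open>t\<close> is the level below the contraction, and the function to be split is encoded by \<open>q\<close> in
  the ball around the vertex \<open>x\<close> of level \<open>t + 1\<close>; \<open>q'\<close> encodes the marks and \<open>j\<close> is the share of
  \<open>old_vert c t\<close>. Walks have even length, and their even positions have to lie in the support.\<close>

definition split :: "inp \<Rightarrow> int \<Rightarrow> int \<Rightarrow> int \<Rightarrow> int \<Rightarrow> int \<Rightarrow> int" where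
  "split c t x q j y = (if is_vert c (t + 1) y then val c (t + 1) x q y else if y = old_vert c t then j
     else val c (t + 1) x q (new_vert c t) - j)"

lemma comp_split [computable_intros]:
  "icomputable f1 \<Longrightarrow> icomputable f2 \<Longrightarrow> icomputable f3 \<Longrightarrow> icomputable f4 \<Longrightarrow> icomputable f5 \<Longrightarrow>
   icomputable (\<lambda>c \<sigma>. split c (f1 c \<sigma>) (f2 c \<sigma>) (f3 c \<sigma>) (f4 c \<sigma>) (f5 c \<sigma>))"
  by (rule comp_app5[of split]; (assumption | (unfold split_def, intro computable_intros)))

text \<open>Odd positions are not tested: they are the middle vertices of \<open>linked\<close>
  steps and may lie outside the support.\<close>

definition conn :: "inp \<Rightarrow> int \<Rightarrow> int \<Rightarrow> int \<Rightarrow> int \<Rightarrow> int \<Rightarrow> int \<Rightarrow> bool" where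
  "conn c t x q j y z \<longleftrightarrow> (\<exists>p\<in>range_of c. walk_end c t y p = z \<and>
     (\<forall>i\<in>range_of c. i \<le> half_length c \<longrightarrow> 0 < split c t x q j (walk c t y p (i + i))))"

lemma comp_conn [computable_intros]:
  "icomputable f1 \<Longrightarrow> icomputable f2 \<Longrightarrow> icomputable f3 \<Longrightarrow> icomputable f4 \<Longrightarrow> icomputable f5 \<Longrightarrow> icomputable f6 \<Longrightarrow>
   bcomputable (\<lambda>c \<sigma>. conn c (f1 c \<sigma>) (f2 c \<sigma>) (f3 c \<sigma>) (f4 c \<sigma>) (f5 c \<sigma>) (f6 c \<sigma>))"
  by (rule bcomp_app6[of conn]; (assumption | (unfold conn_def, intro computable_intros)))

definition split_sat :: "inp \<Rightarrow> int \<Rightarrow> int \<Rightarrow> int \<Rightarrow> int \<Rightarrow> int \<Rightarrow> int \<Rightarrow> bool" where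
  "split_sat c t x q q' j y \<longleftrightarrow> (0 < val c (t + 1) x q' (parent c t y) \<or> (\<exists>l\<in>range_of c. l < num_verts c t \<and>
     red_eq c (t + 1) (parent c t (vert c t l)) (parent c t y) \<and>
     (pos_edge c t (vert c t l) y \<and> 0 < split c t x q j (vert c t l) \<or>
      neg_edge c t (vert c t l) y \<and> split c t x q j (vert c t l) < var_count c t (vert c t l))))"

lemma comp_split_sat [computable_intros]:
  "icomputable f1 \<Longrightarrow> icomputable f2 \<Longrightarrow> icomputable f3 \<Longrightarrow> icomputable f4 \<Longrightarrow> icomputable f5 \<Longrightarrow> icomputable f6 \<Longrightarrow>
   bcomputable (\<lambda>c \<sigma>. split_sat c (f1 c \<sigma>) (f2 c \<sigma>) (f3 c \<sigma>) (f4 c \<sigma>) (f5 c \<sigma>) (f6 c \<sigma>))"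
  by (rule bcomp_app6[of split_sat]; (assumption | (unfold split_sat_def, intro computable_intros)))

definition zero_sat :: "inp \<Rightarrow> int \<Rightarrow> int \<Rightarrow> bool" where
  "zero_sat c t y \<longleftrightarrow> (\<forall>i\<in>range_of c. i < fst c 1 \<and> clause_bag c t i = y \<longrightarrow>
     (\<exists>j\<in>range_of c. j < num_vars c \<and> has_neg c i j \<and> red_eq c t y (var_bag c t j)))"

lemma comp_zero_sat [computable_intros]:
  "icomputable f1 \<Longrightarrow> icomputable f2 \<Longrightarrow>
   bcomputable (\<lambda>c \<sigma>. zero_sat c (f1 c \<sigma>) (f2 c \<sigma>))"
  by (rule bcomp_app2[of zero_sat]; (assumption | (unfold zero_sat_def, intro computable_intros)))

definition near_val :: "inp \<Rightarrow> int \<Rightarrow> int \<Rightarrow> int \<Rightarrow> int \<Rightarrow> bool" where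
  "near_val c t x q y \<longleftrightarrow> (\<exists>l\<in>range_of c. l < num_verts c t \<and> 0 < val c t x q (vert c t l) \<and> red_eq c t (vert c t l) y)"

lemma comp_near_val [computable_intros]:
  "icomputable f1 \<Longrightarrow> icomputable f2 \<Longrightarrow> icomputable f3 \<Longrightarrow> icomputable f4 \<Longrightarrow>
   bcomputable (\<lambda>c \<sigma>. near_val c (f1 c \<sigma>) (f2 c \<sigma>) (f3 c \<sigma>) (f4 c \<sigma>))"
  by (rule bcomp_app4[of near_val]; (assumption | (unfold near_val_def, intro computable_intros)))

definition near_split :: "inp \<Rightarrow> int \<Rightarrow> int \<Rightarrow> int \<Rightarrow> int \<Rightarrow> int \<Rightarrow> bool" where
  "near_split c t x q j y \<longleftrightarrow> (\<exists>l\<in>range_of c. l < num_verts c t \<and> 0 < split c t x q j (vert c t l) \<and> red_eq c t (vert c t l) y)"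

lemma comp_near_split [computable_intros]:
  "icomputable f1 \<Longrightarrow> icomputable f2 \<Longrightarrow> icomputable f3 \<Longrightarrow> icomputable f4 \<Longrightarrow> icomputable f5 \<Longrightarrow>
   bcomputable (\<lambda>c \<sigma>. near_split c (f1 c \<sigma>) (f2 c \<sigma>) (f3 c \<sigma>) (f4 c \<sigma>) (f5 c \<sigma>))"
  by (rule bcomp_app5[of near_split]; (assumption | (unfold near_split_def, intro computable_intros)))

definition admissible :: "inp \<Rightarrow> int \<Rightarrow> int \<Rightarrow> int \<Rightarrow> int \<Rightarrow> int \<Rightarrow> bool" where
  "admissible c t x q q' j \<longleftrightarrow> (\<forall>l\<in>range_of c. l < num_verts c t \<and> near_val c (t + 1) x q (parent c t (vert c t l)) \<and>
     \<not> near_split c t x q j (vert c t l) \<and> \<not> split_sat c t x q q' j (vert c t l) \<longrightarrow> zero_sat c t (vert c t l))"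

lemma comp_admissible [computable_intros]:
  "icomputable f1 \<Longrightarrow> icomputable f2 \<Longrightarrow> icomputable f3 \<Longrightarrow> icomputable f4 \<Longrightarrow> icomputable f5 \<Longrightarrow>
   bcomputable (\<lambda>c \<sigma>. admissible c (f1 c \<sigma>) (f2 c \<sigma>) (f3 c \<sigma>) (f4 c \<sigma>) (f5 c \<sigma>))"
  by (rule bcomp_app5[of admissible]; (assumption | (unfold admissible_def, intro computable_intros)))

definition conn_code :: "inp \<Rightarrow> int \<Rightarrow> int \<Rightarrow> int \<Rightarrow> int \<Rightarrow> int \<Rightarrow> int" where
  "conn_code c t x q j y = (search c (\<lambda>p. \<forall>l\<in>range_of c. l < num_verts c t \<longrightarrow> val c t y p (vert c t l) =
     (if conn c t x q j y (vert c t l) then split c t x q j (vert c t l) else 0)))"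

lemma comp_conn_code [computable_intros]:
  "icomputable f1 \<Longrightarrow> icomputable f2 \<Longrightarrow> icomputable f3 \<Longrightarrow> icomputable f4 \<Longrightarrow> icomputable f5 \<Longrightarrow>
   icomputable (\<lambda>c \<sigma>. conn_code c (f1 c \<sigma>) (f2 c \<sigma>) (f3 c \<sigma>) (f4 c \<sigma>) (f5 c \<sigma>))"
  by (rule comp_app5[of conn_code]; (assumption | (unfold conn_code_def, intro computable_intros)))

definition near_conn :: "inp \<Rightarrow> int \<Rightarrow> int \<Rightarrow> int \<Rightarrow> int \<Rightarrow> int \<Rightarrow> int \<Rightarrow> bool" where
  "near_conn c t x q j y z \<longleftrightarrow> (\<exists>l\<in>range_of c. l < num_verts c t \<and> conn c t x q j y (vert c t l) \<and> red_eq c t (vert c t l) z)"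

lemma comp_near_conn [computable_intros]:
  "icomputable f1 \<Longrightarrow> icomputable f2 \<Longrightarrow> icomputable f3 \<Longrightarrow> icomputable f4 \<Longrightarrow> icomputable f5 \<Longrightarrow> icomputable f6 \<Longrightarrow>
   bcomputable (\<lambda>c \<sigma>. near_conn c (f1 c \<sigma>) (f2 c \<sigma>) (f3 c \<sigma>) (f4 c \<sigma>) (f5 c \<sigma>) (f6 c \<sigma>))"
  by (rule bcomp_app6[of near_conn]; (assumption | (unfold near_conn_def, intro computable_intros)))

text \<open>Marks are recorded only near the component, where they matter by \<open>L_cong\<close>;
  so they fit into the ball around \<open>y\<close>.\<close>

definition sat_code :: "inp \<Rightarrow> int \<Rightarrow> int \<Rightarrow> int \<Rightarrow> int \<Rightarrow> int \<Rightarrow> int \<Rightarrow> int" where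
  "sat_code c t x q q' j y = (search c (\<lambda>p. \<forall>l\<in>range_of c. l < num_verts c t \<longrightarrow> val c t y p (vert c t l) =
     (if near_conn c t x q j y (vert c t l) \<and> split_sat c t x q q' j (vert c t l) then 1 else 0)))"

lemma comp_sat_code [computable_intros]:
  "icomputable f1 \<Longrightarrow> icomputable f2 \<Longrightarrow> icomputable f3 \<Longrightarrow> icomputable f4 \<Longrightarrow> icomputable f5 \<Longrightarrow> icomputable f6 \<Longrightarrow>
   icomputable (\<lambda>c \<sigma>. sat_code c (f1 c \<sigma>) (f2 c \<sigma>) (f3 c \<sigma>) (f4 c \<sigma>) (f5 c \<sigma>) (f6 c \<sigma>))"
  by (rule comp_app6[of sat_code]; (assumption | (unfold sat_code_def, intro computable_intros)))

definition is_root :: "inp \<Rightarrow> int \<Rightarrow> int \<Rightarrow> int \<Rightarrow> int \<Rightarrow> int \<Rightarrow> bool" where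
  "is_root c t x q j y \<longleftrightarrow> (0 < split c t x q j y \<and>
     (\<forall>l\<in>range_of c. l < num_verts c t \<and> conn c t x q j y (vert c t l) \<longrightarrow> y \<le> vert c t l))"

lemma comp_is_root [computable_intros]:
  "icomputable f1 \<Longrightarrow> icomputable f2 \<Longrightarrow> icomputable f3 \<Longrightarrow> icomputable f4 \<Longrightarrow> icomputable f5 \<Longrightarrow>
   bcomputable (\<lambda>c \<sigma>. is_root c (f1 c \<sigma>) (f2 c \<sigma>) (f3 c \<sigma>) (f4 c \<sigma>) (f5 c \<sigma>))"
  by (rule bcomp_app5[of is_root]; (assumption | (unfold is_root_def, intro computable_intros)))

section \<open>Addresses of the table and its recurrence\<close>

definition times :: "inp \<Rightarrow> int \<Rightarrow> int" where
  "times c a = (\<Sum>i\<in>range_of c. a)"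

lemma comp_times [computable_intros]:
  "icomputable f1 \<Longrightarrow>
   icomputable (\<lambda>c \<sigma>. times c (f1 c \<sigma>))"
  by (rule comp_app1[of times]; (assumption | (unfold times_def, intro computable_intros)))

text \<open>The table starts above the weights; the vertices of a level enter through their position \<open>l\<close>.\<close>

definition addr :: "inp \<Rightarrow> int \<Rightarrow> int \<Rightarrow> int \<Rightarrow> int \<Rightarrow> int" where
  "addr c t l q q' = (int (snd c) + times c (times c (times c t + l) + q) + q')"

lemma comp_addr [computable_intros]:
  "icomputable f1 \<Longrightarrow> icomputable f2 \<Longrightarrow> icomputable f3 \<Longrightarrow> icomputable f4 \<Longrightarrow>
   icomputable (\<lambda>c \<sigma>. addr c (f1 c \<sigma>) (f2 c \<sigma>) (f3 c \<sigma>) (f4 c \<sigma>))"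
  by (rule comp_app4[of addr]; (assumption | (unfold addr_def, intro computable_intros)))

definition last_code :: "inp \<Rightarrow> int \<Rightarrow> int" where
  "last_code c j = (search c (\<lambda>q. val c (num_graphs c - 1) (vert c (num_graphs c - 1) 0) q (vert c (num_graphs c - 1) 0) = j))"

lemma comp_last_code [computable_intros]:
  "icomputable f1 \<Longrightarrow>
   icomputable (\<lambda>c \<sigma>. last_code c (f1 c \<sigma>))"
  by (rule comp_app1[of last_code]; (assumption | (unfold last_code_def, intro computable_intros)))

definition base_value :: "inp \<Rightarrow> int \<Rightarrow> int \<Rightarrow> (int \<Rightarrow> real) \<Rightarrow> real" where
  "base_value c l q M = (if \<forall>l'\<in>range_of c. l' < num_verts c 0 \<longrightarrow>
       val c 0 (vert c 0 l) q (vert c 0 l') \<le> var_count c 0 (vert c 0 l')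
     then \<Prod>i\<in>range_of c. if i < num_vars c \<and> 0 < val c 0 (vert c 0 l) q (var_bag c 0 i) then M (i + i) else 1
     else 0)"

text \<open>The right-hand side of \<open>L_Suc\<close>, where the value of \<open>L\<close> on the
  lower level is replaced by the product over its components, looked up at their roots.\<close>

definition step_value :: "inp \<Rightarrow> int \<Rightarrow> int \<Rightarrow> int \<Rightarrow> int \<Rightarrow> (int \<Rightarrow> real) \<Rightarrow> real" where
  "step_value c t x q q' M = (\<Sum>j\<in>range_of c.
     if j \<le> val c (t + 1) x q (new_vert c t) \<and> admissible c t x q q' j
     then (\<Prod>i\<in>range_of c. if i < num_vars c \<and> 0 < val c (t + 1) x q (var_bag c (t + 1) i) \<and>
            \<not> 0 < split c t x q j (var_bag c t i) then M (i + i + 1) else 1) *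
          (\<Prod>l\<in>range_of c. if l < num_verts c t \<and> is_root c t x q j (vert c t l)
            then M (addr c t l (conn_code c t x q j (vert c t l)) (sat_code c t x q q' j (vert c t l))) else 1)
     else 0)"

text \<open>Levels are filled upwards, and every loop has \<open>X\<close> rounds. Cells whose level
  or vertex position exceeds the actual numbers carry no meaning.\<close>

definition fill :: "inp \<Rightarrow> (int \<Rightarrow> real) \<Rightarrow> int \<Rightarrow> real" where
  "fill c M = iter (snd c) (\<lambda>t. iter (snd c) (\<lambda>l. iter (snd c) (\<lambda>q. iter (snd c) (\<lambda>q' M.
     M(addr c t l q q' := if t = 0 then base_value c l q M
       else step_value c (t - 1) (vert c t l) q q' M))))) M"

text \<open>Follows \<open>count_eq\<close>. On the last level the only vertex has position 0, and
  \<open>last_code c 0\<close> codes the absence of marks.\<close>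

definition result :: "inp \<Rightarrow> (int \<Rightarrow> real) \<Rightarrow> real" where
  "result c M = (if 0 \<le> fst c 0 then
     (if \<forall>i\<in>range_of c. i < fst c 1 \<longrightarrow> (\<exists>j\<in>range_of c. j < num_vars c \<and> has_neg c i j)
      then \<Prod>j\<in>range_of c. if j < num_vars c then M (j + j + 1) else 1 else 0) +
     (if 0 < num_graphs c then \<Sum>j\<in>range_of c. if 1 \<le> j \<and> j \<le> fst c 0
        then M (addr c (num_graphs c - 1) 0 (last_code c j) (last_code c 0)) else 0 else 0)
   else 0)"

lemma ucomp_fill: "ucomputable (\<lambda>c \<sigma>. fill c)"
  unfolding fill_def base_value_def step_value_def by (intro computable_intros)

lemma rcomp_result: "rcomputable (\<lambda>c \<sigma>. result c)"
  unfolding result_def by (intro computable_intros)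

section \<open>Filling the table\<close>

text \<open>Compiled loops always run \<open>X\<close> rounds; shorter ones are obtained by letting
  the remaining rounds do nothing.\<close>

lemma iter_cap: "iter n (\<lambda>i a. if i < l then F i a else a) x = iter (min n (nat l)) F x"
proof (induction n)
  case (Suc n)
  show ?case
  proof (cases "int n < l")
    case True
    then have "min (Suc n) (nat l) = Suc (min n (nat l))" "min n (nat l) = n" by auto
    then show ?thesis using Suc True by simp
  next
    case False
    then have "min (Suc n) (nat l) = min n (nat l)" by auto
    then show ?thesis using Suc False by simp
  qed
qed simp

lemma finite_range_of [simp]: "finite (range_of c)"
  unfolding range_of_def by simp

lemma sum_if_card: "(\<Sum>i\<in>range_of c. if \<phi> i then 1 else 0) = int (card {i \<in> range_of c. \<phi> i})"
  by (simp add: sum.If_cases Int_def)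

lemma range_filter: "n \<le> int (snd c) \<Longrightarrow> {i \<in> range_of c. i < n} = {0..<n}"
  unfolding range_of_def by auto

lemma ball_range: "n \<le> int (snd c) \<Longrightarrow> (\<forall>i\<in>range_of c. i < n \<longrightarrow> P i) \<longleftrightarrow> (\<forall>i\<in>{0..<n}. P i)"
  unfolding range_of_def by auto

lemma bex_range: "n \<le> int (snd c) \<Longrightarrow> (\<exists>i\<in>range_of c. i < n \<and> P i) \<longleftrightarrow> (\<exists>i\<in>{0..<n}. P i)"
  unfolding range_of_def by auto

lemma prod_range:
  "n \<le> int (snd c) \<Longrightarrow> (\<Prod>i\<in>range_of c. if i < n \<and> P i then f i else 1) = (\<Prod>i\<in>{0..<n}. if P i then f i else (1::real))"
proof -
  assume n: "n \<le> int (snd c)"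
  have "(\<Prod>i\<in>range_of c. if i < n \<and> P i then f i else 1) =
      (\<Prod>i\<in>range_of c. if i < n then if P i then f i else 1 else 1)" by (intro prod.cong) auto
  also have "\<dots> = (\<Prod>i\<in>{i \<in> range_of c. i < n}. if P i then f i else 1)"
    by (rule prod.inter_filter[symmetric]) simp
  finally show ?thesis unfolding range_filter[OF n] .
qed

lemma digits_exist:
  fixes b :: int
  assumes b: "0 < b" and "\<And>i. i < W \<Longrightarrow> 0 \<le> g i \<and> g i < b"
  shows "\<exists>q. 0 \<le> q \<and> q < b ^ W \<and> (\<forall>i<W. q div b ^ i mod b = g i)"
  using assms(2)
proof (induction W arbitrary: g)
  case 0
  then show ?case by (intro exI[of _ 0]) simp
next
  case (Suc W)
  from Suc.IH[of "\<lambda>i. g (Suc i)"] Suc.prems obtain q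
    where q: "0 \<le> q" "q < b ^ W" "\<And>i. i < W \<Longrightarrow> q div b ^ i mod b = g (Suc i)" by auto
  have g: "0 \<le> g 0" "g 0 < b" using Suc.prems by auto
  let ?q = "g 0 + b * q"
  have "b * (q + 1) \<le> b * b ^ W" using q b by (intro mult_left_mono) auto
  then have "?q < b ^ Suc W" using g by (simp add: distrib_left)
  moreover have "?q div b ^ i mod b = g i" if "i < Suc W" for i
  proof (cases i)
    case 0
    then show ?thesis using g by simp
  next
    case (Suc j)
    have "?q div b ^ Suc j = ?q div b div b ^ j" using b by (simp add: div_mult2_eq' zdiv_zmult2_eq)
    also have "?q div b = q" using g b by simp
    finally show ?thesis using Suc q(3)[of j] that by simp
  qed
  ultimately show ?case using q g b by (intro exI[of _ ?q]) auto
qed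

lemma times_eq: "times c a = int (snd c) * a"
  unfolding times_def by (simp add: range_of_def)

lemma mult_eq: 
  assumes "0 \<le> a" "a \<le> int (snd c)" shows "mult c a b = a * b"
proof -
  have "mult c a b = (\<Sum>i\<in>{i \<in> range_of c. i < a}. b)"
    unfolding mult_def by (rule sum.inter_filter[symmetric]) simp
  then show ?thesis unfolding range_filter[OF assms(2)] using assms by simp
qed

lemma quot_eq:
  assumes "0 \<le> a" "a \<le> int (snd c)" "0 < b" shows "quot c a b = a div b"
proof -
  have d: "0 \<le> a div b" "a div b \<le> a" using assms zdiv_mono2[of a 1 b] by (auto simp: pos_imp_zdiv_nonneg_iff)
  have "(mult c (i + 1) b \<le> a) = (i < a div b)" if "i \<in> range_of c" for i
  proof -
    have "mult c (i + 1) b = (i + 1) * b" using that by (intro mult_eq) (auto simp: range_of_def)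
    moreover have "((i + 1) * b \<le> a) = (i + 1 \<le> a div b)"
    proof
      assume "(i + 1) * b \<le> a"
      from zdiv_mono1[OF this assms(3)] show "i + 1 \<le> a div b" using assms(3) by simp
    next
      assume "i + 1 \<le> a div b"
      then have "(i + 1) * b \<le> a div b * b" using assms(3) by (intro mult_right_mono) auto
      moreover have "a div b * b + a mod b = a" "0 \<le> a mod b" using assms(3) by simp_all
      ultimately show "(i + 1) * b \<le> a" by linarith
    qed
    ultimately show ?thesis by auto
  qed
  then have "{i \<in> range_of c. mult c (i + 1) b \<le> a} = {i \<in> range_of c. i < a div b}" by auto
  then show ?thesis unfolding quot_def sum_if_card using range_filter[of "a div b" c] d assms by simp
qed

text \<open>\<open>F\<close> overwrites the cells in \<open>A\<close>, and the new contents are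
  functions \<open>G\<close> of the memory before \<open>F\<close>. A whole loop can be described
  like this when no value it writes depends on a cell that it writes; see
  \<open>writes_iter\<close>.\<close>

definition writes :: "((int \<Rightarrow> real) \<Rightarrow> int \<Rightarrow> real) \<Rightarrow> int set \<Rightarrow> (int \<Rightarrow> (int \<Rightarrow> real) \<Rightarrow> real) \<Rightarrow> bool" where
  "writes F A G \<longleftrightarrow> (\<forall>M a. F M a = (if a \<in> A then G a M else M a))"

lemma writes_iter:
  assumes w: "\<And>i. i < n \<Longrightarrow> writes (F (int i)) (A i) G"
    and disj: "\<And>i j. i < j \<Longrightarrow> j < n \<Longrightarrow> A i \<inter> A j = {}"
    and dep: "\<And>M M' i a. i < n \<Longrightarrow> a \<in> A i \<Longrightarrow> (\<And>x. x \<notin> (\<Union>i<n. A i) \<Longrightarrow> M x = M' x) \<Longrightarrow> G a M = G a M'"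
  shows "writes (iter n F) (\<Union>i<n. A i) G"
proof -
  have "m \<le> n \<Longrightarrow> iter m F M a = (if a \<in> (\<Union>i<m. A i) then G a M else M a)" for m M a
  proof (induction m arbitrary: a)
    case (Suc m)
    have m: "m < n" using Suc.prems by simp
    have eq: "iter (Suc m) F M a = (if a \<in> A m then G a (iter m F M) else iter m F M a)"
      using w[OF m] unfolding writes_def by simp
    show ?case
    proof (cases "a \<in> A m")
      case True
      have "G a (iter m F M) = G a M"
        by (rule dep[OF m True]) (use Suc.IH m in auto)
      then show ?thesis using eq True by auto
    next
      case False
      then show ?thesis using eq Suc.IH[of a] m by (auto simp: less_Suc_eq)
    qed
  qed simp
  then show ?thesis unfolding writes_def by blast
qed

definition cell_value :: "inp \<Rightarrow> int \<Rightarrow> int \<Rightarrow> int \<Rightarrow> int \<Rightarrow> (int \<Rightarrow> real) \<Rightarrow> real" where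
  "cell_value c t l q q' M = (if t = 0 then base_value c l q M else step_value c (t - 1) (vert c t l) q q' M)"

text \<open>Each level owns \<open>X ^ 3\<close> consecutive cells, one for every triple
  \<open>(l, q, q')\<close>; the first \<open>X\<close> cells are left to the weights.\<close>

definition level_start :: "inp \<Rightarrow> int \<Rightarrow> int" where
  "level_start c t = int (snd c) + t * (int (snd c) * int (snd c) * int (snd c))"

lemma addr_eq: "addr c t l q q' = level_start c t + ((l * int (snd c) + q) * int (snd c) + q')"
  unfolding addr_def times_eq level_start_def by (simp add: algebra_simps)

lemma two_digits:
  fixes X :: int assumes "a < Y" "b < X" "0 \<le> X" shows "a * X + b < Y * X"
proof -
  have "(a + 1) * X \<le> Y * X" using assms by (intro mult_right_mono) auto
  then show ?thesis using assms by (simp add: algebra_simps)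
qed

lemma addr_less:
  assumes "l < int (snd c)" "q < int (snd c)" "q' < int (snd c)"
  shows "addr c t l q q' < level_start c (t + 1)"
  using two_digits[OF two_digits[OF assms(1,2)] assms(3)]
  unfolding addr_eq level_start_def by (simp add: algebra_simps)

lemma addr_ge:
  assumes "0 \<le> l" "0 \<le> q" "0 \<le> q'" shows "level_start c t \<le> addr c t l q q'"
  unfolding addr_eq using assms by simp

lemma level_start_mono: "t \<le> t' \<Longrightarrow> level_start c t \<le> level_start c t'"
  unfolding level_start_def by (simp add: mult_right_mono)

lemma two_digits_inj:
  fixes X :: int assumes "a * X + b = a' * X + b'" "0 \<le> b" "b < X" "0 \<le> b'" "b' < X"
  shows "a = a' \<and> b = b'"
proof -
  have "(b + X * a) div X = a" "(b' + X * a') div X = a'" using assms(2-) by auto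
  with assms(1) have "a = a'" by (simp add: algebra_simps)
  with assms(1) show ?thesis by simp
qed

lemma addr_inj:
  assumes "addr c t l q q' = addr c t m r r'"
    "q \<in> range_of c" "q' \<in> range_of c" "r \<in> range_of c" "r' \<in> range_of c"
  shows "l = m \<and> q = r \<and> q' = r'"
  using assms two_digits_inj[of "l * int (snd c) + q" "int (snd c)" q' "m * int (snd c) + r" r']
    two_digits_inj[of l "int (snd c)" q m r]
  unfolding addr_eq range_of_def by auto

definition cells :: "inp \<Rightarrow> int \<Rightarrow> int set" where
  "cells c t = {addr c t l q q' | l q q'. l \<in> range_of c \<and> q \<in> range_of c \<and> q' \<in> range_of c}"

lemma search_less: "search c \<phi> < int (snd c)" if "0 < snd c"
  using search_found(1)[of _ c \<phi>] search_none[of c \<phi>] that unfolding range_of_def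
  by (cases "\<exists>i\<in>range_of c. \<phi> i") (auto simp: range_of_def)

text \<open>A cell depends only on the weights, which lie below \<open>X\<close>, and on the level
  beneath. So the order of filling within a level does not matter.\<close>

lemma cell_value_cong:
  assumes "num_vars c + num_vars c \<le> int (snd c)" "0 < snd c"
    and M: "\<And>a. a < level_start c t \<Longrightarrow> M a = M' a" and t: "0 \<le> t"
  shows "cell_value c t l q q' M = cell_value c t l q q' M'"
proof -
  have ls: "int (snd c) \<le> level_start c t" unfolding level_start_def using t by simp
  have 1: "M (i + i) = M' (i + i)" "M (i + i + 1) = M' (i + i + 1)" if "i < num_vars c" for i
    using that assms(1) ls by (auto intro!: M)
  have 1: "M (i + i) = M' (i + i)" "M (i + i + 1) = M' (i + i + 1)"
    "M (2 * i) = M' (2 * i)" "M (2 * i + 1) = M' (2 * i + 1)" if "i < num_vars c" for i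
    using 1[OF that] by simp_all
  \<comment> \<open>Only upper bounds on the codes are assumed: a failed search yields -1 and may
    lead to a smaller address, but never to level \<open>t\<close> or above.\<close>
  have 2: "M (addr c (t - 1) l p p') = M' (addr c (t - 1) l p p')"
    if "l \<in> range_of c" "p < int (snd c)" "p' < int (snd c)" for l p p'
    using addr_less[of l c p p' "t - 1"] that by (intro M) (auto simp: range_of_def)
  show ?thesis
  proof (cases "t = 0")
    case True
    then show ?thesis unfolding cell_value_def base_value_def
      using 1 by (auto intro!: prod.cong)
  next
    case False
    show ?thesis unfolding cell_value_def step_value_def if_not_P[OF False]
      by (intro sum.cong prod.cong refl if_cong arg_cong2[where f = "(*)"])
        (auto simp: 1 intro!: 2 search_less[OF assms(2)] simp: conn_code_def sat_code_def)
  qed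
qed

text \<open>Levels occupy disjoint ranges, and a cell is final once its level has been written. So
  the recurrence, which holds for the memory at the time of writing, also holds for the final
  memory.\<close>

lemma fill_spec:
  assumes nv: "num_vars c + num_vars c \<le> int (snd c)" and X: "0 < snd c"
  shows "\<And>a. a < int (snd c) \<Longrightarrow> fill c M a = M a"
    and "\<And>t l q q'. t \<in> range_of c \<Longrightarrow> l \<in> range_of c \<Longrightarrow> q \<in> range_of c \<Longrightarrow> q' \<in> range_of c \<Longrightarrow>
      fill c M (addr c t l q q') = cell_value c t l q q' (fill c M)"
proof -
  \<comment> \<open>Inverts the address, so that the value to be written becomes a function of the
    address, as \<open>writes\<close> requires.\<close>
  define D where "D t a = (THE (l, q, q'). l \<in> range_of c \<and> q \<in> range_of c \<and> q' \<in> range_of c \<and> a = addr c t l q q')"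
    for t a
  define G where "G t a M = (case D t a of (l, q, q') \<Rightarrow> cell_value c t l q q' M)" for t a M
  have D: "D t (addr c t l q q') = (l, q, q')"
    if "l \<in> range_of c" "q \<in> range_of c" "q' \<in> range_of c" for t l q q'
    unfolding D_def using that by (intro the_equality) (auto dest: addr_inj)
  have dep: "G t a M = G t a M'" if "0 \<le> t" "\<And>x. x < level_start c t \<Longrightarrow> M x = M' x" for t a M M'
    unfolding G_def using cell_value_cong[OF nv X that(2,1)] by (auto split: prod.split)
  have disj: "addr c t l q q' \<noteq> addr c t m r r'"
    if "q \<in> range_of c" "q' \<in> range_of c" "r \<in> range_of c" "r' \<in> range_of c" "l < m \<or> q < r \<or> q' < r'"
    for t l q q' m r r'
    using addr_inj[OF _ that(1-4)] that(5) by blast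
  have nl: "x \<notin> A" if "x < level_start c t" "\<And>a. a \<in> A \<Longrightarrow> level_start c t \<le> a" for x A t
    using that by force
  have r: "int i \<in> range_of c" if "i < snd c" for i using that unfolding range_of_def by simp
  let ?F1 = "\<lambda>t l q q' M. M(addr c t l q q' := cell_value c t l q q' M)"
  let ?F2 = "\<lambda>t l q. iter (snd c) (?F1 t l q)"
  let ?F3 = "\<lambda>t l. iter (snd c) (?F2 t l)"
  let ?F4 = "\<lambda>t. iter (snd c) (?F3 t)"
  have w1: "writes (?F1 t l q q') {addr c t l q q'} (G t)"
    if "l \<in> range_of c" "q \<in> range_of c" "q' \<in> range_of c" for t l q q'
    unfolding writes_def G_def using D[OF that] by simp
  have w2: "writes (?F2 t l q) (\<Union>q'<snd c. {addr c t l q (int q')}) (G t)"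
    if "l \<in> range_of c" "q \<in> range_of c" "0 \<le> t" for t l q
  proof (rule writes_iter, goal_cases)
    case (1 i) then show ?case using w1 that r by blast
  next
    case (2 i j) then show ?case using disj[of q "int i" q "int j" l l] that r by auto
  next
    case (3 M M' i a)
    show ?case by (rule dep[OF that(3)], rule 3(3), rule nl, assumption)
      (use that in \<open>auto simp: range_of_def intro!: addr_ge\<close>)
  qed
  have w3: "writes (?F3 t l) (\<Union>q<snd c. \<Union>q'<snd c. {addr c t l (int q) (int q')}) (G t)"
    if "l \<in> range_of c" "0 \<le> t" for t l
  proof (rule writes_iter, goal_cases)
    case (1 i) then show ?case using w2 that r by blast
  next
    case (2 i j) then show ?case using disj[of "int i" _ "int j" _ l l] that r by auto
  next
    case (3 M M' i a)
    show ?case by (rule dep[OF that(2)], rule 3(3), rule nl, assumption)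
      (use that in \<open>auto simp: range_of_def intro!: addr_ge\<close>)
  qed
  have w4: "writes (?F4 t) (\<Union>l<snd c. \<Union>q<snd c. \<Union>q'<snd c. {addr c t (int l) (int q) (int q')}) (G t)"
    if "0 \<le> t" for t
  proof (rule writes_iter, goal_cases)
    case (1 i) then show ?case using w3 that r by blast
  next
    case (2 i j) then show ?case using disj[of _ _ _ _ "int i" "int j"] that r by auto
  next
    case (3 M M' i a)
    show ?case by (rule dep[OF that], rule 3(3), rule nl, assumption)
      (use that in \<open>auto simp: range_of_def intro!: addr_ge\<close>)
  qed
  have cells: "(\<Union>l<snd c. \<Union>q<snd c. \<Union>q'<snd c. {addr c t (int l) (int q) (int q')}) = cells c t" for t
    unfolding cells_def range_of_eq by auto
  define F4 where "F4 = ?F4"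
  have lvl: "F4 t M a = (if a \<in> cells c t then G t a M else M a)" if "0 \<le> t" for t M a
    using w4[OF that] unfolding F4_def writes_def cells by blast
  have cl: "level_start c t \<le> a" "a < level_start c (t + 1)" if "a \<in> cells c t" for t a
    using that addr_ge[of _ _ _ c t] addr_less[of _ c _ _ t] unfolding cells_def by (auto simp: range_of_def)
  have fill: "fill c M = iter (snd c) F4 M"
    unfolding F4_def fill_def cell_value_def ..
  have later: "iter m F4 M a = iter n F4 M a" if "a < level_start c (int n)" "n \<le> m" for m n a
    using that(2)
  proof (induction m rule: dec_induct)
    case (step m)
    have "a \<notin> cells c (int m)" using cl(1)[of a "int m"] level_start_mono[of "int n" "int m" c] step that(1) by force
    then show ?case using step lvl[of "int m"] by simp
  qed simp
  show "fill c M a = M a" if "a < int (snd c)" for a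
    using later[of a 0 "snd c"] that unfolding fill level_start_def by simp
  show "fill c M (addr c t l q q') = cell_value c t l q q' (fill c M)"
    if "t \<in> range_of c" "l \<in> range_of c" "q \<in> range_of c" "q' \<in> range_of c" for t l q q'
  proof -
    from \<open>t \<in> range_of c\<close> obtain i where i: "t = int i" "i < snd c" unfolding range_of_eq by auto
    let ?a = "addr c t l q q'" and ?M = "iter i F4 M"
    have a: "?a \<in> cells c t" using that unfolding cells_def by blast
    have "fill c M ?a = iter (Suc i) F4 M ?a" unfolding fill
      using later[of ?a "Suc i" "snd c"] cl(2)[OF a] i by (simp add: add.commute)
    also have "\<dots> = G t ?a ?M" using lvl[of "int i"] a i by simp
    also have "\<dots> = cell_value c t l q q' ?M" unfolding G_def using D that by simp
    also have "\<dots> = cell_value c t l q q' (fill c M)"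
      by (rule cell_value_cong[OF nv X]) (use later[of _ i "snd c"] i fill in auto)
    finally show ?thesis .
  qed
qed

section \<open>Walks, codes and components\<close>

text \<open>The conditions on the numbers read from an input under which the expressions have their
  intended meaning. \<open>X_large\<close> leaves room below \<open>X\<close> for a code of every
  assignment of digits to the walks of length \<open>2 * m\<close>.\<close>

locale table_input =
  contraction_levels "{0..<num_vars c}" "{0..<fst c 1}" "has_pos c" "has_neg c" "\<lambda>j. M0 (j + j)"
    "\<lambda>j. M0 (j + j + 1)" "nat (num_graphs c)" "\<lambda>t. {y. is_vert c (int t) y}" "\<lambda>t. pos_edge c (int t)"
    "\<lambda>t. neg_edge c (int t)" "\<lambda>t. red_edge c (int t)" "\<lambda>t. parent c (int t)" "\<lambda>t. var_bag c (int t)"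
    "\<lambda>t. clause_bag c (int t)" "\<lambda>t. old_vert c (int t)" "\<lambda>t. new_vert c (int t)"
  for c :: inp and M0 :: "int \<Rightarrow> real" +
  assumes k_nonneg: "0 \<le> fst c 0"
    and X_large: "base c ^ nat (base c ^ nat (2 * (fst c 0 * fst c 0 + 1))) \<le> int (snd c)"
    and max_deg_nonneg: "0 \<le> max_deg c"
    and red_deg_le: "t < nat (num_graphs c) \<Longrightarrow> is_vert c (int t) x \<Longrightarrow> red_deg c (int t) x \<le> max_deg c"
    and num_verts_le: "t < nat (num_graphs c) \<Longrightarrow> num_verts c (int t) \<le> int (snd c)"
    and vert_inj: "t < nat (num_graphs c) \<Longrightarrow> inj_on (vert c (int t)) {0..<num_verts c (int t)}"
    and num_vars_le: "num_vars c + num_vars c \<le> int (snd c)" and num_vars_nonneg: "0 \<le> num_vars c"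
    and num_clauses_le: "fst c 1 \<le> int (snd c)"
    and num_graphs_le: "num_graphs c \<le> int (snd c)"
    and no_red_0: "0 < num_graphs c \<Longrightarrow> \<not> red_edge c 0 x y"
    and var_bag_inj: "0 < num_graphs c \<Longrightarrow> inj_on (var_bag c 0) {0..<num_vars c}"
    and var_clause: "0 < num_graphs c \<Longrightarrow> i \<in> {0..<fst c 1} \<Longrightarrow> j \<in> {0..<num_vars c} \<Longrightarrow> clause_bag c 0 i \<noteq> var_bag c 0 j"
    and last_single: "0 < num_graphs c \<Longrightarrow> \<exists>x. {y. is_vert c (num_graphs c - 1) y} = {x}"
    and no_graphs: "num_graphs c \<le> 0 \<Longrightarrow> num_vars c = 0"
begin

abbreviation "n \<equiv> nat (num_graphs c)"
abbreviation "V t \<equiv> {y. is_vert c (int t) y}"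
abbreviation "k \<equiv> fst c 0"
abbreviation "b \<equiv> base c"
abbreviation "X \<equiv> snd c"

definition m :: nat where "m = nat (k * k + 1)"

lemma b_ge: "2 \<le> b" "k < b" "max_deg c < b"
  using k_nonneg max_deg_nonneg unfolding base_def by auto

lemma b_pow_X: "b ^ nat (b ^ (2 * m)) \<le> int X"
proof -
  have "nat (2 * (k * k + 1)) = 2 * m" unfolding m_def using k_nonneg by (simp add: nat_mult_distrib)
  then show ?thesis using X_large by simp
qed

lemma nat_less_pow: "int a < b ^ a"
proof -
  have "int a < 2 ^ a" using of_nat_less_two_power by blast
  also have "\<dots> \<le> b ^ a" using b_ge by (intro power_mono) auto
  finally show ?thesis .
qed

lemma pow_le_X: "b ^ (2 * m) < int X"
proof -
  have "0 \<le> b ^ (2 * m)" using b_ge by simp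
  then show ?thesis using nat_less_pow[of "nat (b ^ (2 * m))"] b_pow_X by simp
qed

lemma two_m_le: "2 * int m < int X" using nat_less_pow[of "2 * m"] pow_le_X by simp

lemma m_pos: "0 < m"
proof -
  have "0 \<le> k * k" by simp
  then show ?thesis unfolding m_def by linarith
qed

lemma b_le_X: "b \<le> int X"
proof -
  have "b ^ 1 \<le> b ^ (2 * m)" using b_ge m_pos by (intro power_increasing) auto
  then show ?thesis using pow_le_X by simp
qed

lemma half_length_eq: "half_length c = int m"
proof -
  have "k \<le> int X" using b_ge b_le_X by simp
  then show ?thesis unfolding half_length_def m_def using k_nonneg by (simp add: mult_eq)
qed

lemma shift_eq:
  assumes "q \<in> range_of c" "i \<le> X" shows "shift c q (int i) = q div b ^ i"
proof -
  have "iter l (\<lambda>_ a. quot c a b) q = q div b ^ l" for l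
  proof (induction l)
    case (Suc l)
    have q: "0 \<le> q" "q \<le> int X" using assms(1) unfolding range_of_def by auto
    have "0 \<le> q div b ^ l" using q b_ge by (simp add: pos_imp_zdiv_nonneg_iff)
    moreover have "q div b ^ l \<le> q" using zdiv_mono2[of q 1 "b ^ l"] q b_ge by simp
    ultimately have "quot c (q div b ^ l) b = q div b ^ l div b" using q b_ge by (intro quot_eq) auto
    then show ?case using Suc b_ge by (simp add: zdiv_zmult2_eq[symmetric] mult.commute)
  qed simp
  then show ?thesis using assms(2) unfolding shift_def iter_cap by simp
qed

lemma digit_eq:
  assumes "q \<in> range_of c" "i \<le> X" shows "digit c q (int i) = q div b ^ i mod b"
proof -
  let ?s = "q div b ^ i"
  have q: "0 \<le> q" "q \<le> int X" using assms(1) unfolding range_of_def by auto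
  have s: "0 \<le> ?s" "?s \<le> int X" using q b_ge zdiv_mono2[of q 1 "b ^ i"] by (auto simp: pos_imp_zdiv_nonneg_iff)
  have sb: "0 \<le> ?s div b" "?s div b \<le> int X" using s b_ge zdiv_mono2[of ?s 1 b] by (auto simp: pos_imp_zdiv_nonneg_iff)
  have "digit c q (int i) = ?s - ?s div b * b"
    unfolding digit_def shift_eq[OF assms] using quot_eq[OF s] mult_eq[OF sb] b_ge by simp
  then show ?thesis by (simp add: minus_div_mult_eq_mod)
qed

lemma digit_range: "q \<in> range_of c \<Longrightarrow> i \<le> X \<Longrightarrow> 0 \<le> digit c q (int i) \<and> digit c q (int i) < b"
  using b_ge by (simp add: digit_eq)

lemma ex_vert: "(\<exists>l\<in>range_of c. l < num_verts c (int t) \<and> P (vert c (int t) l)) \<longleftrightarrow> (\<exists>y\<in>V t. P y)"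
  unfolding is_vert_def by auto

lemma all_vert: "(\<forall>l\<in>range_of c. l < num_verts c (int t) \<longrightarrow> P (vert c (int t) l)) \<longleftrightarrow> (\<forall>y\<in>V t. P y)"
  unfolding is_vert_def by auto

lemma nb_eq: "red_eq c (int t) x y \<longleftrightarrow> nb t x y"
  unfolding red_eq_def nb_def ..

lemma nb_V: "t < n \<Longrightarrow> nb t x y \<Longrightarrow> x \<in> V t \<Longrightarrow> y \<in> V t"
  using red_V red_sym unfolding nb_def by blast

section \<open>Red steps and walks as strings of digits\<close>

lemma red_rank_less:
  assumes "red_edge c (int t) x y" "y \<in> V t" "y < y'"
  shows "red_rank c (int t) x y < red_rank c (int t) x y'"
proof -
  obtain l where l: "l \<in> range_of c" "l < num_verts c (int t)" "vert c (int t) l = y"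
    using assms(2) unfolding is_vert_def by blast
  let ?A = "\<lambda>z. {l \<in> range_of c. l < num_verts c (int t) \<and> red_edge c (int t) x (vert c (int t) l) \<and> vert c (int t) l < z}"
  have "?A y \<subseteq> ?A y'" using assms(3) by auto
  moreover have "l \<in> ?A y'" "l \<notin> ?A y" using l assms by simp_all
  ultimately have "card (?A y) < card (?A y')" by (intro psubset_card_mono) auto
  then show ?thesis unfolding red_rank_def sum_if_card by simp
qed

lemma red_rank_less_deg:
  assumes "red_edge c (int t) x y" "y \<in> V t"
  shows "red_rank c (int t) x y < red_deg c (int t) x"
proof -
  obtain l where l: "l \<in> range_of c" "l < num_verts c (int t)" "vert c (int t) l = y"
    using assms(2) unfolding is_vert_def by blast
  let ?A = "{l \<in> range_of c. l < num_verts c (int t) \<and> red_edge c (int t) x (vert c (int t) l) \<and> vert c (int t) l < y}"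
  let ?B = "{l \<in> range_of c. l < num_verts c (int t) \<and> red_edge c (int t) x (vert c (int t) l)}"
  have "?A \<subseteq> ?B" by auto
  moreover have "l \<in> ?B" "l \<notin> ?A" using l assms by simp_all
  ultimately have "card ?A < card ?B" by (intro psubset_card_mono) auto
  then show ?thesis unfolding red_rank_def red_deg_def sum_if_card by simp
qed

lemma next_vert_nb: "nb t x (next_vert c (int t) x d)"
proof -
  let ?P = "\<lambda>l. l < num_verts c (int t) \<and> red_edge c (int t) x (vert c (int t) l) \<and>
    red_rank c (int t) x (vert c (int t) l) = d - 1"
  show ?thesis
  proof (cases "\<exists>l\<in>range_of c. ?P l")
    case True
    then obtain l where "l \<in> range_of c" "?P l" by blast
    from search_found(1,2)[of l c ?P, OF this] show ?thesis
      unfolding next_vert_def next_index_def nb_def by (auto simp: range_of_def)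
  next
    case False
    then have "next_index c (int t) x d = - 1" unfolding next_index_def by (intro search_none) blast
    then show ?thesis unfolding next_vert_def nb_def by simp
  qed
qed

lemma next_vert_0: "next_vert c (int t) x 0 = x"
proof -
  have "next_index c (int t) x 0 = - 1" unfolding next_index_def
    by (rule search_none) (simp add: red_rank_def sum_if_card)
  then show ?thesis unfolding next_vert_def by simp
qed

text \<open>The rank strictly increases with the name, so it identifies a red neighbour. It is also
  smaller than the red degree, so rank plus 1 is at most \<open>max_deg c\<close> and is a
  digit.\<close>

lemma next_vert_surj:
  assumes t: "t < n" and x: "x \<in> V t" and nb: "nb t x y"
  shows "\<exists>d. 0 \<le> d \<and> d < b \<and> next_vert c (int t) x d = y"
proof (cases "x = y")
  case True
  then show ?thesis using next_vert_0 b_ge by (intro exI[of _ 0]) auto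
next
  case False
  then have r: "red_edge c (int t) x y" using nb unfolding nb_def by simp
  have y: "y \<in> V t" using nb_V[OF t nb x] .
  then obtain l where l: "l \<in> range_of c" "l < num_verts c (int t)" "vert c (int t) l = y"
    unfolding is_vert_def by auto
  let ?d = "red_rank c (int t) x y + 1"
  let ?P = "\<lambda>l. l < num_verts c (int t) \<and> red_edge c (int t) x (vert c (int t) l) \<and>
      red_rank c (int t) x (vert c (int t) l) = ?d - 1"
  let ?l = "next_index c (int t) x ?d"
  have "?P l" using l r by simp
  note search_found(1,2)[of l c ?P, OF l(1) this]
  then have l': "?l \<in> range_of c" "?P ?l" unfolding next_index_def by simp_all
  then have "vert c (int t) ?l \<in> V t" unfolding is_vert_def by auto
  then have "\<not> y < vert c (int t) ?l" "\<not> vert c (int t) ?l < y"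
    using l'(2) red_rank_less[OF r y, of "vert c (int t) ?l"] red_rank_less[of t x "vert c (int t) ?l" y]
    by auto
  then have "vert c (int t) ?l = y" by simp
  moreover have "0 \<le> ?l" using l'(1) unfolding range_of_def by simp
  ultimately have v: "next_vert c (int t) x ?d = y" unfolding next_vert_def by simp
  have d0: "0 \<le> ?d" unfolding red_rank_def sum_if_card by simp
  have "red_deg c (int t) x \<le> max_deg c" using red_deg_le[OF t] x by simp
  then have "?d < b" using red_rank_less_deg[OF r y] b_ge by linarith
  with v d0 show ?thesis by blast
qed

lemma walk_0: "walk c t x q 0 = x" unfolding walk_def iter_cap by simp

lemma walk_Suc: "i < X \<Longrightarrow> walk c t x q (int (Suc i)) = next_vert c t (walk c t x q (int i)) (digit c q (int i))"
proof -
  assume i: "i < X"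
  have "min X (Suc i) = Suc i" "min X i = i" using i by auto
  then show ?thesis unfolding walk_def iter_cap nat_int by simp
qed

lemma walk_V: "t < n \<Longrightarrow> x \<in> V t \<Longrightarrow> i \<le> X \<Longrightarrow> walk c (int t) x q (int i) \<in> V t"
proof (induction i)
  case (Suc i)
  then show ?case using walk_Suc[of i "int t" x q] nb_V[OF Suc.prems(1) next_vert_nb] by simp
qed (use walk_0 in simp)

lemma walk_end_eq: "walk_end c t x q = walk c t x q (int (2 * m))"
proof -
  have "int m + int m = int (2 * m)" by simp
  then show ?thesis unfolding walk_end_def half_length_eq by simp
qed

lemma walk_end_V: "t < n \<Longrightarrow> x \<in> V t \<Longrightarrow> walk_end c (int t) x q \<in> V t"
  unfolding walk_end_eq using walk_V[of t x "2 * m" q] two_m_le by simp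

lemma pow_range: "0 \<le> q \<Longrightarrow> q < b ^ (2 * m) \<Longrightarrow> q \<in> range_of c"
  using pow_le_X unfolding range_of_def by simp

text \<open>The digits are chosen one by one with \<open>next_vert_surj\<close>. The bound on the
  code carries over to the least code, which \<open>label\<close> uses as a digit position.\<close>

lemma walk_exists:
  assumes t: "t < n" and f0: "f 0 \<in> V t" and f: "\<And>i. nb t (f i) (f (Suc i))"
  shows "\<exists>q. 0 \<le> q \<and> q < b ^ (2 * m) \<and> (\<forall>i\<le>2 * m. walk c (int t) (f 0) q (int i) = f i)"
proof -
  have fV: "f i \<in> V t" for i by (induction i) (use f0 nb_V[OF t f] in auto)
  have "\<forall>i. \<exists>d. 0 \<le> d \<and> d < b \<and> next_vert c (int t) (f i) d = f (Suc i)"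
    using next_vert_surj[OF t fV f] by blast
  then obtain d where d: "\<And>i. 0 \<le> d i \<and> d i < b \<and> next_vert c (int t) (f i) (d i) = f (Suc i)" by metis
  have "0 < b" using b_ge by simp
  from digits_exist[OF this, of "2 * m" d] d obtain q
    where q: "0 \<le> q" "q < b ^ (2 * m)" "\<And>i. i < 2 * m \<Longrightarrow> q div b ^ i mod b = d i" by auto
  have "i \<le> 2 * m \<longrightarrow> walk c (int t) (f 0) q (int i) = f i" for i
  proof (induction i)
    case (Suc i)
    show ?case
    proof
      assume i: "Suc i \<le> 2 * m"
      then have iX: "i < X" using two_m_le by simp
      have "digit c q (int i) = d i" using digit_eq[OF pow_range[OF q(1,2)], of i] q(3)[of i] i iX by simp
      then show "walk c (int t) (f 0) q (int (Suc i)) = f (Suc i)"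
        using Suc i walk_Suc[OF iX, of "int t" "f 0" q] d[of i] by simp
    qed
  qed (simp add: walk_0)
  with q show ?thesis by blast
qed

section \<open>Functions on a ball as numbers\<close>

definition ball where
  "ball t x = {y. \<exists>f. f 0 = x \<and> f (2 * m) = y \<and> (\<forall>i. nb t (f i) (f (Suc i)))}"

lemma label_found:
  assumes "\<not> label c t x y < 0"
  shows "label c t x y \<in> range_of c" "walk_end c t x (label c t x y) = y"
proof -
  have "\<exists>q\<in>range_of c. walk_end c t x q = y"
    using assms search_none[of c "\<lambda>q. walk_end c t x q = y"] unfolding label_def by force
  then obtain q where "q \<in> range_of c" "walk_end c t x q = y" by blast
  from search_found(1,2)[of q c "\<lambda>q. walk_end c t x q = y", OF this]
  show "label c t x y \<in> range_of c" "walk_end c t x (label c t x y) = y" unfolding label_def by auto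
qed

lemma val_range:
  assumes "q \<in> range_of c"
  shows "0 \<le> val c t x q y \<and> val c t x q y < b"
proof (cases "label c t x y < 0")
  case False
  then have "label c t x y \<in> range_of c"
    using label_found(1) by blast
  then show ?thesis using False digit_range[OF assms, of "nat (label c t x y)"] unfolding val_def range_of_def by simp
qed (use b_ge in \<open>simp add: val_def\<close>)

text \<open>At position \<open>i\<close> the code carries the value of \<open>g\<close> at the end
  of walk \<open>i\<close>, for every \<open>i\<close> below \<open>b ^ (2 * m)\<close>. Many
  positions may belong to one vertex, but they agree, so reading the one given by
  \<open>label\<close> is right.\<close>

lemma encode:
  assumes t: "t < n" and x: "x \<in> V t" and g: "\<And>y. y \<in> V t \<Longrightarrow> 0 \<le> g y \<and> g y < b"
    and supp: "\<And>y. y \<in> V t \<Longrightarrow> g y \<noteq> 0 \<Longrightarrow> y \<in> ball t x"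
  shows "\<exists>q\<in>range_of c. \<forall>y\<in>V t. val c (int t) x q y = g y"
proof -
  let ?W = "nat (b ^ (2 * m))"
  let ?g = "\<lambda>i. g (walk_end c (int t) x (int i))"
  have b0: "0 < b" using b_ge by simp
  from digits_exist[OF b0, of ?W ?g] g walk_end_V[OF t x] obtain q
    where q: "0 \<le> q" "q < b ^ ?W" "\<And>i. i < ?W \<Longrightarrow> q div b ^ i mod b = ?g i" by auto
  have qr: "q \<in> range_of c" using q b_pow_X unfolding range_of_def by simp
  have "val c (int t) x q y = g y" if y: "y \<in> V t" for y
  proof (cases "g y = 0")
    case False
    with supp[OF y] obtain f where f: "f 0 = x" "f (2 * m) = y" "\<And>i. nb t (f i) (f (Suc i))"
      unfolding ball_def by blast
    from walk_exists[of t f, OF t _ f(3)] f(1) x obtain p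
      where p: "0 \<le> p" "p < b ^ (2 * m)" "\<And>i. i \<le> 2 * m \<Longrightarrow> walk c (int t) x p (int i) = f i" by auto
    have "walk_end c (int t) x p = y" using p(3)[of "2 * m"] f(2) unfolding walk_end_eq by simp
    from search_found[of p c "\<lambda>q. walk_end c (int t) x q = y", OF pow_range[OF p(1,2)] this]
    have l: "label c (int t) x y \<in> range_of c" "walk_end c (int t) x (label c (int t) x y) = y"
      "label c (int t) x y < b ^ (2 * m)" using p(2) unfolding label_def by auto
    let ?l = "nat (label c (int t) x y)"
    have l': "int ?l = label c (int t) x y" using l unfolding range_of_def by simp
    have "?l < ?W" "?l \<le> X" using l unfolding range_of_def by auto
    then have "digit c q (int ?l) = ?g ?l"
      using trans[OF digit_eq[OF qr] q(3)] by blast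
    then have "digit c q (label c (int t) x y) = g y" unfolding l' l(2) .
    moreover have "\<not> label c (int t) x y < 0" using l(1) unfolding range_of_def by simp
    ultimately show ?thesis unfolding val_def by simp
  next
    case True
    show ?thesis
    proof (cases "label c (int t) x y < 0")
      case True
      then show ?thesis using \<open>g y = 0\<close> unfolding val_def by simp
    next
      case nn: False
      then have l: "label c (int t) x y \<in> range_of c" "walk_end c (int t) x (label c (int t) x y) = y"
        using label_found by blast+
      let ?l = "nat (label c (int t) x y)"
      have l': "int ?l = label c (int t) x y" "?l \<le> X" using l unfolding range_of_def by auto
      \<comment> \<open>A label beyond the filled positions is harmless: there the digit is 0
        because \<open>q < b ^ ?W\<close>, and 0 is the value of \<open>g\<close> in this
        case.\<close>
      have "q div b ^ ?l mod b = 0"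
      proof (cases "?l < ?W")
        case True
        then show ?thesis using q(3)[OF True] l l' \<open>g y = 0\<close> by simp
      next
        case False
        then have "b ^ ?W \<le> b ^ ?l" using b_ge by (intro power_increasing) auto
        then have "q < b ^ ?l" using q by simp
        then show ?thesis using q by simp
      qed
      then have "digit c q (int ?l) = 0" using digit_eq[OF qr l'(2)] by simp
      then show ?thesis using nn True l' unfolding val_def by simp
    qed
  qed
  with qr show ?thesis by blast
qed

lemma supp_le:
  assumes "\<And>y. y \<in> V t \<Longrightarrow> 0 \<le> s y" shows "int (card (supp t s)) \<le> (\<Sum>y\<in>V t. s y)"
proof -
  have "int (card (supp t s)) = (\<Sum>y\<in>supp t s. 1)" by simp
  also have "\<dots> \<le> (\<Sum>y\<in>supp t s. s y)" by (intro sum_mono) (auto simp: supp_def)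
  also have "\<dots> \<le> (\<Sum>y\<in>V t. s y)" using assms finV by (intro sum_mono2) (auto simp: supp_def)
  finally show ?thesis .
qed

text \<open>On at most \<open>k\<close> vertices the relation \<open>R\<close> has at most
  \<open>k * k\<close> pairs, that is, \<open>m - 1\<close>, and reachability needs no more steps
  than pairs. Each step becomes two red steps through a common neighbour, so support vertices stand
  at the even positions; afterwards the walk stays at \<open>z\<close>.\<close>

lemma component_walk:
  assumes y: "y \<in> supp t s" and yz: "(y, z) \<in> (R t s)\<^sup>*" and small: "int (card (supp t s)) \<le> k"
  shows "\<exists>f. f 0 = y \<and> (\<forall>i. nb t (f i) (f (Suc i))) \<and> (\<forall>i\<ge>2 * (m - 1). f i = z) \<and> (\<forall>i. f (2 * i) \<in> supp t s)"
proof -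
  have fs: "finite (supp t s)" unfolding supp_def using finV[of t] by simp
  have Rs: "R t s \<subseteq> supp t s \<times> supp t s" unfolding R_def by auto
  then have fR: "finite (R t s)" using fs finite_subset by blast
  have "card (R t s) \<le> card (supp t s) * card (supp t s)"
    using card_mono[OF _ Rs] fs by (simp add: card_cartesian_product)
  also have "\<dots> \<le> nat k * nat k" using small by (intro mult_le_mono) auto
  also have "\<dots> = m - 1" unfolding m_def using k_nonneg by (simp add: nat_mult_distrib nat_add_distrib)
  finally have cR: "card (R t s) \<le> m - 1" .
  from yz obtain l where l': "l \<le> card (R t s)" "(y, z) \<in> R t s ^^ l"
    unfolding rtrancl_finite_eq_relpow[OF fR] by auto
  then have l: "l \<le> m - 1" "(y, z) \<in> R t s ^^ l" using cR by simp_all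
  obtain g where g: "g 0 = y" "g l = z" "\<And>i. i < l \<Longrightarrow> (g i, g (Suc i)) \<in> R t s"
    using l(2) unfolding relpow_fun_conv by blast
  define h where "h i = (if i < l then g i else z)" for i
  have h: "h 0 = y" "\<And>i. i \<ge> l \<Longrightarrow> h i = z" unfolding h_def using g by auto
  have step: "(h i, h (Suc i)) \<in> R t s \<or> h i = h (Suc i)" for i
    using g(3)[of i] g(2) unfolding h_def by (cases "Suc i = l") auto
  have hs: "h i \<in> supp t s" for i
  proof (induction i)
    case (Suc i)
    then show ?case using step[of i] Rs by auto
  qed (use h(1) y in simp)
  have "\<forall>i. \<exists>v. nb t (h i) v \<and> nb t v (h (Suc i))"
  proof
    fix i
    show "\<exists>v. nb t (h i) v \<and> nb t v (h (Suc i))"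
      using step[of i] unfolding R_def linked_def by (auto simp: nb_def)
  qed
  then obtain v where v: "\<And>i. nb t (h i) (v i)" "\<And>i. nb t (v i) (h (Suc i))" by metis
  define v' where "v' i = (if i < l then v i else z)" for i
  have v': "nb t (h i) (v' i)" "nb t (v' i) (h (Suc i))" for i
    using v h(2)[of i] h(2)[of "Suc i"] unfolding v'_def by (auto simp: nb_def)
  define f where "f i = (if even i then h (i div 2) else v' (i div 2))" for i
  have f2: "f (2 * i) = h i" "f (Suc (2 * i)) = v' i" for i unfolding f_def by simp_all
  have "nb t (f i) (f (Suc i))" for i
  proof (cases "even i")
    case True
    then obtain j where "i = 2 * j" by (rule evenE)
    then show ?thesis using f2 v'(1) by simp
  next
    case False
    then obtain j where "i = 2 * j + 1" by (rule oddE)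
    then have "i = Suc (2 * j)" "Suc i = 2 * Suc j" by simp_all
    then show ?thesis using f2 v'(2) by metis
  qed
  moreover have "f i = z" if "i \<ge> 2 * (m - 1)" for i
  proof -
    have "l \<le> i div 2" using l that by linarith
    then show ?thesis using h(2) unfolding f_def v'_def by auto
  qed
  moreover have "f 0 = y" "\<And>i. f (2 * i) \<in> supp t s" using h(1) hs f2 f2(1)[of 0] by simp_all
  ultimately show ?thesis by blast
qed

text \<open>The walk to \<open>z\<close> takes \<open>2 * (m - 1)\<close> steps; the first of the
  two remaining ones leads to \<open>z'\<close>, the other stays there.\<close>

lemma near_component_ball:
  assumes y: "y \<in> supp t s" and small: "int (card (supp t s)) \<le> k"
    and z: "z \<in> component t s y" and nb: "nb t z z'"
  shows "z' \<in> ball t y"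
proof -
  from z have "(y, z) \<in> (R t s)\<^sup>*" unfolding component_def by simp
  from component_walk[OF y this small] obtain f where f: "f 0 = y" "\<And>i. nb t (f i) (f (Suc i))"
    "\<And>i. i \<ge> 2 * (m - 1) \<Longrightarrow> f i = z" by blast
  let ?f = "\<lambda>i. if i \<le> 2 * (m - 1) then f i else z'"
  have "nb t (?f i) (?f (Suc i))" for i
    using f(2)[of i] f(3)[of i] nb by (auto simp: nb_def)
  moreover have "?f 0 = y" "?f (2 * m) = z'" using f m_pos by auto
  ultimately show ?thesis unfolding ball_def by (intro CollectI exI[of _ ?f]) auto
qed

text \<open>Consecutive even positions of a tested walk are related by \<open>R\<close>, so its end
  lies in the component. Conversely \<open>component_walk\<close> provides a walk of the fixed
  length, for which the support has to be small.\<close>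

lemma conn_eq:
  assumes t: "t < n" and s: "s = split c (int t) x q j" and y: "y \<in> V t"
    and small: "int (card (supp t s)) \<le> k"
  shows "conn c (int t) x q j y z \<longleftrightarrow> y \<in> supp t s \<and> z \<in> component t s y"
proof
  assume "conn c (int t) x q j y z"
  then obtain p where p: "p \<in> range_of c" "walk_end c (int t) y p = z"
    "\<And>i. i \<in> range_of c \<Longrightarrow> i \<le> int m \<Longrightarrow> 0 < s (walk c (int t) y p (i + i))"
    unfolding conn_def half_length_eq s by blast
  let ?w = "\<lambda>i. walk c (int t) y p (int i)"
  have iX: "2 * i \<le> X" if "i \<le> m" for i using that two_m_le by simp
  have wV: "?w (2 * i) \<in> V t" if "i \<le> m" for i using walk_V[OF t y iX[OF that]] .
  have ws: "?w (2 * i) \<in> supp t s" if "i \<le> m" for i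
  proof -
    have "int i + int i = int (2 * i)" "int i \<in> range_of c" using that two_m_le by (auto simp: range_of_def)
    then show ?thesis using p(3)[of "int i"] wV[OF that] that unfolding supp_def by simp
  qed
  have "i \<le> m \<longrightarrow> (y, ?w (2 * i)) \<in> (R t s)\<^sup>*" for i
  proof (induction i)
    case (Suc i)
    show ?case
    proof
      assume i: "Suc i \<le> m"
      have lt: "2 * i < X" "Suc (2 * i) < X" using i two_m_le by auto
      have "nb t (?w (2 * i)) (?w (Suc (2 * i)))" "nb t (?w (Suc (2 * i))) (?w (Suc (Suc (2 * i))))"
        using walk_Suc[OF lt(1), of "int t" y p] walk_Suc[OF lt(2), of "int t" y p] next_vert_nb by metis+
      moreover have "?w (Suc (2 * i)) \<in> V t" using walk_V[OF t y, of "Suc (2 * i)"] lt by simp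
      ultimately have "(?w (2 * i), ?w (2 * Suc i)) \<in> R t s"
        using ws[of i] ws[of "Suc i"] i unfolding R_def linked_def by auto
      then show "(y, ?w (2 * Suc i)) \<in> (R t s)\<^sup>*" using Suc i by (meson Suc_leD rtrancl.rtrancl_into_rtrancl)
    qed
  qed (simp add: walk_0)
  from this[of m] ws[of m] p(2) have "z \<in> component t s y" unfolding component_def walk_end_eq by simp
  moreover have "y \<in> supp t s" using ws[of 0] by (simp add: walk_0)
  ultimately show "y \<in> supp t s \<and> z \<in> component t s y" by simp
next
  assume a: "y \<in> supp t s \<and> z \<in> component t s y"
  then have "(y, z) \<in> (R t s)\<^sup>*" unfolding component_def by simp
  from component_walk[OF _ this small] a obtain f where f: "f 0 = y" "\<And>i. nb t (f i) (f (Suc i))"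
    "\<And>i. i \<ge> 2 * (m - 1) \<Longrightarrow> f i = z" "\<And>i. f (2 * i) \<in> supp t s" by blast
  from walk_exists[of t f, OF t _ f(2)] f(1) y obtain p
    where p: "0 \<le> p" "p < b ^ (2 * m)" "\<And>i. i \<le> 2 * m \<Longrightarrow> walk c (int t) y p (int i) = f i" by auto
  have "walk_end c (int t) y p = z" unfolding walk_end_eq using p(3)[of "2 * m"] f(3)[of "2 * m"] by simp
  moreover have "0 < s (walk c (int t) y p (i + i))" if "i \<in> range_of c" "i \<le> half_length c" for i
  proof -
    have "i + i = int (2 * nat i)" "2 * nat i \<le> 2 * m" using that unfolding range_of_def half_length_eq by auto
    then have "walk c (int t) y p (i + i) = f (2 * nat i)" using p(3) by metis
    then show ?thesis using f(4)[of "nat i"] unfolding supp_def by simp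
  qed
  ultimately show "conn c (int t) x q j y z" unfolding conn_def s using pow_range[OF p(1,2)] by blast
qed

end

section \<open>Correctness of the table\<close>

context table_input
begin

lemma Suc_int: "int (Suc t) = int t + 1" by simp

lemma split_eq: "split c (int t) x q j = ref t (val c (int (Suc t)) x q) j"
  unfolding split_def ref_def Suc_int by (simp add: fun_eq_iff)

lemma var_count_eq: "var_count c (int t) y = nvar t y"
proof -
  have "num_vars c \<le> int X" using num_vars_le num_vars_nonneg by simp
  then have "{j \<in> range_of c. j < num_vars c \<and> var_bag c (int t) j = y} = {j \<in> {0..<num_vars c}. var_bag c (int t) j = y}"
    unfolding range_of_def by auto
  then show ?thesis unfolding var_count_def nvar_def sum_if_card by simp
qed

lemma split_sat_eq:
  "split_sat c (int t) x q q' j y \<longleftrightarrow> eref t (\<lambda>y. 0 < val c (int (Suc t)) x q' y) (split c (int t) x q j) y"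
  using ex_vert[of t "\<lambda>z. red_eq c (int t + 1) (parent c (int t) z) (parent c (int t) y) \<and>
     (pos_edge c (int t) z y \<and> 0 < split c (int t) x q j z \<or>
      neg_edge c (int t) z y \<and> split c (int t) x q j z < var_count c (int t) z)"]
  unfolding split_sat_def eref_def nb_eq[of "Suc t", symmetric] var_count_eq[symmetric] Suc_int by simp

lemma zero_sat_eq: "zero_sat c (int t) y \<longleftrightarrow> zero_ok t y"
proof -
  have "num_vars c \<le> int X" using num_vars_le num_vars_nonneg by simp
  then show ?thesis using num_clauses_le
    unfolding zero_sat_def zero_ok_def nb_eq range_of_def by fastforce
qed

lemma near_val_eq: "near_val c (int t) x q y \<longleftrightarrow> near t (supp t (val c (int t) x q)) y"
  using ex_vert[of t "\<lambda>z. 0 < val c (int t) x q z \<and> red_eq c (int t) z y"]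
  unfolding near_val_def near_def supp_def nb_eq by auto

lemma near_split_eq: "near_split c (int t) x q j y \<longleftrightarrow> near t (supp t (split c (int t) x q j)) y"
  using ex_vert[of t "\<lambda>z. 0 < split c (int t) x q j z \<and> red_eq c (int t) z y"]
  unfolding near_split_def near_def supp_def nb_eq by auto

lemma admissible_eq:
  "admissible c (int t) x q q' j \<longleftrightarrow> chk t (val c (int (Suc t)) x q) (\<lambda>y. 0 < val c (int (Suc t)) x q' y) (split c (int t) x q j)"
  using all_vert[of t "\<lambda>z. near_val c (int t + 1) x q (parent c (int t) z) \<and> \<not> near_split c (int t) x q j z \<and>
    \<not> split_sat c (int t) x q q' j z \<longrightarrow> zero_sat c (int t) z"]
  unfolding admissible_def chk_def split_sat_eq zero_sat_eq near_val_eq[of "Suc t", unfolded Suc_int] near_split_eq Suc_int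
  by auto

text \<open>The total number of ones is unchanged by a split, so the bound \<open>k\<close> passes
  from each level to the one below.\<close>

lemma sum_ref:
  assumes "Suc t < n"
  shows "(\<Sum>y\<in>V t. ref t s j y) = (\<Sum>y\<in>V (Suc t). s y)"
proof -
  obtain v where v: "old_vert c (int t) \<in> V t" "v \<in> V t" "old_vert c (int t) \<noteq> v" "new_vert c (int t) \<notin> V t"
    "V (Suc t) = insert (new_vert c (int t)) (V t - {old_vert c (int t), v})"
    using contracted[OF assms] by blast
  let ?u = "old_vert c (int t)" and ?w = "new_vert c (int t)"
  let ?A = "V t - {?u, v}"
  have A: "finite ?A" using finV[of t] by simp
  have Vt: "V t = insert ?u (insert v ?A)" using v by blast
  have r: "ref t s j ?u = j" "ref t s j v = s ?w - j" using v unfolding ref_def by auto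
  have "ref t s j y = s y" if "y \<in> ?A" for y using v(5) that unfolding ref_def by auto
  then have "sum (ref t s j) ?A = sum s ?A" by simp
  moreover have "sum (ref t s j) (V t) = ref t s j ?u + (ref t s j v + sum (ref t s j) ?A)"
    by (subst Vt) (use A v(3) in simp)
  moreover have "sum s (V (Suc t)) = s ?w + sum s ?A" unfolding v(5) using A v(4) by simp
  ultimately show ?thesis using r by simp
qed

abbreviation "F \<equiv> fill c M0"

lemma X_pos: "0 < X" using two_m_le by simp

lemma F_weights: "i < num_vars c \<Longrightarrow> F (i + i) = M0 (i + i)" "i < num_vars c \<Longrightarrow> F (i + i + 1) = M0 (i + i + 1)"
  using fill_spec(1)[OF num_vars_le X_pos] num_vars_le by auto

lemma level_range: "t < n \<Longrightarrow> int t \<in> range_of c"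
  using num_graphs_le unfolding range_of_def by auto

lemma vert_V: "l \<in> {0..<num_verts c (int t)} \<Longrightarrow> t < n \<Longrightarrow> l \<in> range_of c \<and> vert c (int t) l \<in> V t"
  using num_verts_le[of t] unfolding is_vert_def range_of_def by auto

lemma prod_vars:
  "(\<Prod>i\<in>range_of c. if i < num_vars c \<and> P i then f i else 1) = (\<Prod>i\<in>{0..<num_vars c}. if P i then f i else (1::real))"
  using num_vars_le num_vars_nonneg by (intro prod_range) simp

text \<open>Nothing is claimed for codes whose counts add up to more than \<open>k\<close>: their
  components need not fit into the balls.\<close>

definition table_ok where
  "table_ok t \<longleftrightarrow> (\<forall>l\<in>{0..<num_verts c (int t)}. \<forall>q\<in>range_of c. \<forall>q'\<in>range_of c.
     (\<Sum>y\<in>V t. val c (int t) (vert c (int t) l) q y) \<le> k \<longrightarrow>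
     F (addr c (int t) l q q') = L t (val c (int t) (vert c (int t) l) q) (\<lambda>y. 0 < val c (int t) (vert c (int t) l) q' y))"

lemma table_0: assumes n: "0 < n" shows "table_ok 0"
  unfolding table_ok_def
proof (intro ballI impI)
  fix l q q' assume l: "l \<in> {0..<num_verts c (int 0)}" and q: "q \<in> range_of c" "q' \<in> range_of c"
  let ?x = "vert c (int 0) l"
  let ?s = "val c (int 0) ?x q"
  have lr: "l \<in> range_of c" using vert_V[OF l n] by simp
  have "F (addr c (int 0) l q q') = base_value c l q F"
    using fill_spec(2)[OF num_vars_le X_pos level_range[OF n] lr q] unfolding cell_value_def by simp
  also have "\<dots> = (if \<forall>y\<in>V 0. ?s y \<le> nvar 0 y then \<Prod>i\<in>{0..<num_vars c}. if 0 < ?s (var_bag c (int 0) i) then M0 (i + i) else 1 else 0)"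
  proof -
    have 1: "(\<forall>l'\<in>range_of c. l' < num_verts c 0 \<longrightarrow> ?s (vert c 0 l') \<le> var_count c 0 (vert c 0 l')) \<longleftrightarrow>
      (\<forall>y\<in>V 0. ?s y \<le> nvar 0 y)"
      using all_vert[of 0 "\<lambda>z. ?s z \<le> var_count c 0 z"] var_count_eq[of 0] by simp
    have 2: "(\<Prod>i\<in>range_of c. if i < num_vars c \<and> 0 < ?s (var_bag c 0 i) then F (i + i) else 1) =
      (\<Prod>i\<in>{0..<num_vars c}. if 0 < ?s (var_bag c (int 0) i) then M0 (i + i) else 1)"
      unfolding prod_vars using F_weights(1) by (intro prod.cong) auto
    show ?thesis unfolding base_value_def using 1 2 by (simp cong: if_cong)
  qed
  also have "\<dots> = L 0 ?s (\<lambda>y. 0 < val c (int 0) ?x q' y)"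
    by (rule L_0[symmetric]) (use n no_red_0 var_bag_inj var_clause val_range[OF q(1)] in auto)
  finally show "F (addr c (int 0) l q q') = L 0 ?s (\<lambda>y. 0 < val c (int 0) ?x q' y)" .
qed

lemma component_supp: "y \<in> supp t s \<Longrightarrow> (y, z) \<in> (R t s)\<^sup>* \<Longrightarrow> z \<in> supp t s"
  by (erule rtranclE) (auto simp: R_def)

lemma restr_supp: "supp t (restr s (component t s y)) = component t s y"
  unfolding supp_def restr_def component_def by auto

text \<open>Counts and marks of the component of \<open>y\<close> vanish outside the ball around
  \<open>y\<close>, so \<open>encode\<close> makes both searches succeed. The marks found agree with
  \<open>e\<close> near the component, which suffices by \<open>L_cong\<close>.\<close>

lemma component_lookup:
  assumes t: "Suc t < n" and ok: "table_ok t" and s: "s = split c (int t) x q j"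
    and nonneg: "\<And>y. y \<in> V t \<Longrightarrow> 0 \<le> s y" and small: "(\<Sum>y\<in>V t. s y) \<le> k"
    and l: "l \<in> {0..<num_verts c (int t)}" and y: "y = vert c (int t) l" and ys: "y \<in> supp t s"
    and e: "e = (\<lambda>z. split_sat c (int t) x q q' j z)"
  shows "F (addr c (int t) l (conn_code c (int t) x q j y) (sat_code c (int t) x q q' j y)) =
    L t (restr s (component t s y)) e"
proof -
  have tn: "t < n" using t by simp
  have yV: "y \<in> V t" using vert_V[OF l tn] y by simp
  have cs: "int (card (supp t s)) \<le> k" using supp_le[of t s] nonneg small by fastforce
  note ce = conn_eq[OF tn s yV cs]
  \<comment> \<open>A count is at most the sum of all counts, hence at most \<open>k\<close>, and
    fits into a digit.\<close>
  have leb: "s z < b" if "z \<in> V t" for z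
  proof -
    have "s z \<le> sum s (V t)" using that nonneg finV[of t] by (intro member_le_sum) auto
    then show ?thesis using small b_ge by simp
  qed
  let ?C = "component t s y" let ?g = "restr s ?C" let ?h = "\<lambda>z. if near t ?C z \<and> e z then 1 else 0 :: int"
  have b01: "0 < b" "1 < b" using b_ge by auto
  have "\<exists>p\<in>range_of c. \<forall>z\<in>V t. val c (int t) y p z = ?g z"
  proof (rule encode[OF tn yV])
    show "0 \<le> ?g z \<and> ?g z < b" if "z \<in> V t" for z using nonneg[OF that] leb[OF that] b01 unfolding restr_def by auto
    show "z \<in> ball t y" if "?g z \<noteq> 0" for z
      using near_component_ball[OF ys cs, of z z] that unfolding restr_def nb_def by (auto split: if_splits)
  qed
  then obtain p where p: "p \<in> range_of c" "\<forall>z\<in>V t. val c (int t) y p z = ?g z" by blast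
  let ?P = "\<lambda>p. \<forall>l\<in>range_of c. l < num_verts c (int t) \<longrightarrow> val c (int t) y p (vert c (int t) l) =
     (if conn c (int t) x q j y (vert c (int t) l) then split c (int t) x q j (vert c (int t) l) else 0)"
  have P: "?P p \<longleftrightarrow> (\<forall>z\<in>V t. val c (int t) y p z = ?g z)" for p
    using all_vert[of t "\<lambda>z. val c (int t) y p z = (if conn c (int t) x q j y z then split c (int t) x q j z else 0)"]
    unfolding restr_def ce s[symmetric] using ys by simp
  have q1': "conn_code c (int t) x q j y = search c (\<lambda>p. \<forall>z\<in>V t. val c (int t) y p z = ?g z)"
    unfolding conn_code_def by (rule arg_cong[where f = "search c"], rule ext, rule P)
  have q1: "conn_code c (int t) x q j y \<in> range_of c" "\<forall>z\<in>V t. val c (int t) y (conn_code c (int t) x q j y) z = ?g z"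
    unfolding q1' using search_found(1,2)[of p c "\<lambda>p. \<forall>z\<in>V t. val c (int t) y p z = ?g z", OF p] by blast+
  have nc: "near_conn c (int t) x q j y z \<longleftrightarrow> near t ?C z" for z
    using ex_vert[of t "\<lambda>l. conn c (int t) x q j y l \<and> red_eq c (int t) l z"] ys
    unfolding near_conn_def near_def ce nb_eq by (auto simp: component_def supp_def)
  have "\<exists>p\<in>range_of c. \<forall>z\<in>V t. val c (int t) y p z = ?h z"
  proof (rule encode[OF tn yV])
    show "0 \<le> ?h z \<and> ?h z < b" for z using b01 by auto
    show "z \<in> ball t y" if "?h z \<noteq> 0" for z
      using near_component_ball[OF ys cs] that unfolding near_def by (auto split: if_splits)
  qed
  then obtain p' where p': "p' \<in> range_of c" "\<forall>z\<in>V t. val c (int t) y p' z = ?h z" by blast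
  let ?Q = "\<lambda>p. \<forall>l\<in>range_of c. l < num_verts c (int t) \<longrightarrow> val c (int t) y p (vert c (int t) l) =
     (if near_conn c (int t) x q j y (vert c (int t) l) \<and> split_sat c (int t) x q q' j (vert c (int t) l) then 1 else 0)"
  have Q: "?Q p \<longleftrightarrow> (\<forall>z\<in>V t. val c (int t) y p z = ?h z)" for p
    using all_vert[of t "\<lambda>z. val c (int t) y p z = (if near_conn c (int t) x q j y z \<and> split_sat c (int t) x q q' j z then 1 else 0)"]
    unfolding nc e by simp
  have q2': "sat_code c (int t) x q q' j y = search c (\<lambda>p. \<forall>z\<in>V t. val c (int t) y p z = ?h z)"
    unfolding sat_code_def by (rule arg_cong[where f = "search c"], rule ext, rule Q)
  have q2: "sat_code c (int t) x q q' j y \<in> range_of c" "\<forall>z\<in>V t. val c (int t) y (sat_code c (int t) x q q' j y) z = ?h z"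
    unfolding q2' using search_found(1,2)[of p' c "\<lambda>p. \<forall>z\<in>V t. val c (int t) y p z = ?h z", OF p'] by blast+
  let ?q1 = "conn_code c (int t) x q j y" and ?q2 = "sat_code c (int t) x q q' j y"
  have "(\<Sum>z\<in>V t. val c (int t) y ?q1 z) = (\<Sum>z\<in>V t. ?g z)" using q1(2) by simp
  also have "\<dots> \<le> (\<Sum>z\<in>V t. s z)" using nonneg by (intro sum_mono) (simp add: restr_def)
  finally have "(\<Sum>z\<in>V t. val c (int t) y ?q1 z) \<le> k" using small by simp
  then have "F (addr c (int t) l ?q1 ?q2) = L t (val c (int t) y ?q1) (\<lambda>z. 0 < val c (int t) y ?q2 z)"
    using ok[unfolded table_ok_def, rule_format, OF l q1(1) q2(1)] unfolding y by blast
  also have "\<dots> = L t ?g e"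
  proof (rule L_cong[OF tn])
    show "val c (int t) y ?q1 z = ?g z" if "z \<in> V t" for z using q1(2) that by blast
    have "supp t (val c (int t) y ?q1) = supp t ?g" unfolding supp_def using q1(2) by auto
    then have su: "supp t (val c (int t) y ?q1) = ?C" unfolding restr_supp .
    show "(0 < val c (int t) y ?q2 z) = e z" if "z \<in> V t" "near t (supp t (val c (int t) y ?q1)) z" for z
      using q2(2) that unfolding su by simp
  qed
  finally show ?thesis .
qed

text \<open>The product over positions is a product over vertices, because positions name vertices
  injectively. Only roots contribute to it, so \<open>L_roots\<close> applies.\<close>

lemma roots_lookup:
  assumes t: "Suc t < n" and ok: "table_ok t" and s: "s = split c (int t) x q j"
    and nonneg: "\<And>y. y \<in> V t \<Longrightarrow> 0 \<le> s y" and small: "(\<Sum>y\<in>V t. s y) \<le> k"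
    and e: "e = (\<lambda>z. split_sat c (int t) x q q' j z)"
  shows "(\<Prod>l\<in>range_of c. if l < num_verts c (int t) \<and> is_root c (int t) x q j (vert c (int t) l)
       then F (addr c (int t) l (conn_code c (int t) x q j (vert c (int t) l)) (sat_code c (int t) x q q' j (vert c (int t) l))) else 1)
    = L t s e"
proof -
  have tn: "t < n" using t by simp
  let ?v = "vert c (int t)" and ?N = "{0..<num_verts c (int t)}"
  let ?f = "\<lambda>l. F (addr c (int t) l (conn_code c (int t) x q j (?v l)) (sat_code c (int t) x q q' j (?v l)))"
  have cs: "int (card (supp t s)) \<le> k" using supp_le[of t s] nonneg small by fastforce
  have root: "is_root c (int t) x q j y \<longleftrightarrow> y \<in> roots t s" if y: "y \<in> V t" for y
  proof -
    have "is_root c (int t) x q j y \<longleftrightarrow> 0 < s y \<and> (\<forall>z\<in>V t. conn c (int t) x q j y z \<longrightarrow> y \<le> z)"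
      unfolding is_root_def s[symmetric] all_vert[of t "\<lambda>z. conn c (int t) x q j y z \<longrightarrow> y \<le> z", symmetric]
      by blast
    also have "\<dots> \<longleftrightarrow> y \<in> supp t s \<and> (\<forall>z\<in>V t. z \<in> component t s y \<longrightarrow> y \<le> z)"
      unfolding conn_eq[OF tn s y cs] using y by (auto simp: supp_def)
    also have "\<dots> \<longleftrightarrow> y \<in> roots t s"
      unfolding roots_def component_def using component_supp[of y t s] by blast
    finally show ?thesis .
  qed
  have VN: "V t = ?v ` ?N" using vert_V[OF _ tn] by (auto simp: is_vert_def range_of_def)
  have rV: "roots t s \<subseteq> V t" unfolding roots_def supp_def by auto
  have "(\<Prod>l\<in>range_of c. if l < num_verts c (int t) \<and> is_root c (int t) x q j (?v l) then ?f l else 1)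
    = (\<Prod>l\<in>?N. if is_root c (int t) x q j (?v l) then ?f l else 1)"
    using num_verts_le[OF tn] by (rule prod_range)
  also have "\<dots> = (\<Prod>l\<in>?N. if ?v l \<in> roots t s then L t (restr s (component t s (?v l))) e else 1)"
  proof (rule prod.cong[OF refl])
    fix l assume l: "l \<in> ?N"
    then have "?v l \<in> V t" using VN by blast
    from root[OF this] component_lookup[OF t ok s nonneg small l refl _ e]
    show "(if is_root c (int t) x q j (?v l) then ?f l else 1) =
      (if ?v l \<in> roots t s then L t (restr s (component t s (?v l))) e else 1)"
      by (auto simp: roots_def)
  qed
  also have "\<dots> = (\<Prod>y\<in>V t. if y \<in> roots t s then L t (restr s (component t s y)) e else 1)"
    unfolding VN using prod.reindex[OF vert_inj[OF tn], symmetric] by (simp add: o_def)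
  also have "\<dots> = (\<Prod>y\<in>{y \<in> V t. y \<in> roots t s}. L t (restr s (component t s y)) e)"
    by (rule prod.inter_filter[symmetric]) (rule finV)
  also have "{y \<in> V t. y \<in> roots t s} = roots t s" using rV by blast
  also have "(\<Prod>y\<in>roots t s. L t (restr s (component t s y)) e) = L t s e"
    by (rule L_roots[symmetric, OF tn nonneg])
  finally show ?thesis .
qed

text \<open>The algorithm sums over all \<open>j\<close> below \<open>X\<close>. Shares above the
  count of the new vertex are excluded by the guard, and none is missing, because a count is a digit
  and hence below \<open>X\<close>.\<close>

lemma table_Suc: assumes t: "Suc t < n" and ok: "table_ok t" shows "table_ok (Suc t)"
  unfolding table_ok_def
proof (intro ballI impI)
  fix l q q' assume l: "l \<in> {0..<num_verts c (int (Suc t))}" and q: "q \<in> range_of c" "q' \<in> range_of c"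
  let ?x = "vert c (int (Suc t)) l"
  let ?s = "val c (int (Suc t)) ?x q" and ?e = "\<lambda>y. 0 < val c (int (Suc t)) ?x q' y"
  let ?r = "\<lambda>j. split c (int t) ?x q j" let ?w = "new_vert c (int t)"
  assume small: "(\<Sum>y\<in>V (Suc t). ?s y) \<le> k"
  have lr: "l \<in> range_of c" using vert_V[OF l t] by simp
  have nonneg: "0 \<le> ?s y" "?s y < b" for y using val_range[OF q(1)] by auto
  have wX: "?s ?w < int X" using nonneg[of ?w] b_le_X by simp
  have r_nonneg: "0 \<le> ?r j y" if "y \<in> V t" "j \<in> {0..?s ?w}" for j y
    using nonneg that unfolding split_eq ref_def by auto
  have r_small: "(\<Sum>y\<in>V t. ?r j y) \<le> k" for j
    using small sum_ref[OF t, of ?s j] unfolding split_eq by simp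
  have "F (addr c (int (Suc t)) l q q') = step_value c (int t) ?x q q' F"
    using fill_spec(2)[OF num_vars_le X_pos level_range[OF t] lr q] unfolding cell_value_def by simp
  also have "\<dots> = (\<Sum>j\<in>{0..?s ?w}. if chk t ?s ?e (ref t ?s j)
    then fct t ?s (ref t ?s j) * L t (ref t ?s j) (eref t ?e (ref t ?s j)) else 0)"
    unfolding step_value_def
  proof (rule sum.mono_neutral_cong_right)
    show "{0..?s ?w} \<subseteq> range_of c" using wX unfolding range_of_def by auto
    show "\<forall>j\<in>range_of c - {0..?s ?w}. (if j \<le> val c (int t + 1) ?x q ?w \<and> admissible c (int t) ?x q q' j
      then (\<Prod>i\<in>range_of c. if i < num_vars c \<and> 0 < val c (int t + 1) ?x q (var_bag c (int t + 1) i) \<and>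
            \<not> 0 < ?r j (var_bag c (int t) i) then F (i + i + 1) else 1) *
          (\<Prod>l\<in>range_of c. if l < num_verts c (int t) \<and> is_root c (int t) ?x q j (vert c (int t) l)
            then F (addr c (int t) l (conn_code c (int t) ?x q j (vert c (int t) l)) (sat_code c (int t) ?x q q' j (vert c (int t) l))) else 1)
      else 0) = 0"
      unfolding Suc_int[symmetric] range_of_def by auto
    fix j assume j: "j \<in> {0..?s ?w}"
    have f: "(\<Prod>i\<in>range_of c. if i < num_vars c \<and> 0 < ?s (var_bag c (int (Suc t)) i) \<and>
        \<not> 0 < ?r j (var_bag c (int t) i) then F (i + i + 1) else 1) = fct t ?s (?r j)"
      unfolding prod_vars fct_def using F_weights(2) by (intro prod.cong) auto
    have ee: "(\<lambda>z. split_sat c (int t) ?x q q' j z) = eref t ?e (?r j)" using split_sat_eq by blast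
    have g: "(\<Prod>l\<in>range_of c. if l < num_verts c (int t) \<and> is_root c (int t) ?x q j (vert c (int t) l)
            then F (addr c (int t) l (conn_code c (int t) ?x q j (vert c (int t) l)) (sat_code c (int t) ?x q q' j (vert c (int t) l))) else 1)
      = L t (?r j) (eref t ?e (?r j))"
      by (rule roots_lookup[OF t ok refl r_nonneg[OF _ j] r_small ee[symmetric]])
    show "(if j \<le> val c (int t + 1) ?x q ?w \<and> admissible c (int t) ?x q q' j
      then (\<Prod>i\<in>range_of c. if i < num_vars c \<and> 0 < val c (int t + 1) ?x q (var_bag c (int t + 1) i) \<and>
            \<not> 0 < ?r j (var_bag c (int t) i) then F (i + i + 1) else 1) *
          (\<Prod>l\<in>range_of c. if l < num_verts c (int t) \<and> is_root c (int t) ?x q j (vert c (int t) l)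
            then F (addr c (int t) l (conn_code c (int t) ?x q j (vert c (int t) l)) (sat_code c (int t) ?x q q' j (vert c (int t) l))) else 1)
      else 0) = (if chk t ?s ?e (ref t ?s j)
    then fct t ?s (ref t ?s j) * L t (ref t ?s j) (eref t ?e (ref t ?s j)) else 0)"
      unfolding Suc_int[symmetric] f g admissible_eq unfolding split_eq using j by simp
  qed simp
  also have "\<dots> = L (Suc t) ?s ?e" by (rule L_Suc[OF t, symmetric])
  finally show "F (addr c (int (Suc t)) l q q') = L (Suc t) ?s ?e" .
qed

lemma table_all: "t < n \<Longrightarrow> table_ok t"
  by (induction t) (auto intro: table_0 table_Suc)

text \<open>On the last level every listed position names the only vertex, and every count up to
  \<open>k\<close> has a code. The weights are still in place because the table starts above
  them.\<close>

theorem result_eq: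
  "result c F = (\<Sum>S\<in>{S. S \<subseteq> {0..<num_vars c} \<and> int (card S) \<le> k}.
     if \<forall>i\<in>{0..<fst c 1}. sat S i then weight_of S else 0)"
proof -
  have nv: "num_vars c \<le> int X" using num_vars_le num_vars_nonneg by simp
  have 1: "(\<forall>i\<in>range_of c. i < fst c 1 \<longrightarrow> (\<exists>j\<in>range_of c. j < num_vars c \<and> has_neg c i j)) \<longleftrightarrow>
    (\<forall>i\<in>{0..<fst c 1}. \<exists>j\<in>{0..<num_vars c}. has_neg c i j)"
    unfolding ball_range[OF num_clauses_le] bex_range[OF nv] ..
  have 2: "(\<Prod>j\<in>range_of c. if j < num_vars c then F (j + j + 1) else 1) = (\<Prod>j\<in>{0..<num_vars c}. M0 (j + j + 1))"
    using prod_vars[of "\<lambda>_. True" "\<lambda>j. F (j + j + 1)"] F_weights(2) by simp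
  have 3: "(\<Sum>j\<in>range_of c. if 1 \<le> j \<and> j \<le> k
        then F (addr c (num_graphs c - 1) 0 (last_code c j) (last_code c 0)) else 0) =
      (\<Sum>j\<in>{1..k}. L (n - 1) (\<lambda>_. j) (\<lambda>_. False))" if g: "0 < num_graphs c"
  proof -
    let ?t = "n - 1"
    have t: "int ?t = num_graphs c - 1" "?t < n" using g by auto
    obtain x where x: "V ?t = {x}" using last_single[OF g] t by auto
    let ?N = "{0..<num_verts c (int ?t)}"
    have vx: "vert c (int ?t) l = x" if "l \<in> ?N" for l using vert_V[OF that t(2)] x by auto
    obtain l where l: "l \<in> ?N" using x unfolding is_vert_def range_of_def by fastforce
    then have z: "0 \<in> ?N" by simp
    have xV: "x \<in> V ?t" using x by simp
    have lc: "last_code c j \<in> range_of c \<and> val c (int ?t) x (last_code c j) x = j" if "0 \<le> j" "j \<le> k" for j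
    proof -
      have "x \<in> ball ?t x" unfolding ball_def nb_def by auto
      then have xb: "y \<in> ball ?t x" if "y \<in> V ?t" for y using that x by auto
      have jb: "0 \<le> j \<and> j < b" using that b_ge by simp
      obtain q where q: "q \<in> range_of c" "\<forall>y\<in>V ?t. val c (int ?t) x q y = j"
        using encode[OF t(2) xV, of "\<lambda>_. j", OF jb xb] by blast
      then have "val c (int ?t) x q x = j" using xV by blast
      then show ?thesis using search_found(1,2)[of q c "\<lambda>q. val c (int ?t) x q x = j"] q(1) vx[OF z]
        unfolding last_code_def t(1)[symmetric] by simp
    qed
    have "F (addr c (num_graphs c - 1) 0 (last_code c j) (last_code c 0)) = L ?t (\<lambda>_. j) (\<lambda>_. False)"
      if j: "1 \<le> j" "j \<le> k" for j
    proof -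
      have lj: "last_code c j \<in> range_of c" "val c (int ?t) x (last_code c j) x = j" using lc[of j] j by auto
      have l0: "last_code c 0 \<in> range_of c" "val c (int ?t) x (last_code c 0) x = 0" using lc[of 0] k_nonneg by auto
      have "(\<Sum>y\<in>V ?t. val c (int ?t) x (last_code c j) y) \<le> k" unfolding x using lj j by simp
      then have "F (addr c (int ?t) 0 (last_code c j) (last_code c 0)) =
        L ?t (val c (int ?t) x (last_code c j)) (\<lambda>y. 0 < val c (int ?t) x (last_code c 0) y)"
        using table_all[OF t(2), unfolded table_ok_def, rule_format, OF z lj(1) l0(1)] unfolding vx[OF z] by blast
      also have "\<dots> = L ?t (\<lambda>_. j) (\<lambda>_. False)"
      proof (rule L_cong[OF t(2)])
        show "val c (int ?t) x (last_code c j) y = j" if "y \<in> V ?t" for y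
        proof -
          have "y = x" using that x by blast
          then show ?thesis using lj by simp
        qed
        show "(0 < val c (int ?t) x (last_code c 0) y) = False" if "y \<in> V ?t" for y
        proof -
          have "y = x" using that x by blast
          then show ?thesis using l0 by simp
        qed
      qed
      finally show ?thesis unfolding t(1) .
    qed
    moreover have "{j \<in> range_of c. 1 \<le> j \<and> j \<le> k} = {1..k}" using b_ge b_le_X unfolding range_of_def by auto
    ultimately show ?thesis by (simp add: sum.inter_filter[symmetric])
  qed
  have "result c F = (if 0 \<le> k then (if \<forall>i\<in>{0..<fst c 1}. \<exists>j\<in>{0..<num_vars c}. has_neg c i j
       then \<Prod>j\<in>{0..<num_vars c}. M0 (j + j + 1) else 0) +
       (if 0 < n then \<Sum>j\<in>{1..k}. L (n - 1) (\<lambda>_. j) (\<lambda>_. False) else 0) else 0)"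
    unfolding result_def 1 2 using 3 by simp
  also have "\<dots> = (\<Sum>S\<in>{S. S \<subseteq> {0..<num_vars c} \<and> int (card S) \<le> k}.
     if \<forall>i\<in>{0..<fst c 1}. sat S i then weight_of S else 0)"
  proof (rule count_eq[symmetric])
    show "\<exists>x. V (n - 1) = {x}" if "0 < n" using last_single that by (simp add: of_nat_diff)
    show "{0..<num_vars c} = {}" if "n = 0" using no_graphs that by simp
  qed
  finally show ?thesis .
qed

end

section \<open>Decoding the input\<close>

lemma pair_eq_new:
  assumes "{p, q} = {w, z}" "z \<noteq> w" shows "p = w \<and> q = z \<or> p = z \<and> q = w"
  using assms by (auto simp: doubleton_eq_iff)

context
  fixes G H :: "'v trigraph" and u v w :: 'v and \<pi> :: "'v \<Rightarrow> 'v"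
  assumes G: "is_signed_trigraph G" and uv: "u \<in> verts G" "v \<in> verts G" "u \<noteq> v" and w: "w \<notin> verts G"
    and H: "H = contract G u v w"
    and \<pi>: "\<And>x. \<pi> x = (if x \<in> verts H then x else w)"
begin

lemma verts_contract: "verts H = insert w (verts G - {u, v})"
  unfolding H contract_def Let_def by simp

lemma card_contract: "card (verts H) = card (verts G) - 1"
proof -
  have f: "finite (verts G)" using G unfolding is_signed_trigraph_def by simp
  have "card (verts H) = Suc (card (verts G - {u, v}))" unfolding verts_contract using f w by simp
  also have "card (verts G - {u, v}) = card (verts G) - 2"
    using uv f by (subst card_Diff_subset) auto
  moreover have "card {u, v} \<le> card (verts G)" using uv f by (intro card_mono) auto
  ultimately show ?thesis using uv by simp
qed

lemma image_in: "x \<in> verts G \<Longrightarrow> \<pi> x \<in> verts H"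
  unfolding \<pi> verts_contract by simp

lemma image_cases:
  assumes "x \<in> verts G"
  shows "(x = u \<or> x = v) \<and> \<pi> x = w \<or> x \<noteq> u \<and> x \<noteq> v \<and> \<pi> x = x \<and> x \<noteq> w"
  using assms w unfolding \<pi> verts_contract by auto

lemma image_new: "x \<in> verts G \<Longrightarrow> \<pi> x = w \<Longrightarrow> x = u \<or> x = v" using image_cases[of x] by auto
lemma image_old: "x \<in> verts G \<Longrightarrow> \<pi> x \<noteq> w \<Longrightarrow> \<pi> x = x" using image_cases[of x] by auto

lemma edge_verts: "e \<in> pos_edges G \<union> neg_edges G \<union> red_edges G \<Longrightarrow> e \<subseteq> verts G"
  using G unfolding is_signed_trigraph_def by blast

text \<open>Positive and negative edges of the contracted trigraph arise alike: they are old edges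
  away from \<open>u\<close> and \<open>v\<close>, or edges at \<open>w\<close> that both
  \<open>u\<close> and \<open>v\<close> had. The argument is given once, for a set \<open>E\<close>
  of edges and a set \<open>Z\<close> of common neighbours.\<close>

lemma homogeneous_contract:
  assumes xy: "x \<in> verts G" "y \<in> verts G" and E: "E \<subseteq> pos_edges G \<union> neg_edges G \<union> red_edges G"
    and Z: "Z \<subseteq> verts G - {u, v}" "\<And>z. z \<in> Z \<Longrightarrow> {u, z} \<in> E \<and> {v, z} \<in> E"
    and e: "{\<pi> x, \<pi> y} \<in> {e \<in> E. u \<notin> e \<and> v \<notin> e} \<union> (\<lambda>x. {w, x}) ` Z"
  shows "{x, y} \<in> E"
  using e
proof
  assume a: "{\<pi> x, \<pi> y} \<in> {e \<in> E. u \<notin> e \<and> v \<notin> e}"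
  then have "{\<pi> x, \<pi> y} \<subseteq> verts G" using E edge_verts by blast
  then have "\<pi> x \<noteq> w" "\<pi> y \<noteq> w" using w by auto
  then show ?thesis using a image_old[OF xy(1)] image_old[OF xy(2)] by simp
next
  assume "{\<pi> x, \<pi> y} \<in> (\<lambda>x. {w, x}) ` Z"
  then obtain z where z: "z \<in> Z" "{\<pi> x, \<pi> y} = {w, z}" by blast
  then have zw: "z \<noteq> w" using Z(1) w by blast
  have "x = u \<or> x = v \<or> \<pi> x = z" "y = u \<or> y = v \<or> \<pi> y = z"
    using pair_eq_new[OF z(2) zw] image_new[OF xy(1)] image_new[OF xy(2)] by blast+
  from pair_eq_new[OF z(2) zw] show ?thesis
  proof
    assume a: "\<pi> x = w \<and> \<pi> y = z"
    then have "x = u \<or> x = v" "y = z" using image_new[OF xy(1)] image_old[OF xy(2)] zw by auto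
    then show ?thesis using Z(2)[OF z(1)] by auto
  next
    assume a: "\<pi> x = z \<and> \<pi> y = w"
    then have "y = u \<or> y = v" "x = z" using image_new[OF xy(2)] image_old[OF xy(1)] zw by auto
    then show ?thesis using Z(2)[OF z(1)] by (auto simp: insert_commute)
  qed
qed

lemma pos_contract: "x \<in> verts G \<Longrightarrow> y \<in> verts G \<Longrightarrow> {\<pi> x, \<pi> y} \<in> pos_edges H \<Longrightarrow> {x, y} \<in> pos_edges G"
  by (rule homogeneous_contract[of x y "pos_edges G" "{x \<in> verts G - {u, v}. is_pos G u x \<and> is_pos G v x}"])
    (auto simp: H contract_def Let_def is_pos_def)

lemma neg_contract: "x \<in> verts G \<Longrightarrow> y \<in> verts G \<Longrightarrow> {\<pi> x, \<pi> y} \<in> neg_edges H \<Longrightarrow> {x, y} \<in> neg_edges G"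
  by (rule homogeneous_contract[of x y "neg_edges G" "{x \<in> verts G - {u, v}. is_neg G u x \<and> is_neg G v x}"])
    (auto simp: H contract_def Let_def is_neg_def)

lemma edge_contract1:
  assumes x: "x = u \<or> x = v" and y: "y \<in> verts G" "y \<noteq> u" "y \<noteq> v"
    and e: "{x, y} \<in> pos_edges G \<union> neg_edges G \<union> red_edges G"
  shows "{w, y} \<in> pos_edges H \<union> neg_edges H \<union> red_edges H"
    and "{x, y} \<in> red_edges G \<Longrightarrow> {w, y} \<in> red_edges H"
proof -
  have na: "\<not> (is_absent G u y \<and> is_absent G v y)" using x e unfolding is_absent_def by blast
  have yX: "y \<in> verts G - {u, v}" using y by simp
  show "{w, y} \<in> pos_edges H \<union> neg_edges H \<union> red_edges H"
    unfolding H contract_def Let_def using yX na by auto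
  assume r: "{x, y} \<in> red_edges G"
  then have "{x, y} \<notin> pos_edges G" "{x, y} \<notin> neg_edges G" using G unfolding is_signed_trigraph_def by blast+
  then have "\<not> (is_pos G u y \<and> is_pos G v y)" "\<not> (is_neg G u y \<and> is_neg G v y)"
    using x unfolding is_pos_def is_neg_def by auto
  then show "{w, y} \<in> red_edges H"
    unfolding H contract_def Let_def using yX na by auto
qed

text \<open>Contraposed, an edge missing between different images was missing before the contraction
  as well. A red edge stays red, because it prevents the new edge from being homogeneous.\<close>

lemma edge_contract:
  assumes x: "x \<in> verts G" and y: "y \<in> verts G"
    and e: "{x, y} \<in> pos_edges G \<union> neg_edges G \<union> red_edges G"
  shows "\<pi> x = \<pi> y \<or> {\<pi> x, \<pi> y} \<in> pos_edges H \<union> neg_edges H \<union> red_edges H"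
    and "{x, y} \<in> red_edges G \<Longrightarrow> \<pi> x = \<pi> y \<or> {\<pi> x, \<pi> y} \<in> red_edges H"
proof -
  have c: "{y, x} = {x, y}" "\<And>a. {\<pi> x, a} = {a, \<pi> x}" by auto
  have both: "(\<pi> x = \<pi> y \<or> {\<pi> x, \<pi> y} \<in> pos_edges H \<union> neg_edges H \<union> red_edges H) \<and>
    ({x, y} \<in> red_edges G \<longrightarrow> \<pi> x = \<pi> y \<or> {\<pi> x, \<pi> y} \<in> red_edges H)"
  proof (cases "x = u \<or> x = v")
    case True
    then have px: "\<pi> x = w" using image_cases[OF x] by blast
    show ?thesis
    proof (cases "y = u \<or> y = v")
      case False
      then have "\<pi> y = y" using image_cases[OF y] by blast
      with edge_contract1[OF True y] e False px show ?thesis by simp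
    qed (use image_cases[OF y] px in auto)
  next
    case False
    then have px: "\<pi> x = x" using image_cases[OF x] by blast
    show ?thesis
    proof (cases "y = u \<or> y = v")
      case True
      then have "\<pi> y = w" using image_cases[OF y] by blast
      with edge_contract1[OF True x] e False px show ?thesis by (simp add: insert_commute)
    next
      case nf: False
      then have "\<pi> y = y" using image_cases[OF y] by blast
      then show ?thesis using e px False nf unfolding H contract_def Let_def by auto
    qed
  qed
  from both show "\<pi> x = \<pi> y \<or> {\<pi> x, \<pi> y} \<in> pos_edges H \<union> neg_edges H \<union> red_edges H" by blast
  from both show "{x, y} \<in> red_edges G \<Longrightarrow> \<pi> x = \<pi> y \<or> {\<pi> x, \<pi> y} \<in> red_edges H" by blast
qed

end

section \<open>Lists in memory and the decoding of edge lists\<close>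

definition segment :: "(int \<Rightarrow> 'a) \<Rightarrow> int \<Rightarrow> 'a list \<Rightarrow> bool" where
  "segment I p xs \<longleftrightarrow> (\<forall>j<length xs. I (p + int j) = xs ! j)"

lemma segment_Nil: "segment I p []"
  unfolding segment_def by simp

lemma segment_Cons: "segment I p (x # xs) \<longleftrightarrow> I p = x \<and> segment I (p + 1) xs"
  by (simp add: segment_def All_less_Suc2 add.assoc)

lemma segment_append: "segment I p (xs @ ys) \<longleftrightarrow> segment I p xs \<and> segment I (p + int (length xs)) ys"
  by (induction xs arbitrary: p) (simp_all add: segment_Nil segment_Cons add.assoc)

lemma segment_mem: "segment (mem_of_list xs) 0 xs"
  unfolding segment_def mem_of_list_def by simp

lemma segment_concat:
  "segment I p (concat cs) \<Longrightarrow> i < length cs \<Longrightarrow> segment I (p + int (length (concat (take i cs)))) (cs ! i)"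
proof -
  assume a: "segment I p (concat cs)" and i: "i < length cs"
  have "concat cs = concat (take i cs) @ cs ! i @ concat (drop (Suc i) cs)"
    using i by (metis append_take_drop_id concat.simps(2) concat_append Cons_nth_drop_Suc)
  with a show ?thesis by (simp add: segment_append)
qed

lemma length_concat_take:
  "i < length cs \<Longrightarrow> length (concat (take (Suc i) cs)) = length (concat (take i cs)) + length (cs ! i)"
  by (simp add: take_Suc_conv_app_nth)

lemma length_concat_ge: "(\<And>c. c \<in> set cs \<Longrightarrow> 1 \<le> length c) \<Longrightarrow> length cs \<le> length (concat cs)"
  by (induction cs) (auto, fastforce)

lemma nth_le_length_concat:
  assumes "i < length cs" shows "length (cs ! i) \<le> length (concat cs)"
  using elem_le_sum_list[of i "map length cs"] assms by (simp add: length_concat)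

text \<open>\<open>enc_edge\<close> leaves the orientation open; here the listed pairs are made
  explicit, since the cells hold ordered pairs.\<close>

definition edge_list where
  "edge_list \<nu> E code \<longleftrightarrow> (\<exists>es :: (node \<times> node) list. E = (\<lambda>(a, b). {a, b}) ` set es \<and>
     code = int (length es) # concat (map (\<lambda>(a, b). [\<nu> a, \<nu> b]) es))"

lemma enc_set_edge_list: "enc_set (enc_edge \<nu>) E code \<Longrightarrow> edge_list \<nu> E code"
proof -
  assume "enc_set (enc_edge \<nu>) E code"
  then obtain xs cs where 1: "set xs = E" "list_all2 (enc_edge \<nu>) xs cs" "code = int (length xs) # concat cs"
    unfolding enc_set_def enc_list_def by blast
  from 1(2) have "\<exists>es. length es = length xs \<and> set xs = (\<lambda>(a, b). {a, b}) ` set es \<and> concat cs = concat (map (\<lambda>(a, b). [\<nu> a, \<nu> b]) es)"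
  proof (induction rule: list_all2_induct)
    case (Cons x xs c cs)
    from Cons(1) obtain a b where ab: "x = {a, b}" "c = [\<nu> a, \<nu> b]" unfolding enc_edge_def by blast
    from Cons obtain es where "length es = length xs" "set xs = (\<lambda>(a, b). {a, b}) ` set es"
      "concat cs = concat (map (\<lambda>(a, b). [\<nu> a, \<nu> b]) es)" by blast
    with ab show ?case by (intro exI[of _ "(a, b) # es"]) simp
  qed simp
  with 1 show ?thesis unfolding edge_list_def by metis
qed

lemma edge_list_length:
  assumes "edge_list \<nu> E code" "segment I p code"
  shows "int (length code) = 1 + I p + I p"
proof -
  have "length (concat (map (\<lambda>(a, b). [\<nu> a, \<nu> b]) es)) = 2 * length es" for es :: "(node \<times> node) list"
    by (induction es) auto
  with assms show ?thesis unfolding edge_list_def by (auto simp: segment_Cons)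
qed

lemma edge_list_edge_at:
  assumes el: "edge_list \<nu> E code" and seg: "segment (fst c) p code" and X: "length code \<le> snd c"
  shows "edge_at c p x y \<longleftrightarrow> (\<exists>a b. x = \<nu> a \<and> y = \<nu> b \<and> {a, b} \<in> E)"
proof -
  obtain es where es: "E = (\<lambda>(a, b). {a, b}) ` set es"
    "code = int (length es) # concat (map (\<lambda>(a, b). [\<nu> a, \<nu> b]) es)" using el unfolding edge_list_def by blast
  have n: "fst c p = int (length es)" using seg es(2) by (simp add: segment_Cons)
  have len: "int (length es) \<le> int (snd c)" using edge_list_length[OF el seg] n X by simp
  have pos: "length (concat (take i (map (\<lambda>(a, b). [\<nu> a, \<nu> b]) es))) = i + i" if "i \<le> length es" for i
    using that by (induction i) (auto simp: take_Suc_conv_app_nth split: prod.split)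
  have m: "fst c (p + 1 + int i + int i) = \<nu> (fst (es ! i)) \<and> fst c (p + 2 + int i + int i) = \<nu> (snd (es ! i))"
    if i: "i < length es" for i
  proof -
    have "segment (fst c) (p + 1) (concat (map (\<lambda>(a, b). [\<nu> a, \<nu> b]) es))" using seg es(2) by (simp add: segment_Cons)
    from segment_concat[OF this, of i] i pos[of i]
    have sg: "segment (fst c) (p + 1 + int (i + i)) [\<nu> (fst (es ! i)), \<nu> (snd (es ! i))]"
      by (simp add: case_prod_beta)
    have "p + 1 + int i + int i = p + 1 + int (i + i)" "p + 2 + int i + int i = p + 1 + int (i + i) + 1" by simp_all
    then show ?thesis using sg by (simp only: segment_Cons)
  qed
  have "edge_at c p x y \<longleftrightarrow> (\<exists>j\<in>{0..<int (length es)}.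
     (fst c (p + 1 + j + j) = x \<and> fst c (p + 2 + j + j) = y \<or> fst c (p + 1 + j + j) = y \<and> fst c (p + 2 + j + j) = x))"
    unfolding edge_at_def n bex_range[OF len] ..
  also have "\<dots> \<longleftrightarrow> (\<exists>i<length es. \<nu> (fst (es ! i)) = x \<and> \<nu> (snd (es ! i)) = y \<or> \<nu> (fst (es ! i)) = y \<and> \<nu> (snd (es ! i)) = x)"
    (is "(\<exists>j\<in>?S. ?P j) \<longleftrightarrow> (\<exists>i<?n. ?Q i)")
  proof
    assume "\<exists>j\<in>?S. ?P j"
    then obtain j where j: "j \<in> ?S" "?P j" by blast
    then have "int (nat j) = j" "nat j < ?n" by auto
    with m[of "nat j"] j(2) show "\<exists>i<?n. ?Q i" by metis
  next
    assume "\<exists>i<?n. ?Q i"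
    then obtain i where "i < ?n" "?Q i" by blast
    then show "\<exists>j\<in>?S. ?P j" using m[of i] by (intro bexI[of _ "int i"]) auto
  qed
  also have "\<dots> \<longleftrightarrow> (\<exists>a b. x = \<nu> a \<and> y = \<nu> b \<and> {a, b} \<in> E)"
  proof
    assume "\<exists>i<?n. ?Q i"
    then obtain i where i: "i < ?n" "?Q i" by blast
    obtain a b where ab: "es ! i = (a, b)" by fastforce
    have "(a, b) \<in> set es" using i(1) ab by (metis nth_mem)
    then have "{a, b} \<in> E" "{b, a} \<in> E" unfolding es(1) by (auto simp: insert_commute image_iff intro!: bexI[of _ "(a, b)"])
    then show "\<exists>a b. x = \<nu> a \<and> y = \<nu> b \<and> {a, b} \<in> E" using i(2) ab by auto
  next
    assume "\<exists>a b. x = \<nu> a \<and> y = \<nu> b \<and> {a, b} \<in> E"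
    then obtain a b where ab: "x = \<nu> a" "y = \<nu> b" "{a, b} \<in> E" by blast
    from ab(3) obtain a' b' where e: "(a', b') \<in> set es" "{a, b} = {a', b'}" unfolding es(1) by auto
    from e(1) obtain i where "i < ?n" "es ! i = (a', b')" by (metis in_set_conv_nth)
    then show "\<exists>i<?n. ?Q i" using e(2) ab by (intro exI[of _ i]) (auto simp: doubleton_eq_iff)
  qed
  finally show ?thesis .
qed

lemma list_all2_eq_map: "list_all2 (\<lambda>x y. y = f x) xs ys \<longleftrightarrow> ys = map f xs"
  by (induction xs arbitrary: ys) (auto simp: list_all2_Cons1)

lemma concat_singletons: "concat (map (\<lambda>x. [f x]) xs) = map f xs"
  by (induction xs) auto

lemma length_concat_pairs: "length (concat (map (\<lambda>x. [f x, g x]) xs)) = length xs + length xs"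
  by (induction xs) auto

lemma concat_pairs_nth:
  assumes "segment I p (concat (map (\<lambda>x. [f x, g x]) xs))" "i < length xs"
  shows "I (p + int i + int i) = f (xs ! i)" "I (p + int i + int i + 1) = g (xs ! i)"
proof -
  have "length (concat (take i (map (\<lambda>x. [f x, g x]) xs))) = i + i"
    using length_concat_pairs[of f g "take i xs"] assms(2) by (simp add: take_map)
  with segment_concat[OF assms(1), of i] assms(2)
  have s: "segment I (p + int (i + i)) [f (xs ! i), g (xs ! i)]" by simp
  have "p + int i + int i = p + int (i + i)" by simp
  then show "I (p + int i + int i) = f (xs ! i)" "I (p + int i + int i + 1) = g (xs ! i)"
    using s by (simp_all only: segment_Cons)
qed

lemma lit_code_inj: "lit_code l = lit_code l' \<Longrightarrow> l = l'"
  by (cases l; cases l') auto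

text \<open>The witnesses hidden in \<open>enc_instance\<close> (the naming of vertices, the orders
  of clauses and variables, the partial codes) become parameters, so that they stay fixed
  throughout.\<close>

locale encoded_instance =
  fixes F :: formula and w :: "lit \<Rightarrow> real" and k :: int and d :: nat and Gs :: "node trigraph list"
    and ins :: "int list" and rs :: "real list" and \<nu> :: "node \<Rightarrow> int" and fs :: "clause list"
    and cls :: "int list list" and xs :: "nat list" and gcs :: "int list list"
  assumes cnf: "is_cnf F" and dseq: "is_d_sequence d (incidence_graph F) Gs"
    and inj: "inj_on \<nu> (\<Union>G\<in>set Gs. verts G)"
    and fs: "distinct fs" "set fs = F" and cls: "list_all2 (enc_clause \<nu>) fs cls"
    and xs: "distinct xs" "set xs = vars F"
    and gcs: "list_all2 (enc_trigraph \<nu>) Gs gcs"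
    and ins: "ins = k # (int (length fs) # concat cls) @
      (int (length xs) # concat (map (\<lambda>x. [int x + 1, \<nu> (Var_node x)]) xs)) @ (int (length Gs) # concat gcs)"
    and rs: "rs = concat (map (\<lambda>x. [w (Pos x), w (Neg x)]) xs)"

lemma enc_instanceE:
  assumes "is_cnf F" "is_d_sequence d (incidence_graph F) Gs" "enc_instance F w k Gs ins rs"
  obtains \<nu> fs cls xs gcs where "encoded_instance F w k d Gs ins rs \<nu> fs cls xs gcs"
proof -
  from assms(3) obtain \<nu> xs cF cV cG where e: "inj_on \<nu> (\<Union>G\<in>set Gs. verts G)"
    "enc_set (enc_clause \<nu>) F cF" "distinct xs" "set xs = vars F" "enc_list (enc_var \<nu>) xs cV"
    "enc_list (enc_trigraph \<nu>) Gs cG" "ins = k # cF @ cV @ cG"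
    "rs = concat (map (\<lambda>x. [w (Pos x), w (Neg x)]) xs)"
    unfolding enc_instance_def by blast
  from e(2) obtain fs cls where f: "distinct fs" "set fs = F" "list_all2 (enc_clause \<nu>) fs cls"
    "cF = int (length fs) # concat cls" unfolding enc_set_def enc_list_def by blast
  from e(5) have v: "cV = int (length xs) # concat (map (\<lambda>x. [int x + 1, \<nu> (Var_node x)]) xs)"
    unfolding enc_list_def enc_var_def lit_code.simps list_all2_eq_map by blast
  from e(6) obtain gcs where g: "list_all2 (enc_trigraph \<nu>) Gs gcs" "cG = int (length Gs) # concat gcs"
    unfolding enc_list_def by blast
  have "encoded_instance F w k d Gs ins rs \<nu> fs cls xs gcs"
    by unfold_locales (fact assms e f g | simp only: e(7) f(4) v g(2))+
  then show ?thesis by (rule that)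
qed

context encoded_instance
begin

abbreviation "I \<equiv> mem_of_list ins"
abbreviation "n \<equiv> length Gs"

definition vars_start where "vars_start = 2 + int (length (concat cls))"
definition graphs_start where "graphs_start = vars_start + 1 + int (length xs) + int (length xs)"

lemma len_cls: "length cls = length fs" using cls list_all2_lengthD by fastforce
lemma len_gcs: "length gcs = n" using gcs list_all2_lengthD by fastforce

lemma input_segments:
  "I 0 = k" "I 1 = int (length fs)" "segment I 2 (concat cls)" "I vars_start = int (length xs)"
  "segment I (vars_start + 1) (concat (map (\<lambda>x. [int x + 1, \<nu> (Var_node x)]) xs))" "I graphs_start = int n"
  "segment I (graphs_start + 1) (concat gcs)"
proof -
  have "segment I 0 (k # (int (length fs) # concat cls) @
      (int (length xs) # concat (map (\<lambda>x. [int x + 1, \<nu> (Var_node x)]) xs)) @ (int n # concat gcs))"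
    using segment_mem[of ins] ins by simp
  then have 1: "I 0 = k" "I 1 = int (length fs)" "segment I 2 (concat cls)"
    "segment I (2 + int (length (concat cls))) ((int (length xs) # concat (map (\<lambda>x. [int x + 1, \<nu> (Var_node x)]) xs)) @ (int n # concat gcs))"
    by (simp_all only: segment_Cons segment_append append_Cons list.size) (simp_all add: add.assoc)
  then show "I 0 = k" "I 1 = int (length fs)" "segment I 2 (concat cls)" by blast+
  from 1(4) have 2: "segment I vars_start (int (length xs) # concat (map (\<lambda>x. [int x + 1, \<nu> (Var_node x)]) xs))"
    "segment I (vars_start + int (length (int (length xs) # concat (map (\<lambda>x. [int x + 1, \<nu> (Var_node x)]) xs)))) (int n # concat gcs)"
    unfolding vars_start_def[symmetric] segment_append by blast+
  have "vars_start + int (length (int (length xs) # concat (map (\<lambda>x. [int x + 1, \<nu> (Var_node x)]) xs))) = graphs_start"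
    unfolding graphs_start_def list.size(4) length_concat_pairs by simp
  with 2 show "I vars_start = int (length xs)" "segment I (vars_start + 1) (concat (map (\<lambda>x. [int x + 1, \<nu> (Var_node x)]) xs))"
    "I graphs_start = int n" "segment I (graphs_start + 1) (concat gcs)" by (simp_all only: segment_Cons)
qed

lemma length_ins: "int (length ins) = graphs_start + 1 + int (length (concat gcs))"
proof -
  have "length ins = 2 + length (concat cls) + Suc (length xs + length xs) + Suc (length (concat gcs))"
    unfolding ins by (simp only: list.size length_append length_concat_pairs append_Cons)
  then show ?thesis unfolding graphs_start_def vars_start_def by simp
qed

lemma clause_code:
  assumes "i < length fs"
  obtains ls where "cls ! i = \<nu> (Clause_node (fs ! i)) # int (length ls) # map lit_code ls" "set ls = fs ! i"
proof -
  have "enc_clause \<nu> (fs ! i) (cls ! i)" using list_all2_nthD[OF cls assms] .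
  then obtain ls cs where 1: "set ls = fs ! i" "list_all2 (\<lambda>l c. c = [lit_code l]) ls cs"
    "cls ! i = \<nu> (Clause_node (fs ! i)) # int (length ls) # concat cs"
    unfolding enc_clause_def enc_set_def enc_list_def by blast
  from 1(2) have "cs = map (\<lambda>l. [lit_code l]) ls" unfolding list_all2_eq_map .
  with 1 that concat_singletons show ?thesis by metis
qed

lemma clause_segment:
  "i < length fs \<Longrightarrow> segment I (2 + int (length (concat (take i cls)))) (cls ! i)"
  using segment_concat[OF input_segments(3)] len_cls by simp

text \<open>The loop bound only has to reach the number of clauses, not the length of the input. The
  program relies on this while it is still determining that length.\<close>

lemma off_clause_eq:
  assumes c: "fst c = I" "i \<le> length fs" "length fs \<le> snd c"
  shows "off_clause c (int i) = 2 + int (length (concat (take i cls)))"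
proof -
  have "iter i (\<lambda>_ a. a + 2 + I (a + 1)) 2 = 2 + int (length (concat (take i cls)))"
    using c(2)
  proof (induction i)
    case (Suc i)
    then have i: "i < length fs" by simp
    obtain ls where ls: "cls ! i = \<nu> (Clause_node (fs ! i)) # int (length ls) # map lit_code ls"
      using clause_code[OF i] .
    let ?p = "2 + int (length (concat (take i cls)))"
    have "I (?p + 1) = int (length ls)" using clause_segment[OF i] unfolding ls by (simp only: segment_Cons)
    then have "?p + 2 + I (?p + 1) = 2 + int (length (concat (take (Suc i) cls)))"
      using length_concat_take[of i cls] len_cls i ls by simp
    then show ?case using Suc i by simp
  qed simp
  moreover have "min (snd c) i = i" using c by simp
  ultimately show ?thesis unfolding off_clause_def iter_cap nat_int c(1) by simp
qed

lemma off_vars_eq: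
  assumes c: "fst c = I" "length fs \<le> snd c"
  shows "off_vars c = vars_start" "num_vars c = int (length xs)" "off_seq c = graphs_start" "num_graphs c = int n"
proof -
  show 1: "off_vars c = vars_start"
    unfolding off_vars_def c(1) input_segments(2) off_clause_eq[OF c(1) order_refl c(2)] vars_start_def using len_cls by simp
  show 2: "num_vars c = int (length xs)" unfolding num_vars_def 1 c(1) input_segments(4) ..
  show 3: "off_seq c = graphs_start" unfolding off_seq_def 1 2 graphs_start_def ..
  show "num_graphs c = int n" unfolding num_graphs_def 3 c(1) input_segments(6) ..
qed

lemma graph_code:
  assumes "t < n"
  obtains vs P N R where "gcs ! t = (int (length vs) # map \<nu> vs) @ P @ N @ R" "distinct vs" "set vs = verts (Gs ! t)"
    "edge_list \<nu> (pos_edges (Gs ! t)) P" "edge_list \<nu> (neg_edges (Gs ! t)) N" "edge_list \<nu> (red_edges (Gs ! t)) R"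
proof -
  have "enc_trigraph \<nu> (Gs ! t) (gcs ! t)" using list_all2_nthD[OF gcs assms] .
  then obtain A P N R where 1: "enc_set (enc_node \<nu>) (verts (Gs ! t)) A"
    "enc_set (enc_edge \<nu>) (pos_edges (Gs ! t)) P" "enc_set (enc_edge \<nu>) (neg_edges (Gs ! t)) N"
    "enc_set (enc_edge \<nu>) (red_edges (Gs ! t)) R" "gcs ! t = A @ P @ N @ R"
    unfolding enc_trigraph_def by blast
  from 1(1) obtain vs cs where vs: "distinct vs" "set vs = verts (Gs ! t)"
    "list_all2 (\<lambda>x code. code = [\<nu> x]) vs cs" "A = int (length vs) # concat cs"
    unfolding enc_set_def enc_list_def enc_node_def by blast
  from vs(3) have "cs = map (\<lambda>x. [\<nu> x]) vs" unfolding list_all2_eq_map .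
  then have "A = int (length vs) # map \<nu> vs" using vs(4) concat_singletons by metis
  with 1(5) vs(1,2) enc_set_edge_list[OF 1(2)] enc_set_edge_list[OF 1(3)] enc_set_edge_list[OF 1(4)] that
  show ?thesis by metis
qed

lemma graph_segment:
  "t < n \<Longrightarrow> segment I (graphs_start + 1 + int (length (concat (take t gcs)))) (gcs ! t)"
  using segment_concat[OF input_segments(7)] len_gcs by simp

lemma edge_segments:
  assumes c: "fst c = I" and seg: "segment I g ((int (length vs) # map \<nu> vs) @ P @ N @ R)"
    and el: "edge_list \<nu> EP P" "edge_list \<nu> EN N" "edge_list \<nu> ER R"
  shows "segment I (pos_base c g) P" "segment I (neg_base c g) N" "segment I (red_base c g) R"
    "after_edges c (red_base c g) = g + int (length ((int (length vs) # map \<nu> vs) @ P @ N @ R))"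
proof -
  let ?p = "g + int (length (int (length vs) # map \<nu> vs))"
  have 1: "segment I g (int (length vs) # map \<nu> vs)" "segment I ?p P" "segment I (?p + int (length P)) N"
    "segment I (?p + int (length P) + int (length N)) R" using seg unfolding segment_append by blast+
  have "I g = int (length vs)" using 1(1) by (simp only: segment_Cons)
  then have p: "pos_base c g = ?p" unfolding pos_base_def c by simp
  have q: "neg_base c g = ?p + int (length P)"
    unfolding neg_base_def p after_edges_def c using edge_list_length[OF el(1) 1(2)] by simp
  have r: "red_base c g = ?p + int (length P) + int (length N)"
    unfolding red_base_def q after_edges_def c using edge_list_length[OF el(2) 1(3)] by simp
  show "segment I (pos_base c g) P" "segment I (neg_base c g) N" "segment I (red_base c g) R"
    unfolding p q r using 1 by blast+
  show "after_edges c (red_base c g) = g + int (length ((int (length vs) # map \<nu> vs) @ P @ N @ R))"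
    unfolding r after_edges_def c using edge_list_length[OF el(3) 1(4)] by simp
qed

lemma off_graph_eq:
  assumes c: "fst c = I" "length fs \<le> snd c" "n \<le> snd c" and t: "t \<le> n"
  shows "off_graph c (int t) = graphs_start + 1 + int (length (concat (take t gcs)))"
proof -
  have "iter t (\<lambda>_ a. after_edges c (red_base c a)) (graphs_start + 1) = graphs_start + 1 + int (length (concat (take t gcs)))"
    using t
  proof (induction t)
    case (Suc t)
    then have tn: "t < n" by simp
    obtain vs P N R where g: "gcs ! t = (int (length vs) # map \<nu> vs) @ P @ N @ R"
      "edge_list \<nu> (pos_edges (Gs ! t)) P" "edge_list \<nu> (neg_edges (Gs ! t)) N" "edge_list \<nu> (red_edges (Gs ! t)) R"
      using graph_code[OF tn] by metis
    note b = edge_segments(4)[OF c(1) graph_segment[OF tn, unfolded g(1)] g(2-4)]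
    show ?case using Suc tn b length_concat_take[of t gcs] len_gcs g(1) by simp
  qed simp
  moreover have "min (snd c) t = t" using c t by simp
  ultimately show ?thesis unfolding off_graph_def iter_cap nat_int off_vars_eq(3)[OF c(1,2)] by simp
qed

text \<open>The sequence is the last part of the input, so the position after its last trigraph is
  the length of the input, which is stored nowhere.\<close>

lemma off_graph_end:
  assumes c: "fst c = I" "length fs \<le> snd c" "n \<le> snd c"
  shows "off_graph c (num_graphs c) = int (length ins)"
  unfolding off_vars_eq(4)[OF c(1,2)] off_graph_eq[OF c order_refl] length_ins using len_gcs by simp

lemma length_bounds: "length fs \<le> length ins" "2 * length xs \<le> length ins" "n \<le> length ins"
  "length rs = 2 * length xs" "4 \<le> length ins" "length fs + n \<le> length ins"
  and length_graph: "t < n \<Longrightarrow> length (gcs ! t) < length ins"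
proof -
  have li: "length ins = 2 + length (concat cls) + Suc (length xs + length xs) + Suc (length (concat gcs))"
    unfolding ins by (simp only: list.size length_append length_concat_pairs append_Cons)
  have "length cls \<le> length (concat cls)"
  proof (rule length_concat_ge)
    fix c assume "c \<in> set cls"
    then obtain i where i: "i < length fs" "c = cls ! i" using len_cls by (metis in_set_conv_nth)
    from clause_code[OF i(1)] show "1 \<le> length c" unfolding i(2) by (metis One_nat_def Suc_leI length_Cons zero_less_Suc)
  qed
  moreover have "length gcs \<le> length (concat gcs)"
  proof (rule length_concat_ge)
    fix c assume "c \<in> set gcs"
    then obtain i where i: "i < n" "c = gcs ! i" using len_gcs by (metis in_set_conv_nth)
    obtain vs P N R where "gcs ! i = (int (length vs) # map \<nu> vs) @ P @ N @ R" using graph_code[OF i(1)] by metis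
    then show "1 \<le> length c" unfolding i(2) by simp
  qed
  ultimately show "length fs \<le> length ins" "2 * length xs \<le> length ins" "n \<le> length ins" "4 \<le> length ins"
    "length fs + n \<le> length ins" using li len_cls len_gcs by simp_all
  show "length rs = 2 * length xs" unfolding rs length_concat_pairs by simp
  show "length (gcs ! t) < length ins" if "t < n"
    using nth_le_length_concat[of t gcs] that len_gcs li by simp
qed

end

section \<open>Bags of vertices along the sequence\<close>

context encoded_instance
begin

text \<open>\<open>is_contraction\<close> leaves the name of the merged vertex existential; it is
  determined as the only vertex that is new.\<close>

definition newn :: "nat \<Rightarrow> node" where
  "newn t = (THE x. x \<in> verts (Gs ! Suc t) \<and> x \<notin> verts (Gs ! t))"

primrec bagn :: "nat \<Rightarrow> node \<Rightarrow> node" where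
  "bagn 0 v = v"
| "bagn (Suc t) v = (if bagn t v \<in> verts (Gs ! Suc t) then bagn t v else newn t)"

lemma contraction_seq: "is_contraction_sequence (incidence_graph F) Gs"
  using dseq unfolding is_d_sequence_def by simp

lemma trigraph: "t < n \<Longrightarrow> is_signed_trigraph (Gs ! t)"
  using contraction_seq unfolding is_contraction_sequence_def by simp

lemma edge_subset:
  "t < n \<Longrightarrow> e \<in> pos_edges (Gs ! t) \<union> neg_edges (Gs ! t) \<union> red_edges (Gs ! t) \<Longrightarrow> e \<subseteq> verts (Gs ! t) \<and> card e = 2"
  using trigraph unfolding is_signed_trigraph_def by blast

lemma finite_verts: "t < n \<Longrightarrow> finite (verts (Gs ! t))"
  using trigraph unfolding is_signed_trigraph_def by blast

lemma first_trigraph: "0 < n \<Longrightarrow> Gs ! 0 = incidence_graph F"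
  using contraction_seq hd_conv_nth[of Gs] unfolding is_contraction_sequence_def by auto

lemma contractE:
  assumes "Suc t < n"
  obtains u v where "u \<in> verts (Gs ! t)" "v \<in> verts (Gs ! t)" "u \<noteq> v" "newn t \<notin> verts (Gs ! t)"
    "Gs ! Suc t = contract (Gs ! t) u v (newn t)"
proof -
  have "is_contraction (Gs ! t) (Gs ! Suc t)"
    using contraction_seq assms unfolding is_contraction_sequence_def by blast
  then obtain u v x where 1: "u \<in> verts (Gs ! t)" "v \<in> verts (Gs ! t)" "u \<noteq> v" "x \<notin> verts (Gs ! t)"
    "Gs ! Suc t = contract (Gs ! t) u v x" unfolding is_contraction_def by blast
  have tn: "t < n" using assms by simp
  have "verts (Gs ! Suc t) = insert x (verts (Gs ! t) - {u, v})"
    unfolding 1(5) contract_def Let_def by simp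
  then have "newn t = x" unfolding newn_def using 1(4) by (intro the_equality) auto
  with 1 that show ?thesis by blast
qed

lemma verts_Suc:
  assumes "Suc t < n"
  obtains u v where "u \<in> verts (Gs ! t)" "v \<in> verts (Gs ! t)" "u \<noteq> v" "newn t \<notin> verts (Gs ! t)"
    "verts (Gs ! Suc t) = insert (newn t) (verts (Gs ! t) - {u, v})"
proof -
  obtain u v where 1: "u \<in> verts (Gs ! t)" "v \<in> verts (Gs ! t)" "u \<noteq> v" "newn t \<notin> verts (Gs ! t)"
    "Gs ! Suc t = contract (Gs ! t) u v (newn t)" using contractE[OF assms] .
  have "verts (Gs ! Suc t) = insert (newn t) (verts (Gs ! t) - {u, v})"
    unfolding 1(5) contract_def Let_def by simp
  with 1(1-4) that show ?thesis by blast
qed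

lemma card_verts: "t < n \<Longrightarrow> card (verts (Gs ! t)) = n - t"
proof (induction t)
  case 0
  then show ?case using contraction_seq first_trigraph unfolding is_contraction_sequence_def by simp
next
  case (Suc t)
  have tn: "t < n" using Suc.prems by simp
  obtain u v where 1: "u \<in> verts (Gs ! t)" "v \<in> verts (Gs ! t)" "u \<noteq> v" "newn t \<notin> verts (Gs ! t)"
    "Gs ! Suc t = contract (Gs ! t) u v (newn t)" using contractE[OF Suc.prems] .
  show ?case using card_contract[OF trigraph[OF tn] 1] Suc.IH[OF tn] by simp
qed

text \<open>Positive and negative edges between bags pull back to the given graph, by
  \<open>pos_contract\<close> and \<open>neg_contract\<close> at each step. Conversely an edge of
  the given graph survives between the bags of its ends unless these are merged; so missing edges
  between bags are homogeneous too.\<close>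

lemma bagn_props:
  "t < n \<Longrightarrow> a \<in> verts (Gs ! 0) \<Longrightarrow> b \<in> verts (Gs ! 0) \<Longrightarrow>
    bagn t a \<in> verts (Gs ! t) \<and>
    ({bagn t a, bagn t b} \<in> pos_edges (Gs ! t) \<longrightarrow> {a, b} \<in> pos_edges (Gs ! 0)) \<and>
    ({bagn t a, bagn t b} \<in> neg_edges (Gs ! t) \<longrightarrow> {a, b} \<in> neg_edges (Gs ! 0)) \<and>
    ({a, b} \<in> pos_edges (Gs ! 0) \<union> neg_edges (Gs ! 0) \<union> red_edges (Gs ! 0) \<longrightarrow> bagn t a = bagn t b \<or>
      {bagn t a, bagn t b} \<in> pos_edges (Gs ! t) \<union> neg_edges (Gs ! t) \<union> red_edges (Gs ! t))"
proof (induction t arbitrary: a b)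
  case (Suc t)
  have tn: "t < n" using Suc.prems by simp
  obtain u v where c: "u \<in> verts (Gs ! t)" "v \<in> verts (Gs ! t)" "u \<noteq> v" "newn t \<notin> verts (Gs ! t)"
    "Gs ! Suc t = contract (Gs ! t) u v (newn t)" using contractE[OF Suc.prems(1)] .
  let ?p = "\<lambda>x. if x \<in> verts (Gs ! Suc t) then x else newn t"
  note c' = trigraph[OF tn] c refl[of "?p _"]
  have b: "bagn (Suc t) x = ?p (bagn t x)" for x by simp
  note IHa = Suc.IH[OF tn Suc.prems(2,3)] and IHb = Suc.IH[OF tn Suc.prems(3,2)]
  have va: "bagn t a \<in> verts (Gs ! t)" "bagn t b \<in> verts (Gs ! t)" using IHa IHb by blast+
  show ?case unfolding b
  proof (intro conjI impI)
    show "?p (bagn t a) \<in> verts (Gs ! Suc t)" using image_in[OF c' va(1)] .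
    show "{a, b} \<in> pos_edges (Gs ! 0)" if "{?p (bagn t a), ?p (bagn t b)} \<in> pos_edges (Gs ! Suc t)"
      using pos_contract[OF c' va that] IHa by blast
    show "{a, b} \<in> neg_edges (Gs ! 0)" if "{?p (bagn t a), ?p (bagn t b)} \<in> neg_edges (Gs ! Suc t)"
      using neg_contract[OF c' va that] IHa by blast
    assume "{a, b} \<in> pos_edges (Gs ! 0) \<union> neg_edges (Gs ! 0) \<union> red_edges (Gs ! 0)"
    then consider "bagn t a = bagn t b"
      | "{bagn t a, bagn t b} \<in> pos_edges (Gs ! t) \<union> neg_edges (Gs ! t) \<union> red_edges (Gs ! t)" using IHa by blast
    then show "?p (bagn t a) = ?p (bagn t b) \<or> {?p (bagn t a), ?p (bagn t b)}
      \<in> pos_edges (Gs ! Suc t) \<union> neg_edges (Gs ! Suc t) \<union> red_edges (Gs ! Suc t)"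
    proof cases
      case 2
      then show ?thesis using edge_contract(1)[OF c' va] by blast
    qed simp
  qed
qed auto

lemma red_step:
  assumes t: "Suc t < n" and e: "{a, b} \<in> red_edges (Gs ! t)"
  defines "p \<equiv> \<lambda>x. if x \<in> verts (Gs ! Suc t) then x else newn t"
  shows "p a = p b \<or> {p a, p b} \<in> red_edges (Gs ! Suc t)"
proof -
  have tn: "t < n" using t by simp
  obtain u v where c: "u \<in> verts (Gs ! t)" "v \<in> verts (Gs ! t)" "u \<noteq> v" "newn t \<notin> verts (Gs ! t)"
    "Gs ! Suc t = contract (Gs ! t) u v (newn t)" using contractE[OF t] .
  have ab: "a \<in> verts (Gs ! t)" "b \<in> verts (Gs ! t)" using edge_subset[OF tn, of "{a, b}"] e by auto
  have p: "p x = (if x \<in> verts (Gs ! Suc t) then x else newn t)" for x unfolding p_def ..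
  have "{a, b} \<in> pos_edges (Gs ! t) \<union> neg_edges (Gs ! t) \<union> red_edges (Gs ! t)" using e by blast
  from edge_contract(2)[OF trigraph[OF tn] c p ab this e] show ?thesis .
qed

text \<open>Injectivity holds across all levels together, so comparing names from different levels
  is the same as comparing vertices.\<close>

lemma nu_inj: "t < n \<Longrightarrow> t' < n \<Longrightarrow> a \<in> verts (Gs ! t) \<Longrightarrow> b \<in> verts (Gs ! t') \<Longrightarrow> \<nu> a = \<nu> b \<longleftrightarrow> a = b"
  using inj unfolding inj_on_def by (metis UN_I nth_mem)

text \<open>The facts below hold for every loop bound that reaches the length of the input. They are
  used for this length itself and for the final, much larger bound.\<close>

definition big :: "inp \<Rightarrow> bool" where "big c \<longleftrightarrow> fst c = I \<and> length ins \<le> snd c"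

lemma bigD:
  assumes "big c"
  shows "fst c = I" "length fs \<le> snd c" "n \<le> snd c" "length ins \<le> snd c"
  using assms length_bounds unfolding big_def by auto

lemma graph_facts:
  assumes c: "big c" and t: "t < n"
  obtains vs where "distinct vs" "set vs = verts (Gs ! t)" "num_verts c (int t) = int (length vs)"
    "length vs < length ins" "\<And>j. j < length vs \<Longrightarrow> vert c (int t) (int j) = \<nu> (vs ! j)"
    "\<And>x y. pos_edge c (int t) x y \<longleftrightarrow> (\<exists>a b. x = \<nu> a \<and> y = \<nu> b \<and> {a, b} \<in> pos_edges (Gs ! t))"
    "\<And>x y. neg_edge c (int t) x y \<longleftrightarrow> (\<exists>a b. x = \<nu> a \<and> y = \<nu> b \<and> {a, b} \<in> neg_edges (Gs ! t))"
    "\<And>x y. red_edge c (int t) x y \<longleftrightarrow> (\<exists>a b. x = \<nu> a \<and> y = \<nu> b \<and> {a, b} \<in> red_edges (Gs ! t))"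
proof -
  obtain vs P N R where g: "gcs ! t = (int (length vs) # map \<nu> vs) @ P @ N @ R" "distinct vs" "set vs = verts (Gs ! t)"
    "edge_list \<nu> (pos_edges (Gs ! t)) P" "edge_list \<nu> (neg_edges (Gs ! t)) N" "edge_list \<nu> (red_edges (Gs ! t)) R"
    using graph_code[OF t] .
  let ?g = "off_graph c (int t)"
  have og: "?g = graphs_start + 1 + int (length (concat (take t gcs)))"
    using off_graph_eq[OF bigD(1-3)[OF c]] t by simp
  have sg: "segment I ?g ((int (length vs) # map \<nu> vs) @ P @ N @ R)"
    using graph_segment[OF t] unfolding og g(1) .
  note b = edge_segments[OF bigD(1)[OF c] sg g(4-6)]
  have len: "length P \<le> snd c" "length N \<le> snd c" "length R \<le> snd c" "length vs < length ins"
    using length_graph[OF t] bigD(4)[OF c] unfolding g(1) by simp_all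
  from sg have s1: "I ?g = int (length vs)" "segment I (?g + 1) (map \<nu> vs)"
    unfolding segment_append segment_Cons by blast+
  show ?thesis
  proof (rule that[OF g(2,3) _ len(4)])
    show "num_verts c (int t) = int (length vs)" unfolding num_verts_def bigD(1)[OF c] by (rule s1(1))
    show "vert c (int t) (int j) = \<nu> (vs ! j)" if "j < length vs" for j
      using s1(2) that unfolding vert_def bigD(1)[OF c] segment_def by simp
  qed (unfold pos_edge_def neg_edge_def red_edge_def,
    (rule edge_list_edge_at[OF g(4) b(1)[folded bigD(1)[OF c]] len(1)]
        edge_list_edge_at[OF g(5) b(2)[folded bigD(1)[OF c]] len(2)]
        edge_list_edge_at[OF g(6) b(3)[folded bigD(1)[OF c]] len(3)])+)
qed

lemma edge_facts:
  assumes "big c" "t < n"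
  shows "pos_edge c (int t) x y \<longleftrightarrow> (\<exists>a b. x = \<nu> a \<and> y = \<nu> b \<and> {a, b} \<in> pos_edges (Gs ! t))"
    "neg_edge c (int t) x y \<longleftrightarrow> (\<exists>a b. x = \<nu> a \<and> y = \<nu> b \<and> {a, b} \<in> neg_edges (Gs ! t))"
    "red_edge c (int t) x y \<longleftrightarrow> (\<exists>a b. x = \<nu> a \<and> y = \<nu> b \<and> {a, b} \<in> red_edges (Gs ! t))"
  using graph_facts[OF assms] by metis+

lemma edge_nu:
  assumes c: "big c" "t < n" and ab: "a \<in> verts (Gs ! t)" "b \<in> verts (Gs ! t)"
  shows "pos_edge c (int t) (\<nu> a) (\<nu> b) \<longleftrightarrow> {a, b} \<in> pos_edges (Gs ! t)"
    "neg_edge c (int t) (\<nu> a) (\<nu> b) \<longleftrightarrow> {a, b} \<in> neg_edges (Gs ! t)"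
    "red_edge c (int t) (\<nu> a) (\<nu> b) \<longleftrightarrow> {a, b} \<in> red_edges (Gs ! t)"
proof -
  have "(\<exists>a' b'. \<nu> a = \<nu> a' \<and> \<nu> b = \<nu> b' \<and> {a', b'} \<in> E) \<longleftrightarrow> {a, b} \<in> E"
    if E: "E \<subseteq> pos_edges (Gs ! t) \<union> neg_edges (Gs ! t) \<union> red_edges (Gs ! t)" for E
  proof
    assume "\<exists>a' b'. \<nu> a = \<nu> a' \<and> \<nu> b = \<nu> b' \<and> {a', b'} \<in> E"
    then obtain a' b' where 1: "\<nu> a = \<nu> a'" "\<nu> b = \<nu> b'" "{a', b'} \<in> E" by blast
    then have "{a', b'} \<subseteq> verts (Gs ! t)" using edge_subset[OF c(2), of "{a', b'}"] E by blast
    then have "a = a'" "b = b'" using 1(1,2) nu_inj[OF c(2) c(2)] ab by auto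
    then show "{a, b} \<in> E" using 1(3) by simp
  qed blast
  note e = this
  show "pos_edge c (int t) (\<nu> a) (\<nu> b) \<longleftrightarrow> {a, b} \<in> pos_edges (Gs ! t)"
    "neg_edge c (int t) (\<nu> a) (\<nu> b) \<longleftrightarrow> {a, b} \<in> neg_edges (Gs ! t)"
    "red_edge c (int t) (\<nu> a) (\<nu> b) \<longleftrightarrow> {a, b} \<in> red_edges (Gs ! t)"
    unfolding edge_facts[OF c] by (rule e; blast)+
qed

lemma is_vert_eq:
  assumes c: "big c" and t: "t < n"
  shows "is_vert c (int t) y \<longleftrightarrow> (\<exists>v\<in>verts (Gs ! t). y = \<nu> v)"
proof -
  obtain vs where vs: "set vs = verts (Gs ! t)" "num_verts c (int t) = int (length vs)"
    "length vs < length ins" "\<And>j. j < length vs \<Longrightarrow> vert c (int t) (int j) = \<nu> (vs ! j)"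
    using graph_facts[OF c t] by metis
  have le: "int (length vs) \<le> int (snd c)" using vs(3) bigD(4)[OF c] by simp
  have "is_vert c (int t) y \<longleftrightarrow> (\<exists>j\<in>{0..<int (length vs)}. vert c (int t) j = y)"
    unfolding is_vert_def vs(2) bex_range[OF le] ..
  also have "\<dots> \<longleftrightarrow> (\<exists>j<length vs. \<nu> (vs ! j) = y)"
  proof
    assume "\<exists>j\<in>{0..<int (length vs)}. vert c (int t) j = y"
    then obtain j where "j \<in> {0..<int (length vs)}" "vert c (int t) j = y" by blast
    then show "\<exists>j<length vs. \<nu> (vs ! j) = y" using vs(4)[of "nat j"] by (intro exI[of _ "nat j"]) auto
  next
    assume "\<exists>j<length vs. \<nu> (vs ! j) = y"
    then obtain j where "j < length vs" "\<nu> (vs ! j) = y" by blast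
    then show "\<exists>j\<in>{0..<int (length vs)}. vert c (int t) j = y" using vs(4)[of j] by (intro bexI[of _ "int j"]) auto
  qed
  also have "\<dots> \<longleftrightarrow> (\<exists>v\<in>verts (Gs ! t). y = \<nu> v)" unfolding vs(1)[symmetric] by (metis in_set_conv_nth)
  finally show ?thesis .
qed

lemma is_vert_nu:
  assumes "big c" "t < n" "t' < n" "v \<in> verts (Gs ! t')"
  shows "is_vert c (int t) (\<nu> v) \<longleftrightarrow> v \<in> verts (Gs ! t)"
  unfolding is_vert_eq[OF assms(1,2)] using nu_inj[OF assms(3,2,4)] by blast

lemma vert_found:
  assumes c: "big c" and t: "t < n" and v: "v \<in> verts (Gs ! t)" "P (\<nu> v)"
  shows "\<exists>v'\<in>verts (Gs ! t). vert c (int t) (search c (\<lambda>j. j < num_verts c (int t) \<and> P (vert c (int t) j))) = \<nu> v' \<and> P (\<nu> v')"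
proof -
  let ?P = "\<lambda>j. j < num_verts c (int t) \<and> P (vert c (int t) j)"
  let ?j = "search c ?P"
  have "is_vert c (int t) (\<nu> v)" using is_vert_eq[OF c t] v(1) by blast
  then obtain i where i: "i \<in> range_of c" "i < num_verts c (int t)" "vert c (int t) i = \<nu> v"
    unfolding is_vert_def by blast
  then have "?P i" using v(2) by simp
  note j = search_found(1,2)[of i c ?P, OF i(1) this]
  then have "is_vert c (int t) (vert c (int t) ?j)" unfolding is_vert_def by blast
  then obtain v' where v': "v' \<in> verts (Gs ! t)" "vert c (int t) ?j = \<nu> v'" using is_vert_eq[OF c t] by blast
  have "P (vert c (int t) ?j)" using j(2) by simp
  then have "P (\<nu> v')" unfolding v'(2) .
  with v' show ?thesis by blast
qed

lemma new_vert_eq: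
  assumes c: "big c" and t: "Suc t < n"
  shows "new_vert c (int t) = \<nu> (newn t)"
proof -
  obtain u v where uv: "newn t \<notin> verts (Gs ! t)"
    "verts (Gs ! Suc t) = insert (newn t) (verts (Gs ! t) - {u, v})" using verts_Suc[OF t] by metis
  have tn: "t < n" using t by simp
  have vS: "newn t \<in> verts (Gs ! Suc t)" using uv(2) by blast
  have nv: "\<not> is_vert c (int t) (\<nu> (newn t))" using is_vert_nu[OF c tn t vS] uv(1) by simp
  have nvq: "new_vert c (int t) = vert c (int (Suc t)) (search c (\<lambda>j. j < num_verts c (int (Suc t)) \<and>
      \<not> is_vert c (int t) (vert c (int (Suc t)) j)))"
    unfolding new_vert_def by (simp add: add.commute)
  obtain z where z: "z \<in> verts (Gs ! Suc t)" "vert c (int (Suc t)) (search c (\<lambda>j. j < num_verts c (int (Suc t)) \<and>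
      \<not> is_vert c (int t) (vert c (int (Suc t)) j))) = \<nu> z" "\<not> is_vert c (int t) (\<nu> z)"
    using vert_found[OF c t vS, of "\<lambda>y. \<not> is_vert c (int t) y", OF nv] by blast
  have zn: "new_vert c (int t) = \<nu> z" using trans[OF nvq z(2)] .
  from z(3) have "z \<notin> verts (Gs ! t)" using is_vert_nu[OF c tn t z(1)] by simp
  then have "z = newn t" using z(1) uv(2) by blast
  then show ?thesis using zn by simp
qed

end

context encoded_instance
begin

lemma old_vert_eq:
  assumes c: "big c" and t: "Suc t < n"
  obtains u where "old_vert c (int t) = \<nu> u" "u \<in> verts (Gs ! t)" "u \<notin> verts (Gs ! Suc t)"
proof -
  obtain u v where uv: "u \<in> verts (Gs ! t)" "newn t \<notin> verts (Gs ! t)"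
    "verts (Gs ! Suc t) = insert (newn t) (verts (Gs ! t) - {u, v})" using verts_Suc[OF t] by metis
  have tn: "t < n" using t by simp
  have "u \<notin> verts (Gs ! Suc t)" using uv by auto
  then have nv: "\<not> is_vert c (int (Suc t)) (\<nu> u)" using is_vert_nu[OF c t tn uv(1)] by simp
  have ovq: "old_vert c (int t) = vert c (int t) (search c (\<lambda>j. j < num_verts c (int t) \<and>
      \<not> is_vert c (int (Suc t)) (vert c (int t) j)))"
    unfolding old_vert_def by (simp add: add.commute)
  obtain z where z: "z \<in> verts (Gs ! t)" "vert c (int t) (search c (\<lambda>j. j < num_verts c (int t) \<and>
      \<not> is_vert c (int (Suc t)) (vert c (int t) j))) = \<nu> z" "\<not> is_vert c (int (Suc t)) (\<nu> z)"
    using vert_found[OF c tn uv(1), of "\<lambda>y. \<not> is_vert c (int (Suc t)) y", OF nv] by blast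
  have "z \<notin> verts (Gs ! Suc t)" using z(3) is_vert_nu[OF c t tn z(1)] by simp
  with that[OF trans[OF ovq z(2)] z(1)] show ?thesis by blast
qed

lemma parent_eq:
  assumes c: "big c" and t: "Suc t < n" and v: "v \<in> verts (Gs ! t)"
  shows "parent c (int t) (\<nu> v) = \<nu> (if v \<in> verts (Gs ! Suc t) then v else newn t)"
proof -
  have tn: "t < n" using t by simp
  have "is_vert c (int t + 1) (\<nu> v) \<longleftrightarrow> v \<in> verts (Gs ! Suc t)"
    using is_vert_nu[OF c t tn v] by (simp add: add.commute)
  then show ?thesis unfolding parent_def new_vert_eq[OF c t] by simp
qed

lemma bag_eq:
  assumes c: "big c" and t: "t < n" and v: "v \<in> verts (Gs ! 0)"
  shows "bag c (int t) (\<nu> v) = \<nu> (bagn t v)"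
proof -
  have "iter t (parent c) (\<nu> v) = \<nu> (bagn t v)" using t
  proof (induction t)
    case (Suc t)
    then have "t < n" by simp
    then have "bagn t v \<in> verts (Gs ! t)" using bagn_props[OF _ v v] by blast
    then show ?case using Suc parent_eq[OF c Suc.prems] by simp
  qed simp
  moreover have "min (snd c) t = t" using bigD(3)[OF c] t by simp
  ultimately show ?thesis unfolding bag_def iter_cap nat_int by simp
qed

lemma var_name:
  assumes "fst c = I" "j < length xs"
  shows "fst c (vars_start + 1 + int j + int j) = int (xs ! j) + 1" "fst c (vars_start + 2 + int j + int j) = \<nu> (Var_node (xs ! j))"
proof -
  note p = concat_pairs_nth[OF input_segments(5) assms(2)]
  show "fst c (vars_start + 1 + int j + int j) = int (xs ! j) + 1" unfolding assms(1) by (rule p(1))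
  have e: "vars_start + 2 + int j + int j = vars_start + 1 + int j + int j + 1" by simp
  show "fst c (vars_start + 2 + int j + int j) = \<nu> (Var_node (xs ! j))" unfolding assms(1) e by (rule p(2))
qed

lemma var_in: "0 < n \<Longrightarrow> j < length xs \<Longrightarrow> Var_node (xs ! j) \<in> verts (Gs ! 0)"
  using first_trigraph xs(2) nth_mem[of j xs] by (simp add: incidence_graph_def)

lemma clause_in: "0 < n \<Longrightarrow> i < length fs \<Longrightarrow> Clause_node (fs ! i) \<in> verts (Gs ! 0)"
  using first_trigraph fs(2) nth_mem[of i fs] by (simp add: incidence_graph_def)

lemma var_bag_eq:
  assumes c: "big c" and t: "t < n" and j: "j < length xs"
  shows "var_bag c (int t) (int j) = \<nu> (bagn t (Var_node (xs ! j)))"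
proof -
  have "off_vars c = vars_start" using off_vars_eq(1)[OF bigD(1,2)[OF c]] .
  moreover have "Var_node (xs ! j) \<in> verts (Gs ! 0)" using t by (intro var_in[OF _ j]) linarith
  ultimately show ?thesis unfolding var_bag_def using var_name(2)[OF bigD(1)[OF c] j] bag_eq[OF c t] by simp
qed

lemma clause_segment':
  assumes c: "big c" and i: "i < length fs"
  obtains ls where "fst c (off_clause c (int i)) = \<nu> (Clause_node (fs ! i))"
    "fst c (off_clause c (int i) + 1) = int (length ls)" "segment (fst c) (off_clause c (int i) + 2) (map lit_code ls)"
    "set ls = fs ! i" "length ls \<le> snd c"
proof -
  obtain ls where ls: "cls ! i = \<nu> (Clause_node (fs ! i)) # int (length ls) # map lit_code ls" "set ls = fs ! i"
    using clause_code[OF i] .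
  let ?p = "off_clause c (int i)"
  have "?p = 2 + int (length (concat (take i cls)))" using off_clause_eq[OF bigD(1)[OF c] _ bigD(2)[OF c]] i by simp
  then have s: "segment I ?p (\<nu> (Clause_node (fs ! i)) # int (length ls) # map lit_code ls)"
    using clause_segment[OF i] ls by simp
  have "length (cls ! i) \<le> length (concat cls)" using nth_le_length_concat[of i cls] i len_cls by simp
  also have "\<dots> \<le> length ins" unfolding ins by simp
  finally have len: "length ls \<le> snd c" using ls(1) bigD(4)[OF c] by simp
  have "?p + 1 + 1 = ?p + 2" by simp
  with s have "I ?p = \<nu> (Clause_node (fs ! i))" "I (?p + 1) = int (length ls)" "segment I (?p + 2) (map lit_code ls)"
    unfolding segment_Cons by (simp_all only:)
  with that ls(2) len show ?thesis unfolding bigD(1)[OF c] by blast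
qed

lemma clause_bag_eq:
  assumes c: "big c" and t: "t < n" and i: "i < length fs"
  shows "clause_bag c (int t) (int i) = \<nu> (bagn t (Clause_node (fs ! i)))"
proof -
  have "fst c (off_clause c (int i)) = \<nu> (Clause_node (fs ! i))" using clause_segment'[OF c i] by metis
  moreover have "Clause_node (fs ! i) \<in> verts (Gs ! 0)" using t by (intro clause_in[OF _ i]) linarith
  ultimately show ?thesis unfolding clause_bag_def using bag_eq[OF c t] by simp
qed

lemma has_lit_eq:
  assumes c: "big c" and i: "i < length fs"
  shows "has_lit c (int i) (lit_code l) \<longleftrightarrow> l \<in> fs ! i"
proof -
  let ?p = "off_clause c (int i)"
  obtain ls where ls: "fst c (?p + 1) = int (length ls)" "segment (fst c) (?p + 2) (map lit_code ls)"
    "set ls = fs ! i" "length ls \<le> snd c" using clause_segment'[OF c i] by metis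
  have le: "int (length ls) \<le> int (snd c)" using ls(4) by simp
  have v: "fst c (?p + 2 + int j) = lit_code (ls ! j)" if "j < length ls" for j
    using ls(2) that unfolding segment_def by simp
  have "has_lit c (int i) (lit_code l) \<longleftrightarrow> (\<exists>j\<in>{0..<int (length ls)}. fst c (?p + 2 + j) = lit_code l)"
    unfolding has_lit_def ls(1) bex_range[OF le] ..
  also have "\<dots> \<longleftrightarrow> l \<in> set ls"
  proof
    assume "\<exists>j\<in>{0..<int (length ls)}. fst c (?p + 2 + j) = lit_code l"
    then obtain j where j: "j \<in> {0..<int (length ls)}" "fst c (?p + 2 + j) = lit_code l" by blast
    then have "lit_code (ls ! nat j) = lit_code l" "nat j < length ls" using v[of "nat j"] by auto
    then show "l \<in> set ls" using lit_code_inj by (metis nth_mem)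
  next
    assume "l \<in> set ls"
    then obtain j where "j < length ls" "ls ! j = l" by (metis in_set_conv_nth)
    then show "\<exists>j\<in>{0..<int (length ls)}. fst c (?p + 2 + j) = lit_code l"
      using v[of j] by (intro bexI[of _ "int j"]) auto
  qed
  finally show ?thesis unfolding ls(3) .
qed

lemma has_pos_neg_eq:
  assumes c: "big c" and i: "i < length fs" and j: "j < length xs"
  shows "has_pos c (int i) (int j) \<longleftrightarrow> Pos (xs ! j) \<in> fs ! i"
    "has_neg c (int i) (int j) \<longleftrightarrow> Neg (xs ! j) \<in> fs ! i"
proof -
  have o: "off_vars c = vars_start" using off_vars_eq(1)[OF bigD(1,2)[OF c]] .
  note v = var_name(1)[OF bigD(1)[OF c] j]
  have p: "int (xs ! j) + 1 = lit_code (Pos (xs ! j))" "0 - (int (xs ! j) + 1) = lit_code (Neg (xs ! j))" by simp_all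
  show "has_pos c (int i) (int j) \<longleftrightarrow> Pos (xs ! j) \<in> fs ! i"
    unfolding has_pos_def o v unfolding p(1) by (rule has_lit_eq[OF c i])
  show "has_neg c (int i) (int j) \<longleftrightarrow> Neg (xs ! j) \<in> fs ! i"
    unfolding has_neg_def o v unfolding p(2) by (rule has_lit_eq[OF c i])
qed

section \<open>Red degrees and their least bound\<close>

definition red_nbs :: "nat \<Rightarrow> node \<Rightarrow> nat" where
  "red_nbs t v = card {v' \<in> verts (Gs ! t). {v, v'} \<in> red_edges (Gs ! t)}"

lemma red_nbs_le: assumes t: "t < n" and v: "v \<in> verts (Gs ! t)" shows "red_nbs t v \<le> d"
proof -
  have "red_nbs t v \<le> red_degree (Gs ! t) v"
    unfolding red_nbs_def red_degree_def
  proof (rule card_inj_on_le[of "\<lambda>v'. {v, v'}"])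
    show "inj_on (\<lambda>v'. {v, v'}) {v' \<in> verts (Gs ! t). {v, v'} \<in> red_edges (Gs ! t)}"
      by (rule inj_onI) (auto simp: doubleton_eq_iff)
    have "{e \<in> red_edges (Gs ! t). v \<in> e} \<subseteq> Pow (verts (Gs ! t))" using edge_subset[OF t] by blast
    then show "finite {e \<in> red_edges (Gs ! t). v \<in> e}" using finite_verts[OF t] finite_subset by blast
  qed auto
  also have "\<dots> \<le> d" using dseq t v unfolding is_d_sequence_def by auto
  finally show ?thesis .
qed

lemma red_deg_eq:
  assumes c: "big c" and t: "t < n" and v: "v \<in> verts (Gs ! t)"
  shows "red_deg c (int t) (\<nu> v) = int (red_nbs t v)"
proof -
  obtain vs where vs: "distinct vs" "set vs = verts (Gs ! t)" "num_verts c (int t) = int (length vs)"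
    "length vs < length ins" "\<And>j. j < length vs \<Longrightarrow> vert c (int t) (int j) = \<nu> (vs ! j)"
    using graph_facts[OF c t] by metis
  let ?A = "{j \<in> range_of c. j < num_verts c (int t) \<and> red_edge c (int t) (\<nu> v) (vert c (int t) j)}"
  let ?B = "{v' \<in> verts (Gs ! t). {v, v'} \<in> red_edges (Gs ! t)}"
  have j: "vert c (int t) j = \<nu> (vs ! nat j)" "nat j < length vs" "vs ! nat j \<in> verts (Gs ! t)"
    if "j \<in> range_of c" "j < num_verts c (int t)" for j
  proof -
    show 1: "nat j < length vs" using that vs(3) unfolding range_of_def by (auto simp: nat_less_iff)
    show "vert c (int t) j = \<nu> (vs ! nat j)" using vs(5)[OF 1] that unfolding range_of_def by simp
    show "vs ! nat j \<in> verts (Gs ! t)" using 1 vs(2) nth_mem by blast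
  qed
  have "bij_betw (\<lambda>j. vs ! nat j) ?A ?B"
  proof (rule bij_betwI')
    fix x y assume "x \<in> ?A" "y \<in> ?A"
    then show "(vs ! nat x = vs ! nat y) = (x = y)"
      using j(2)[of x] j(2)[of y] vs(1) by (auto simp: nth_eq_iff_index_eq range_of_def)
  next
    fix x assume "x \<in> ?A"
    then show "vs ! nat x \<in> ?B" using j[of x] edge_nu(3)[OF c t v, of "vs ! nat x"] by simp
  next
    fix v' assume v': "v' \<in> ?B"
    then obtain i where i: "i < length vs" "vs ! i = v'" using vs(2) by (metis (no_types, lifting) in_set_conv_nth mem_Collect_eq)
    have "int i \<in> ?A" using i v' vs(3,4) vs(5)[OF i(1)] bigD(4)[OF c] edge_nu(3)[OF c t v, of v'] by (simp add: range_of_def)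
    then show "\<exists>x\<in>?A. v' = vs ! nat x" using i(2) by (intro bexI[of _ "int i"]) simp_all
  qed
  then show ?thesis unfolding red_deg_def sum_if_card red_nbs_def by (simp add: bij_betw_same_card)
qed

text \<open>The first, second and fourth statements characterise \<open>max_deg c\<close> as a least
  bound without reference to \<open>snd c\<close>. The search succeeds because a vertex has fewer
  red neighbours than the input has cells.\<close>

lemma max_deg_props:
  assumes c: "big c"
  shows "0 \<le> max_deg c" "\<And>t v. t < n \<Longrightarrow> v \<in> verts (Gs ! t) \<Longrightarrow> int (red_nbs t v) \<le> max_deg c"
    "max_deg c < int (length ins)"
    "\<And>D. 0 \<le> D \<Longrightarrow> (\<And>t v. t < n \<Longrightarrow> v \<in> verts (Gs ! t) \<Longrightarrow> int (red_nbs t v) \<le> D) \<Longrightarrow> max_deg c \<le> D"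
proof -
  let ?Q = "\<lambda>D. \<forall>t<n. \<forall>v\<in>verts (Gs ! t). int (red_nbs t v) \<le> D"
  have ng: "num_graphs c = int n" "int n \<le> int (snd c)" using off_vars_eq(4)[OF bigD(1,2)[OF c]] bigD(3)[OF c] by auto
  have inner: "(\<forall>l\<in>range_of c. l < num_verts c (int t) \<longrightarrow> red_deg c (int t) (vert c (int t) l) \<le> D) \<longleftrightarrow>
    (\<forall>v\<in>verts (Gs ! t). int (red_nbs t v) \<le> D)" if t: "t < n" for t D
  proof -
    have "(\<forall>l\<in>range_of c. l < num_verts c (int t) \<longrightarrow> red_deg c (int t) (vert c (int t) l) \<le> D) \<longleftrightarrow>
      (\<forall>y. is_vert c (int t) y \<longrightarrow> red_deg c (int t) y \<le> D)" unfolding is_vert_def by blast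
    also have "\<dots> \<longleftrightarrow> (\<forall>v\<in>verts (Gs ! t). red_deg c (int t) (\<nu> v) \<le> D)" unfolding is_vert_eq[OF c t] by blast
    finally show ?thesis using red_deg_eq[OF c t] by simp
  qed
  have P: "(\<forall>t\<in>range_of c. t < num_graphs c \<longrightarrow> (\<forall>l\<in>range_of c. l < num_verts c t \<longrightarrow> red_deg c t (vert c t l) \<le> D)) \<longleftrightarrow> ?Q D" for D
  proof -
    have "(\<forall>t\<in>{0..<int n}. R t) \<longleftrightarrow> (\<forall>t<n. R (int t))" for R
    proof
      assume a: "\<forall>t<n. R (int t)"
      show "\<forall>t\<in>{0..<int n}. R t"
      proof
        fix t assume t: "t \<in> {0..<int n}"
        then have "nat t < n" by (auto simp: nat_less_iff)
        with a have "R (int (nat t))" by blast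
        then show "R t" using t by simp
      qed
    qed simp
    then show ?thesis unfolding ng(1) ball_range[OF ng(2)] using inner by simp
  qed
  have md: "max_deg c = search c ?Q" unfolding max_deg_def by (rule arg_cong[where f = "search c"], rule ext, rule P)
  have small: "int (red_nbs t v) \<le> int (length ins) - 1" if t: "t < n" "v \<in> verts (Gs ! t)" for t v
  proof -
    obtain vs where vs: "distinct vs" "set vs = verts (Gs ! t)" "length vs < length ins"
      using graph_facts[OF c t(1)] by metis
    have "red_nbs t v \<le> card (verts (Gs ! t))" unfolding red_nbs_def using finite_verts[OF t(1)] by (intro card_mono) auto
    also have "\<dots> \<le> length vs" unfolding vs(2)[symmetric] by (rule card_length)
    finally show ?thesis using vs(3) by simp
  qed
  have r: "int (length ins) - 1 \<in> range_of c" using bigD(4)[OF c] length_bounds(5) by (auto simp: range_of_def)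
  have q: "?Q (int (length ins) - 1)" using small by blast
  note sf = search_found[of "int (length ins) - 1" c ?Q, OF r q, folded md]
  show "0 \<le> max_deg c" using sf(1) unfolding range_of_def by simp
  show "int (red_nbs t v) \<le> max_deg c" if "t < n" "v \<in> verts (Gs ! t)" for t v using sf(2) that by blast
  show "max_deg c < int (length ins)" using sf(3) by simp
  show "max_deg c \<le> D" if "0 \<le> D" "\<And>t v. t < n \<Longrightarrow> v \<in> verts (Gs ! t) \<Longrightarrow> int (red_nbs t v) \<le> D" for D
  proof (cases "D \<in> range_of c")
    case True
    have "?Q D" using that(2) by blast
    from search_found(3)[of D c ?Q, OF True this] show ?thesis unfolding md .
  next
    case False
    then have "int (snd c) \<le> D" using that(1) unfolding range_of_def by simp
    then show ?thesis using sf(1) unfolding range_of_def by simp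
  qed
qed

lemma max_deg_le_d: "big c \<Longrightarrow> max_deg c \<le> int d"
  by (rule max_deg_props(4)) (use red_nbs_le in auto)

text \<open>The base is computed with the length of the input as loop bound, but the table is filled
  under the final bound, which is itself derived from the base. Both evaluations must agree.\<close>

lemma max_deg_unique: "big c \<Longrightarrow> big c' \<Longrightarrow> max_deg c = max_deg c'"
  using max_deg_props(1,2) max_deg_props(4)[of c "max_deg c'"] max_deg_props(4)[of c' "max_deg c"] by (meson antisym)

lemma base_unique: "big c \<Longrightarrow> big c' \<Longrightarrow> base c = base c'"
  unfolding base_def using max_deg_unique bigD(1) by metis

end

section \<open>An encoded input satisfies the assumptions on the levels\<close>

context encoded_instance
begin

lemma int_index: "j \<in> {0..<int l} \<Longrightarrow> \<exists>i<l. j = int i"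
  by (intro exI[of _ "nat j"]) (auto simp: nat_less_iff)

lemma V_image: "big c \<Longrightarrow> t < n \<Longrightarrow> {y. is_vert c (int t) y} = \<nu> ` verts (Gs ! t)"
  using is_vert_eq by auto

lemma pos_first: "0 < n \<Longrightarrow> {Clause_node C, Var_node x} \<in> pos_edges (Gs ! 0) \<longleftrightarrow> C \<in> F \<and> Pos x \<in> C"
  using first_trigraph by (auto simp: incidence_graph_def doubleton_eq_iff)

lemma neg_first: "0 < n \<Longrightarrow> {Clause_node C, Var_node x} \<in> neg_edges (Gs ! 0) \<longleftrightarrow> C \<in> F \<and> Neg x \<in> C"
  using first_trigraph by (auto simp: incidence_graph_def doubleton_eq_iff)

lemma graph_verts:
  assumes c: "big c" and t: "t < n"
  obtains vs where "distinct vs" "set vs = verts (Gs ! t)" "num_verts c (int t) = int (length vs)"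
    "length vs < length ins" "\<forall>j<length vs. vert c (int t) (int j) = \<nu> (vs ! j)"
  by (rule graph_facts[OF c t], rule that) (assumption | intro allI impI)+

lemma contraction_levels_input:
  assumes c: "big c"
  shows "contraction_levels {0..<num_vars c} {0..<fst c 1} (has_pos c) (has_neg c) (nat (num_graphs c))
    (\<lambda>t. {y. is_vert c (int t) y}) (\<lambda>t. pos_edge c (int t))
    (\<lambda>t. neg_edge c (int t)) (\<lambda>t. red_edge c (int t)) (\<lambda>t. parent c (int t)) (\<lambda>t. var_bag c (int t))
    (\<lambda>t. clause_bag c (int t)) (\<lambda>t. old_vert c (int t)) (\<lambda>t. new_vert c (int t))"
proof -
  have eqs: "nat (num_graphs c) = n" "num_vars c = int (length xs)" "fst c 1 = int (length fs)"
    using off_vars_eq[OF bigD(1,2)[OF c]] bigD(1)[OF c] input_segments(2) by simp_all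
  have vn: "Var_node (xs ! j) \<in> verts (Gs ! 0)" if "t < n" "j < length xs" for t j
    using that by (intro var_in) linarith+
  have cn: "Clause_node (fs ! i) \<in> verts (Gs ! 0)" if "t < n" "i < length fs" for t i
    using that by (intro clause_in) linarith+
  have bv: "bagn t (Var_node (xs ! j)) \<in> verts (Gs ! t)" if "t < n" "j < length xs" for t j
    using bagn_props[OF that(1) vn[OF that] vn[OF that]] by blast
  have bc: "bagn t (Clause_node (fs ! i)) \<in> verts (Gs ! t)" if "t < n" "i < length fs" for t i
    using bagn_props[OF that(1) cn[OF that] cn[OF that]] by blast
  have red_sym: "red_edge c t y x" if "red_edge c t x y" for t x y
    using that unfolding red_edge_def edge_at_def by blast
  have pair_commute: "{b, a} = {a, b}" for a b :: node by (rule insert_commute)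
  have n0: "0 < n" if "t < n" for t using that by linarith
  show ?thesis
    unfolding eqs
  proof (unfold_locales, goal_cases)
    case 1 show ?case by simp
  next
    case (2 t) 
    have "{y. is_vert c (int t) y} \<subseteq> vert c (int t) ` range_of c" unfolding is_vert_def by auto
    then show ?case by (rule finite_subset) simp
  next
    case (3 t j)
    then obtain i where i: "i < length xs" "j = int i" using int_index by blast
    show ?case unfolding V_image[OF c 3(1)] i(2) var_bag_eq[OF c 3(1) i(1)] using bv[OF 3(1) i(1)] by blast
  next
    case (4 t j)
    then obtain i where i: "i < length fs" "j = int i" using int_index by blast
    show ?case unfolding V_image[OF c 4(1)] i(2) clause_bag_eq[OF c 4(1) i(1)] using bc[OF 4(1) i(1)] by blast
  next
    case (5 t j)
    then obtain i where i: "i < length xs" "j = int i" using int_index by blast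
    have tn: "t < n" using 5 by simp
    show ?case unfolding i(2) var_bag_eq[OF c 5(1) i(1)] var_bag_eq[OF c tn i(1)] parent_eq[OF c 5(1) bv[OF tn i(1)]] by simp
  next
    case (6 t j)
    then obtain i where i: "i < length fs" "j = int i" using int_index by blast
    have tn: "t < n" using 6 by simp
    show ?case unfolding i(2) clause_bag_eq[OF c 6(1) i(1)] clause_bag_eq[OF c tn i(1)] parent_eq[OF c 6(1) bc[OF tn i(1)]] by simp
  next
    case (7 t x y) then show ?case by (rule red_sym)
  next
    case (8 t x y)
    then obtain a b where "x = \<nu> a" "{a, b} \<in> red_edges (Gs ! t)" using edge_facts(3)[OF c 8(1), of x y] by blast
    moreover then have "a \<in> verts (Gs ! t)" using edge_subset[OF 8(1), of "{a, b}"] by blast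
    ultimately show ?case unfolding V_image[OF c 8(1)] by blast
  next
    case (9 t x y)
    have tn: "t < n" using 9 by simp
    from 9(2) obtain a b where ab: "x = \<nu> a" "y = \<nu> b" "{a, b} \<in> red_edges (Gs ! t)"
      using edge_facts(3)[OF c tn, of x y] by blast
    have v: "a \<in> verts (Gs ! t)" "b \<in> verts (Gs ! t)" using edge_subset[OF tn, of "{a, b}"] ab(3) by blast+
    let ?p = "\<lambda>x. if x \<in> verts (Gs ! Suc t) then x else newn t"
    have p: "parent c (int t) x = \<nu> (?p a)" "parent c (int t) y = \<nu> (?p b)"
      unfolding ab by (rule parent_eq[OF c 9(1) v(1)], rule parent_eq[OF c 9(1) v(2)])
    from red_step[OF 9(1) ab(3)] have "?p a = ?p b \<or> {?p a, ?p b} \<in> red_edges (Gs ! Suc t)" .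
    then have "\<nu> (?p a) = \<nu> (?p b) \<or> red_edge c (int (Suc t)) (\<nu> (?p a)) (\<nu> (?p b))"
    proof
      assume "?p a = ?p b" then show ?thesis by (intro disjI1) (rule arg_cong)
    next
      assume "{?p a, ?p b} \<in> red_edges (Gs ! Suc t)"
      then show ?thesis unfolding edge_facts(3)[OF c 9(1)] by (intro disjI2 exI conjI) (assumption | rule refl)+
    qed
    then show ?case unfolding p .
  next
    case (10 t i j)
    obtain i' j' where i: "i' < length fs" "i = int i'" and j: "j' < length xs" "j = int j'" using int_index[OF 10(2)] int_index[OF 10(3)] by blast
    from 10(4) have "{bagn t (Var_node (xs ! j')), bagn t (Clause_node (fs ! i'))} \<in> pos_edges (Gs ! t)"
      unfolding i(2) j(2) var_bag_eq[OF c 10(1) j(1)] clause_bag_eq[OF c 10(1) i(1)]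
        edge_nu(1)[OF c 10(1) bv[OF 10(1) j(1)] bc[OF 10(1) i(1)]] .
    then have "{Var_node (xs ! j'), Clause_node (fs ! i')} \<in> pos_edges (Gs ! 0)"
      using bagn_props[OF 10(1) vn[OF 10(1) j(1)] cn[OF 10(1) i(1)]] by blast
    then have "Pos (xs ! j') \<in> fs ! i'" using pos_first[OF n0[OF 10(1)], of "fs ! i'" "xs ! j'"] unfolding pair_commute[of "Clause_node (fs ! i')" "Var_node (xs ! j')"] by blast
    then show ?case unfolding i(2) j(2) has_pos_neg_eq(1)[OF c i(1) j(1)] .
  next
    case (11 t i j)
    obtain i' j' where i: "i' < length fs" "i = int i'" and j: "j' < length xs" "j = int j'" using int_index[OF 11(2)] int_index[OF 11(3)] by blast
    from 11(4) have "{bagn t (Var_node (xs ! j')), bagn t (Clause_node (fs ! i'))} \<in> neg_edges (Gs ! t)"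
      unfolding i(2) j(2) var_bag_eq[OF c 11(1) j(1)] clause_bag_eq[OF c 11(1) i(1)]
        edge_nu(2)[OF c 11(1) bv[OF 11(1) j(1)] bc[OF 11(1) i(1)]] .
    then have "{Var_node (xs ! j'), Clause_node (fs ! i')} \<in> neg_edges (Gs ! 0)"
      using bagn_props[OF 11(1) vn[OF 11(1) j(1)] cn[OF 11(1) i(1)]] by blast
    then have "Neg (xs ! j') \<in> fs ! i'" using neg_first[OF n0[OF 11(1)], of "fs ! i'" "xs ! j'"] unfolding pair_commute[of "Clause_node (fs ! i')" "Var_node (xs ! j')"] by blast
    then show ?case unfolding i(2) j(2) has_pos_neg_eq(2)[OF c i(1) j(1)] .
  next
    case (12 t i j)
    obtain i' j' where i: "i' < length fs" "i = int i'" and j: "j' < length xs" "j = int j'" using int_index[OF 12(2)] int_index[OF 12(3)] by blast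
    let ?v = "Var_node (xs ! j')" and ?C = "Clause_node (fs ! i')"
    have "Pos (xs ! j') \<in> fs ! i' \<or> Neg (xs ! j') \<in> fs ! i'"
      using 12(4) unfolding i(2) j(2) has_pos_neg_eq[OF c i(1) j(1)] .
    moreover have "fs ! i' \<in> F" using i(1) fs(2) nth_mem by blast
    ultimately have "{?v, ?C} \<in> pos_edges (Gs ! 0) \<union> neg_edges (Gs ! 0) \<union> red_edges (Gs ! 0)"
      using pos_first[OF n0[OF 12(1)], of "fs ! i'" "xs ! j'"] neg_first[OF n0[OF 12(1)], of "fs ! i'" "xs ! j'"]
      unfolding pair_commute[of ?C ?v] by blast
    then have "bagn t ?v = bagn t ?C \<or> {bagn t ?v, bagn t ?C} \<in> pos_edges (Gs ! t) \<union> neg_edges (Gs ! t) \<union> red_edges (Gs ! t)"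
      using bagn_props[OF 12(1) vn[OF 12(1) j(1)] cn[OF 12(1) i(1)]] by blast
    then show ?case
      unfolding i(2) j(2) var_bag_eq[OF c 12(1) j(1)] clause_bag_eq[OF c 12(1) i(1)]
        edge_nu[OF c 12(1) bv[OF 12(1) j(1)] bc[OF 12(1) i(1)]] by auto
  next
    case (13 i j)
    obtain i' j' where i: "i' < length fs" "i = int i'" and j: "j' < length xs" "j = int j'" using int_index[OF 13(1)] int_index[OF 13(2)] by blast
    have "is_clause (fs ! i')" using cnf i(1) fs(2) nth_mem unfolding is_cnf_def by blast
    then show ?case using 13(3) unfolding i(2) j(2) has_pos_neg_eq[OF c i(1) j(1)] is_clause_def by blast
  next
    case (14 t)
    have tn: "t < n" using 14 by simp
    obtain x where x: "old_vert c (int t) = \<nu> x" "x \<in> verts (Gs ! t)" "x \<notin> verts (Gs ! Suc t)" using old_vert_eq[OF c 14] .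
    obtain a b where ab: "a \<in> verts (Gs ! t)" "b \<in> verts (Gs ! t)" "a \<noteq> b" "newn t \<notin> verts (Gs ! t)"
      "verts (Gs ! Suc t) = insert (newn t) (verts (Gs ! t) - {a, b})" using verts_Suc[OF 14] .
    \<comment> \<open>\<open>old_vert\<close> yields one of the two contracted vertices, whichever
      is listed first; \<open>y\<close> is the other one.\<close>
    have "\<exists>y. y \<in> verts (Gs ! t) \<and> x \<noteq> y \<and> {a, b} = {x, y}"
    proof (cases "x = a")
      case True then show ?thesis using ab by blast
    next
      case False
      then have "x = b" using x(2,3) ab(5) by blast
      then show ?thesis using ab by blast
    qed
    then obtain y where y: "y \<in> verts (Gs ! t)" "x \<noteq> y" "{a, b} = {x, y}" by blast
    have nin: "newn t \<in> verts (Gs ! Suc t)" unfolding ab(5) by blast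
    have ni: "inj_on \<nu> (verts (Gs ! t))" using nu_inj[OF tn tn] by (auto intro!: inj_onI)
    have "\<nu> ` verts (Gs ! Suc t) = insert (\<nu> (newn t)) (\<nu> ` verts (Gs ! t) - {\<nu> x, \<nu> y})"
      unfolding ab(5) y(3) image_insert using inj_on_image_set_diff[OF ni, of "verts (Gs ! t)" "{x, y}"] x(2) y(1) by simp
    moreover have "\<nu> (newn t) \<notin> \<nu> ` verts (Gs ! t)"
      using nu_inj[OF 14 tn nin] ab(4) by blast
    moreover have "\<nu> x \<noteq> \<nu> y" using nu_inj[OF tn tn x(2) y(1)] y(2) by simp
    ultimately show ?case unfolding V_image[OF c tn] V_image[OF c 14] x(1) new_vert_eq[OF c 14]
      using x(2) y(1) by (intro exI[of _ "\<nu> y"]) blast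
  next
    case (15 t x)
    show ?case unfolding parent_def by (simp add: add.commute)
  qed
qed

lemma table_input_holds:
  assumes c: "big c" and k: "0 \<le> k"
    and X: "base c ^ nat (base c ^ nat (2 * (k * k + 1))) \<le> int (snd c)"
  shows "table_input c"
proof -
  have ng: "num_graphs c = int n" "num_vars c = int (length xs)" "fst c 1 = int (length fs)" "fst c 0 = k"
    using off_vars_eq[OF bigD(1,2)[OF c]] bigD(1)[OF c] input_segments(1,2) by simp_all
  have n0: "0 < n" if "0 < num_graphs c" using that unfolding ng by linarith
  show ?thesis
  proof (rule table_input.intro[OF contraction_levels_input[OF c]], unfold_locales, goal_cases)
    case 1 show ?case unfolding ng by (rule k)
  next
    case 2 show ?case unfolding ng by (rule X)
  next
    case 3 show ?case by (rule max_deg_props(1)[OF c])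
  next
    case (4 t x)
    then have tn: "t < n" unfolding ng by simp
    obtain v where v: "v \<in> verts (Gs ! t)" "x = \<nu> v" using 4(2) unfolding is_vert_eq[OF c tn] by (elim bexE)
    show ?case unfolding v(2) red_deg_eq[OF c tn v(1)] by (rule max_deg_props(2)[OF c tn v(1)])
  next
    case (5 t)
    then have tn: "t < n" unfolding ng by simp
    obtain vs where vs: "distinct vs" "set vs = verts (Gs ! t)" "num_verts c (int t) = int (length vs)"
      "length vs < length ins" "\<forall>j<length vs. vert c (int t) (int j) = \<nu> (vs ! j)"
      using graph_verts[OF c tn] .
    show ?case unfolding vs(3) using vs(4) bigD(4)[OF c] by linarith
  next
    case (6 t)
    then have tn: "t < n" unfolding ng by simp
    obtain vs where vs: "distinct vs" "set vs = verts (Gs ! t)" "num_verts c (int t) = int (length vs)"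
      "length vs < length ins" "\<forall>j<length vs. vert c (int t) (int j) = \<nu> (vs ! j)"
      using graph_verts[OF c tn] .
    show ?case
    proof (rule inj_onI)
      fix a b assume "a \<in> {0..<num_verts c (int t)}" "b \<in> {0..<num_verts c (int t)}"
        and eq: "vert c (int t) a = vert c (int t) b"
      then have "\<exists>i<length vs. a = int i" "\<exists>i<length vs. b = int i" unfolding vs(3) using int_index by blast+
      then obtain i j where ij: "i < length vs" "a = int i" "j < length vs" "b = int j" by blast
      have "vs ! i \<in> verts (Gs ! t)" "vs ! j \<in> verts (Gs ! t)" using ij vs(2) nth_mem by blast+
      then have "vs ! i = vs ! j" using eq vs(5) ij nu_inj[OF tn tn] by simp
      then show "a = b" using ij vs(1) nth_eq_iff_index_eq by blast
    qed
  next
    case 7 show ?case unfolding ng using length_bounds(2) bigD(4)[OF c] by simp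
  next
    case 8 show ?case unfolding ng by simp
  next
    case 9 show ?case unfolding ng using bigD(2)[OF c] by simp
  next
    case 10 show ?case unfolding ng using bigD(3)[OF c] by simp
  next
    case (11 x y)
    have n: "0 < n" by (rule n0[OF 11])
    show ?case using edge_facts(3)[OF c n, of x y] first_trigraph[OF n] by (simp add: incidence_graph_def)
  next
    case 12
    have n: "0 < n" by (rule n0[OF 12])
    show ?case
    proof (rule inj_onI)
      fix a b assume "a \<in> {0..<num_vars c}" "b \<in> {0..<num_vars c}" and eq: "var_bag c 0 a = var_bag c 0 b"
      then have "\<exists>i<length xs. a = int i" "\<exists>i<length xs. b = int i" unfolding ng using int_index by blast+
      then obtain i j where ij: "i < length xs" "a = int i" "j < length xs" "b = int j" by blast
      have "\<nu> (Var_node (xs ! i)) = \<nu> (Var_node (xs ! j))"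
        using eq var_bag_eq[OF c n ij(1)] var_bag_eq[OF c n ij(3)] ij by simp
      then have "xs ! i = xs ! j" using nu_inj[OF n n var_in[OF n ij(1)] var_in[OF n ij(3)]] by simp
      then show "a = b" using ij xs(1) nth_eq_iff_index_eq by blast
    qed
  next
    case (13 i j)
    have n: "0 < n" by (rule n0[OF 13(1)])
    obtain i' j' where i: "i' < length fs" "i = int i'" and j: "j' < length xs" "j = int j'"
      using int_index[OF 13(2)[unfolded ng]] int_index[OF 13(3)[unfolded ng]] by blast
    show ?case using var_bag_eq[OF c n j(1)] clause_bag_eq[OF c n i(1)] nu_inj[OF n n clause_in[OF n i(1)] var_in[OF n j(1)]]
      unfolding i(2) j(2) by simp
  next
    case 14
    have n: "0 < n" by (rule n0[OF 14])
    then have t: "n - 1 < n" "int (n - 1) = int n - 1" by linarith+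
    have "card (verts (Gs ! (n - 1))) = 1" using card_verts[OF t(1)] n by simp
    then obtain v where "verts (Gs ! (n - 1)) = {v}" using card_1_singletonE by blast
    then have "{y. is_vert c (int n - 1) y} = {\<nu> v}" using V_image[OF c t(1)] unfolding t(2) by simp
    then show ?case unfolding ng by blast
  next
    case 15
    then have n: "n = 0" unfolding ng by simp
    have f: "finite (verts (incidence_graph F))"
    proof -
      have "finite F" "finite (vars F)" using fs(2) xs(2) List.finite_set by metis+
      then show ?thesis unfolding incidence_graph_def by simp
    qed
    have "card (verts (incidence_graph F)) = 0" using contraction_seq n unfolding is_contraction_sequence_def by simp
    then have "verts (incidence_graph F) = {}" using f by simp
    moreover have "Var_node ` vars F \<subseteq> verts (incidence_graph F)" unfolding incidence_graph_def by simp
    ultimately have "vars F = {}" by blast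
    then show ?case unfolding ng using xs(2) by simp
  qed
qed

section \<open>Assignments as sets of variable positions\<close>

abbreviation "Xs \<equiv> {0..<int (length xs)}"
definition var_at :: "int \<Rightarrow> nat" where "var_at j = xs ! nat j"
definition ones_of :: "(nat \<Rightarrow> nat) \<Rightarrow> int set" where "ones_of \<pi> = {j \<in> Xs. \<pi> (var_at j) = 1}"
text \<open>The value \<open>undefined\<close> outside \<open>vars F\<close> is the one prescribed
  for extensional functions; it makes \<open>assignment_of\<close> and \<open>ones_of\<close>
  inverse to each other.\<close>

definition assignment_of :: "int set \<Rightarrow> nat \<Rightarrow> nat" where
  "assignment_of S = (\<lambda>x. if x \<in> vars F then if x \<in> var_at ` S then 1 else 0 else undefined)"

lemma var_at_bij: "bij_betw var_at Xs (vars F)"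
proof (rule bij_betwI')
  fix a b assume "a \<in> Xs" "b \<in> Xs"
  then show "(var_at a = var_at b) = (a = b)"
    unfolding var_at_def using xs(1) by (auto simp: nth_eq_iff_index_eq nat_less_iff)
next
  fix a assume "a \<in> Xs"
  then have "nat a < length xs" by (auto simp: nat_less_iff)
  then show "var_at a \<in> vars F" unfolding var_at_def using xs(2) nth_mem by blast
next
  fix x assume "x \<in> vars F"
  then obtain i where "i < length xs" "xs ! i = x" using xs(2) by (metis in_set_conv_nth)
  then show "\<exists>a\<in>Xs. x = var_at a" unfolding var_at_def by (intro bexI[of _ "int i"]) auto
qed

lemma var_at_inj: "inj_on var_at Xs" and var_at_image: "var_at ` Xs = vars F"
  using var_at_bij unfolding bij_betw_def by blast+

lemma ones_of_subset: "ones_of \<pi> \<subseteq> Xs" unfolding ones_of_def by blast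

lemma ones_of_assignment:
  assumes S: "S \<subseteq> Xs" shows "ones_of (assignment_of S) = S"
proof -
  have "assignment_of S (var_at j) = 1 \<longleftrightarrow> j \<in> S" if "j \<in> Xs" for j
  proof -
    have "var_at j \<in> vars F" using that var_at_image by blast
    then show ?thesis unfolding assignment_of_def inj_on_image_mem_iff[OF var_at_inj that S] by simp
  qed
  then show ?thesis using S unfolding ones_of_def by blast
qed

lemma assignment_of_ones:
  assumes "\<pi> \<in> vars F \<rightarrow>\<^sub>E {0, 1}" shows "assignment_of (ones_of \<pi>) = \<pi>"
proof
  fix x
  show "assignment_of (ones_of \<pi>) x = \<pi> x"
  proof (cases "x \<in> vars F")
    case True
    then have "x \<in> var_at ` Xs" using var_at_image by simp
    then obtain j where j: "j \<in> Xs" "x = var_at j" by (elim imageE) simp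
    have "x \<in> var_at ` ones_of \<pi> \<longleftrightarrow> j \<in> ones_of \<pi>"
      unfolding j(2) by (rule inj_on_image_mem_iff[OF var_at_inj j(1) ones_of_subset])
    also have "\<dots> \<longleftrightarrow> \<pi> x = 1" using j unfolding ones_of_def by simp
    finally have m: "x \<in> var_at ` ones_of \<pi> \<longleftrightarrow> \<pi> x = 1" .
    have "\<pi> x \<in> {0, 1}" using assms True by (rule PiE_mem)
    then show ?thesis unfolding assignment_of_def m using True by (cases "\<pi> x = 1") simp_all
  next
    case False
    have "\<pi> x = undefined" using assms False by (rule PiE_arb)
    then show ?thesis using False unfolding assignment_of_def by simp
  qed
qed

lemma assignment_PiE: "assignment_of S \<in> vars F \<rightarrow>\<^sub>E {0, 1}"
  unfolding assignment_of_def by (auto simp: PiE_iff extensional_def)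

lemma ones_eq: "ones F \<pi> = card (ones_of \<pi>)"
proof -
  have "{v \<in> vars F. \<pi> v = 1} = var_at ` ones_of \<pi>" unfolding ones_of_def var_at_image[symmetric] by blast
  moreover have "inj_on var_at (ones_of \<pi>)" using var_at_inj ones_of_subset by (rule inj_on_subset)
  ultimately show ?thesis unfolding ones_def by (simp add: card_image)
qed

lemma models_eq:
  assumes "\<pi> \<in> vars F \<rightarrow>\<^sub>E {0, 1}"
  shows "\<pi> \<in> models F \<longleftrightarrow> (\<forall>i<length fs. \<exists>j\<in>Xs. Pos (var_at j) \<in> fs ! i \<and> j \<in> ones_of \<pi> \<or> Neg (var_at j) \<in> fs ! i \<and> j \<notin> ones_of \<pi>)"
proof -
  have "(\<exists>z\<in>C. lit_value \<pi> z = 1) \<longleftrightarrow>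
    (\<exists>j\<in>Xs. Pos (var_at j) \<in> C \<and> j \<in> ones_of \<pi> \<or> Neg (var_at j) \<in> C \<and> j \<notin> ones_of \<pi>)" if C: "C \<in> F" for C
  proof
    assume "\<exists>z\<in>C. lit_value \<pi> z = 1"
    then obtain z where z: "z \<in> C" "lit_value \<pi> z = 1" by blast
    show "\<exists>j\<in>Xs. Pos (var_at j) \<in> C \<and> j \<in> ones_of \<pi> \<or> Neg (var_at j) \<in> C \<and> j \<notin> ones_of \<pi>"
    proof (cases z)
      case (Pos x)
      then have "x \<in> vars F" using z C unfolding vars_def by blast
      then obtain j where j: "j \<in> Xs" "x = var_at j" using var_at_image by blast
      then have "Pos (var_at j) \<in> C" "j \<in> ones_of \<pi>" using z Pos unfolding ones_of_def by simp_all
      then show ?thesis using j(1) by blast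
    next
      case (Neg x)
      then have "x \<in> vars F" using z C unfolding vars_def by blast
      then obtain j where j: "j \<in> Xs" "x = var_at j" using var_at_image by blast
      then have "Neg (var_at j) \<in> C" "j \<notin> ones_of \<pi>" using z Neg unfolding ones_of_def by simp_all
      then show ?thesis using j(1) by blast
    qed
  next
    assume "\<exists>j\<in>Xs. Pos (var_at j) \<in> C \<and> j \<in> ones_of \<pi> \<or> Neg (var_at j) \<in> C \<and> j \<notin> ones_of \<pi>"
    then obtain j where j: "j \<in> Xs" "Pos (var_at j) \<in> C \<and> j \<in> ones_of \<pi> \<or> Neg (var_at j) \<in> C \<and> j \<notin> ones_of \<pi>" by blast
    have "var_at j \<in> vars F" using j(1) var_at_image by blast
    with assms have "\<pi> (var_at j) \<in> {0, 1}" by (rule PiE_mem)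
    then have v: "\<pi> (var_at j) = 0 \<or> \<pi> (var_at j) = 1" by blast
    from j(2) show "\<exists>z\<in>C. lit_value \<pi> z = 1"
    proof
      assume "Pos (var_at j) \<in> C \<and> j \<in> ones_of \<pi>"
      then show ?thesis unfolding ones_of_def by (intro bexI[of _ "Pos (var_at j)"]) auto
    next
      assume "Neg (var_at j) \<in> C \<and> j \<notin> ones_of \<pi>"
      then show ?thesis using v j(1) unfolding ones_of_def by (intro bexI[of _ "Neg (var_at j)"]) auto
    qed
  qed
  note eq = this
  have "\<pi> \<in> models F \<longleftrightarrow> (\<forall>C\<in>F. \<exists>z\<in>C. lit_value \<pi> z = 1)" using assms unfolding models_def by blast
  also have "\<dots> \<longleftrightarrow> (\<forall>C\<in>F. \<exists>j\<in>Xs. Pos (var_at j) \<in> C \<and> j \<in> ones_of \<pi> \<or> Neg (var_at j) \<in> C \<and> j \<notin> ones_of \<pi>)"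
    by (rule ball_cong[OF refl eq])
  also have "\<dots> \<longleftrightarrow> (\<forall>C\<in>set fs. \<exists>j\<in>Xs. Pos (var_at j) \<in> C \<and> j \<in> ones_of \<pi> \<or> Neg (var_at j) \<in> C \<and> j \<notin> ones_of \<pi>)"
    unfolding fs(2) ..
  also have "\<dots> \<longleftrightarrow> (\<forall>i<length fs. \<exists>j\<in>Xs. Pos (var_at j) \<in> fs ! i \<and> j \<in> ones_of \<pi> \<or> Neg (var_at j) \<in> fs ! i \<and> j \<notin> ones_of \<pi>)"
    by (rule all_set_conv_all_nth)
  finally show ?thesis .
qed

lemma weight_eq:
  assumes "\<pi> \<in> vars F \<rightarrow>\<^sub>E {0, 1}"
  shows "weight F w \<pi> = (\<Prod>j\<in>Xs. if j \<in> ones_of \<pi> then w (Pos (var_at j)) else w (Neg (var_at j)))"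
proof -
  have fin: "finite (vars F)" unfolding xs(2)[symmetric] by simp
  have z: "{v \<in> vars F. \<pi> v = 0} = {v \<in> vars F. \<not> \<pi> v = 1}" using assms by (auto simp: PiE_iff)
  have "weight F w \<pi> = (\<Prod>v\<in>vars F. if \<pi> v = 1 then w (Pos v) else w (Neg v))"
    unfolding weight_def z using prod.If_cases[OF fin, of "\<lambda>v. \<pi> v = 1" "\<lambda>v. w (Pos v)" "\<lambda>v. w (Neg v)"]
    by (simp add: Int_def)
  also have "\<dots> = (\<Prod>j\<in>Xs. if \<pi> (var_at j) = 1 then w (Pos (var_at j)) else w (Neg (var_at j)))"
    by (rule prod.reindex_bij_betw[OF var_at_bij, symmetric])
  finally show ?thesis unfolding ones_of_def by simp
qed

lemma weights_at: "j \<in> Xs \<Longrightarrow> mem_of_list rs (j + j) = w (Pos (var_at j)) \<and> mem_of_list rs (j + j + 1) = w (Neg (var_at j))"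
proof -
  assume "j \<in> Xs"
  then obtain i where i: "i < length xs" "j = int i" using int_index by blast
  have "segment (mem_of_list rs) 0 (concat (map (\<lambda>x. [w (Pos x), w (Neg x)]) xs))"
    using segment_mem[of rs] unfolding rs .
  from concat_pairs_nth[OF this i(1)] show ?thesis unfolding var_at_def i(2) by simp
qed

text \<open>For \<open>k < 0\<close> both sides vanish: no assignment qualifies, and the algorithm
  tests the sign of \<open>k\<close>. Otherwise an assignment corresponds to the set of positions of
  its ones.\<close>

theorem result_bwmc:
  assumes c: "big c" and X: "0 \<le> k \<Longrightarrow> base c ^ nat (base c ^ nat (2 * (k * k + 1))) \<le> int (snd c)"
  shows "result c (fill c (mem_of_list rs)) = bwmc F w k"
proof (cases "0 \<le> k")
  case False
  have "{\<pi> \<in> models F. int (ones F \<pi>) \<le> k} = {}" using False by auto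
  moreover have "fst c 0 = k" using bigD(1)[OF c] input_segments(1) by simp
  ultimately show ?thesis using False unfolding bwmc_def result_def by simp
next
  case k: True
  interpret T: table_input c "mem_of_list rs" by (rule table_input_holds[OF c k X[OF k]])
  have eqs: "num_vars c = int (length xs)" "fst c 1 = int (length fs)" "fst c 0 = k"
    using off_vars_eq[OF bigD(1,2)[OF c]] bigD(1)[OF c] input_segments(1,2) by simp_all
  let ?sat = "\<lambda>S. \<forall>i<length fs. \<exists>j\<in>Xs. Pos (var_at j) \<in> fs ! i \<and> j \<in> S \<or> Neg (var_at j) \<in> fs ! i \<and> j \<notin> S"
  let ?wt = "\<lambda>S. \<Prod>j\<in>Xs. if j \<in> S then w (Pos (var_at j)) else w (Neg (var_at j))"
  have sat: "(\<forall>i\<in>{0..<int (length fs)}. T.sat S i) \<longleftrightarrow> ?sat S" for S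
  proof -
    have h: "has_pos c (int i) j \<longleftrightarrow> Pos (var_at j) \<in> fs ! i" "has_neg c (int i) j \<longleftrightarrow> Neg (var_at j) \<in> fs ! i"
      if "i < length fs" "j \<in> Xs" for i j
    proof -
      from int_index[OF that(2)] obtain j' where j': "j' < length xs" "j = int j'" by blast
      show "has_pos c (int i) j \<longleftrightarrow> Pos (var_at j) \<in> fs ! i" "has_neg c (int i) j \<longleftrightarrow> Neg (var_at j) \<in> fs ! i"
        using has_pos_neg_eq[OF c that(1) j'(1)] unfolding var_at_def j'(2) nat_int by blast+
    qed
    have s: "T.sat S (int i) \<longleftrightarrow> (\<exists>j\<in>Xs. Pos (var_at j) \<in> fs ! i \<and> j \<in> S \<or> Neg (var_at j) \<in> fs ! i \<and> j \<notin> S)"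
      if "i < length fs" for i
      unfolding T.sat_def unfolding eqs using h[OF that] by blast
    have "(\<forall>i\<in>{0..<int (length fs)}. T.sat S i) \<longleftrightarrow> (\<forall>i<length fs. T.sat S (int i))"
    proof
      assume a: "\<forall>i<length fs. T.sat S (int i)"
      show "\<forall>i\<in>{0..<int (length fs)}. T.sat S i"
      proof
        fix i assume "i \<in> {0..<int (length fs)}"
        from int_index[OF this] a show "T.sat S i" by blast
      qed
    qed simp
    then show ?thesis using s by blast
  qed
  have wt: "T.weight_of S = ?wt S" for S
    unfolding T.weight_of_def unfolding eqs
    by (rule prod.cong[OF refl]) (use weights_at in presburger)
  have fin: "finite {S. S \<subseteq> Xs \<and> int (card S) \<le> k}" by (rule finite_subset[of _ "Pow Xs"]) auto
  have "result c (fill c (mem_of_list rs)) = (\<Sum>S\<in>{S. S \<subseteq> Xs \<and> int (card S) \<le> k}. if ?sat S then ?wt S else 0)"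
    using T.result_eq unfolding eqs sat[unfolded eqs] wt[unfolded eqs] .
  also have "\<dots> = (\<Sum>S\<in>{S \<in> {S. S \<subseteq> Xs \<and> int (card S) \<le> k}. ?sat S}. ?wt S)"
    by (rule sum.inter_filter[symmetric, OF fin])
  also have "\<dots> = (\<Sum>\<pi>\<in>{\<pi> \<in> models F. int (ones F \<pi>) \<le> k}. weight F w \<pi>)"
  proof (rule sum.reindex_bij_witness[of _ ones_of assignment_of], goal_cases)
    case (1 S)
    then have "S \<subseteq> Xs" by blast
    then show ?case by (rule ones_of_assignment)
  next
    case (2 S)
    then have S: "S \<subseteq> Xs" "int (card S) \<le> k" "?sat S" by blast+
    note o = ones_of_assignment[OF S(1)]
    have "assignment_of S \<in> models F"
      unfolding models_eq[OF assignment_PiE] o by (rule S(3))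
    moreover have "int (ones F (assignment_of S)) \<le> k" unfolding ones_eq o by (rule S(2))
    ultimately show ?case by blast
  next
    case (3 \<pi>)
    then have "\<pi> \<in> vars F \<rightarrow>\<^sub>E {0, 1}" unfolding models_def by blast
    then show ?case by (rule assignment_of_ones)
  next
    case (4 \<pi>)
    then have p: "\<pi> \<in> vars F \<rightarrow>\<^sub>E {0, 1}" "\<pi> \<in> models F" "int (ones F \<pi>) \<le> k" unfolding models_def by blast+
    have "?sat (ones_of \<pi>)" using p(2) unfolding models_eq[OF p(1)] .
    moreover have "int (card (ones_of \<pi>)) \<le> k" using p(3) unfolding ones_eq .
    ultimately show ?case using ones_of_subset by blast
  next
    case (5 S)
    then have S: "S \<subseteq> Xs" by blast
    show ?case using weight_eq[OF assignment_PiE[of S]] unfolding ones_of_assignment[OF S] .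
  qed
  finally show ?thesis unfolding bwmc_def .
qed

end

section \<open>The program and its running time\<close>

lemma poly_bounded_mono:
  assumes "poly_bounded T"
  obtains T' where "poly_bounded T'" "mono T'" "\<forall>x. T x \<le> T' x"
proof -
  from assms obtain c e where b: "\<And>x. T x \<le> c * (x + 1) ^ e" unfolding poly_bounded_def by blast
  have "poly_bounded (\<lambda>x. c * (x + 1) ^ e)" unfolding poly_bounded_def by blast
  moreover have "mono (\<lambda>x. c * (x + 1) ^ e)" by (intro monoI mult_le_mono power_mono) auto
  ultimately show ?thesis using b that by blast
qed

text \<open>Replaces the content of register 1 by two to its power, or by 1 if it is not positive.
  The time is linear in the exponent; in the main program every exponent is at most the final loop
  bound.\<close>

definition doubling :: program where
  "doubling = Seq (Do (Const 2 1)) (Seq (Loop 1 (Seq (Do (Add 2 2 2)) (Seq (Do (Const 3 1)) (Do (Sub 1 1 3)))))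
     (Seq (Do (Const 3 0)) (Do (Add 1 2 3))))"

lemma runs_doubling:
  assumes "\<And>s'. imem s' = imem s \<Longrightarrow> rmem s' = rmem s \<Longrightarrow> (\<And>r. r = 0 \<or> 3 < r \<Longrightarrow> ireg s' r = ireg s r) \<Longrightarrow>
    ireg s' 1 = 2 ^ nat (ireg s 1) \<Longrightarrow> R s'"
  shows "runs doubling s (4 * nat (ireg s 1) + 4) R"
proof -
  let ?n = "nat (ireg s 1)"
  define Inv where "Inv i s2 \<longleftrightarrow> imem s2 = imem s \<and> rmem s2 = rmem s \<and> (\<forall>r. r = 0 \<or> 3 < r \<longrightarrow> ireg s2 r = ireg s r) \<and>
    ireg s2 2 = 2 ^ i \<and> (ireg s 1 > 0 \<longrightarrow> ireg s2 1 = int (?n - i))" for i and s2 :: state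
  let ?B = "Seq (Do (Add 2 2 2)) (Seq (Do (Const 3 1)) (Do (Sub 1 1 3)))"
  let ?s = "exec_instr (Const 2 1) s"
  have I0: "Inv 0 ?s" unfolding Inv_def by auto
  have "runs (Loop 1 ?B) ?s (?n * (3 + 1) + 1) (Inv ?n)"
  proof (cases "ireg s 1 > 0")
    case True
    show ?thesis
    proof (rule runs_Loop[where Inv = Inv and n = ?n])
      show "Inv 0 ?s" by (rule I0)
    next
      fix i s2 assume i: "i < ?n" and I: "Inv i s2"
      have "runs ?B s2 (Suc (Suc 1)) (Inv (Suc i))"
        by (intro runs_Do_Seq runs_Do) (use I True i in \<open>auto simp: Inv_def\<close>)
      then show "runs ?B s2 3 (Inv (Suc i))" by (simp add: eval_nat_numeral)
    qed (use True in \<open>simp add: Inv_def\<close>)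
  next
    case False
    then have "\<not> ireg ?s 1 > 0" by simp
    from exec_Loop_False[OF this, of ?B] I0 False show ?thesis unfolding runs_def by auto
  qed
  then have "runs doubling s (Suc (?n * (3 + 1) + 1 + Suc 1)) R"
    unfolding doubling_def
    by (intro runs_Do_Seq[of _ _ s] runs_Seq[of "Loop _ _"], elim runs_mono[OF _ order_refl])
      (intro runs_Do_Seq runs_Do assms, auto simp: Inv_def)
  then show ?thesis by (rule runs_mono) simp_all
qed

lemma runs_doubling':
  assumes "ireg s 1 = v" "\<And>s'. imem s' = imem s \<Longrightarrow> rmem s' = rmem s \<Longrightarrow>
    (\<And>r. r = 0 \<or> 3 < r \<Longrightarrow> ireg s' r = ireg s r) \<Longrightarrow> ireg s' 1 = 2 ^ nat v \<Longrightarrow> R s'"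
  shows "runs doubling s (4 * nat v + 4) R"
  using runs_doubling[of s R] assms by blast

lemma eval_program:
  assumes "icomputable f"
  obtains P T where "poly_bounded T" "mono T"
    "\<forall>s X R. ireg s 0 = int X \<longrightarrow> (\<forall>s'. imem s' = imem s \<and> rmem s' = rmem s \<and> ireg s' 0 = int X \<and>
      ireg s' 1 = f (imem s, X) (\<lambda>_. int X) \<longrightarrow> R s') \<longrightarrow> runs P s (T X) R"
proof -
  obtain P T where T: "poly_bounded T" and f: "icomp P T f" using assms unfolding icomputable_def by blast
  obtain T' where T': "poly_bounded T'" "mono T'" "\<forall>x. T x \<le> T' x" using poly_bounded_mono[OF T] .
  have "runs (P (\<lambda>_. 0) 1) s (T' X) R" if "ireg s 0 = int X"
    "\<forall>s'. imem s' = imem s \<and> rmem s' = rmem s \<and> ireg s' 0 = int X \<and>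
      ireg s' 1 = f (imem s, X) (\<lambda>_. int X) \<longrightarrow> R s'" for s X R
  proof -
    have "runs (P (\<lambda>_. 0) 1) s (T X) R"
      by (rule icompD[OF f]) (use that keepsD in \<open>auto\<close>)
    then show ?thesis using spec[OF T'(3)] by (rule runs_mono)
  qed
  with T' that show ?thesis by blast
qed

lemma update_program:
  assumes "ucomputable (\<lambda>c \<sigma>. f c)"
  obtains P T where "poly_bounded T" "mono T"
    "\<forall>s X R. ireg s 0 = int X \<longrightarrow> (\<forall>s'. imem s' = imem s \<and> rmem s' = f (imem s, X) (rmem s) \<and> ireg s' 0 = int X \<longrightarrow>
      R s') \<longrightarrow> runs P s (T X) R"
proof -
  obtain P T where T: "poly_bounded T" and f: "ucomp P T (\<lambda>c \<sigma>. f c)" using assms unfolding ucomputable_def by blast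
  obtain T' where T': "poly_bounded T'" "mono T'" "\<forall>x. T x \<le> T' x" using poly_bounded_mono[OF T] .
  have "runs (P (\<lambda>_. 0) 1) s (T' X) R" if "ireg s 0 = int X"
    "\<forall>s'. imem s' = imem s \<and> rmem s' = f (imem s, X) (rmem s) \<and> ireg s' 0 = int X \<longrightarrow> R s'" for s X R
    using f[unfolded ucomp_def, rule_format, of "\<lambda>_. 0" 1 s X] that(1) spec[OF T'(3), of X]
    by (auto intro!: that(2)[rule_format] elim!: runs_mono)
  with T' that show ?thesis by blast
qed

lemma output_program:
  assumes "rcomputable (\<lambda>c \<sigma>. f c)"
  obtains P T where "poly_bounded T" "mono T"
    "\<forall>s X R. ireg s 0 = int X \<longrightarrow> (\<forall>s'. rreg s' 0 = f (imem s, X) (rmem s) \<longrightarrow> R s') \<longrightarrow> runs P s (T X) R"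
proof -
  obtain P T where T: "poly_bounded T" and f: "rcomp P T (\<lambda>c \<sigma>. f c)" using assms unfolding rcomputable_def by blast
  have "poly_bounded (\<lambda>x. T x + Suc 1)" by (intro poly_bounded_intros T)
  then obtain T' where T': "poly_bounded T'" "mono T'" "\<forall>x. T x + Suc 1 \<le> T' x" using poly_bounded_mono by blast
  let ?P = "Seq (P (\<lambda>_. 0) 1) (Seq (Do (RConst 2 0)) (Do (RAdd 0 1 2)))"
  have "runs ?P s (T' X) R" if "ireg s 0 = int X" "\<forall>s'. rreg s' 0 = f (imem s, X) (rmem s) \<longrightarrow> R s'" for s X R
  proof -
    have "runs ?P s (T X + Suc 1) R"
    proof (rule runs_Seq, rule rcompD[OF f], goal_cases)
      case (3 s')
      show ?case by (intro runs_Do_Seq runs_Do that(2)[rule_format]) (use 3 in simp_all)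
    qed (use that(1) in simp_all)
    then show ?thesis using spec[OF T'(3)] by (rule runs_mono)
  qed
  with T' that show ?thesis by blast
qed

section \<open>A loop bound from the length of the input and a tower of powers\<close>

abbreviation tower :: "int \<Rightarrow> nat" where "tower q \<equiv> 2 ^ (2 ^ (2 ^ nat q))"

lemma tower_ge: "nat q \<le> tower q" "2 ^ nat q \<le> tower q" "(2::nat) ^ 2 ^ nat q \<le> tower q" "4 \<le> tower q"
proof -
  have l: "(a::nat) \<le> 2 ^ a" for a using less_exp[of a] by simp
  show 2: "(2::nat) ^ 2 ^ nat q \<le> tower q" by (rule l)
  show 1: "2 ^ nat q \<le> tower q" using l[of "2 ^ nat q"] 2 by linarith
  show "nat q \<le> tower q" using l[of "nat q"] 1 by linarith
  have "(2::nat) ^ 1 \<le> 2 ^ 2 ^ nat q" by (intro power_increasing) auto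
  then have "(2::nat) ^ 2 \<le> tower q" by (intro power_increasing) auto
  then show "4 \<le> tower q" by simp
qed

text \<open>The estimate \<open>a \<le> 2 ^ a\<close> turns both nested powers into powers of two,
  with \<open>B + B * ?M\<close> as the exponent at the top. Since
  \<open>?M \<le> 2 * (B * B)\<close>, this is at most \<open>4 * (B * B * B)\<close>, hence at most
  \<open>2 ^ (3 * B + 2)\<close>. The argument \<open>b + b + b + 2\<close> of the tower needs
  additions only.\<close>

lemma tower_large:
  fixes b k :: int
  assumes "0 \<le> k" "k + 2 \<le> b"
  shows "b ^ nat (b ^ nat (2 * (k * k + 1))) \<le> int (tower (b + b + b + 2))"
proof -
  define B where "B = nat b"
  have B: "b = int B" "2 \<le> B" unfolding B_def using assms by auto
  let ?M = "nat (2 * (k * k + 1))"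
  have "k * k \<le> (b - 1) * (b - 1)" using assms by (intro mult_mono) auto
  also have "\<dots> \<le> b * b - 1" using assms by (simp add: algebra_simps)
  finally have M: "?M \<le> 2 * (B * B)" using B by (simp add: nat_le_iff)
  have l: "a \<le> 2 ^ a" for a :: nat using less_exp[of a] by simp
  have B3: "B + B * N \<le> 2 ^ (3 * B + 2)" if M: "N \<le> 2 * (B * B)" for N
  proof -
    have "B * N \<le> B * (2 * (B * B))" using M by (rule mult_le_mono2)
    moreover have "B \<le> B * (B * B)" using B by simp
    ultimately have "B + B * N \<le> B * (B * B) + B * (2 * (B * B))" by linarith
    also have "\<dots> \<le> 4 * (B * B * B)" by (simp add: algebra_simps)
    also have "\<dots> \<le> 4 * (2 ^ B * 2 ^ B * 2 ^ B)" by (intro mult_le_mono l order_refl)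
    also have "\<dots> = 2 ^ (B + B + B + 2)" by (simp add: power_add)
    also have "B + B + B + 2 = 3 * B + 2" by simp
    finally show ?thesis .
  qed
  note B3 = B3[OF M]
  have "B ^ ?M \<le> (2 ^ B) ^ ?M" by (intro power_mono l) simp
  then have p: "B ^ ?M \<le> 2 ^ (B * ?M)" by (simp add: power_mult)
  have "B ^ (B ^ ?M) \<le> (2 ^ B) ^ (B ^ ?M)" by (intro power_mono l) simp
  also have "\<dots> = 2 ^ (B * B ^ ?M)" by (simp add: power_mult)
  also have "\<dots> \<le> 2 ^ (2 ^ B * 2 ^ (B * ?M))" using p l[of B] by (intro power_increasing mult_le_mono) auto
  also have "\<dots> = 2 ^ (2 ^ (B + B * ?M))" by (simp add: power_add)
  also have "\<dots> \<le> 2 ^ (2 ^ (2 ^ (3 * B + 2)))" using B3 by (intro power_increasing) auto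
  also have "3 * B + 2 = nat (b + b + b + 2)" using B by simp
  finally have "B ^ (B ^ ?M) \<le> tower (b + b + b + 2)" .
  then have "int (B ^ (B ^ ?M)) \<le> int (tower (b + b + b + 2))" by (simp only: of_nat_le_iff)
  moreover have "nat (b ^ ?M) = B ^ ?M" unfolding B(1) by (metis nat_int of_nat_power)
  ultimately show ?thesis unfolding B(1) by simp
qed

text \<open>The first three evaluations bootstrap the loop bound: the number of clauses suffices to locate
  the number of graphs, both together suffice to find the end of the input, and its length suffices
  to compute the maximum red degree.\<close>

lemma bwmc_program:
  obtains P U where "poly_bounded U" "mono U"
    "\<forall>F w k d Gs ins rs \<nu> fs cls xs gcs. encoded_instance F w k d Gs ins rs \<nu> fs cls xs gcs \<longrightarrow>
      runs P (init_state ins rs)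
        (U (length ins + tower (let b = base (mem_of_list ins, length ins) in b + b + b + 2)))
        (\<lambda>s. rreg s 0 = bwmc F w k)"
proof -
  have "icomputable (\<lambda>c \<sigma>. fst c 1 + num_graphs c)" by (intro computable_intros)
  then obtain P1 T1 where p1: "poly_bounded T1" "mono T1"
    "\<forall>s X R. ireg s 0 = int X \<longrightarrow> (\<forall>s'. imem s' = imem s \<and> rmem s' = rmem s \<and> ireg s' 0 = int X \<and>
      ireg s' 1 = fst (imem s, X) 1 + num_graphs (imem s, X) \<longrightarrow> R s') \<longrightarrow> runs P1 s (T1 X) R"
    by (rule eval_program)
  have "icomputable (\<lambda>c \<sigma>. off_graph c (num_graphs c))" by (intro computable_intros)
  then obtain P2 T2 where p2: "poly_bounded T2" "mono T2"
    "\<forall>s X R. ireg s 0 = int X \<longrightarrow> (\<forall>s'. imem s' = imem s \<and> rmem s' = rmem s \<and> ireg s' 0 = int X \<and>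
      ireg s' 1 = off_graph (imem s, X) (num_graphs (imem s, X)) \<longrightarrow> R s') \<longrightarrow> runs P2 s (T2 X) R"
    by (rule eval_program)
  have "icomputable (\<lambda>c \<sigma>. base c + base c + base c + 2)" by (intro computable_intros)
  then obtain P3 T3 where p3: "poly_bounded T3" "mono T3"
    "\<forall>s X R. ireg s 0 = int X \<longrightarrow> (\<forall>s'. imem s' = imem s \<and> rmem s' = rmem s \<and> ireg s' 0 = int X \<and>
      ireg s' 1 = base (imem s, X) + base (imem s, X) + base (imem s, X) + 2 \<longrightarrow> R s') \<longrightarrow> runs P3 s (T3 X) R"
    by (rule eval_program)
  obtain P4 T4 where p4: "poly_bounded T4" "mono T4"
    "\<forall>s X R. ireg s 0 = int X \<longrightarrow> (\<forall>s'. imem s' = imem s \<and> rmem s' = fill (imem s, X) (rmem s) \<and> ireg s' 0 = int X \<longrightarrow>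
      R s') \<longrightarrow> runs P4 s (T4 X) R"
    by (rule update_program[OF ucomp_fill])
  obtain P5 T5 where p5: "poly_bounded T5" "mono T5"
    "\<forall>s X R. ireg s 0 = int X \<longrightarrow> (\<forall>s'. rreg s' 0 = result (imem s, X) (rmem s) \<longrightarrow> R s') \<longrightarrow> runs P5 s (T5 X) R"
    by (rule output_program[OF rcomp_result])
  let ?P = "Seq (Do (Const 1 1)) (Seq (Do (Load 0 1)) (Seq P1 (Seq (Do (Const 2 0)) (Seq (Do (Add 0 1 2))
    (Seq P2 (Seq (Do (Const 2 0)) (Seq (Do (Add 0 1 2)) (Seq P3 (Seq doubling (Seq doubling (Seq doubling
    (Seq (Do (Add 0 0 1)) (Seq P4 P5)))))))))))))"
  \<comment> \<open>Each of the three doublings costs four steps per unit of its exponent, and no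
    exponent exceeds the final bound; this gives \<open>12 * x\<close>. Single instructions and
    constants fit into 20.\<close>
  let ?U = "\<lambda>x. T1 x + T2 x + T3 x + T4 x + T5 x + 12 * x + 20"
  have pb: "poly_bounded ?U" by (intro poly_bounded_intros p1 p2 p3 p4 p5)
  have mo: "mono ?U"
    using p1(2) p2(2) p3(2) p4(2) p5(2) unfolding mono_def by (auto intro!: add_mono)
  have main: "runs ?P (init_state ins rs)
        (?U (length ins + tower (let b = base (mem_of_list ins, length ins) in b + b + b + 2)))
        (\<lambda>s. rreg s 0 = bwmc F w k)"
    if enc: "encoded_instance F w k d Gs ins rs \<nu> fs cls xs gcs" for F w k d Gs ins rs \<nu> fs cls xs gcs
  proof -
    interpret encoded_instance F w k d Gs ins rs \<nu> fs cls xs gcs by (rule enc)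
    let ?N = "length ins"
    define b where "b = base (I, ?N)"
    let ?q = "b + b + b + 2"
    let ?X = "?N + tower ?q"
    have e1: "fst (I, length fs) 1 + num_graphs (I, length fs) = int (length fs + n)"
      using off_vars_eq(4)[of "(I, length fs)"] input_segments(2) by simp
    have e2: "off_graph (I, length fs + n) (num_graphs (I, length fs + n)) = int ?N"
      using off_graph_end[of "(I, length fs + n)"] by simp
    have big: "big (I, ?N)" "big (I, ?X)" unfolding big_def by simp_all
    have bX: "base (I, ?X) = b" by (rule trans[OF base_unique[OF big(2,1)] b_def[symmetric]])
    have "k + 2 \<le> b" unfolding b_def base_def using max_deg_props(1)[OF big(1)] input_segments(1) by simp
    then have large: "base (I, ?X) ^ nat (base (I, ?X) ^ nat (2 * (k * k + 1))) \<le> int (snd (I, ?X))" if "0 \<le> k"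
      unfolding bX using tower_large[OF that, of b] by simp
    have le: "length fs \<le> ?X" "length fs + n \<le> ?X" "?N \<le> ?X" "nat ?q \<le> ?X" "2 ^ nat ?q \<le> ?X" "(2::nat) ^ 2 ^ nat ?q \<le> ?X"
      using tower_ge[of ?q] length_bounds(1,6) by linarith+
    have res: "result (I, ?X) (fill (I, ?X) (mem_of_list rs)) = bwmc F w k"
      by (rule result_bwmc[OF big(2)]) (rule large)
    have nat_power_two: "nat (2 ^ m) = 2 ^ m" for m by (simp add: nat_power_eq)
    let ?T = "Suc (Suc (T1 (length fs) + Suc (Suc (T2 (length fs + n) + Suc (Suc (T3 ?N +
      ((4 * nat ?q + 4) + ((4 * nat (2 ^ nat ?q) + 4) + ((4 * nat (2 ^ nat (2 ^ nat ?q)) + 4) + Suc (T4 ?X + T5 ?X))))))))))"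
    have "runs ?P (init_state ins rs) ?T (\<lambda>s. rreg s 0 = bwmc F w k)"
    proof (intro runs_Do_Seq, rule runs_Seq, rule p1(3)[rule_format], goal_cases)
      case 1
      then show ?case using input_segments(2) by (simp add: init_state_def)
    next
      case (2 s1)
      then have s1: "imem s1 = I" "rmem s1 = mem_of_list rs" "ireg s1 1 = int (length fs + n)"
        using e1 by (simp_all add: init_state_def)
      show ?case
      proof (intro runs_Do_Seq, rule runs_Seq, rule p2(3)[rule_format], goal_cases)
        case 1
        then show ?case using s1 by simp
      next
        case (2 s2)
        then have s2: "imem s2 = I" "rmem s2 = mem_of_list rs" "ireg s2 1 = int ?N"
          using s1 e2 by simp_all
        show ?case
        proof (intro runs_Do_Seq, rule runs_Seq, rule p3(3)[rule_format], goal_cases)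
          case 1
          then show ?case using s2 by simp
        next
          case (2 s3)
          then have s3: "imem s3 = I" "rmem s3 = mem_of_list rs" "ireg s3 0 = int ?N" "ireg s3 1 = ?q"
            using s2 by (simp_all add: b_def)
          show ?case
          proof (rule runs_Seq, rule runs_doubling'[OF s3(4)], rule runs_Seq, rule runs_doubling', assumption,
              rule runs_Seq, rule runs_doubling', assumption, goal_cases)
            case (1 s4 s5 s6)
            have s6: "imem s6 = I" "rmem s6 = mem_of_list rs" "ireg s6 0 + ireg s6 1 = int ?X"
              using 1 s3 by (simp_all add: nat_power_two)
            show ?case
            proof (intro runs_Do_Seq, rule runs_Seq, rule p4(3)[rule_format], goal_cases)
              case 1
              then show ?case using s6 by simp
            next
              case (2 s7)
              then have s7: "imem s7 = I" "rmem s7 = fill (I, ?X) (mem_of_list rs)" "ireg s7 0 = int ?X"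
                using s6 by simp_all
              show ?case
              proof (rule p5(3)[rule_format, OF s7(3)])
                fix s8 assume "rreg s8 0 = result (imem s7, ?X) (rmem s7)"
                then show "rreg s8 0 = bwmc F w k"
                  unfolding s7 res .
              qed
            qed
          qed
        qed
      qed
    qed
    moreover have "?T \<le> ?U ?X"
    proof -
      have "T1 (length fs) \<le> T1 ?X" "T2 (length fs + n) \<le> T2 ?X" "T3 ?N \<le> T3 ?X"
        using le p1(2) p2(2) p3(2) unfolding mono_def by blast+
      moreover have "Suc (Suc (t1 + Suc (Suc (t2 + Suc (Suc (t3 + ((4 * p + 4) + ((4 * r + 4) + ((4 * v + 4) +
          Suc (t4 + t5)))))))))) \<le> t1' + t2' + t3' + t4 + t5 + 12 * x + 20"
        if "t1 \<le> t1'" "t2 \<le> t2'" "t3 \<le> t3'" "p \<le> x" "r \<le> x" "v \<le> x"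
        for t1 t2 t3 t4 t5 t1' t2' t3' p r v x :: nat
        using that by linarith
      ultimately show ?thesis unfolding nat_power_two using le by blast
    qed
    ultimately show ?thesis unfolding b_def[symmetric] Let_def by (rule runs_mono)
  qed
  show ?thesis by (rule that[OF pb mo]) (use main in blast)
qed

text \<open>The tower is a power of two with exponent \<open>2 ^ (2 ^ nat q)\<close>. Its fixed
  powers and a constant factor are absorbed by multiplying this exponent plus 1 by a constant, so
  the bound is again one power of two and can be computed by \<open>doubling\<close>. The number
  \<open>3 * (k + int d + 2) + 2\<close> is the bound on \<open>3 * base c + 2\<close> that results
  from \<open>max_deg c \<le> int d\<close>.\<close>

definition time_bound :: "nat \<Rightarrow> int \<Rightarrow> nat \<Rightarrow> nat" where
  "time_bound a k d = 2 ^ (a * (2 ^ (2 ^ nat (3 * (k + int d + 2) + 2)) + 1))"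

text \<open>The factor 3 is two additions and the constant \<open>a\<close> a loop of
  \<open>a\<close> additions; the powers are three runs of \<open>doubling\<close>.\<close>

lemma computable_time_bound: "computable2 (time_bound a)"
proof -
  let ?B = "Seq (Do (Add 4 4 1)) (Seq (Do (Const 6 1)) (Do (Sub 5 5 6)))"
  let ?P = "Seq (Do (Const 5 0)) (Seq (Do (Load 1 5)) (Seq (Do (Const 5 1)) (Seq (Do (Load 2 5))
    (Seq (Do (Add 1 1 2)) (Seq (Do (Const 2 2)) (Seq (Do (Add 1 1 2)) (Seq (Do (Add 2 1 1)) (Seq (Do (Add 1 2 1))
    (Seq (Do (Const 2 2)) (Seq (Do (Add 1 1 2)) (Seq doubling (Seq doubling
    (Seq (Do (Const 2 1)) (Seq (Do (Add 1 1 2)) (Seq (Do (Const 4 0)) (Seq (Do (Const 5 (int a))) (Seq (Loop 5 ?B)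
    (Seq (Do (Const 2 0)) (Seq (Do (Add 1 4 2)) (Seq doubling (Seq (Do (Const 2 0)) (Do (Add 0 1 2)))))))))))))))))))))))"
  have "\<exists>T. runs ?P (init_state [k, int d] []) T (\<lambda>s. ireg s 0 = int (time_bound a k d))" for k d
  proof -
    let ?q = "3 * (k + int d + 2) + 2"
    let ?g = "2 ^ (2 ^ nat ?q) + 1 :: int"
    have nat_power_two: "nat (2 ^ m) = 2 ^ m" for m by (simp add: nat_power_eq)
    let ?T4 = "(4 * nat (int a * ?g) + 4) + Suc 1"
    let ?T = "Suc (Suc (Suc (Suc (Suc (Suc (Suc (Suc (Suc (Suc (Suc ((4 * nat ?q + 4) + ((4 * nat (2 ^ nat ?q) + 4) +
      Suc (Suc (Suc (Suc ((a * (3 + 1) + 1) + Suc (Suc ?T4)))))))))))))))))"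
    have "runs ?P (init_state [k, int d] []) ?T (\<lambda>s. ireg s 0 = int (time_bound a k d))"
    proof (intro runs_Do_Seq, rule runs_Seq, rule runs_doubling', goal_cases)
      case 1
      show ?case by (simp add: init_state_def mem_of_list_def)
    next
      case (2 s1)
      show ?case
      proof (rule runs_Seq, rule runs_doubling'[OF 2(4)], intro runs_Do_Seq, rule runs_Seq, goal_cases)
        case (1 s2)
        let ?s = "exec_instr (Const 5 (int a)) (exec_instr (Const 4 0) (exec_instr (Add 1 1 2) (exec_instr (Const 2 1) s2)))"
        define Inv where "Inv i s \<longleftrightarrow> ireg s 1 = ?g \<and> ireg s 4 = int i * ?g \<and> ireg s 5 = int (a - i)" for i and s :: state
        have I0: "Inv 0 ?s" using 1(4) unfolding Inv_def by (simp add: nat_power_two)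
        show ?case
        proof (rule runs_mono[OF runs_Loop[where Inv = Inv and n = a and T = 3]])
          show "Inv 0 ?s" by (rule I0)
        next
          fix i s assume i: "i < a" and I: "Inv i s"
          have "runs ?B s (Suc (Suc 1)) (Inv (Suc i))"
            by (intro runs_Do_Seq runs_Do) (use I i in \<open>auto simp: Inv_def algebra_simps\<close>)
          then show "runs ?B s 3 (Inv (Suc i))" by (simp add: eval_nat_numeral)
        next
          show "\<And>i s. i \<le> a \<Longrightarrow> Inv i s \<Longrightarrow> ireg s 5 = int (a - i)" unfolding Inv_def by simp
        next
          fix s assume I: "Inv a s"
          show "runs (Seq (Do (Const 2 0)) (Seq (Do (Add 1 4 2)) (Seq doubling (Seq (Do (Const 2 0)) (Do (Add 0 1 2))))))
            s (Suc (Suc ?T4)) (\<lambda>s. ireg s 0 = int (time_bound a k d))"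
          proof (intro runs_Do_Seq, rule runs_Seq, rule runs_doubling', goal_cases)
            case 1
            show ?case using I unfolding Inv_def by simp
          next
            case (2 s')
            have "nat (int a * ?g) = a * (2 ^ (2 ^ nat ?q) + 1)" by (simp add: nat_mult_distrib nat_add_distrib nat_power_two)
            then show ?case using 2(4) by (intro runs_Do_Seq runs_Do) (simp_all add: time_bound_def)
          qed
        qed simp
      qed
    qed
    then show ?thesis by blast
  qed
  then show ?thesis unfolding computable2_def runs_def by meson
qed

theorem theorem1:
  "\<exists>(P :: program) (f :: int \<Rightarrow> nat \<Rightarrow> nat) (c :: nat). computable2 f \<and>
     (\<forall>(F :: formula) (w :: lit \<Rightarrow> real) (k :: int) (d :: nat) (Gs :: node trigraph list)
        (is :: int list) (rs :: real list).
        is_cnf F \<longrightarrow> is_d_sequence d (incidence_graph F) Gs \<longrightarrow> enc_instance F w k Gs is rs \<longrightarrow>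
        (\<exists>t s. exec P (init_state is rs) t s \<and>
           rreg s 0 = bwmc F w k \<and>
           t \<le> f k d * (length is + length rs) ^ c))"
proof -
  obtain P U where U: "poly_bounded U" "\<forall>F w k d Gs ins rs \<nu> fs cls xs gcs. encoded_instance F w k d Gs ins rs \<nu> fs cls xs gcs \<longrightarrow>
      runs P (init_state ins rs)
        (U (length ins + tower (let b = base (mem_of_list ins, length ins) in b + b + b + 2)))
        (\<lambda>s. rreg s 0 = bwmc F w k)"
    by (rule bwmc_program)
  obtain a c where ac: "\<And>x. U x \<le> a * (x + 1) ^ c" using U(1) unfolding poly_bounded_def by blast
  have "\<exists>t s. exec P (init_state is rs) t s \<and> rreg s 0 = bwmc F w k \<and>
      t \<le> time_bound (a + c) k d * (length is + length rs) ^ c"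
    if inst: "is_cnf F" "is_d_sequence d (incidence_graph F) Gs" "enc_instance F w k Gs is rs"
    for F w k d Gs "is" rs
  proof -
    obtain \<nu> fs cls xs gcs where enc: "encoded_instance F w k d Gs is rs \<nu> fs cls xs gcs"
      using enc_instanceE[OF inst] .
    interpret encoded_instance F w k d Gs "is" rs \<nu> fs cls xs gcs by (rule enc)
    let ?N = "length is"
    define b where "b = base (I, ?N)"
    let ?q = "b + b + b + 2"
    have "runs P (init_state is rs) (U (?N + tower ?q)) (\<lambda>s. rreg s 0 = bwmc F w k)"
      using U(2)[rule_format, OF enc] unfolding b_def Let_def .
    then obtain t s where ts: "exec P (init_state is rs) t s" "t \<le> U (?N + tower ?q)" "rreg s 0 = bwmc F w k"
      unfolding runs_def by blast
    have big: "big (I, ?N)" unfolding big_def by simp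
    \<comment> \<open>The computed degree is at most the promised \<open>d\<close>, so a bound in
      terms of \<open>d\<close> covers the running time.\<close>
    have "b \<le> k + int d + 2" unfolding b_def base_def using max_deg_le_d[OF big] input_segments(1) by simp
    then have "?q \<le> (k + int d + 2) + (k + int d + 2) + (k + int d + 2) + 2" by (intro add_mono order_refl)
    then have "nat ?q \<le> nat (3 * (k + int d + 2) + 2)" by (intro nat_mono) simp
    then have g: "(2::nat) ^ (2 ^ nat ?q) \<le> 2 ^ (2 ^ nat (3 * (k + int d + 2) + 2))" (is "?g \<le> ?h")
      by (intro power_increasing) auto
    \<comment> \<open>Both numbers are at least 4, so the sum plus 1 is at most the product. This
      separates the parameter from the length of the input, and the power distributes over the two
      factors.\<close>
    have "?N + tower ?q + 1 \<le> tower ?q * ?N"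
    proof -
      have "\<exists>x. ?N = x + 4" "\<exists>y. tower ?q = y + 4" using length_bounds(5) tower_ge(4)[of ?q] by (metis add.commute le_Suc_ex)+
      then obtain x y where "?N = x + 4" "tower ?q = y + 4" by blast
      then show ?thesis by (simp only:) (simp add: algebra_simps)
    qed
    then have "(?N + tower ?q + 1) ^ c \<le> (tower ?q * ?N) ^ c" by (intro power_mono) auto
    also have "\<dots> = 2 ^ (?g * c) * ?N ^ c" by (simp add: power_mult_distrib power_mult)
    finally have "a * (?N + tower ?q + 1) ^ c \<le> 2 ^ a * (2 ^ (?g * c) * ?N ^ c)"
      by (intro mult_le_mono) (use less_exp[of a] in auto)
    also have "\<dots> = 2 ^ (a + ?g * c) * ?N ^ c" by (simp add: power_add)
    also have "\<dots> \<le> time_bound (a + c) k d * (?N + length rs) ^ c"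
      unfolding time_bound_def
    proof (intro mult_le_mono power_increasing power_mono)
      have "a + ?g * c \<le> (a + c) * 1 + (a + c) * ?g" by (simp add: algebra_simps)
      also have "\<dots> \<le> (a + c) * 1 + (a + c) * ?h" using g by (intro add_mono mult_le_mono order_refl)
      finally show "a + ?g * c \<le> (a + c) * (?h + 1)" by (simp add: algebra_simps)
    qed auto
    finally have "t \<le> time_bound (a + c) k d * (?N + length rs) ^ c"
      using ts(2) ac[of "?N + tower ?q"] by linarith
    with ts show ?thesis by blast
  qed
  with computable_time_bound[of "a + c"] show ?thesis by blast
qed

end
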